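(* Let $F=\frac{(b\alpha+\beta)^2}{\alpha}$ be a singular square metric on an $n$-dimensional manifold with $n\geq 3$. Then $F$ is an Einstein metric if and only if $F$ is Ricci-flat and there exist scalar functions $c=c(x)$, $d=d(x)$ such that $\alpha$ and $\beta$ satisfy \begin{align*} Ric_{00}={}&-\frac{1}{9b^4}\Big\{\big[9(n-1)b^2c^2-2b^6d^2-6b^4d_b+144(n-3)t+36b^2s^i{}_{|i}\big]\alpha^2-2(n-2)b^4d^2\beta^2-6(n-2)b^4\beta d_0\\ &-72(n-2)c\beta s_0-84(n-2)b^2d\beta s_0+288(n-2)s_0^2+36(n-2)b^2s_{0|0}\Big\},\\ r_{00}={}&c\,\alpha^2+d\,\beta^2-\frac{6}{b^2}\beta s_0,\\ s^i{}_0={}&\frac{1}{b^2}\big(s_0b^i-\beta s^i\big), \end{align*} where $Ric_{00}$ is the Ricci curvature of $\alpha$.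
   Context: Setting: $\alpha=\sqrt{a_{ij}(x)y^iy^j}$ is a Riemannian metric and $\beta=b_i(x)y^i$ is a nowhere-vanishing 1-form on an $n$-dimensional manifold; $b=b(x)=\sqrt{a^{ij}b_ib_j}$ is the length of $\beta$ with respect to $\alpha$ (not assumed constant). The singular square metric is the (non-regular) Finsler metric $F=\frac{(b\alpha+\beta)^2}{\alpha}$; its curvatures are considered at those $y\neq 0$ where its fundamental tensor is nondegenerate (i.e. where $b^2\alpha^2-\beta^2\neq0$). Curvature: for a Finsler metric $F$, $g_{ij}=\frac12[F^2]_{y^iy^j}$ with inverse $(g^{ij})$, the spray coefficients are $G^i=\frac14g^{il}\{[F^2]_{x^ky^l}y^k-[F^2]_{x^l}\}$, the Riemann tensor is ${}^FR^i{}_k=2G^i_{x^k}-G^i_{x^ly^k}y^l+2G^lG^i_{y^ky^l}-G^i_{y^l}G^l_{y^k}$, and ${}^FRic_{00}={}^FR^m{}_m$. $F$ is an Einstein metric if ${}^FRic_{00}=(n-1)K(x)F^2$ for some scalar function $K(x)$, and is Ricci-flat if ${}^FRic_{00}=0$. Quantities without the superscript $F$, such as $Ric_{00}=R^m{}_m$, are those of $\alpha$. Notation: $_{|}$ denotes covariant derivative with respect to the Levi-Civita connection of $\alpha$; indices are raised and lowered with $a^{ij}$ and $a_{ij}$; an index $0$ means contraction with $y^i$ and an index $b$ means contraction with $b^i$ (covariant derivatives being taken first). $r_{ij}=\frac12(b_{i|j}+b_{j|i})$, $s_{ij}=\frac12(b_{i|j}-b_{j|i})$; $r_{00}=r_{ij}y^iy^j$;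 $s^i{}_0=a^{im}s_{mj}y^j$; $s_i=b^ms_{mi}$, $s^i=a^{im}s_m$, $s_0=s_iy^i$; $s_{0|0}=s_{i|j}y^iy^j$; $s^i{}_{|i}$ is the divergence of $s^i$. $t_{ij}=s_{im}s^m{}_j$ and $t=t_{ij}b^ib^j$. For the scalar function $d$: $d_k=d_{|k}=\partial d/\partial x^k$, $d_0=d_ky^k$, $d_b=d_kb^k$. *)

theory Defs
  imports "HOL-Analysis.Analysis"
begin

section \<open>Smooth functions on open subsets of coordinate space\<close>

definition pd :: "'n \<Rightarrow> (real ^ 'n \<Rightarrow> real) \<Rightarrow> real ^ 'n \<Rightarrow> real" where
  "pd i f x = deriv (\<lambda>t. f (x + t *\<^sub>R axis i 1)) 0"

primrec Ck_on :: "nat \<Rightarrow> (real ^ 'n) set \<Rightarrow> (real ^ 'n \<Rightarrow> real) \<Rightarrow> bool" where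
  "Ck_on 0 S f \<longleftrightarrow> continuous_on S f"
| "Ck_on (Suc k) S f \<longleftrightarrow> (\<forall>x\<in>S. f differentiable (at x)) \<and> (\<forall>i. Ck_on k S (pd i f))"

text \<open>Only meant for open \<open>S\<close>.\<close>

definition smooth_on :: "(real ^ 'n) set \<Rightarrow> (real ^ 'n \<Rightarrow> real) \<Rightarrow> bool" where
  "smooth_on S f \<longleftrightarrow> (\<forall>k. Ck_on k S f)"

section \<open>Smooth manifolds and tensor fields in components\<close>

text \<open>A chart is a pair \<open>(U, \<phi>)\<close> of a domain and a coordinate map; the values of \<open>\<phi>\<close> outside
  \<open>U\<close> are irrelevant. The dimension of the manifold is \<open>CARD('n)\<close>.\<close>

type_synonym ('m, 'n) chart = "'m set \<times> ('m \<Rightarrow> real ^ 'n)"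

abbreviation cdom :: "('m, 'n::finite) chart \<Rightarrow> 'm set" where "cdom \<kappa> \<equiv> fst \<kappa>"
abbreviation cmap :: "('m, 'n::finite) chart \<Rightarrow> 'm \<Rightarrow> real ^ 'n" where "cmap \<kappa> \<equiv> snd \<kappa>"
abbreviation cimg :: "('m, 'n::finite) chart \<Rightarrow> (real ^ 'n) set" where "cimg \<kappa> \<equiv> cmap \<kappa> ` cdom \<kappa>"

definition is_chart :: "'m topology \<Rightarrow> ('m, 'n::finite) chart \<Rightarrow> bool" where
  "is_chart X \<kappa> \<longleftrightarrow> openin X (cdom \<kappa>) \<and> open (cimg \<kappa>) \<and>
     homeomorphic_map (subtopology X (cdom \<kappa>)) (top_of_set (cimg \<kappa>)) (cmap \<kappa>)"

definition in_chart :: "('m, 'n::finite) chart \<Rightarrow> ('m \<Rightarrow> 'b) \<Rightarrow> real ^ 'n \<Rightarrow> 'b" where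
  "in_chart \<kappa> f x = f (inv_into (cdom \<kappa>) (cmap \<kappa>) x)"

definition coord_change :: "('m, 'n::finite) chart \<Rightarrow> ('m, 'n) chart \<Rightarrow> real ^ 'n \<Rightarrow> real ^ 'n" where
  "coord_change \<kappa> \<kappa>' = in_chart \<kappa> (cmap \<kappa>')"

definition smooth_manifold :: "'m topology \<Rightarrow> ('m, 'n::finite) chart set \<Rightarrow> bool" where
  "smooth_manifold X A \<longleftrightarrow>
     Hausdorff_space X \<and> second_countable X \<and>
     (\<forall>\<kappa>\<in>A. is_chart X \<kappa>) \<and> (\<Union>\<kappa>\<in>A. cdom \<kappa>) = topspace X \<and>
     (\<forall>\<kappa>\<in>A. \<forall>\<kappa>'\<in>A. \<forall>i. smooth_on (cmap \<kappa> ` (cdom \<kappa> \<inter> cdom \<kappa>')) (\<lambda>x. coord_change \<kappa> \<kappa>' x $ i))"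

definition scalar_field :: "('m, 'n::finite) chart set \<Rightarrow> ('m \<Rightarrow> real) \<Rightarrow> bool" where
  "scalar_field A f \<longleftrightarrow> (\<forall>\<kappa>\<in>A. smooth_on (cimg \<kappa>) (in_chart \<kappa> f))"

text \<open>\<open>jac \<kappa> \<kappa>' p k i\<close> is \<open>\<partial>x'\<^sup>k / \<partial>x\<^sup>i\<close> at the point \<open>p\<close>, where \<open>x\<close>, \<open>x'\<close> are the coordinates
  of \<open>\<kappa>\<close>, \<open>\<kappa>'\<close>.\<close>

definition jac :: "('m, 'n::finite) chart \<Rightarrow> ('m, 'n) chart \<Rightarrow> 'm \<Rightarrow> 'n \<Rightarrow> 'n \<Rightarrow> real" where
  "jac \<kappa> \<kappa>' p k i = pd i (\<lambda>x. coord_change \<kappa> \<kappa>' x $ k) (cmap \<kappa> p)"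

text \<open>Covariant tensor fields are families, indexed by the charts of the atlas, of component
  functions of the coordinates, related by the tensor transformation law.\<close>

definition riemannian_metric ::
    "('m, 'n::finite) chart set \<Rightarrow> (('m, 'n::finite) chart \<Rightarrow> real ^ 'n \<Rightarrow> real ^ 'n ^ 'n) \<Rightarrow> bool" where
  "riemannian_metric A a \<longleftrightarrow>
     (\<forall>\<kappa>\<in>A. (\<forall>i j. smooth_on (cimg \<kappa>) (\<lambda>x. a \<kappa> x $ i $ j)) \<and>
        (\<forall>x\<in>cimg \<kappa>. transpose (a \<kappa> x) = a \<kappa> x \<and> (\<forall>y. y \<noteq> 0 \<longrightarrow> 0 < y \<bullet> (a \<kappa> x *v y)))) \<and>
     (\<forall>\<kappa>\<in>A. \<forall>\<kappa>'\<in>A. \<forall>p\<in>cdom \<kappa> \<inter> cdom \<kappa>'. \<forall>i j.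
        a \<kappa> (cmap \<kappa> p) $ i $ j =
        (\<Sum>k\<in>UNIV. \<Sum>l\<in>UNIV. jac \<kappa> \<kappa>' p k i * jac \<kappa> \<kappa>' p l j * a \<kappa>' (cmap \<kappa>' p) $ k $ l))"

definition one_form ::
    "('m, 'n::finite) chart set \<Rightarrow> (('m, 'n::finite) chart \<Rightarrow> real ^ 'n \<Rightarrow> real ^ 'n) \<Rightarrow> bool" where
  "one_form A b \<longleftrightarrow>
     (\<forall>\<kappa>\<in>A. \<forall>i. smooth_on (cimg \<kappa>) (\<lambda>x. b \<kappa> x $ i)) \<and>
     (\<forall>\<kappa>\<in>A. \<forall>\<kappa>'\<in>A. \<forall>p\<in>cdom \<kappa> \<inter> cdom \<kappa>'. \<forall>i.
        b \<kappa> (cmap \<kappa> p) $ i = (\<Sum>k\<in>UNIV. jac \<kappa> \<kappa>' p k i * b \<kappa>' (cmap \<kappa>' p) $ k))"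

section \<open>Curvature of a Finsler metric\<close>

text \<open>In a chart, a Finsler metric is a function \<open>F x y\<close> of coordinates \<open>x\<close> and tangent
  components \<open>y\<close>.\<close>

definition dx :: "'n \<Rightarrow> (real ^ 'n \<Rightarrow> real ^ 'n \<Rightarrow> real) \<Rightarrow> real ^ 'n \<Rightarrow> real ^ 'n \<Rightarrow> real" where
  "dx k f x y = pd k (\<lambda>x'. f x' y) x"

definition dy :: "'n \<Rightarrow> (real ^ 'n \<Rightarrow> real ^ 'n \<Rightarrow> real) \<Rightarrow> real ^ 'n \<Rightarrow> real ^ 'n \<Rightarrow> real" where
  "dy k f x y = pd k (\<lambda>y'. f x y') y"

definition energy :: "(real ^ 'n \<Rightarrow> real ^ 'n \<Rightarrow> real) \<Rightarrow> real ^ 'n \<Rightarrow> real ^ 'n \<Rightarrow> real" where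
  "energy F x y = (F x y)\<^sup>2"

definition fundamental_tensor ::
    "(real ^ 'n \<Rightarrow> real ^ 'n \<Rightarrow> real) \<Rightarrow> real ^ 'n \<Rightarrow> real ^ 'n \<Rightarrow> real ^ 'n ^ 'n" where
  "fundamental_tensor F x y = (\<chi> i j. 1 / 2 * dy j (dy i (energy F)) x y)"

definition spray ::
    "(real ^ 'n \<Rightarrow> real ^ 'n \<Rightarrow> real) \<Rightarrow> 'n \<Rightarrow> real ^ 'n::finite \<Rightarrow> real ^ 'n \<Rightarrow> real" where
  "spray F i x y = 1 / 4 * (\<Sum>l\<in>UNIV. matrix_inv (fundamental_tensor F x y) $ i $ l *
     ((\<Sum>k\<in>UNIV. dx k (dy l (energy F)) x y * y $ k) - dx l (energy F) x y))"

definition riemann ::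
    "(real ^ 'n \<Rightarrow> real ^ 'n \<Rightarrow> real) \<Rightarrow> 'n \<Rightarrow> 'n \<Rightarrow> real ^ 'n::finite \<Rightarrow> real ^ 'n \<Rightarrow> real" where
  "riemann F i k x y =
     2 * dx k (spray F i) x y
     - (\<Sum>l\<in>UNIV. dx l (dy k (spray F i)) x y * y $ l)
     + 2 * (\<Sum>l\<in>UNIV. spray F l x y * dy k (dy l (spray F i)) x y)
     - (\<Sum>l\<in>UNIV. dy l (spray F i) x y * dy k (spray F l) x y)"

definition ricci :: "(real ^ 'n \<Rightarrow> real ^ 'n \<Rightarrow> real) \<Rightarrow> real ^ 'n::finite \<Rightarrow> real ^ 'n \<Rightarrow> real" where
  "ricci F x y = (\<Sum>m\<in>UNIV. riemann F m m x y)"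

definition nondegenerate_at ::
    "(real ^ 'n \<Rightarrow> real ^ 'n \<Rightarrow> real) \<Rightarrow> real ^ 'n::finite \<Rightarrow> real ^ 'n \<Rightarrow> bool" where
  "nondegenerate_at F x y \<longleftrightarrow> y \<noteq> 0 \<and> invertible (fundamental_tensor F x y)"

definition einstein ::
    "('m, 'n::finite) chart set \<Rightarrow> (('m, 'n::finite) chart \<Rightarrow> real ^ 'n \<Rightarrow> real ^ 'n \<Rightarrow> real) \<Rightarrow> bool" where
  "einstein A F \<longleftrightarrow> (\<exists>K. scalar_field A K \<and>
     (\<forall>\<kappa>\<in>A. \<forall>p\<in>cdom \<kappa>. \<forall>y. nondegenerate_at (F \<kappa>) (cmap \<kappa> p) y \<longrightarrow>
        ricci (F \<kappa>) (cmap \<kappa> p) y = (real CARD('n) - 1) * K p * (F \<kappa> (cmap \<kappa> p) y)\<^sup>2))"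

definition ricci_flat ::
    "('m, 'n::finite) chart set \<Rightarrow> (('m, 'n::finite) chart \<Rightarrow> real ^ 'n \<Rightarrow> real ^ 'n \<Rightarrow> real) \<Rightarrow> bool" where
  "ricci_flat A F \<longleftrightarrow>
     (\<forall>\<kappa>\<in>A. \<forall>p\<in>cdom \<kappa>. \<forall>y. nondegenerate_at (F \<kappa>) (cmap \<kappa> p) y \<longrightarrow>
        ricci (F \<kappa>) (cmap \<kappa> p) y = 0)"

section \<open>Tensor calculus of a Riemannian metric and a 1-form in a chart\<close>

definition alpha :: "(real ^ 'n \<Rightarrow> real ^ 'n ^ 'n) \<Rightarrow> real ^ 'n::finite \<Rightarrow> real ^ 'n \<Rightarrow> real" where
  "alpha a x y = sqrt (\<Sum>i\<in>UNIV. \<Sum>j\<in>UNIV. a x $ i $ j * y $ i * y $ j)"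

text \<open>\<open>pairing w x y = w\<^sub>i(x) y\<^sup>i\<close>; for \<open>w = b\<close> this is \<open>\<beta>\<close>.\<close>

definition pairing :: "(real ^ 'n \<Rightarrow> real ^ 'n) \<Rightarrow> real ^ 'n::finite \<Rightarrow> real ^ 'n \<Rightarrow> real" where
  "pairing w x y = (\<Sum>i\<in>UNIV. w x $ i * y $ i)"

definition raise ::
    "(real ^ 'n \<Rightarrow> real ^ 'n ^ 'n) \<Rightarrow> (real ^ 'n \<Rightarrow> real ^ 'n) \<Rightarrow> real ^ 'n::finite \<Rightarrow> real ^ 'n" where
  "raise a w x = (\<chi> i. \<Sum>j\<in>UNIV. matrix_inv (a x) $ i $ j * w x $ j)"

definition form_norm ::
    "(real ^ 'n \<Rightarrow> real ^ 'n ^ 'n) \<Rightarrow> (real ^ 'n \<Rightarrow> real ^ 'n) \<Rightarrow> real ^ 'n::finite \<Rightarrow> real" where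
  "form_norm a w x =
     sqrt (\<Sum>i\<in>UNIV. \<Sum>j\<in>UNIV. matrix_inv (a x) $ i $ j * w x $ i * w x $ j)"

definition christoffel ::
    "(real ^ 'n \<Rightarrow> real ^ 'n ^ 'n) \<Rightarrow> 'n \<Rightarrow> 'n \<Rightarrow> 'n \<Rightarrow> real ^ 'n::finite \<Rightarrow> real" where
  "christoffel a k i j x = 1 / 2 * (\<Sum>l\<in>UNIV. matrix_inv (a x) $ k $ l *
     (pd i (\<lambda>z. a z $ j $ l) x + pd j (\<lambda>z. a z $ i $ l) x - pd l (\<lambda>z. a z $ i $ j) x))"

text \<open>\<open>covd a w i j = w\<^bsub>i|j\<^esub>\<close>: the last index is the direction of differentiation.\<close>

definition covd ::
    "(real ^ 'n \<Rightarrow> real ^ 'n ^ 'n) \<Rightarrow> (real ^ 'n \<Rightarrow> real ^ 'n) \<Rightarrow> 'n \<Rightarrow> 'n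
      \<Rightarrow> real ^ 'n::finite \<Rightarrow> real" where
  "covd a w i j x = pd j (\<lambda>z. w z $ i) x - (\<Sum>k\<in>UNIV. christoffel a k i j x * w x $ k)"

definition divergence ::
    "(real ^ 'n \<Rightarrow> real ^ 'n ^ 'n) \<Rightarrow> (real ^ 'n \<Rightarrow> real ^ 'n) \<Rightarrow> real ^ 'n::finite \<Rightarrow> real" where
  "divergence a v x = (\<Sum>i\<in>UNIV. pd i (\<lambda>z. v z $ i) x +
     (\<Sum>k\<in>UNIV. christoffel a i i k x * v x $ k))"

definition r_tensor ::
    "(real ^ 'n \<Rightarrow> real ^ 'n ^ 'n) \<Rightarrow> (real ^ 'n \<Rightarrow> real ^ 'n) \<Rightarrow> 'n \<Rightarrow> 'n
      \<Rightarrow> real ^ 'n::finite \<Rightarrow> real" where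
  "r_tensor a b i j x = 1 / 2 * (covd a b i j x + covd a b j i x)"

definition s_tensor ::
    "(real ^ 'n \<Rightarrow> real ^ 'n ^ 'n) \<Rightarrow> (real ^ 'n \<Rightarrow> real ^ 'n) \<Rightarrow> 'n \<Rightarrow> 'n
      \<Rightarrow> real ^ 'n::finite \<Rightarrow> real" where
  "s_tensor a b i j x = 1 / 2 * (covd a b i j x - covd a b j i x)"

text \<open>\<open>s_mixed a b i j = s\<^sup>i\<^sub>j\<close> and \<open>s_form a b = (s\<^sub>i)\<close> with \<open>s\<^sub>i = b\<^sup>m s\<^bsub>mi\<^esub>\<close>.\<close>

definition s_mixed ::
    "(real ^ 'n \<Rightarrow> real ^ 'n ^ 'n) \<Rightarrow> (real ^ 'n \<Rightarrow> real ^ 'n) \<Rightarrow> 'n \<Rightarrow> 'n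
      \<Rightarrow> real ^ 'n::finite \<Rightarrow> real" where
  "s_mixed a b i j x = (\<Sum>m\<in>UNIV. matrix_inv (a x) $ i $ m * s_tensor a b m j x)"

definition s_form ::
    "(real ^ 'n \<Rightarrow> real ^ 'n ^ 'n) \<Rightarrow> (real ^ 'n \<Rightarrow> real ^ 'n) \<Rightarrow> real ^ 'n::finite \<Rightarrow> real ^ 'n" where
  "s_form a b x = (\<chi> i. \<Sum>m\<in>UNIV. raise a b x $ m * s_tensor a b m i x)"

definition t_tensor ::
    "(real ^ 'n \<Rightarrow> real ^ 'n ^ 'n) \<Rightarrow> (real ^ 'n \<Rightarrow> real ^ 'n) \<Rightarrow> 'n \<Rightarrow> 'n
      \<Rightarrow> real ^ 'n::finite \<Rightarrow> real" where
  "t_tensor a b i j x = (\<Sum>m\<in>UNIV. s_tensor a b i m x * s_mixed a b m j x)"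

definition t_scalar ::
    "(real ^ 'n \<Rightarrow> real ^ 'n ^ 'n) \<Rightarrow> (real ^ 'n \<Rightarrow> real ^ 'n) \<Rightarrow> real ^ 'n::finite \<Rightarrow> real" where
  "t_scalar a b x =
     (\<Sum>i\<in>UNIV. \<Sum>j\<in>UNIV. t_tensor a b i j x * raise a b x $ i * raise a b x $ j)"

definition grad_form :: "(real ^ 'n \<Rightarrow> real) \<Rightarrow> real ^ 'n \<Rightarrow> real ^ 'n" where
  "grad_form f x = (\<chi> k. pd k f x)"

definition singular_square ::
    "(real ^ 'n \<Rightarrow> real ^ 'n ^ 'n) \<Rightarrow> (real ^ 'n \<Rightarrow> real ^ 'n) \<Rightarrow> real ^ 'n::finite \<Rightarrow> real ^ 'n
      \<Rightarrow> real" where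
  "singular_square a b x y = (form_norm a b x * alpha a x y + pairing b x y)\<^sup>2 / alpha a x y"

end

theory Submission
  imports Defs
begin

text \<open>Replacing \<open>\<alpha>\<close>, \<open>\<beta>\<close> by \<open>b\<^sup>2\<alpha>\<close>, \<open>b\<beta>\<close> does not change \<open>F\<close> and makes the 1-form a unit form. For a unit form
  the spray of \<open>F\<close> is \<open>G\<^sup>i + \<lambda> s\<^sup>i\<^sub>0 + \<chi> (\<alpha>\<^sup>2 b\<^sup>i + (\<alpha> - 2\<beta>) y\<^sup>i)\<close> with \<open>\<lambda> = 2\<alpha>\<^sup>2/(\<alpha> - \<beta>)\<close> and
  \<open>\<chi> = (r\<^sub>0\<^sub>0 - 2\<lambda> s\<^sub>0)/(3(\<alpha>\<^sup>2 - \<beta>\<^sup>2))\<close>, so in the plane spanned by \<open>b\<^sup>i\<close> and an orthogonal vector the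
  Einstein equation is an identity between functions with poles at \<open>\<alpha> = \<beta>\<close>. Comparing the pole parts gives
  \<open>s\<^sub>i = 0\<close>, then \<open>s\<^sub>i\<^sub>j = 0\<close>, \<open>K = 0\<close> and \<open>r\<^sub>i\<^sub>j = c (a\<^sub>i\<^sub>j - b\<^sub>i b\<^sub>j)\<close>; what remains is
  \<open>c\<^sub>k = -(2/3) c\<^sup>2 b\<^sub>k\<close> and an explicit formula for the Ricci tensor of \<open>\<alpha>\<close>. The conformal change
  back to the original \<open>\<alpha>\<close>, \<open>\<beta>\<close> turns these into the three stated equations. The functions \<open>c\<close>, \<open>d\<close>
  agree on overlaps of charts because they can be read off from \<open>r\<^sub>0\<^sub>0\<close> on vectors orthogonal to \<open>\<beta>\<close> and on
  \<open>b\<^sup>i\<close>. Conversely, a Ricci-flat metric is Einstein with \<open>K = 0\<close>.\<close>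

section \<open>Directional derivatives and smooth functions\<close>

text \<open>A unit form removes one set of unknowns: constant length forces
  \<open>r_{ij} b^j = - s_i\<close>, and the length of \<beta> no longer has derivatives. The spray
  is not found by inverting the fundamental tensor; it is guessed and checked in the Euler-Lagrange
  equations, with \<lambda> and \<chi> as the two scalars that balance them. The Ricci curvature of
  F is worked out only where s_0 = 0. This is the use of n \<ge> 3: some w is orthogonal to both b
  and s, so the condition holds on the plane of b and w. Terms odd in w carry unknown derivatives;
  averaging over w and -w cancels them. The conclusions are pointwise but get differentiated
  afterwards, so each is established on the whole chart and packed into a locale; likewise c is a
  normalised divergence of b, which is visibly smooth. Two algebraic facts carry the middle part: on
  the complement of b the endomorphism s squares to a multiple of the identity, which clashes with a
  second relation unless s = 0; and x^2 + y^2 divides the square of a quadratic form only if it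
  divides the form, which makes r proportional to the metric there.\<close>

definition dd :: "'e::real_normed_vector \<Rightarrow> ('e \<Rightarrow> real) \<Rightarrow> 'e \<Rightarrow> real" where
  "dd v f x = deriv (\<lambda>t. f (x + t *\<^sub>R v)) 0"

text \<open>All directions are quantified over, instead of a basis, so that one calculus serves a
  chart domain and its tangent bundle, a product space without \<open>axis\<close> vectors of its
  own. \<open>Ck_on_Cd\<close> shows that on open subsets of coordinate space nothing
  changes.\<close>

primrec Cd :: "nat \<Rightarrow> 'e::real_normed_vector set \<Rightarrow> ('e \<Rightarrow> real) \<Rightarrow> bool" where
  "Cd 0 S f \<longleftrightarrow> continuous_on S f"
| "Cd (Suc k) S f \<longleftrightarrow> (\<forall>x\<in>S. f differentiable (at x)) \<and> (\<forall>v. Cd k S (dd v f))"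

definition Cinf :: "'e::real_normed_vector set \<Rightarrow> ('e \<Rightarrow> real) \<Rightarrow> bool" where
  "Cinf S f \<longleftrightarrow> (\<forall>k. Cd k S f)"

lemma dd_frechet_DERIV:
  assumes "(f has_derivative f') (at x)"
  shows "((\<lambda>t. f (x + t *\<^sub>R v)) has_real_derivative f' v) (at 0)"
proof -
  have "((\<lambda>t. x + t *\<^sub>R v) has_derivative (\<lambda>t. t *\<^sub>R v)) (at (0::real))"
    by (auto intro!: derivative_eq_intros)
  moreover have "(f has_derivative f') (at (x + 0 *\<^sub>R v))" using assms by simp
  ultimately have "((\<lambda>t. f (x + t *\<^sub>R v)) has_derivative (\<lambda>t. f' (t *\<^sub>R v))) (at 0)"
    by (rule has_derivative_compose)
  then show ?thesis
    using assms by (simp add: has_field_derivative_def linear_cmul has_derivative_linear mult.commute[of _ "f' v"] fun_eq_iff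
        has_derivative_bounded_linear bounded_linear.linear)
qed

lemma dd_frechet:
  assumes "(f has_derivative f') (at x)"
  shows "dd v f x = f' v"
  unfolding dd_def using dd_frechet_DERIV[OF assms] by (rule DERIV_imp_deriv)

lemma dd_has_derivative:
  assumes "f differentiable (at x)"
  shows "(f has_derivative (\<lambda>v. dd v f x)) (at x)"
  using assms dd_frechet unfolding differentiable_def by (metis (no_types, lifting) ext)

lemma dd_DERIV:
  assumes "f differentiable (at x)"
  shows "((\<lambda>t. f (x + t *\<^sub>R v)) has_real_derivative dd v f x) (at 0)"
  using dd_frechet_DERIV[OF dd_has_derivative[OF assms]] .

lemma dd_eqI:
  assumes "((\<lambda>t. f (x + t *\<^sub>R v)) has_real_derivative c) (at 0)"
  shows "dd v f x = c"
  unfolding dd_def using assms by (rule DERIV_imp_deriv)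

lemma dd_linear: "f differentiable (at x) \<Longrightarrow> linear (\<lambda>v. dd v f x)"
  using dd_has_derivative has_derivative_linear by blast

lemma dd_dir_add: "f differentiable (at x) \<Longrightarrow> dd (v + w) f x = dd v f x + dd w f x"
  using dd_linear linear_add by blast

lemma dd_dir_diff: "f differentiable (at x) \<Longrightarrow> dd (v - w) f x = dd v f x - dd w f x"
  using dd_linear linear_diff by blast

lemma dd_dir_scaleR: "f differentiable (at x) \<Longrightarrow> dd (c *\<^sub>R v) f x = c * dd v f x"
  using dd_linear linear_cmul by fastforce

lemma dd_dir_zero: "f differentiable (at x) \<Longrightarrow> dd 0 f x = 0"
  using dd_linear linear_0 by blast

lemma dd_dir_sum: "f differentiable (at x) \<Longrightarrow> dd (\<Sum>i\<in>I. v i) f x = (\<Sum>i\<in>I. dd (v i) f x)"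
  using linear_sum[OF dd_linear] by blast

lemma dd_transform:
  assumes "open S" "x \<in> S" "\<And>y. y \<in> S \<Longrightarrow> f y = g y"
  shows "dd v f x = dd v g x"
proof -
  have "continuous_on UNIV (\<lambda>t. x + t *\<^sub>R v)" by (intro continuous_intros)
  then have "open ((\<lambda>t. x + t *\<^sub>R v) -` S)"
    using assms(1) by (auto simp: continuous_on_open_vimage)
  then have "\<forall>\<^sub>F t in nhds (0::real). x + t *\<^sub>R v \<in> S"
    using assms(2) by (auto simp: eventually_nhds intro!: exI[of _ "(\<lambda>t. x + t *\<^sub>R v) -` S"])
  then have "\<forall>\<^sub>F t in nhds 0. f (x + t *\<^sub>R v) = g (x + t *\<^sub>R v)"
    by eventually_elim (use assms in auto)
  then show ?thesis unfolding dd_def by (rule deriv_cong_ev) simp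
qed

lemma differentiable_transform_open:
  assumes "open S" "x \<in> S" "\<And>y. y \<in> S \<Longrightarrow> f y = g y" "f differentiable (at x)"
  shows "g differentiable (at x)"
  using assms has_derivative_transform_within_open unfolding differentiable_def by blast

lemma Cd_cong:
  assumes "open S" "\<And>y. y \<in> S \<Longrightarrow> f y = g y"
  shows "Cd k S f \<longleftrightarrow> Cd k S g"
  using assms(2)
proof (induction k arbitrary: f g)
  case 0
  then show ?case by (simp cong: continuous_on_cong)
next
  case (Suc k)
  have "Cd k S (dd v f) \<longleftrightarrow> Cd k S (dd v g)" for v
    by (rule Suc.IH) (use dd_transform assms(1) Suc.prems in blast)
  moreover have "f differentiable (at x) \<longleftrightarrow> g differentiable (at x)" if "x \<in> S" for x
    using differentiable_transform_open[OF assms(1) that] Suc.prems by metis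
  ultimately show ?case by simp
qed

lemma Cd_Suc_imp: "Cd (Suc k) S f \<Longrightarrow> Cd k S f"
proof (induction k arbitrary: f)
  case 0
  then show ?case
    by (auto intro!: continuous_at_imp_continuous_on differentiable_imp_continuous_within)
next
  case (Suc k)
  then show ?case by simp
qed

lemma Cinf_cong:
  assumes "open S" "\<And>y. y \<in> S \<Longrightarrow> f y = g y"
  shows "Cinf S f \<longleftrightarrow> Cinf S g"
  unfolding Cinf_def using Cd_cong[OF assms] by simp

lemma Cinf_differentiable: "Cinf S f \<Longrightarrow> x \<in> S \<Longrightarrow> f differentiable (at x)"
  unfolding Cinf_def using Cd.simps(2) by blast

lemma Cinf_continuous: "Cinf S f \<Longrightarrow> continuous_on S f"
  unfolding Cinf_def using Cd.simps(1) by blast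

lemma Cinf_dd: "Cinf S f \<Longrightarrow> Cinf S (dd v f)"
  unfolding Cinf_def using Cd.simps(2) by blast

lemma Cd_subset: "Cd k S f \<Longrightarrow> T \<subseteq> S \<Longrightarrow> Cd k T f"
  by (induction k arbitrary: f) (auto intro: continuous_on_subset)

lemma Cinf_subset: "Cinf S f \<Longrightarrow> T \<subseteq> S \<Longrightarrow> Cinf T f"
  unfolding Cinf_def using Cd_subset by blast

lemma dd_const [simp]: "dd v (\<lambda>x. c) x = 0"
  unfolding dd_def by simp

lemma dd_add:
  assumes "f differentiable (at x)" "g differentiable (at x)"
  shows "dd v (\<lambda>x. f x + g x) x = dd v f x + dd v g x"
  by (rule dd_eqI) (use dd_DERIV[OF assms(1), of v] dd_DERIV[OF assms(2), of v] in
      \<open>auto intro!: derivative_eq_intros\<close>)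

lemma dd_diff:
  assumes "f differentiable (at x)" "g differentiable (at x)"
  shows "dd v (\<lambda>x. f x - g x) x = dd v f x - dd v g x"
  by (rule dd_eqI) (use dd_DERIV[OF assms(1), of v] dd_DERIV[OF assms(2), of v] in
      \<open>auto intro!: derivative_eq_intros\<close>)

lemma dd_minus:
  assumes "f differentiable (at x)"
  shows "dd v (\<lambda>x. - f x) x = - dd v f x"
  by (rule dd_eqI) (use dd_DERIV[OF assms(1), of v] in \<open>auto intro!: derivative_eq_intros\<close>)

lemma dd_mult:
  assumes "f differentiable (at x)" "g differentiable (at x)"
  shows "dd v (\<lambda>x. f x * g x) x = dd v f x * g x + f x * dd v g x"
  by (rule dd_eqI) (use dd_DERIV[OF assms(1), of v] dd_DERIV[OF assms(2), of v] in
      \<open>auto intro!: derivative_eq_intros\<close>)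

lemma dd_cmult:
  assumes "f differentiable (at x)"
  shows "dd v (\<lambda>x. c * f x) x = c * dd v f x"
  using dd_mult[OF differentiable_const assms] by simp

lemma dd_sum:
  assumes "finite I" "\<And>i. i \<in> I \<Longrightarrow> f i differentiable (at x)"
  shows "dd v (\<lambda>x. \<Sum>i\<in>I. f i x) x = (\<Sum>i\<in>I. dd v (f i) x)"
  using assms
proof (induction I rule: finite_induct)
  case (insert i I)
  then show ?case by (simp add: dd_add differentiable_sum)
qed simp

lemma dd_inverse:
  assumes "f differentiable (at x)" "f x \<noteq> 0"
  shows "dd v (\<lambda>x. inverse (f x)) x = - dd v f x * (inverse (f x) * inverse (f x))"
  by (rule dd_eqI) (use dd_DERIV[OF assms(1), of v] assms(2) in
      \<open>auto intro!: derivative_eq_intros\<close>)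

lemma dd_sqrt:
  assumes "f differentiable (at x)" "f x > 0"
  shows "dd v (\<lambda>x. sqrt (f x)) x = dd v f x * (inverse 2 * inverse (sqrt (f x)))"
  by (rule dd_eqI) (use dd_DERIV[OF assms(1), of v] assms(2) in
      \<open>auto intro!: derivative_eq_intros simp: field_simps\<close>)

lemma differentiable_sqrt:
  fixes f :: "'e::real_normed_vector \<Rightarrow> real"
  assumes "f differentiable (at x)" "f x > 0"
  shows "(\<lambda>x. sqrt (f x)) differentiable (at x)"
proof -
  obtain f' where "(f has_derivative f') (at x)" using assms(1) differentiable_def by blast
  from has_derivative_real_sqrt[OF assms(2) this] show ?thesis
    unfolding differentiable_def by blast
qed

lemma Cd_const: "Cd k (S :: 'e::real_normed_vector set) (\<lambda>x. c)"
proof (induction k arbitrary: c)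
  case (Suc k)
  have "dd v (\<lambda>x. c) = (\<lambda>x. 0)" for v :: 'e by (rule ext) simp
  then show ?case using Suc by simp
qed simp

lemma Cd_add:
  assumes "open S"
  shows "Cd k S f \<Longrightarrow> Cd k S g \<Longrightarrow> Cd k S (\<lambda>x. f x + g x)"
proof (induction k arbitrary: f g)
  case 0
  then show ?case by (auto intro: continuous_intros)
next
  case (Suc k)
  have "Cd k S (dd v (\<lambda>x. f x + g x))" for v
    using Suc Cd_cong[OF assms, of "dd v (\<lambda>x. f x + g x)" "\<lambda>x. dd v f x + dd v g x"]
    by (simp add: dd_add)
  then show ?case using Suc.prems by auto
qed

lemma Cd_mult:
  assumes "open S"
  shows "Cd k S f \<Longrightarrow> Cd k S g \<Longrightarrow> Cd k S (\<lambda>x. f x * g x)"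
proof (induction k arbitrary: f g)
  case 0
  then show ?case by (auto intro: continuous_intros)
next
  case (Suc k)
  have "Cd k S (\<lambda>x. dd v f x * g x + f x * dd v g x)" for v
    using Suc Cd_Suc_imp[OF Suc.prems(1)] Cd_Suc_imp[OF Suc.prems(2)]
    by (intro Cd_add[OF assms] Suc.IH) auto
  then have "Cd k S (dd v (\<lambda>x. f x * g x))" for v
    using Suc.prems Cd_cong[OF assms, of "dd v (\<lambda>x. f x * g x)" "\<lambda>x. dd v f x * g x + f x * dd v g x"]
    by (simp add: dd_mult)
  then show ?case using Suc.prems by auto
qed

lemma Cd_inverse:
  assumes "open S" "\<And>x. x \<in> S \<Longrightarrow> f x \<noteq> 0"
  shows "Cd k S f \<Longrightarrow> Cd k S (\<lambda>x. inverse (f x))"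
proof (induction k)
  case 0
  then show ?case using assms by (auto intro!: continuous_intros)
next
  case (Suc k)
  have i: "Cd k S (\<lambda>x. inverse (f x))" using Suc.IH[OF Cd_Suc_imp[OF Suc.prems]] .
  have "Cd k S (\<lambda>x. - 1 * dd v f x * (inverse (f x) * inverse (f x)))" for v
    using Suc.prems i by (intro Cd_mult[OF assms(1)] Cd_const) auto
  then have "Cd k S (dd v (\<lambda>x. inverse (f x)))" for v
    using Suc.prems assms(2) Cd_cong[OF assms(1), of "dd v (\<lambda>x. inverse (f x))"
        "\<lambda>x. - 1 * dd v f x * (inverse (f x) * inverse (f x))"]
    by (simp add: dd_inverse)
  then show ?case using Suc.prems assms(2) by (auto intro!: differentiable_inverse)
qed

lemma Cd_sqrt:
  assumes "open S" "\<And>x. x \<in> S \<Longrightarrow> f x > 0"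
  shows "Cd k S f \<Longrightarrow> Cd k S (\<lambda>x. sqrt (f x))"
proof (induction k)
  case 0
  then show ?case by (auto intro!: continuous_intros)
next
  case (Suc k)
  have i: "Cd k S (\<lambda>x. sqrt (f x))" using Suc.IH[OF Cd_Suc_imp[OF Suc.prems]] .
  have "Cd k S (\<lambda>x. dd v f x * (inverse 2 * inverse (sqrt (f x))))" for v
    using Suc.prems i assms(2)
    by (intro Cd_mult[OF assms(1)] Cd_const Cd_inverse assms(1)) (auto simp: less_le dest!: assms(2))
  then have "Cd k S (dd v (\<lambda>x. sqrt (f x)))" for v
    using Suc.prems assms(2) Cd_cong[OF assms(1), of "dd v (\<lambda>x. sqrt (f x))"
        "\<lambda>x. dd v f x * (inverse 2 * inverse (sqrt (f x)))"]
    by (simp add: dd_sqrt)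
  then show ?case using Suc.prems assms(2) by (auto intro!: differentiable_sqrt)
qed

lemma Cinf_const: "Cinf S (\<lambda>x. c)"
  unfolding Cinf_def using Cd_const by blast

lemma Cinf_add: "open S \<Longrightarrow> Cinf S f \<Longrightarrow> Cinf S g \<Longrightarrow> Cinf S (\<lambda>x. f x + g x)"
  unfolding Cinf_def using Cd_add by blast

lemma Cinf_mult: "open S \<Longrightarrow> Cinf S f \<Longrightarrow> Cinf S g \<Longrightarrow> Cinf S (\<lambda>x. f x * g x)"
  unfolding Cinf_def using Cd_mult by blast

lemma Cinf_minus: "open S \<Longrightarrow> Cinf S f \<Longrightarrow> Cinf S (\<lambda>x. - f x)"
  using Cinf_mult[of S "\<lambda>x. -1" f] Cinf_const by auto

lemma Cinf_diff: "open S \<Longrightarrow> Cinf S f \<Longrightarrow> Cinf S g \<Longrightarrow> Cinf S (\<lambda>x. f x - g x)"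
  using Cinf_add[of S f "\<lambda>x. - g x"] Cinf_minus[of S g] by auto

lemma Cinf_sum: "open S \<Longrightarrow> (\<And>i. i \<in> I \<Longrightarrow> Cinf S (f i)) \<Longrightarrow> Cinf S (\<lambda>x. \<Sum>i\<in>I. f i x)"
  by (induction I rule: infinite_finite_induct) (auto intro: Cinf_const Cinf_add)

lemma Cinf_prod: "open S \<Longrightarrow> (\<And>i. i \<in> I \<Longrightarrow> Cinf S (f i)) \<Longrightarrow> Cinf S (\<lambda>x. \<Prod>i\<in>I. f i x)"
  by (induction I rule: infinite_finite_induct) (auto intro: Cinf_const Cinf_mult)

lemma Cinf_power: "open S \<Longrightarrow> Cinf S f \<Longrightarrow> Cinf S (\<lambda>x. f x ^ k)"
  by (induction k) (auto intro: Cinf_const Cinf_mult)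

lemma Cinf_inverse:
  "open S \<Longrightarrow> Cinf S f \<Longrightarrow> (\<And>x. x \<in> S \<Longrightarrow> f x \<noteq> 0) \<Longrightarrow> Cinf S (\<lambda>x. inverse (f x))"
  unfolding Cinf_def using Cd_inverse by blast

lemma Cinf_divide:
  "open S \<Longrightarrow> Cinf S f \<Longrightarrow> Cinf S g \<Longrightarrow> (\<And>x. x \<in> S \<Longrightarrow> g x \<noteq> 0) \<Longrightarrow> Cinf S (\<lambda>x. f x / g x)"
  unfolding divide_inverse by (intro Cinf_mult Cinf_inverse)

lemma Cinf_sqrt:
  "open S \<Longrightarrow> Cinf S f \<Longrightarrow> (\<And>x. x \<in> S \<Longrightarrow> f x > 0) \<Longrightarrow> Cinf S (\<lambda>x. sqrt (f x))"
  unfolding Cinf_def using Cd_sqrt by blast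

lemma Cinf_linear:
  assumes "bounded_linear f"
  shows "Cinf S f"
proof -
  have d: "dd v f = (\<lambda>x. f v)" for v
    using dd_frechet[OF bounded_linear_imp_has_derivative[OF assms]] by blast
  have "Cd k S f" for k
  proof (cases k)
    case 0
    then show ?thesis using assms linear_continuous_on by auto
  next
    case (Suc m)
    then show ?thesis
      using d Cd_const bounded_linear_imp_differentiable[OF assms] by auto
  qed
  then show ?thesis unfolding Cinf_def by blast
qed

lemma Cd_linear_compose:
  assumes "bounded_linear h" "\<And>p. p \<in> T \<Longrightarrow> h p \<in> S"
  shows "Cd k S f \<Longrightarrow> open T \<Longrightarrow> Cd k T (\<lambda>p. f (h p))"
proof (induction k arbitrary: f)
  case 0
  then show ?case
    using continuous_on_compose2[of S f T h] linear_continuous_on[OF assms(1)] assms(2) by auto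
next
  case (Suc k)
  have hd: "((\<lambda>p. f (h p)) has_derivative (\<lambda>v. dd (h v) f (h p))) (at p)" if "p \<in> T" for p
    using has_derivative_compose[OF bounded_linear_imp_has_derivative[OF assms(1)]
        dd_has_derivative[of f "h p"]] Suc.prems(1) assms(2) that by auto
  have "Cd k T (dd v (\<lambda>p. f (h p)))" for v
    using Suc dd_frechet[OF hd] Cd_cong[OF Suc.prems(2), of "dd v (\<lambda>p. f (h p))" "\<lambda>p. dd (h v) f (h p)"]
    by simp
  then show ?case using hd unfolding differentiable_def Cd.simps by blast
qed

lemma Cinf_linear_compose:
  assumes "bounded_linear h" "\<And>p. p \<in> T \<Longrightarrow> h p \<in> S" "Cinf S f" "open T"
  shows "Cinf T (\<lambda>p. f (h p))"
  using assms Cd_linear_compose unfolding Cinf_def by blast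

lemma dd_linear_compose:
  fixes f :: "'e::real_normed_vector \<Rightarrow> real"
  assumes "bounded_linear h" "f differentiable (at (h p))"
  shows "dd v (\<lambda>p. f (h p)) p = dd (h v) f (h p)"
  using dd_frechet[OF has_derivative_compose[OF bounded_linear_imp_has_derivative[OF assms(1)]
        dd_has_derivative[OF assms(2)]]] .

lemma differentiable_linear_compose:
  fixes f :: "'e::real_normed_vector \<Rightarrow> real"
  assumes "bounded_linear h" "f differentiable (at (h p))"
  shows "(\<lambda>p. f (h p)) differentiable (at p)"
  using has_derivative_compose[OF bounded_linear_imp_has_derivative[OF assms(1)]
        dd_has_derivative[OF assms(2)]] unfolding differentiable_def by blast

lemma dd_bounded_linear:
  assumes "bounded_linear f"
  shows "dd v f x = f v"
  using dd_frechet[OF bounded_linear_imp_has_derivative[OF assms]] by blast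

section \<open>Symmetry of second derivatives\<close>

lemma open_line_ball:
  assumes "open S" "x \<in> S"
  obtains e where "e > 0" "\<And>s t. \<bar>s\<bar> \<le> e \<Longrightarrow> \<bar>t\<bar> \<le> e \<Longrightarrow> x + s *\<^sub>R u + t *\<^sub>R (v::'e::real_normed_vector) \<in> S"
proof -
  obtain r where r: "r > 0" "ball x r \<subseteq> S" using assms open_contains_ball by blast
  define e where "e = r / (2 * (norm u + norm v + 1))"
  have pos: "norm u + norm v + 1 > 0" by (smt (verit) norm_ge_zero)
  have e: "e > 0" unfolding e_def using r pos by auto
  have "x + s *\<^sub>R u + t *\<^sub>R v \<in> S" if "\<bar>s\<bar> \<le> e" "\<bar>t\<bar> \<le> e" for s t
  proof -
    have "norm (s *\<^sub>R u + t *\<^sub>R v) \<le> \<bar>s\<bar> * norm u + \<bar>t\<bar> * norm v"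
      using norm_triangle_ineq[of "s *\<^sub>R u" "t *\<^sub>R v"] by simp
    also have "\<dots> \<le> e * norm u + e * norm v"
      using that by (intro add_mono mult_right_mono) auto
    also have "\<dots> \<le> e * (norm u + norm v + 1)" using e by (simp add: algebra_simps)
    also have "\<dots> = r / 2" unfolding e_def using pos by (simp add: field_simps)
    finally have "norm (s *\<^sub>R u + t *\<^sub>R v) < r" using r by simp
    then have "x + (s *\<^sub>R u + t *\<^sub>R v) \<in> ball x r"
      by (metis add_diff_cancel_left' dist_commute dist_norm mem_ball)
    then show ?thesis using r by (auto simp: add.assoc)
  qed
  with e show thesis using that by blast
qed

lemma DERIV_along:
  fixes f :: "'e::real_normed_vector \<Rightarrow> real"
  assumes "f differentiable (at (x + s *\<^sub>R v))"
  shows "((\<lambda>t. f (x + t *\<^sub>R v)) has_real_derivative dd v f (x + s *\<^sub>R v)) (at s)"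
proof -
  have "((\<lambda>t. f ((x + s *\<^sub>R v) + t *\<^sub>R v)) has_real_derivative dd v f (x + s *\<^sub>R v)) (at 0)"
    using dd_DERIV[OF assms] .
  then have "((\<lambda>t. f ((x + s *\<^sub>R v) + (t - s) *\<^sub>R v)) has_real_derivative dd v f (x + s *\<^sub>R v)) (at s)"
    using DERIV_shift[of "\<lambda>t. f ((x + s *\<^sub>R v) + t *\<^sub>R v)" _ s "-s"] by simp
  then show ?thesis by (simp add: algebra_simps)
qed

text \<open>The mean value theorem is applied along \<open>u\<close> to a difference of
  \<open>f\<close> in direction \<open>v\<close>, and then along \<open>v\<close> to the derivative
  obtained. The point is that the second difference on the left is symmetric in \<open>u\<close> and
  \<open>v\<close>.\<close>

lemma second_difference_mean_value:
  fixes f :: "'e::real_normed_vector \<Rightarrow> real"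
  assumes S: "\<And>s t. \<bar>s\<bar> \<le> e \<Longrightarrow> \<bar>t\<bar> \<le> e \<Longrightarrow> x + s *\<^sub>R u + t *\<^sub>R v \<in> S"
    and f: "Cd 2 S f" and h: "0 < h" "h \<le> e"
  shows "\<exists>s t. 0 < s \<and> s < h \<and> 0 < t \<and> t < h \<and>
    f (x + h *\<^sub>R u + h *\<^sub>R v) - f (x + h *\<^sub>R u) - f (x + h *\<^sub>R v) + f x
      = h * h * dd v (dd u f) (x + s *\<^sub>R u + t *\<^sub>R v)"
proof -
  have df: "\<And>p. p \<in> S \<Longrightarrow> f differentiable (at p)"
    and ddf: "\<And>p. p \<in> S \<Longrightarrow> dd u f differentiable (at p)"
    using f by (auto simp: numeral_2_eq_2)
  define \<phi> where "\<phi> s = f (x + h *\<^sub>R v + s *\<^sub>R u) - f (x + s *\<^sub>R u)" for s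
  have der: "(\<phi> has_real_derivative (dd u f (x + h *\<^sub>R v + s *\<^sub>R u) - dd u f (x + s *\<^sub>R u))) (at s)"
    if "0 \<le> s" "s \<le> h" for s
  proof -
    have "x + h *\<^sub>R v + s *\<^sub>R u \<in> S" "x + s *\<^sub>R u \<in> S"
      using S[of s h] S[of s 0] that h by (auto simp: algebra_simps)
    then show ?thesis unfolding \<phi>_def by (intro DERIV_diff DERIV_along df)
  qed
  obtain s where s: "0 < s" "s < h" "\<phi> h - \<phi> 0 = h * (dd u f (x + h *\<^sub>R v + s *\<^sub>R u) - dd u f (x + s *\<^sub>R u))"
    using MVT2[OF h(1), of \<phi> "\<lambda>s. dd u f (x + h *\<^sub>R v + s *\<^sub>R u) - dd u f (x + s *\<^sub>R u)"] der by auto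
  have "((\<lambda>t. dd u f (x + s *\<^sub>R u + t *\<^sub>R v)) has_real_derivative dd v (dd u f) (x + s *\<^sub>R u + t *\<^sub>R v)) (at t)"
    if "0 \<le> t" "t \<le> h" for t
    by (intro DERIV_along ddf S) (use s that h in auto)
  then obtain t where t: "0 < t" "t < h"
    "dd u f (x + s *\<^sub>R u + h *\<^sub>R v) - dd u f (x + s *\<^sub>R u + 0 *\<^sub>R v) = (h - 0) * dd v (dd u f) (x + s *\<^sub>R u + t *\<^sub>R v)"
    using MVT2[OF h(1), of "\<lambda>t. dd u f (x + s *\<^sub>R u + t *\<^sub>R v)" "\<lambda>t. dd v (dd u f) (x + s *\<^sub>R u + t *\<^sub>R v)"] by blast
  have "f (x + h *\<^sub>R u + h *\<^sub>R v) - f (x + h *\<^sub>R u) - f (x + h *\<^sub>R v) + f x = \<phi> h - \<phi> 0"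
    unfolding \<phi>_def by (simp add: algebra_simps)
  also have "\<dots> = h * h * dd v (dd u f) (x + s *\<^sub>R u + t *\<^sub>R v)"
    using s(3) t(3) by (simp add: algebra_simps)
  finally show ?thesis using s t by blast
qed

text \<open>Both mixed derivatives, each taken at some point close to \<open>x\<close>, express the
  same second difference divided by \<open>h * h\<close>. Along \<open>h = e / Suc k\<close> these
  points converge to \<open>x\<close>, and continuity of the second derivatives finishes the
  argument.\<close>

lemma dd_commute:
  fixes f :: "'e::real_normed_vector \<Rightarrow> real"
  assumes "open S" "x \<in> S" "Cd 2 S f"
  shows "dd u (dd v f) x = dd v (dd u f) x"
proof -
  obtain e where e: "e > 0" "\<And>s t. \<bar>s\<bar> \<le> e \<Longrightarrow> \<bar>t\<bar> \<le> e \<Longrightarrow> x + s *\<^sub>R u + t *\<^sub>R v \<in> S"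
    using open_line_ball[OF assms(1,2)] by blast
  have e': "\<And>s t. \<bar>s\<bar> \<le> e \<Longrightarrow> \<bar>t\<bar> \<le> e \<Longrightarrow> x + s *\<^sub>R v + t *\<^sub>R u \<in> S"
    using e(2) by (metis add.assoc add.commute)
  have key: "\<exists>s t s' t'. 0 < s \<and> s < h \<and> 0 < t \<and> t < h \<and> 0 < s' \<and> s' < h \<and> 0 < t' \<and> t' < h \<and>
      dd v (dd u f) (x + s *\<^sub>R u + t *\<^sub>R v) = dd u (dd v f) (x + s' *\<^sub>R v + t' *\<^sub>R u)"
    if h: "0 < h" "h \<le> e" for h
  proof -
    obtain s t where 1: "0 < s" "s < h" "0 < t" "t < h"
      "f (x + h *\<^sub>R u + h *\<^sub>R v) - f (x + h *\<^sub>R u) - f (x + h *\<^sub>R v) + f x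
        = h * h * dd v (dd u f) (x + s *\<^sub>R u + t *\<^sub>R v)"
      using second_difference_mean_value[OF e(2) assms(3) h] by blast
    obtain s' t' where 2: "0 < s'" "s' < h" "0 < t'" "t' < h"
      "f (x + h *\<^sub>R v + h *\<^sub>R u) - f (x + h *\<^sub>R v) - f (x + h *\<^sub>R u) + f x
        = h * h * dd u (dd v f) (x + s' *\<^sub>R v + t' *\<^sub>R u)"
      using second_difference_mean_value[OF e' assms(3) h] by blast
    have "h * h * dd v (dd u f) (x + s *\<^sub>R u + t *\<^sub>R v) = h * h * dd u (dd v f) (x + s' *\<^sub>R v + t' *\<^sub>R u)"
      using 1(5) 2(5) by (simp add: algebra_simps)
    then have "dd v (dd u f) (x + s *\<^sub>R u + t *\<^sub>R v) = dd u (dd v f) (x + s' *\<^sub>R v + t' *\<^sub>R u)"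
      using h by simp
    with 1 2 show ?thesis by blast
  qed
  have "\<forall>k::nat. \<exists>s t s' t'. 0 < s \<and> s < e / Suc k \<and> 0 < t \<and> t < e / Suc k \<and> 0 < s' \<and> s' < e / Suc k \<and> 0 < t' \<and> t' < e / Suc k \<and>
      dd v (dd u f) (x + s *\<^sub>R u + t *\<^sub>R v) = dd u (dd v f) (x + s' *\<^sub>R v + t' *\<^sub>R u)"
    using e(1) by (intro allI key) (auto simp: field_simps)
  then obtain s t s' t' where st: "\<And>k::nat. 0 < s k \<and> s k < e / Suc k" "\<And>k. 0 < t k \<and> t k < e / Suc k"
     "\<And>k. 0 < s' k \<and> s' k < e / Suc k" "\<And>k. 0 < t' k \<and> t' k < e / Suc k"
     and eq: "\<And>k. dd v (dd u f) (x + s k *\<^sub>R u + t k *\<^sub>R v) = dd u (dd v f) (x + s' k *\<^sub>R v + t' k *\<^sub>R u)"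
    by metis
  have lim: "(\<lambda>k. e / real (Suc k)) \<longlonglongrightarrow> 0"
    using LIMSEQ_inverse_real_of_nat tendsto_mult_right[of "\<lambda>k. inverse (real (Suc k))" 0 sequentially e]
    by (simp add: divide_inverse mult.commute)
  have squeeze: "w \<longlonglongrightarrow> 0" if "\<And>k. 0 < w k \<and> w k < e / Suc k" for w :: "nat \<Rightarrow> real"
    by (rule tendsto_sandwich[OF _ _ tendsto_const lim]) (use that less_imp_le in \<open>auto intro!: always_eventually\<close>)
  have c: "isCont (dd v (dd u f)) x" "isCont (dd u (dd v f)) x"
    using assms by (auto simp: numeral_2_eq_2 continuous_on_eq_continuous_at)
  have "(\<lambda>k. x + s k *\<^sub>R u + t k *\<^sub>R v) \<longlonglongrightarrow> x + 0 *\<^sub>R u + 0 *\<^sub>R v"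
    by (intro tendsto_intros squeeze st)
  then have 1: "(\<lambda>k. dd v (dd u f) (x + s k *\<^sub>R u + t k *\<^sub>R v)) \<longlonglongrightarrow> dd v (dd u f) x"
    using isCont_tendsto_compose[OF c(1)] by simp
  have "(\<lambda>k. x + s' k *\<^sub>R v + t' k *\<^sub>R u) \<longlonglongrightarrow> x + 0 *\<^sub>R v + 0 *\<^sub>R u"
    by (intro tendsto_intros squeeze st)
  then have 2: "(\<lambda>k. dd u (dd v f) (x + s' k *\<^sub>R v + t' k *\<^sub>R u)) \<longlonglongrightarrow> dd u (dd v f) x"
    using isCont_tendsto_compose[OF c(2)] by simp
  show ?thesis using LIMSEQ_unique[OF 1] 2 eq by simp
qed

lemma Cinf_dd_commute:
  "open S \<Longrightarrow> x \<in> S \<Longrightarrow> Cinf S f \<Longrightarrow> dd u (dd v f) x = dd v (dd u f) x"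
  unfolding Cinf_def using dd_commute by blast

lemma pd_dd: "pd i = dd (axis i 1)"
  unfolding pd_def dd_def by (intro ext) simp

lemma axis_expansion: "(v::real^'n::finite) = (\<Sum>i\<in>UNIV. v $ i *\<^sub>R axis i 1)"
  using basis_expansion[of v] by (simp add: scalar_mult_eq_scaleR)

lemma dd_pd:
  fixes f :: "real ^ 'n::finite \<Rightarrow> real"
  assumes "f differentiable (at x)"
  shows "dd v f x = (\<Sum>i\<in>UNIV. v $ i * pd i f x)"
  by (subst axis_expansion) (simp add: dd_dir_sum[OF assms] dd_dir_scaleR[OF assms] pd_dd)

text \<open>For a differentiable function \<open>dd v f\<close> is a combination of the
  \<open>pd i f\<close> with constant coefficients, so smoothness along the axes passes to every
  direction.\<close>

lemma Ck_on_Cd: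
  fixes f :: "real ^ 'n::finite \<Rightarrow> real"
  assumes "open S"
  shows "Ck_on k S f \<longleftrightarrow> Cd k S f"
proof (induction k arbitrary: f)
  case (Suc k)
  have "Cd k S (dd v f)" if d: "\<forall>x\<in>S. f differentiable (at x)" and c: "\<forall>i. Cd k S (dd (axis i 1) f)" for v
  proof -
    have "Cd k S (\<lambda>x. \<Sum>i\<in>I. v $ i * dd (axis i 1) f x)" for I
    proof (induction I rule: infinite_finite_induct)
      case (insert i I)
      then show ?case using c by (simp, intro Cd_add Cd_mult Cd_const assms) auto
    qed (auto intro: Cd_const)
    then show ?thesis
      using Cd_cong[OF assms, of "dd v f" "\<lambda>x. \<Sum>i\<in>UNIV. v $ i * dd (axis i 1) f x"] dd_pd[of f _ v] d
      by (simp add: pd_dd)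
  qed
  then show ?case by (auto simp: Suc.IH pd_dd)
qed simp

lemma smooth_on_Cinf:
  fixes f :: "real ^ 'n::finite \<Rightarrow> real"
  shows "open S \<Longrightarrow> smooth_on S f \<longleftrightarrow> Cinf S f"
  unfolding smooth_on_def Cinf_def using Ck_on_Cd by blast

section \<open>The Levi-Civita connection in a chart\<close>

text \<open>With \<open>dy_dd\<close> this turns both kinds of partial derivatives into directional
  derivatives of a single function on the tangent bundle, so that mixed ones commute by the general
  symmetry result.\<close>

lemma dx_dd: "dx k f x y = dd (axis k 1, 0) (\<lambda>p. f (fst p) (snd p)) (x, y)"
  unfolding dx_def pd_def dd_def by simp

lemma dy_dd: "dy k f x y = dd (0, axis k 1) (\<lambda>p. f (fst p) (snd p)) (x, y)"
  unfolding dy_def pd_def dd_def by simp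

definition vdd :: "'e::real_normed_vector \<Rightarrow> ('e \<Rightarrow> real ^ 'n) \<Rightarrow> 'e \<Rightarrow> real ^ 'n" where
  "vdd v V p = (\<chi> i. dd v (\<lambda>p. V p $ i) p)"

text \<open>The matrix field is arbitrary: besides the metric it will be r, s and the matrices of
  Christoffel symbols, all evaluated as bilinear forms at a point.\<close>

definition gin :: "('e \<Rightarrow> real ^ 'n ^ 'n) \<Rightarrow> 'e \<Rightarrow> real ^ 'n::finite \<Rightarrow> real ^ 'n \<Rightarrow> real" where
  "gin a x v w = v \<bullet> (a x *v w)"

lemma gin_sum: "gin a x v w = (\<Sum>i\<in>UNIV. \<Sum>j\<in>UNIV. a x $ i $ j * v $ i * w $ j)"
  unfolding gin_def inner_vec_def matrix_vector_mult_def
  by (simp add: sum_distrib_left mult_ac)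

lemma gin_linear1: "linear (\<lambda>v. gin a x v w)" and gin_linear2: "linear (\<lambda>w. gin a x v w)"
  unfolding gin_def by (auto intro!: linearI simp: inner_add_left inner_add_right
      matrix_vector_right_distrib matrix_vector_mult_scaleR)

lemmas gin_simps =
  linear_add[OF gin_linear1] linear_add[OF gin_linear2]
  linear_diff[OF gin_linear1] linear_diff[OF gin_linear2]
  linear_cmul[OF gin_linear1] linear_cmul[OF gin_linear2]
  linear_0[OF gin_linear1] linear_0[OF gin_linear2]
  linear_neg[OF gin_linear1] linear_neg[OF gin_linear2]

definition Gam :: "(real ^ 'n \<Rightarrow> real ^ 'n ^ 'n) \<Rightarrow> real ^ 'n::finite \<Rightarrow> real ^ 'n \<Rightarrow> real ^ 'n \<Rightarrow> real ^ 'n" where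
  "Gam a x v w = (\<chi> m. \<Sum>i\<in>UNIV. \<Sum>j\<in>UNIV. christoffel a m i j x * v $ i * w $ j)"

lemma Gam_linear1: "linear (\<lambda>v. Gam a x v w)" and Gam_linear2: "linear (\<lambda>w. Gam a x v w)"
  unfolding Gam_def by (auto intro!: linearI simp: vec_eq_iff algebra_simps sum.distrib sum_distrib_left)

lemmas Gam_simps =
  linear_add[OF Gam_linear1] linear_add[OF Gam_linear2]
  linear_diff[OF Gam_linear1] linear_diff[OF Gam_linear2]
  linear_cmul[OF Gam_linear1] linear_cmul[OF Gam_linear2]
  linear_0[OF Gam_linear1] linear_0[OF Gam_linear2]
  linear_neg[OF Gam_linear1] linear_neg[OF Gam_linear2]

text \<open>Horizontal lift: differentiating along it is covariant differentiation of tensors depending on \<open>y\<close>.\<close>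

definition hor :: "(real ^ 'n \<Rightarrow> real ^ 'n ^ 'n) \<Rightarrow> (real ^ 'n) \<times> (real ^ 'n) \<Rightarrow> real ^ 'n::finite \<Rightarrow> (real ^ 'n) \<times> (real ^ 'n)" where
  "hor a p v = (v, - Gam a (fst p) v (snd p))"

text \<open>The field \<open>V\<close> may depend on \<open>y\<close> as well as on
  \<open>x\<close>. The horizontal lift takes care of the argument \<open>y\<close>, and the added
  term of the vector index of \<open>V\<close>.\<close>

definition cov :: "(real ^ 'n \<Rightarrow> real ^ 'n ^ 'n) \<Rightarrow> real ^ 'n::finite \<Rightarrow> ((real ^ 'n) \<times> (real ^ 'n) \<Rightarrow> real ^ 'n)
    \<Rightarrow> (real ^ 'n) \<times> (real ^ 'n) \<Rightarrow> real ^ 'n" where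
  "cov a v V p = vdd (hor a p v) V p + Gam a (fst p) v (V p)"

lemma sum_axis: "(\<Sum>i\<in>UNIV. f i * axis k (1::real) $ i) = f (k::'n::finite)"
  "(\<Sum>i\<in>UNIV. axis k (1::real) $ i * f i) = f (k::'n::finite)"
proof -
  have "f i * axis k (1::real) $ i = (if i = k then f i else 0)"
    "axis k (1::real) $ i * f i = (if i = k then f i else 0)" for i
    by (simp_all add: axis_def)
  then show "(\<Sum>i\<in>UNIV. f i * axis k (1::real) $ i) = f k"
    "(\<Sum>i\<in>UNIV. axis k (1::real) $ i * f i) = f k" by simp_all
qed

lemma vec_scaleR_sum_axis: "(\<Sum>i\<in>UNIV. (f i :: real) *\<^sub>R axis i 1) = (\<chi> i. f (i::'n::finite))"
  using axis_expansion[of "\<chi> i. f i"] by simp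

lemma sum3_reverse:
  "(\<Sum>j\<in>A. \<Sum>k\<in>B. \<Sum>m\<in>C. f j k m) = (\<Sum>m\<in>C. \<Sum>k\<in>B. \<Sum>j\<in>A. f j k m)"
  by (subst sum.swap, subst (2) sum.swap, subst sum.swap) (rule refl)

lemma Cinf_if: "Cinf S f \<Longrightarrow> Cinf S g \<Longrightarrow> Cinf S (\<lambda>x. if P then f x else g x)"
  by (cases P) simp_all

locale metric_chart =
  fixes U :: "(real ^ 'n::finite) set" and a :: "real ^ 'n \<Rightarrow> real ^ 'n ^ 'n"
  assumes openU: "open U"
    and a_smooth: "\<And>i j. Cinf U (\<lambda>x. a x $ i $ j)"
    and a_sym: "\<And>x i j. x \<in> U \<Longrightarrow> a x $ i $ j = a x $ j $ i"
    and a_pos: "\<And>x y. x \<in> U \<Longrightarrow> y \<noteq> 0 \<Longrightarrow> 0 < y \<bullet> (a x *v y)"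
begin

abbreviation "TU \<equiv> U \<times> (UNIV :: (real ^ 'n) set)"

lemma openTU: "open TU"
  using openU by (simp add: open_Times)

lemma gin_sym: "x \<in> U \<Longrightarrow> gin a x v w = gin a x w v"
  unfolding gin_sum by (subst sum.swap) (simp add: a_sym mult_ac)

lemma gin_pos: "x \<in> U \<Longrightarrow> v \<noteq> 0 \<Longrightarrow> 0 < gin a x v v"
  unfolding gin_def using a_pos by blast

lemma gin_eq_0_iff: "x \<in> U \<Longrightarrow> gin a x v v = 0 \<longleftrightarrow> v = 0"
  using gin_pos[of x v] by (cases "v = 0") (auto simp: gin_simps)

lemma gin_nonneg: "x \<in> U \<Longrightarrow> 0 \<le> gin a x v v"
  using gin_pos[of x v] by (cases "v = 0") (auto simp: gin_simps)

lemma gin_eqI: "x \<in> U \<Longrightarrow> (\<And>w. gin a x v w = gin a x v' w) \<Longrightarrow> v = v'"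
  using gin_eq_0_iff[of x "v - v'"] by (simp add: gin_simps)

lemma a_invertible: "x \<in> U \<Longrightarrow> invertible (a x)"
  unfolding invertible_left_inverse matrix_left_invertible_ker
  using a_pos by (metis inner_zero_right less_irrefl)

lemma ai_right: "x \<in> U \<Longrightarrow> a x ** matrix_inv (a x) = mat 1"
  and ai_left: "x \<in> U \<Longrightarrow> matrix_inv (a x) ** a x = mat 1"
proof -
  assume "x \<in> U"
  then have "\<exists>B. a x ** B = mat 1 \<and> B ** a x = mat 1" using a_invertible invertible_def by blast
  then have "a x ** matrix_inv (a x) = mat 1 \<and> matrix_inv (a x) ** a x = mat 1"
    unfolding matrix_inv_def by (rule someI_ex)
  then show "a x ** matrix_inv (a x) = mat 1" "matrix_inv (a x) ** a x = mat 1" by auto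
qed

lemma a_ai_vec: "x \<in> U \<Longrightarrow> a x *v (matrix_inv (a x) *v w) = w"
  by (simp add: matrix_vector_mul_assoc ai_right)

lemma gin_ai: "x \<in> U \<Longrightarrow> gin a x v (matrix_inv (a x) *v w) = v \<bullet> w"
  unfolding gin_def by (simp add: a_ai_vec)

lemma gin_ai': "x \<in> U \<Longrightarrow> gin a x (matrix_inv (a x) *v w) v = w \<bullet> v"
  by (simp add: gin_sym[of x _ v] gin_ai inner_commute)

lemma ai_sym:
  assumes "x \<in> U"
  shows "matrix_inv (a x) $ i $ j = matrix_inv (a x) $ j $ i"
proof -
  have *: "(matrix_inv (a x) *v axis j 1) $ i = matrix_inv (a x) $ i $ j" for i j
    by (simp add: matrix_vector_mult_def sum_axis)
  have "axis i 1 \<bullet> (matrix_inv (a x) *v axis j 1) = axis j 1 \<bullet> (matrix_inv (a x) *v axis i 1)"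
    using gin_ai'[OF assms, of "axis i 1" "matrix_inv (a x) *v axis j 1"]
      gin_ai[OF assms, of "matrix_inv (a x) *v axis i 1" "axis j 1"]
    by (simp add: inner_commute)
  then show ?thesis using * by (simp add: inner_axis' )
qed

text \<open>Cramer's rule. It exhibits the inverse metric as a quotient of polynomials in the
  entries of \<open>a\<close>, which is how \<open>ai_smooth\<close> gets its smoothness.\<close>

lemma ai_entry:
  assumes "x \<in> U"
  shows "matrix_inv (a x) $ i $ j
    = det (\<chi> p q. if q = i then (if p = j then 1 else 0) else a x $ p $ q) / det (a x)"
proof -
  have d: "det (a x) \<noteq> 0" using a_invertible[OF assms] invertible_det_nz by blast
  have "a x *v (matrix_inv (a x) *v axis j 1) = axis j 1" by (rule a_ai_vec[OF assms])
  then have "matrix_inv (a x) *v axis j 1 = (\<chi> k. det (\<chi> p q. if q = k then axis j 1 $ p else a x $ p $ q) / det (a x))"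
    using cramer[OF d] by blast
  then have "(matrix_inv (a x) *v axis j 1) $ i = det (\<chi> p q. if q = i then axis j 1 $ p else a x $ p $ q) / det (a x)"
    by simp
  moreover have "(matrix_inv (a x) *v axis j 1) $ i = matrix_inv (a x) $ i $ j"
    by (simp add: matrix_vector_mult_def sum_axis)
  moreover have "(\<chi> p q. if q = i then axis j 1 $ p else a x $ p $ q) = (\<chi> p q. if q = i then (if p = j then 1 else 0) else a x $ p $ q)"
    by (simp add: vec_eq_iff axis_def)
  ultimately show ?thesis by simp
qed

lemma ai_smooth: "Cinf U (\<lambda>x. matrix_inv (a x) $ i $ j)"
proof -
  have 1: "Cinf U (\<lambda>x. det (\<chi> p q. if q = i then (if p = j then 1 else 0) else a x $ p $ q))"
    unfolding det_def
    by (intro Cinf_sum Cinf_mult Cinf_prod Cinf_const openU)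
      (use Cinf_if[OF Cinf_if[OF Cinf_const Cinf_const] a_smooth] in \<open>simp add: Cinf_const\<close>)
  have 2: "Cinf U (\<lambda>x. det (a x))"
    unfolding det_def by (intro Cinf_sum Cinf_mult Cinf_prod Cinf_const openU a_smooth)
  have "Cinf U (\<lambda>x. det (\<chi> p q. if q = i then (if p = j then 1 else 0) else a x $ p $ q) / det (a x))"
    by (rule Cinf_divide[OF openU 1 2]) (use a_invertible invertible_det_nz in blast)
  then show ?thesis
    using Cinf_cong[OF openU, of "\<lambda>x. matrix_inv (a x) $ i $ j"
      "\<lambda>x. det (\<chi> p q. if q = i then (if p = j then 1 else 0) else a x $ p $ q) / det (a x)"] ai_entry
    by blast
qed

lemma christoffel_smooth: "Cinf U (christoffel a k i j)"
  unfolding christoffel_def[abs_def] pd_dd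
  by (intro Cinf_sum Cinf_mult Cinf_const Cinf_add Cinf_diff Cinf_dd ai_smooth a_smooth openU)

lemma pd_a_sym: "x \<in> U \<Longrightarrow> pd k (\<lambda>z. a z $ i $ j) x = pd k (\<lambda>z. a z $ j $ i) x"
  unfolding pd_dd by (rule dd_transform[OF openU]) (auto simp: a_sym)

lemma christoffel_sym: "x \<in> U \<Longrightarrow> christoffel a k i j x = christoffel a k j i x"
  unfolding christoffel_def by (simp add: pd_a_sym[of x _ i j] add.commute)

lemma christoffel_lower:
  assumes "x \<in> U"
  shows "(\<Sum>m\<in>UNIV. a x $ l $ m * christoffel a m i j x) = 1 / 2 *
    (pd i (\<lambda>z. a z $ j $ l) x + pd j (\<lambda>z. a z $ i $ l) x - pd l (\<lambda>z. a z $ i $ j) x)"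
proof -
  define w :: "real ^ 'n" where "w = (\<chi> l. 1 / 2 * (pd i (\<lambda>z. a z $ j $ l) x + pd j (\<lambda>z. a z $ i $ l) x - pd l (\<lambda>z. a z $ i $ j) x))"
  have "(\<chi> m. christoffel a m i j x) = matrix_inv (a x) *v w"
    by (simp add: vec_eq_iff matrix_vector_mult_def w_def christoffel_def sum_distrib_left mult_ac)
  then have "a x *v (\<chi> m. christoffel a m i j x) = w" using a_ai_vec[OF assms] by simp
  then have "(a x *v (\<chi> m. christoffel a m i j x)) $ l = w $ l" by simp
  then show ?thesis by (simp add: matrix_vector_mult_def w_def)
qed

lemma pd_a:
  assumes "x \<in> U"
  shows "pd k (\<lambda>z. a z $ i $ j) x =
    (\<Sum>m\<in>UNIV. a x $ j $ m * christoffel a m k i x) + (\<Sum>m\<in>UNIV. a x $ i $ m * christoffel a m k j x)"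
  unfolding christoffel_lower[OF assms] using pd_a_sym[OF assms, of _ i j]
  by (simp add: pd_a_sym[OF assms, of _ k i] pd_a_sym[OF assms, of _ k j] field_simps)

lemma Gam_sym: "x \<in> U \<Longrightarrow> Gam a x v w = Gam a x w v"
  unfolding Gam_def by (subst sum.swap) (simp add: christoffel_sym[of x _ _ ] mult_ac vec_eq_iff)

lemma a_diff: "x \<in> U \<Longrightarrow> (\<lambda>z. a z $ i $ j) differentiable (at x)"
  using Cinf_differentiable[OF a_smooth] .

text \<open>Metric compatibility of the Levi-Civita connection. The vectors \<open>v\<close> and
  \<open>w\<close> are constant in the chart, so their covariant derivatives consist of the
  Christoffel terms alone.\<close>

lemma gin_compat:
  assumes "x \<in> U"
  shows "dd u (\<lambda>x. gin a x v w) x = gin a x (Gam a x u v) w + gin a x v (Gam a x u w)"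
proof -
  have d: "(\<lambda>x. a x $ i $ j * v $ i * w $ j) differentiable (at x)" for i j
    using a_diff[OF assms] by (intro differentiable_mult differentiable_const)
  have e: "dd u (\<lambda>x. a x $ i $ j * v $ i * w $ j) x = (\<Sum>k\<in>UNIV. u $ k * pd k (\<lambda>z. a z $ i $ j) x) * v $ i * w $ j" for i j
    using dd_cmult[OF a_diff[OF assms, of i j], of u "v $ i * w $ j"] dd_pd[OF a_diff[OF assms, of i j], of u]
    by (simp add: mult_ac)
  have "dd u (\<lambda>x. gin a x v w) x = (\<Sum>i\<in>UNIV. \<Sum>j\<in>UNIV. \<Sum>k\<in>UNIV. u $ k * pd k (\<lambda>z. a z $ i $ j) x * v $ i * w $ j)"
    unfolding gin_sum
    by (subst dd_sum, simp, intro differentiable_sum finite ballI d, intro sum.cong refl,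
        subst dd_sum, simp, rule d, intro sum.cong refl)
      (simp add: e sum_distrib_right)
  also have "\<dots> = (\<Sum>i\<in>UNIV. \<Sum>j\<in>UNIV. \<Sum>k\<in>UNIV. \<Sum>m\<in>UNIV. a x $ j $ m * christoffel a m k i x * u $ k * v $ i * w $ j)
     + (\<Sum>i\<in>UNIV. \<Sum>j\<in>UNIV. \<Sum>k\<in>UNIV. \<Sum>m\<in>UNIV. a x $ i $ m * christoffel a m k j x * u $ k * v $ i * w $ j)"
    unfolding pd_a[OF assms] sum.distrib[symmetric]
    by (intro sum.cong refl) (simp add: sum_distrib_left sum_distrib_right distrib_left distrib_right sum.distrib mult_ac)
  also have "(\<Sum>i\<in>UNIV. \<Sum>j\<in>UNIV. \<Sum>k\<in>UNIV. \<Sum>m\<in>UNIV. a x $ i $ m * christoffel a m k j x * u $ k * v $ i * w $ j)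
      = gin a x v (Gam a x u w)"
    unfolding gin_sum Gam_def
    by (subst sum3_reverse) (simp add: sum_distrib_left sum_distrib_right mult_ac)
  also have "(\<Sum>i\<in>UNIV. \<Sum>j\<in>UNIV. \<Sum>k\<in>UNIV. \<Sum>m\<in>UNIV. a x $ j $ m * christoffel a m k i x * u $ k * v $ i * w $ j)
      = gin a x w (Gam a x u v)"
    unfolding gin_sum Gam_def
    by (subst sum.swap, subst sum3_reverse) (simp add: sum_distrib_left sum_distrib_right mult_ac)
  finally show ?thesis using gin_sym[OF assms] by simp
qed

end

section \<open>Calculus on the tangent bundle\<close>

definition mdd :: "'e::real_normed_vector \<Rightarrow> ('e \<Rightarrow> real ^ 'n ^ 'n) \<Rightarrow> 'e \<Rightarrow> real ^ 'n ^ 'n" where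
  "mdd v N p = (\<chi> i j. dd v (\<lambda>p. N p $ i $ j) p)"

definition vdiff :: "('e::real_normed_vector \<Rightarrow> real ^ 'n) \<Rightarrow> 'e \<Rightarrow> bool" where
  "vdiff V p \<longleftrightarrow> (\<forall>i. (\<lambda>p. V p $ i) differentiable (at p))"

definition mdiff :: "('e::real_normed_vector \<Rightarrow> real ^ 'n ^ 'n) \<Rightarrow> 'e \<Rightarrow> bool" where
  "mdiff N p \<longleftrightarrow> (\<forall>i j. (\<lambda>p. N p $ i $ j) differentiable (at p))"

lemma diff_inner:
  fixes V :: "'e::real_normed_vector \<Rightarrow> real ^ 'n::finite"
  shows "vdiff w p \<Longrightarrow> vdiff V p \<Longrightarrow> (\<lambda>p. w p \<bullet> V p) differentiable (at p)"
  unfolding inner_vec_def vdiff_def by (auto intro!: differentiable_sum)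

lemma dd_inner:
  fixes V :: "'e::real_normed_vector \<Rightarrow> real ^ 'n::finite"
  shows "vdiff w p \<Longrightarrow> vdiff V p \<Longrightarrow> dd v (\<lambda>p. w p \<bullet> V p) p = vdd v w p \<bullet> V p + w p \<bullet> vdd v V p"
  unfolding inner_vec_def vdiff_def vdd_def
  by (simp add: dd_sum dd_mult sum.distrib)

lemma diff_matvec:
  fixes V :: "'e::real_normed_vector \<Rightarrow> real ^ 'n::finite"
  shows "mdiff N p \<Longrightarrow> vdiff V p \<Longrightarrow> vdiff (\<lambda>p. N p *v V p) p"
  unfolding matrix_vector_mult_def vdiff_def mdiff_def by (auto intro!: differentiable_sum)

lemma vdd_matvec:
  fixes V :: "'e::real_normed_vector \<Rightarrow> real ^ 'n::finite"
  shows "mdiff N p \<Longrightarrow> vdiff V p \<Longrightarrow>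
    vdd v (\<lambda>p. N p *v V p) p = mdd v N p *v V p + N p *v vdd v V p"
  unfolding matrix_vector_mult_def vdiff_def mdiff_def vdd_def mdd_def vec_eq_iff
  by (simp add: dd_sum dd_mult sum.distrib)

lemma diff_gin:
  fixes V :: "'e::real_normed_vector \<Rightarrow> real ^ 'n::finite"
  shows "mdiff N p \<Longrightarrow> vdiff V p \<Longrightarrow> vdiff Z p \<Longrightarrow> (\<lambda>p. gin N p (V p) (Z p)) differentiable (at p)"
  unfolding gin_def by (intro diff_inner diff_matvec)

lemma dd_gin:
  fixes V :: "'e::real_normed_vector \<Rightarrow> real ^ 'n::finite"
  shows "mdiff N p \<Longrightarrow> vdiff V p \<Longrightarrow> vdiff Z p \<Longrightarrow> dd v (\<lambda>p. gin N p (V p) (Z p)) p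
    = gin (mdd v N) p (V p) (Z p) + gin N p (vdd v V p) (Z p) + gin N p (V p) (vdd v Z p)"
  unfolding gin_def by (simp add: dd_inner diff_matvec vdd_matvec inner_add_right)

lemma vdiff_const [simp]: "vdiff (\<lambda>p. c) p" and mdiff_const [simp]: "mdiff (\<lambda>p. c') p"
  unfolding vdiff_def mdiff_def by simp_all

lemma vdd_const [simp]: "vdd v (\<lambda>p. c) p = 0" and mdd_const [simp]: "mdd v (\<lambda>p. c') p = 0"
  unfolding vdd_def mdd_def by (simp_all add: vec_eq_iff)

lemma dd_gin_const:
  "mdiff N p \<Longrightarrow> dd v (\<lambda>p. gin N p c c') p = gin (mdd v N) p c c'"
  using dd_gin[of N p "\<lambda>p. c" "\<lambda>p. c'" v] by (simp add: gin_simps)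

lemma bounded_linear_snd_nth: "bounded_linear (\<lambda>p::'a::real_normed_vector \<times> (real ^ 'n::finite). snd p $ i)"
  by (intro bounded_linear_compose[OF bounded_linear_vec_nth] bounded_linear_snd)

lemma vdiff_snd [simp]: "vdiff snd (p :: 'a::real_normed_vector \<times> (real ^ 'n::finite))"
  unfolding vdiff_def using bounded_linear_imp_differentiable[OF bounded_linear_snd_nth] by blast

lemma vdd_snd [simp]: "vdd v snd p = snd (v :: 'a::real_normed_vector \<times> (real ^ 'n::finite))"
  unfolding vdd_def by (simp add: vec_eq_iff dd_bounded_linear[OF bounded_linear_snd_nth])

lemma dd_fst: "f differentiable (at (fst p)) \<Longrightarrow> dd v (\<lambda>p. f (fst p)) p = dd (fst v) f (fst p)"
  by (rule dd_linear_compose[OF bounded_linear_fst])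

lemma diff_fst: "(f :: _ \<Rightarrow> real) differentiable (at (fst p)) \<Longrightarrow> (\<lambda>p. f (fst p)) differentiable (at p)"
  by (rule differentiable_linear_compose[OF bounded_linear_fst])

lemma vdiff_fst: "vdiff w (fst p) \<Longrightarrow> vdiff (\<lambda>p. w (fst p)) p"
  unfolding vdiff_def using diff_fst by blast

lemma mdiff_fst: "mdiff w (fst p) \<Longrightarrow> mdiff (\<lambda>p. w (fst p)) p"
  unfolding mdiff_def using diff_fst[of "\<lambda>x. w x $ i $ j" p for i j] by blast

lemma vdd_fst: "vdiff w (fst p) \<Longrightarrow> vdd v (\<lambda>p. w (fst p)) p = vdd (fst v) w (fst p)"
  unfolding vdiff_def vdd_def using dd_fst[of "\<lambda>x. w x $ i" p v for i] by (simp add: vec_eq_iff)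

lemma mdd_fst: "mdiff w (fst p) \<Longrightarrow> mdd v (\<lambda>p. w (fst p)) p = mdd (fst v) w (fst p)"
  unfolding mdiff_def mdd_def using dd_fst[of "\<lambda>x. w x $ i $ j" p v for i j] by (simp add: vec_eq_iff)

lemma vdiff_scaleR: "f differentiable (at p) \<Longrightarrow> vdiff V p \<Longrightarrow> vdiff (\<lambda>p. f p *\<^sub>R V p) p"
  unfolding vdiff_def by simp

lemma vdd_scaleR: "f differentiable (at p) \<Longrightarrow> vdiff V p \<Longrightarrow>
    vdd v (\<lambda>p. f p *\<^sub>R V p) p = dd v f p *\<^sub>R V p + f p *\<^sub>R vdd v V p"
  unfolding vdiff_def vdd_def by (simp add: vec_eq_iff dd_mult)

lemma vdiff_add: "vdiff V p \<Longrightarrow> vdiff Z p \<Longrightarrow> vdiff (\<lambda>p. V p + Z p) p"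
  unfolding vdiff_def by simp

lemma vdd_add: "vdiff V p \<Longrightarrow> vdiff Z p \<Longrightarrow> vdd v (\<lambda>p. V p + Z p) p = vdd v V p + vdd v Z p"
  unfolding vdiff_def vdd_def by (simp add: vec_eq_iff dd_add)

lemma vdd_linear: "vdiff V p \<Longrightarrow> linear (\<lambda>v. vdd v V p)"
  unfolding vdiff_def vdd_def
  by (auto intro!: linearI simp: vec_eq_iff dd_dir_add dd_dir_scaleR)

lemma mdd_linear: "mdiff V p \<Longrightarrow> linear (\<lambda>v. mdd v V p)"
  unfolding mdiff_def mdd_def
  by (auto intro!: linearI simp: vec_eq_iff dd_dir_add dd_dir_scaleR)

lemma vdd_transform:
  assumes "open S" "x \<in> S" "\<And>y. y \<in> S \<Longrightarrow> f y = g y"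
  shows "vdd v f x = vdd v g x"
  unfolding vdd_def vec_eq_iff using dd_transform[OF assms(1,2), of "\<lambda>y. f y $ i" "\<lambda>y. g y $ i" v for i] assms(3) by simp

text \<open>The Ricci curvature as a function of the spray coefficients \<open>G\<^sup>i\<close>.\<close>

definition RicOp :: "('n \<Rightarrow> (real ^ 'n) \<times> (real ^ 'n) \<Rightarrow> real) \<Rightarrow> (real ^ 'n::finite) \<times> (real ^ 'n) \<Rightarrow> real" where
  "RicOp G p = (\<Sum>m\<in>UNIV. 2 * dd (axis m 1, 0) (G m) p - dd (snd p, 0) (dd (0, axis m 1) (G m)) p
     + 2 * dd (0, \<chi> l. G l p) (dd (0, axis m 1) (G m)) p
     - (\<Sum>l\<in>UNIV. dd (0, axis l 1) (G m) p * dd (0, axis m 1) (G l) p))"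

lemma dd_fst_axis:
  fixes f :: "(real ^ 'n::finite) \<times> 'b::real_normed_vector \<Rightarrow> real"
  assumes "f differentiable (at p)"
  shows "(\<Sum>l\<in>UNIV. dd (axis l 1, 0) f p * v $ l) = dd (v, 0) f p"
proof -
  have "(v, 0) = (\<Sum>l\<in>UNIV. v $ l *\<^sub>R (axis l 1, 0 :: 'b))"
    using axis_expansion[of v] by (auto simp: prod_eq_iff fst_sum snd_sum)
  then show ?thesis by (simp add: dd_dir_sum[OF assms] dd_dir_scaleR[OF assms] mult.commute del: scaleR_Pair)
qed

lemma dd_snd_axis:
  fixes f :: "'b::real_normed_vector \<times> (real ^ 'n::finite) \<Rightarrow> real"
  assumes "f differentiable (at p)"
  shows "(\<Sum>l\<in>UNIV. v $ l * dd (0, axis l 1) f p) = dd (0, v) f p"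
proof -
  have "(0, v) = (\<Sum>l\<in>UNIV. v $ l *\<^sub>R (0 :: 'b, axis l 1))"
    using axis_expansion[of v] by (auto simp: prod_eq_iff fst_sum snd_sum)
  then show ?thesis by (simp add: dd_dir_sum[OF assms] dd_dir_scaleR[OF assms] mult.commute del: scaleR_Pair)
qed

text \<open>A formula for the spray on an open set around the point is enough. Since second
  derivatives commute, the contractions with \<open>y\<close> and with the spray collapse into
  single directional derivatives.\<close>

lemma ricci_RicOp:
  fixes F :: "real ^ 'n::finite \<Rightarrow> real ^ 'n \<Rightarrow> real"
  assumes W: "open W" "p \<in> W" and G: "\<And>i. Cinf W (G i)"
    and eq: "\<And>i q. q \<in> W \<Longrightarrow> spray F i (fst q) (snd q) = G i q"
  shows "ricci F (fst p) (snd p) = RicOp G p"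
proof -
  have 1: "dd v (\<lambda>q. spray F i (fst q) (snd q)) q = dd v (G i) q" if "q \<in> W" for v i q
    by (rule dd_transform[OF W(1) that]) (use eq in auto)
  have 2: "dd u (dd v (\<lambda>q. spray F i (fst q) (snd q))) p = dd u (dd v (G i)) p" for u v i
    by (rule dd_transform[OF W]) (use 1 in auto)
  have d: "dd v (G i) differentiable (at p)" for v i
    using Cinf_differentiable[OF Cinf_dd[OF G] W(2)] .
  have "riemann F m m (fst p) (snd p) = 2 * dd (axis m 1, 0) (G m) p - dd (snd p, 0) (dd (0, axis m 1) (G m)) p
     + 2 * dd (0, \<chi> l. G l p) (dd (0, axis m 1) (G m)) p
     - (\<Sum>l\<in>UNIV. dd (0, axis l 1) (G m) p * dd (0, axis m 1) (G l) p)" for m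
  proof -
    have "riemann F m m (fst p) (snd p) = 2 * dd (axis m 1, 0) (G m) p
      - (\<Sum>l\<in>UNIV. dd (axis l 1, 0) (dd (0, axis m 1) (G m)) p * snd p $ l)
      + 2 * (\<Sum>l\<in>UNIV. G l p * dd (0, axis m 1) (dd (0, axis l 1) (G m)) p)
      - (\<Sum>l\<in>UNIV. dd (0, axis l 1) (G m) p * dd (0, axis m 1) (G l) p)"
      unfolding riemann_def dx_dd dy_dd by (simp add: 1 2 W eq)
    also have "(\<Sum>l\<in>UNIV. dd (axis l 1, 0) (dd (0, axis m 1) (G m)) p * snd p $ l) = dd (snd p, 0) (dd (0, axis m 1) (G m)) p"
      by (rule dd_fst_axis[OF d])
    also have "(\<Sum>l\<in>UNIV. G l p * dd (0, axis m 1) (dd (0, axis l 1) (G m)) p)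
      = (\<Sum>l\<in>UNIV. (\<chi> l. G l p) $ l * dd (0, axis l 1) (dd (0, axis m 1) (G m)) p)"
      using Cinf_dd_commute[OF W G] by simp
    also have "\<dots> = dd (0, \<chi> l. G l p) (dd (0, axis m 1) (G m)) p"
      by (rule dd_snd_axis[OF d])
    finally show ?thesis .
  qed
  then show ?thesis unfolding ricci_def RicOp_def by simp
qed

text \<open>\<open>RicOp\<close> is a quadratic polynomial in the derivatives of the spray, so this
  lists its linear, mixed and quadratic parts. The two mixed traces agree after exchanging the
  summation indices.\<close>

lemma RicOp_add:
  fixes G T :: "'n::finite \<Rightarrow> (real ^ 'n) \<times> (real ^ 'n) \<Rightarrow> real"
  assumes W: "open W" "p \<in> W" and G: "\<And>i. Cinf W (G i)" and T: "\<And>i. Cinf W (T i)"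
  shows "RicOp (\<lambda>i q. G i q + T i q) p = RicOp G p
    + 2 * (\<Sum>m\<in>UNIV. dd (axis m 1, 0) (T m) p)
    - dd (snd p, 0) (\<lambda>q. \<Sum>m\<in>UNIV. dd (0, axis m 1) (T m) q) p
    + 2 * dd (0, \<chi> l. G l p) (\<lambda>q. \<Sum>m\<in>UNIV. dd (0, axis m 1) (T m) q) p
    + 2 * dd (0, \<chi> l. T l p) (\<lambda>q. \<Sum>m\<in>UNIV. dd (0, axis m 1) (G m) q) p
    + 2 * dd (0, \<chi> l. T l p) (\<lambda>q. \<Sum>m\<in>UNIV. dd (0, axis m 1) (T m) q) p
    - 2 * (\<Sum>m\<in>UNIV. \<Sum>l\<in>UNIV. dd (0, axis l 1) (G m) p * dd (0, axis m 1) (T l) p)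
    - (\<Sum>m\<in>UNIV. \<Sum>l\<in>UNIV. dd (0, axis l 1) (T m) p * dd (0, axis m 1) (T l) p)"
proof -
  note dG = Cinf_differentiable[OF G W(2)] and dT = Cinf_differentiable[OF T W(2)]
  note ddG = Cinf_differentiable[OF Cinf_dd[OF G] W(2)] and ddT = Cinf_differentiable[OF Cinf_dd[OF T] W(2)]
  have 1: "dd u (dd v (\<lambda>q. G i q + T i q)) p = dd u (dd v (G i)) p + dd u (dd v (T i)) p" for u v i
    using dd_transform[OF W, of "dd v (\<lambda>q. G i q + T i q)" "\<lambda>q. dd v (G i) q + dd v (T i) q" u]
      dd_add[OF Cinf_differentiable[OF G] Cinf_differentiable[OF T]] dd_add[OF ddG ddT] by auto
  have 2: "(\<chi> l. G l p + T l p) = (\<chi> l. G l p) + (\<chi> l. T l p)" by (simp add: vec_eq_iff)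
  have 3: "dd (0, (\<chi> l. G l p) + (\<chi> l. T l p)) (dd v (X i)) p = dd (0, \<chi> l. G l p) (dd v (X i)) p + dd (0, \<chi> l. T l p) (dd v (X i)) p"
    if "dd v (X i) differentiable (at p)" for v i and X :: "'n \<Rightarrow> (real ^ 'n) \<times> (real ^ 'n) \<Rightarrow> real"
    using dd_dir_add[OF that, of "(0, \<chi> l. G l p)" "(0, \<chi> l. T l p)"] by simp
  have 4: "(\<Sum>m\<in>UNIV. \<Sum>l\<in>UNIV. dd (0, axis l 1) (T m) p * dd (0, axis m 1) (G l) p)
     = (\<Sum>m\<in>UNIV. \<Sum>l\<in>UNIV. dd (0, axis l 1) (G m) p * dd (0, axis m 1) (T l) p)"
    by (subst sum.swap) (simp add: mult.commute)
  show ?thesis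
    unfolding RicOp_def
    by (simp add: 1 2 3 ddG ddT dd_add[OF dG dT] dd_sum sum.distrib sum_subtractf sum_distrib_left[symmetric] distrib_left distrib_right 4)
qed

section \<open>Effect on the Ricci curvature of a deviation from the spray of \<alpha>\<close>

context metric_chart
begin

lemma mdiff_a: "x \<in> U \<Longrightarrow> mdiff a x"
  unfolding mdiff_def using a_diff by blast

definition Cmat :: "'n \<Rightarrow> real ^ 'n \<Rightarrow> real ^ 'n ^ 'n" where
  "Cmat m x = (\<chi> i j. christoffel a m i j x)"

lemma mdiff_Cmat: "x \<in> U \<Longrightarrow> mdiff (Cmat m) x"
  unfolding mdiff_def Cmat_def using Cinf_differentiable[OF christoffel_smooth] by simp

lemma Gam_nth: "Gam a x v w $ m = gin (Cmat m) x v w"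
  unfolding Gam_def gin_sum Cmat_def by simp

lemma Cinf_fst: "Cinf U f \<Longrightarrow> Cinf TU (\<lambda>p. f (fst p))"
  using Cinf_linear_compose[OF bounded_linear_fst, of TU U f] openTU by auto

lemma Cinf_snd_nth: "Cinf S (\<lambda>p::(real ^ 'n) \<times> (real ^ 'n). snd p $ i)"
  by (rule Cinf_linear[OF bounded_linear_snd_nth])

definition G0 :: "'n \<Rightarrow> (real ^ 'n) \<times> (real ^ 'n) \<Rightarrow> real" where
  "G0 i p = 1 / 2 * Gam a (fst p) (snd p) (snd p) $ i"

lemma G0_smooth: "Cinf TU (G0 i)"
  unfolding G0_def[abs_def] Gam_def vec_lambda_beta
  by (intro Cinf_mult Cinf_const Cinf_sum openTU Cinf_snd_nth Cinf_fst christoffel_smooth)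

lemma dd_G0:
  assumes "fst p \<in> U"
  shows "dd (0, v) (G0 i) p = Gam a (fst p) v (snd p) $ i"
proof -
  have m: "mdiff (\<lambda>p. Cmat i (fst p)) p" by (rule mdiff_fst[OF mdiff_Cmat[OF assms]])
  have "dd (0, v) (G0 i) p = 1 / 2 * dd (0, v) (\<lambda>p. gin (\<lambda>p. Cmat i (fst p)) p (snd p) (snd p)) p"
    unfolding G0_def[abs_def] Gam_nth
    using dd_cmult[OF diff_gin[OF m vdiff_snd vdiff_snd], of "(0, v)" "1 / 2"]
    by (simp add: gin_def)
  also have "\<dots> = 1 / 2 * (gin (\<lambda>p. Cmat i (fst p)) p v (snd p) + gin (\<lambda>p. Cmat i (fst p)) p (snd p) v)"
    using linear_0[OF mdd_linear[OF mdiff_Cmat[OF assms]], of i]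
    by (simp add: dd_gin[OF m, unfolded gin_def] mdd_fst[OF mdiff_Cmat[OF assms]] gin_def)
  also have "\<dots> = Gam a (fst p) v (snd p) $ i"
    using arg_cong[OF Gam_sym[OF assms, of v "snd p"], of "\<lambda>u. u $ i"] Gam_nth[of "fst p" _ _ i]
    by (simp add: gin_def)
  finally show ?thesis .
qed

lemma dd_dd_G0:
  assumes "fst p \<in> U"
  shows "dd (0, w) (dd (0, v) (G0 i)) p = Gam a (fst p) v w $ i"
proof -
  have m: "mdiff (\<lambda>p. Cmat i (fst p)) p" by (rule mdiff_fst[OF mdiff_Cmat[OF assms]])
  have "dd (0, w) (dd (0, v) (G0 i)) p = dd (0, w) (\<lambda>p. gin (\<lambda>p. Cmat i (fst p)) p v (snd p)) p"
    by (rule dd_transform[OF openTU]) (use assms in \<open>auto simp: dd_G0 Gam_nth gin_def mem_Times_iff\<close>)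
  also have "\<dots> = gin (\<lambda>p. Cmat i (fst p)) p v w"
    using linear_0[OF mdd_linear[OF mdiff_Cmat[OF assms]], of i]
    by (simp add: dd_gin[OF m, unfolded gin_def] mdd_fst[OF mdiff_Cmat[OF assms]] gin_def)
  finally show ?thesis by (simp add: Gam_nth gin_def)
qed

definition hdiv :: "('n \<Rightarrow> (real ^ 'n) \<times> (real ^ 'n) \<Rightarrow> real) \<Rightarrow> (real ^ 'n) \<times> (real ^ 'n) \<Rightarrow> real" where
  "hdiv T p = (\<Sum>m\<in>UNIV. dd (hor a p (axis m 1)) (T m) p + Gam a (fst p) (axis m 1) (\<chi> l. T l p) $ m)"

definition vdiv :: "('n \<Rightarrow> (real ^ 'n) \<times> (real ^ 'n) \<Rightarrow> real) \<Rightarrow> (real ^ 'n) \<times> (real ^ 'n) \<Rightarrow> real" where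
  "vdiv T p = (\<Sum>m\<in>UNIV. dd (0, axis m 1) (T m) p)"

lemma vdiv_smooth: "open W \<Longrightarrow> (\<And>i. Cinf W (T i)) \<Longrightarrow> Cinf W (vdiv T)"
  unfolding vdiv_def[abs_def] by (intro Cinf_sum Cinf_dd)

text \<open>The mixed terms with \<open>G0\<close> are exactly what converts derivatives in
  \<open>x\<close> into horizontal derivatives and the coordinate divergence into
  \<open>hdiv\<close>. Hence only covariant expressions in \<open>T\<close> remain.\<close>

theorem RicOp_deviation:
  assumes W: "open W" "p \<in> W" "W \<subseteq> TU" and T: "\<And>i. Cinf W (T i)"
  shows "RicOp (\<lambda>i q. G0 i q + T i q) p = RicOp G0 p + 2 * hdiv T p
    - dd (hor a p (snd p)) (vdiv T) p + 2 * dd (0, \<chi> l. T l p) (vdiv T) p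
    - (\<Sum>m\<in>UNIV. \<Sum>l\<in>UNIV. dd (0, axis l 1) (T m) p * dd (0, axis m 1) (T l) p)"
proof -
  have p: "fst p \<in> U" using W by auto
  note dT = Cinf_differentiable[OF T W(2)]
  have dv: "vdiv T differentiable (at p)" using Cinf_differentiable[OF vdiv_smooth[OF W(1) T] W(2)] by simp
  have dG: "dd v (G0 i) differentiable (at p)" for v i
    using Cinf_differentiable[OF Cinf_dd[OF G0_smooth]] W by blast
  have 1: "dd (0, \<chi> l. T l p) (\<lambda>q. \<Sum>m\<in>UNIV. dd (0, axis m 1) (G0 m) q) p
     = (\<Sum>m\<in>UNIV. Gam a (fst p) (axis m 1) (\<chi> l. T l p) $ m)"
    by (simp add: dd_sum dG dd_dd_G0 p)
  have 2: "dd (hor a p v) (T i) p = dd (v, 0) (T i) p - dd (0, Gam a (fst p) v (snd p)) (T i) p" for v i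
    using dd_dir_diff[OF dT, of "(v, 0)" "(0, Gam a (fst p) v (snd p))"] unfolding hor_def by simp
  \<comment> \<open>The horizontal lift of \<open>y\<close> at \<open>y\<close> is the geodesic
    vector field \<open>(y, - 2 G0)\<close>.\<close>
  have 3: "dd (hor a p (snd p)) (vdiv T) p = dd (snd p, 0) (vdiv T) p - 2 * dd (0, \<chi> l. G0 l p) (vdiv T) p"
  proof -
    have e: "Gam a (fst p) (snd p) (snd p) = 2 *\<^sub>R (\<chi> l. G0 l p)" by (simp add: G0_def vec_eq_iff)
    have "hor a p (snd p) = (snd p, 0) - 2 *\<^sub>R (0, \<chi> l. G0 l p)" unfolding hor_def e by simp
    then show ?thesis using dd_dir_diff[OF dv] dd_dir_scaleR[OF dv] by metis
  qed
  have 4: "(\<Sum>m\<in>UNIV. \<Sum>l\<in>UNIV. dd (0, axis l 1) (G0 m) p * dd (0, axis m 1) (T l) p)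
     = (\<Sum>l\<in>UNIV. dd (0, Gam a (fst p) (axis l 1) (snd p)) (T l) p)"
    by (subst sum.swap) (simp add: dd_G0 p dd_snd_axis[OF dT])
  show ?thesis
    unfolding RicOp_add[OF W(1,2) Cinf_subset[OF G0_smooth W(3)] T] 1 4 3 hdiv_def 2
    unfolding vdiv_def[abs_def, symmetric]
    by (simp add: vdiv_def[abs_def] sum.distrib sum_subtractf algebra_simps)
qed

end

section \<open>Covariant derivatives of 1-forms, and the spray as the solution of a linear
  system\<close>

definition covf :: "(real ^ 'n \<Rightarrow> real ^ 'n ^ 'n) \<Rightarrow> (real ^ 'n \<Rightarrow> real ^ 'n) \<Rightarrow> real ^ 'n::finite \<Rightarrow> real ^ 'n \<Rightarrow> real ^ 'n \<Rightarrow> real" where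
  "covf a w x v u = vdd u w x \<bullet> v - w x \<bullet> Gam a x v u"

lemma covf_covd:
  assumes "vdiff w x"
  shows "covf a w x v u = (\<Sum>i\<in>UNIV. \<Sum>j\<in>UNIV. covd a w i j x * v $ i * u $ j)"
proof -
  have "vdd u w x \<bullet> v = (\<Sum>i\<in>UNIV. \<Sum>j\<in>UNIV. pd j (\<lambda>z. w z $ i) x * v $ i * u $ j)"
    using assms unfolding vdd_def inner_vec_def vdiff_def
    by (simp add: dd_pd sum_distrib_left sum_distrib_right mult_ac)
  moreover have "w x \<bullet> Gam a x v u = (\<Sum>i\<in>UNIV. \<Sum>j\<in>UNIV. \<Sum>k\<in>UNIV. christoffel a k i j x * w x $ k * v $ i * u $ j)"
    unfolding inner_vec_def Gam_def
    by (simp add: sum_distrib_left sum_distrib_right mult_ac)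
      (subst sum.swap, rule sum.cong, rule refl, rule sum.swap)
  ultimately show ?thesis
    unfolding covf_def covd_def by (simp add: sum_subtractf[symmetric] left_diff_distrib sum_distrib_right)
qed

lemma covf_linear1: "linear (\<lambda>v. covf a w x v u)"
  unfolding covf_def by (auto intro!: linearI simp: Gam_simps inner_add_right algebra_simps)

lemma covf_linear2:
  assumes "vdiff w x"
  shows "linear (\<lambda>u. covf a w x v u)"
  unfolding covf_def
  by (auto intro!: linearI simp: Gam_simps inner_add_right inner_add_left algebra_simps
      linear_add[OF vdd_linear[OF assms]] linear_cmul[OF vdd_linear[OF assms]])

lemma hor_add: "hor a p (v + w) = hor a p v + hor a p w"
  and hor_scaleR: "hor a p (c *\<^sub>R v) = c *\<^sub>R hor a p v"
  by (simp_all add: hor_def Gam_simps)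

lemma dd_hor_linear: "f differentiable (at p) \<Longrightarrow> linear (\<lambda>v. dd (hor a p v) f p)"
  by (rule linearI) (simp_all add: hor_add hor_scaleR dd_dir_add dd_dir_scaleR)

lemma alpha_gin: "alpha a x y = sqrt (gin a x y y)"
  unfolding alpha_def gin_sum ..

lemma fundamental_tensor_vec:
  fixes F :: "real ^ 'n::finite \<Rightarrow> real ^ 'n \<Rightarrow> real"
  assumes W: "open W" "(x, y) \<in> W" and E: "Cinf W E"
    and eq: "\<And>q. q \<in> W \<Longrightarrow> energy F (fst q) (snd q) = E q"
  shows "(fundamental_tensor F x y *v u) $ i = 1 / 2 * dd (0, u) (dd (0, axis i 1) E) (x, y)"
proof -
  have 1: "dd u (\<lambda>q. energy F (fst q) (snd q)) q = dd u E q" if "q \<in> W" for u q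
    by (rule dd_transform[OF W(1) that]) (use eq in auto)
  have 2: "dd u (dd v (\<lambda>q. energy F (fst q) (snd q))) (x, y) = dd u (dd v E) (x, y)" for u v
    by (rule dd_transform[OF W]) (use 1 in auto)
  have d: "dd v E differentiable (at (x, y))" for v
    using Cinf_differentiable[OF Cinf_dd[OF E] W(2)] .
  have g: "fundamental_tensor F x y $ i $ j = 1 / 2 * dd (0, axis j 1) (dd (0, axis i 1) E) (x, y)" for i j
    unfolding fundamental_tensor_def dy_dd by (simp add: 2)
  show ?thesis
    unfolding matrix_vector_mult_def using dd_snd_axis[OF d[of "(0, axis i 1)"], of u]
    by (simp add: g sum_distrib_left[symmetric] sum_divide_distrib[symmetric] mult.commute)
qed

text \<open>A square matrix with trivial kernel is invertible. Phrased with the Hessian of the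
  energy, the kernel condition can be tested on conveniently chosen vectors
  \<open>w\<close>.\<close>

lemma fundamental_tensor_invertible:
  fixes F :: "real ^ 'n::finite \<Rightarrow> real ^ 'n \<Rightarrow> real"
  assumes W: "open W" "(x, y) \<in> W" and E: "Cinf W E"
    and eq: "\<And>q. q \<in> W \<Longrightarrow> energy F (fst q) (snd q) = E q"
    and inv: "\<And>v. (\<And>w. dd (0, v) (dd (0, w) E) (x, y) = 0) \<Longrightarrow> v = 0"
  shows "invertible (fundamental_tensor F x y)"
proof -
  have d: "dd v E differentiable (at (x, y))" for v
    using Cinf_differentiable[OF Cinf_dd[OF E] W(2)] .
  have "u = 0" if "fundamental_tensor F x y *v u = 0" for u
  proof (rule inv)
    fix w
    have "dd (0, u) (dd (0, axis i 1) E) (x, y) = 0" for i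
      using arg_cong[OF that, of "\<lambda>v. v $ i"] fundamental_tensor_vec[OF W E eq, of u i] by simp
    then have "dd (0, axis i 1) (dd (0, u) E) (x, y) = 0" for i
      using Cinf_dd_commute[OF W E] by metis
    then have "dd (0, w) (dd (0, u) E) (x, y) = 0"
      using dd_snd_axis[OF d[of "(0, u)"], of w] by simp
    then show "dd (0, u) (dd (0, w) E) (x, y) = 0"
      using Cinf_dd_commute[OF W E] by metis
  qed
  then show ?thesis
    unfolding invertible_left_inverse matrix_left_invertible_ker by blast
qed

text \<open>The Euler-Lagrange equations are linear in the spray coefficients, with the fundamental
  tensor as matrix. A candidate that solves them is therefore the spray as soon as the kernel is
  trivial, and no inverse has to be computed. The factor 2 combines the 1/4 in \<open>spray\<close>
  with the 1/2 in the fundamental tensor.\<close>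

lemma spray_eqI:
  fixes F :: "real ^ 'n::finite \<Rightarrow> real ^ 'n \<Rightarrow> real"
  assumes W: "open W" "(x, y) \<in> W" and E: "Cinf W E"
    and eq: "\<And>q. q \<in> W \<Longrightarrow> energy F (fst q) (snd q) = E q"
    and inv: "\<And>v. (\<And>w. dd (0, v) (dd (0, w) E) (x, y) = 0) \<Longrightarrow> v = 0"
    and el: "\<And>w. dd (y, 0) (dd (0, w) E) (x, y) - dd (w, 0) E (x, y) = 2 * dd (0, v) (dd (0, w) E) (x, y)"
  shows "spray F i x y = v $ i"
proof -
  have 1: "dd u (\<lambda>q. energy F (fst q) (snd q)) q = dd u E q" if "q \<in> W" for u q
    by (rule dd_transform[OF W(1) that]) (use eq in auto)
  have 2: "dd u (dd v (\<lambda>q. energy F (fst q) (snd q))) (x, y) = dd u (dd v E) (x, y)" for u v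
    by (rule dd_transform[OF W]) (use 1 in auto)
  have d: "dd v E differentiable (at (x, y))" for v
    using Cinf_differentiable[OF Cinf_dd[OF E] W(2)] .
  define g where "g = fundamental_tensor F x y"
  have gv: "(g *v u) $ i = 1 / 2 * dd (0, u) (dd (0, axis i 1) E) (x, y)" for u i
    unfolding g_def by (rule fundamental_tensor_vec[OF W E eq])
  have "invertible g" unfolding g_def by (rule fundamental_tensor_invertible[OF W E eq inv])
  then have "\<exists>B. g ** B = mat 1 \<and> B ** g = mat 1" using invertible_def by blast
  then have "g ** matrix_inv g = mat 1 \<and> matrix_inv g ** g = mat 1"
    unfolding matrix_inv_def by (rule someI_ex)
  then have ig: "matrix_inv g *v (g *v v) = v" by (simp add: matrix_vector_mul_assoc)
  have "(\<Sum>k\<in>UNIV. dx k (dy l (energy F)) x y * y $ k) - dx l (energy F) x y = 4 * (g *v v) $ l" for l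
    unfolding dx_dd dy_dd using dd_fst_axis[OF d[of "(0, axis l 1)"], of y] el[of "axis l 1"]
    by (simp add: 1 2 W gv)
  then have "spray F i x y = 1 / 4 * (\<Sum>l\<in>UNIV. matrix_inv g $ i $ l * (4 * (g *v v) $ l))"
    unfolding spray_def g_def by simp
  also have "\<dots> = (matrix_inv g *v (g *v v)) $ i"
    unfolding matrix_vector_mult_def[of "matrix_inv g"] by (simp add: sum_distrib_left mult_ac)
  finally show ?thesis using ig by simp
qed

context metric_chart
begin

lemma mem_TU: "fst p \<in> U \<longleftrightarrow> p \<in> TU"
  by (simp add: mem_Times_iff)

lemma dd_hor_gin:
  assumes p: "fst p \<in> U" and V: "vdiff V p" and Z: "vdiff Z p"
  shows "dd (hor a p u) (\<lambda>p. gin a (fst p) (V p) (Z p)) p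
    = gin a (fst p) (cov a u V p) (Z p) + gin a (fst p) (V p) (cov a u Z p)"
proof -
  have m: "mdiff (\<lambda>p. a (fst p)) p" by (rule mdiff_fst[OF mdiff_a[OF p]])
  have "dd (hor a p u) (\<lambda>p. gin a (fst p) (V p) (Z p)) p
    = gin (mdd u a) (fst p) (V p) (Z p) + gin a (fst p) (vdd (hor a p u) V p) (Z p) + gin a (fst p) (V p) (vdd (hor a p u) Z p)"
    using dd_gin[OF m V Z, of "hor a p u"] mdd_fst[OF mdiff_a[OF p], of "hor a p u"]
    by (simp add: gin_def hor_def)
  also have "gin (mdd u a) (fst p) (V p) (Z p) = gin a (fst p) (Gam a (fst p) u (V p)) (Z p) + gin a (fst p) (V p) (Gam a (fst p) u (Z p))"
    using gin_compat[OF p] dd_gin_const[OF mdiff_a[OF p]] by metis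
  finally show ?thesis unfolding cov_def by (simp add: gin_simps)
qed

lemma dd_hor_inner:
  assumes w: "vdiff w (fst p)" and V: "vdiff V p" and p: "fst p \<in> U"
  shows "dd (hor a p u) (\<lambda>p. w (fst p) \<bullet> V p) p = covf a w (fst p) (V p) u + w (fst p) \<bullet> cov a u V p"
  unfolding covf_def cov_def
  using dd_inner[OF vdiff_fst[OF w] V, of "hor a p u"] vdd_fst[OF w, of "hor a p u"] Gam_sym[OF p, of u "V p"]
  by (simp add: hor_def inner_add_right)

lemma cov_snd [simp]: "cov a u snd p = 0"
  unfolding cov_def by (simp add: hor_def)

lemma cov_const [simp]: "cov a u (\<lambda>p. c) p = Gam a (fst p) u c"
  unfolding cov_def by simp

definition Af :: "(real ^ 'n) \<times> (real ^ 'n) \<Rightarrow> real" where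
  "Af p = gin a (fst p) (snd p) (snd p)"

lemma gin_smooth:
  assumes S: "open S" "S \<subseteq> TU" and "\<And>i. Cinf S (\<lambda>p. V p $ i)" "\<And>i. Cinf S (\<lambda>p. Z p $ i)"
  shows "Cinf S (\<lambda>p. gin a (fst p) (V p) (Z p))"
  unfolding gin_sum
  by (intro Cinf_sum Cinf_mult S assms Cinf_subset[OF Cinf_fst[OF a_smooth] S(2)])

lemma Af_smooth: "Cinf TU Af"
  unfolding Af_def[abs_def] by (intro gin_smooth openTU Cinf_snd_nth) auto

lemma gin_snd_smooth: "Cinf TU (\<lambda>p. gin a (fst p) (snd p) v)"
  by (intro gin_smooth openTU Cinf_snd_nth Cinf_const) auto

lemma dd_hor_Af: "fst p \<in> U \<Longrightarrow> dd (hor a p u) Af p = 0"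
  unfolding Af_def[abs_def] by (simp add: dd_hor_gin gin_simps)

lemma dd_ver_gin:
  assumes p: "fst p \<in> U" and V: "vdiff V p" and Z: "vdiff Z p"
  shows "dd (0, u) (\<lambda>p. gin a (fst p) (V p) (Z p)) p
    = gin a (fst p) (vdd (0, u) V p) (Z p) + gin a (fst p) (V p) (vdd (0, u) Z p)"
proof -
  have m: "mdiff (\<lambda>p. a (fst p)) p" by (rule mdiff_fst[OF mdiff_a[OF p]])
  show ?thesis
    using dd_gin[OF m V Z, of "(0, u)"] mdd_fst[OF mdiff_a[OF p], of "(0, u)"] linear_0[OF mdd_linear[OF mdiff_a[OF p]]]
    by (simp add: gin_def)
qed

lemma dd_ver_Af: "fst p \<in> U \<Longrightarrow> dd (0, u) Af p = 2 * gin a (fst p) (snd p) u"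
  unfolding Af_def[abs_def] by (simp add: dd_ver_gin gin_sym)

lemma dd_ver_gin_snd: "fst p \<in> U \<Longrightarrow> dd (0, u) (\<lambda>p. gin a (fst p) (snd p) v) p = gin a (fst p) u v"
  by (simp add: dd_ver_gin gin_simps)

lemma dd_hor_gin_snd: "fst p \<in> U \<Longrightarrow> dd (hor a p u) (\<lambda>p. gin a (fst p) (snd p) v) p = gin a (fst p) (snd p) (Gam a (fst p) u v)"
  by (simp add: dd_hor_gin gin_simps)

lemma dd_fst_hor:
  assumes "f differentiable (at p)"
  shows "dd (v, 0) f p = dd (hor a p v) f p + dd (0, Gam a (fst p) v (snd p)) f p"
  using dd_dir_add[OF assms, of "hor a p v" "(0, Gam a (fst p) v (snd p))"] unfolding hor_def by simp

text \<open>The same criterion for the deviation \<open>v\<close> from the spray of \<alpha>. The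
  term with \<open>Gam a (fst p) w (snd p)\<close> comes from splitting \<open>(w, 0)\<close> into
  its horizontal and vertical parts.\<close>

lemma spray_eq_hor:
  fixes F :: "real ^ 'n \<Rightarrow> real ^ 'n \<Rightarrow> real"
  assumes W: "open W" "p \<in> W" "W \<subseteq> TU" and E: "Cinf W E"
    and eq: "\<And>q. q \<in> W \<Longrightarrow> energy F (fst q) (snd q) = E q"
    and inv: "\<And>v. (\<And>w. dd (0, v) (dd (0, w) E) p = 0) \<Longrightarrow> v = 0"
    and el: "\<And>w. dd (hor a p (snd p)) (dd (0, w) E) p - dd (hor a p w) E p - dd (0, Gam a (fst p) w (snd p)) E p
        = 2 * dd (0, v) (dd (0, w) E) p"
  shows "spray F i (fst p) (snd p) = G0 i p + v $ i"
proof -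
  note dE = Cinf_differentiable[OF E W(2)] and ddE = Cinf_differentiable[OF Cinf_dd[OF E] W(2)]
  have p: "(fst p, snd p) = p" by simp
  have "spray F i (fst p) (snd p) = ((1/2) *\<^sub>R Gam a (fst p) (snd p) (snd p) + v) $ i"
  proof (rule spray_eqI[OF W(1) _ E eq])
    fix w
    let ?G = "Gam a (fst p) (snd p) (snd p)"
    have "dd (0, (1/2) *\<^sub>R ?G + v) (dd (0, w) E) p = 1/2 * dd (0, ?G) (dd (0, w) E) p + dd (0, v) (dd (0, w) E) p"
      using dd_dir_add[OF ddE, of "(1/2) *\<^sub>R (0, ?G)" "(0, v)"] dd_dir_scaleR[OF ddE, of "1/2" "(0, ?G)"] by simp
    then show "dd (snd p, 0) (dd (0, w) E) (fst p, snd p) - dd (w, 0) E (fst p, snd p)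
        = 2 * dd (0, (1/2) *\<^sub>R ?G + v) (dd (0, w) E) (fst p, snd p)"
      using el[of w] dd_fst_hor[OF ddE, of "snd p" "(0, w)"] dd_fst_hor[OF dE, of w] by simp
  qed (use W inv p in auto)
  then show ?thesis by (simp add: G0_def)
qed

lemma spray_alpha: "fst p \<in> U \<Longrightarrow> spray (alpha a) i (fst p) (snd p) = G0 i p"
proof -
  assume p: "fst p \<in> U"
  then have pT: "p \<in> TU" by (simp add: mem_TU)
  have d1: "dd (0, w) Af q = 2 * gin a (fst q) (snd q) w" if "q \<in> TU" for w q
    using dd_ver_Af that by auto
  have d2: "dd u (dd (0, w) Af) p = 2 * dd u (\<lambda>q. gin a (fst q) (snd q) w) p" for u w
    using dd_transform[OF openTU pT, of "dd (0, w) Af" "\<lambda>q. 2 * gin a (fst q) (snd q) w" u] d1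
      dd_cmult[OF Cinf_differentiable[OF gin_snd_smooth pT], of u 2 w] by simp
  have "spray (alpha a) i (fst p) (snd p) = G0 i p + 0 $ i"
  proof (rule spray_eq_hor[OF openTU pT order_refl Af_smooth])
    show "energy (alpha a) (fst q) (snd q) = Af q" if "q \<in> TU" for q
      using that gin_nonneg[of "fst q" "snd q"] by (auto simp: energy_def alpha_gin Af_def)
    show "v = 0" if "\<And>w. dd (0, v) (dd (0, w) Af) p = 0" for v
      using that[of v] by (simp add: d2 dd_ver_gin_snd p gin_eq_0_iff)
    show "dd (hor a p (snd p)) (dd (0, w) Af) p - dd (hor a p w) Af p - dd (0, Gam a (fst p) w (snd p)) Af p
        = 2 * dd (0, 0) (dd (0, w) Af) p" for w
      using dd_dir_zero[OF Cinf_differentiable[OF Cinf_dd[OF Af_smooth] pT], of "(0, w)"] Gam_sym[OF p, of w "snd p"]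
      by (simp add: d2 dd_hor_gin_snd dd_hor_Af dd_ver_Af p zero_prod_def)
  qed
  then show ?thesis by simp
qed

lemma ricci_alpha: "fst p \<in> U \<Longrightarrow> ricci (alpha a) (fst p) (snd p) = RicOp G0 p"
  by (rule ricci_RicOp[OF openTU _ G0_smooth]) (auto simp: mem_TU spray_alpha)

text \<open>The Ricci tensor of \<open>a\<close> written in Christoffel symbols. As a bilinear form
  it can be expanded when \<open>y\<close> is a combination of b and an orthogonal vector.\<close>

definition RB :: "real ^ 'n \<Rightarrow> real ^ 'n \<Rightarrow> real ^ 'n \<Rightarrow> real" where
  "RB x u v = (\<Sum>m\<in>UNIV. gin (mdd (axis m 1) (Cmat m)) x u v - gin (mdd u (Cmat m)) x (axis m 1) v
     + Gam a x (axis m 1) (Gam a x u v) $ m - (\<Sum>l\<in>UNIV. Gam a x (axis l 1) u $ m * Gam a x (axis m 1) v $ l))"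

lemma RB_linear1:
  assumes "x \<in> U" shows "linear (\<lambda>u. RB x u v)"
proof -
  have 1: "gin (mdd (u + u') (Cmat m)) x w v = gin (mdd u (Cmat m)) x w v + gin (mdd u' (Cmat m)) x w v" for m u u' w
    using linear_add[OF mdd_linear[OF mdiff_Cmat[OF assms]]] unfolding gin_def by (simp add: matrix_vector_mult_add_rdistrib inner_add_right)
  have 2: "gin (mdd (c *\<^sub>R u) (Cmat m)) x w v = c * gin (mdd u (Cmat m)) x w v" for m u c w
    using linear_cmul[OF mdd_linear[OF mdiff_Cmat[OF assms]]] unfolding gin_def by (simp add: scaleR_matrix_vector_assoc[symmetric])
  show ?thesis unfolding RB_def
    by (rule linearI) (simp_all add: 1 2 gin_simps Gam_simps sum.distrib sum_subtractf sum_distrib_left sum_distrib_right algebra_simps)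
qed

lemma RB_linear2: "linear (\<lambda>v. RB x u v)"
  unfolding RB_def
  by (rule linearI) (simp_all add: gin_simps Gam_simps sum.distrib sum_subtractf sum_distrib_left algebra_simps)

lemma ricci_alpha_RB:
  assumes x: "x \<in> U" shows "ricci (alpha a) x y = RB x y y"
proof -
  let ?p = "(x, y)"
  have p: "fst ?p \<in> U" using x by simp
  have m: "mdiff (\<lambda>p. Cmat i (fst p)) ?p" for i by (rule mdiff_fst[OF mdiff_Cmat[OF p]])
  have 1: "dd (v, 0) (G0 i) ?p = 1 / 2 * gin (mdd v (Cmat i)) x y y" for v i
  proof -
    have "dd (v, 0) (G0 i) ?p = 1 / 2 * dd (v, 0) (\<lambda>p. gin (\<lambda>p. Cmat i (fst p)) p (snd p) (snd p)) ?p"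
      unfolding G0_def[abs_def] Gam_nth
      using dd_cmult[OF diff_gin[OF m[of i] vdiff_snd vdiff_snd], of "(v, 0)" "1 / 2"]
      by (simp add: gin_def)
    then show ?thesis
      using mdd_fst[OF mdiff_Cmat[OF p, of i], of "(v, 0)"] by (simp add: dd_gin[OF m, unfolded gin_def] gin_def)
  qed
  have 2: "dd (v, 0) (dd (0, w) (G0 i)) ?p = gin (mdd v (Cmat i)) x w y" for v w i
  proof -
    have "dd (v, 0) (dd (0, w) (G0 i)) ?p = dd (v, 0) (\<lambda>p. gin (\<lambda>p. Cmat i (fst p)) p w (snd p)) ?p"
      by (rule dd_transform[OF openTU]) (use x in \<open>auto simp: dd_G0 Gam_nth gin_def mem_Times_iff\<close>)
    then show ?thesis
      using mdd_fst[OF mdiff_Cmat[OF p, of i], of "(v, 0)"] by (simp add: dd_gin[OF m, unfolded gin_def] gin_def)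
  qed
  have 3: "(\<chi> l. G0 l ?p) = (1/2) *\<^sub>R Gam a x y y" by (simp add: G0_def vec_eq_iff)
  show ?thesis
    using ricci_alpha[OF p] unfolding RicOp_def RB_def
    by (simp add: 1 2 3 dd_dd_G0 dd_G0 x Gam_simps)
qed

text \<open>Adding a multiple of \<open>y\<close> to a spray only reparametrises its geodesics, and
  accordingly all terms with \<open>P\<close> collect into a multiple of n - 1. Euler's identities
  for \<open>Q\<close> of degree two and \<open>P\<close> of degree one are what makes the remaining
  terms cancel.\<close>

theorem RicOp_projective:
  fixes Q :: "'n \<Rightarrow> (real ^ 'n) \<times> (real ^ 'n) \<Rightarrow> real"
  assumes W: "open W" "p \<in> W" "W \<subseteq> TU" and Q: "\<And>i. Cinf W (Q i)" and P: "Cinf W P"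
    and hQ: "\<And>i q. q \<in> W \<Longrightarrow> dd (0, snd q) (Q i) q = 2 * Q i q"
    and hP: "\<And>q. q \<in> W \<Longrightarrow> dd (0, snd q) P q = P q"
  shows "RicOp (\<lambda>i q. G0 i q + (Q i q + P q * snd q $ i)) p = RicOp G0 p + 2 * hdiv Q p
    - dd (hor a p (snd p)) (vdiv Q) p + 2 * dd (0, \<chi> l. Q l p) (vdiv Q) p
    - (\<Sum>m\<in>UNIV. \<Sum>l\<in>UNIV. dd (0, axis l 1) (Q m) p * dd (0, axis m 1) (Q l) p)
    + (real CARD('n) - 1) * ((P p)\<^sup>2 - dd (hor a p (snd p)) P p + 2 * dd (0, \<chi> l. Q l p) P p)"
proof -
  let ?T = "\<lambda>i q. Q i q + P q * snd q $ i"
  let ?n = "real CARD('n)"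
  have p: "fst p \<in> U" using W by auto
  note sy = Cinf_snd_nth[of W]
  have T: "Cinf W (?T i)" for i by (intro Cinf_add Cinf_mult W Q P sy)
  have dQ: "Q i differentiable (at q)" and dP: "P differentiable (at q)" and dy: "(\<lambda>q. snd q $ i) differentiable (at q)"
    if "q \<in> W" for i q
    using Cinf_differentiable[OF Q that] Cinf_differentiable[OF P that] Cinf_differentiable[OF sy that] by auto
  have ddQ: "dd v (Q i) differentiable (at p)" for v i using Cinf_differentiable[OF Cinf_dd[OF Q] W(2)] .
  have dvQ: "vdiv Q differentiable (at p)" using Cinf_differentiable[OF vdiv_smooth[OF W(1) Q] W(2)] by simp
  have sy': "dd v (\<lambda>q. snd q $ i) q = snd v $ i" for v i and q :: "(real ^ 'n) \<times> (real ^ 'n)"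
    using dd_bounded_linear[OF bounded_linear_snd_nth] by fast
  have dT: "dd v (?T i) q = dd v (Q i) q + (dd v P q * snd q $ i + P q * snd v $ i)" if "q \<in> W" for v i q
    using that by (simp add: dd_add dd_mult dQ dP dy sy')
  have s1: "(\<Sum>m\<in>(UNIV::'n set). axis m (1::real) $ m) = ?n" by simp
  have s2: "(\<Sum>m\<in>UNIV. dd (0, axis m 1) P q * snd q $ m) = P q" if "q \<in> W" for q
    using dd_snd_axis[OF dP[OF that], of "snd q"] hP[OF that] by (simp add: mult.commute)
  have vT: "vdiv ?T q = vdiv Q q + (?n + 1) * P q" if "q \<in> W" for q
  proof -
    have "vdiv ?T q = vdiv Q q + ((\<Sum>m\<in>UNIV. dd (0, axis m 1) P q * snd q $ m) + P q * (\<Sum>m\<in>(UNIV::'n set). axis m (1::real) $ m))"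
      unfolding vdiv_def dT[OF that] snd_conv by (simp only: sum.distrib sum_distrib_left)
    then show ?thesis unfolding s1 s2[OF that] by (simp add: algebra_simps)
  qed
  have dvT: "dd v (vdiv ?T) p = dd v (vdiv Q) p + (?n + 1) * dd v P p" for v
    using dd_transform[OF W(1,2), of "vdiv ?T" "\<lambda>q. vdiv Q q + (?n + 1) * P q" v] vT
    by (simp add: dd_add dd_cmult dvQ dP W)
  have hT: "hdiv ?T p = hdiv Q p + dd (hor a p (snd p)) P p"
  proof -
    have lin: "linear (\<lambda>v. dd (hor a p v) P p)" by (rule dd_hor_linear[OF dP[OF W(2)]])
    have "dd (hor a p (snd p)) P p = (\<Sum>m\<in>UNIV. snd p $ m * dd (hor a p (axis m 1)) P p)"
      by (subst axis_expansion[of "snd p"]) (simp add: linear_sum[OF lin] linear_cmul[OF lin])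
    moreover have "(\<chi> l. ?T l p) = (\<chi> l. Q l p) + P p *\<^sub>R snd p" by (simp add: vec_eq_iff)
    moreover have "dd (hor a p (axis m 1)) (?T m) p + Gam a (fst p) (axis m 1) ((\<chi> l. Q l p) + P p *\<^sub>R snd p) $ m
        = (dd (hor a p (axis m 1)) (Q m) p + Gam a (fst p) (axis m 1) (\<chi> l. Q l p) $ m)
          + snd p $ m * dd (hor a p (axis m 1)) P p" for m
      by (simp add: dT[OF W(2)] Gam_simps hor_def)
    ultimately show ?thesis unfolding hdiv_def by (simp only: sum.distrib)
  qed
  have vT2: "dd (0, \<chi> l. ?T l p) f p = dd (0, \<chi> l. Q l p) f p + P p * dd (0, snd p) f p"
    if "f differentiable (at p)" for f
  proof -
    have e: "(0, \<chi> l. ?T l p) = (0, \<chi> l. Q l p) + P p *\<^sub>R (0 :: real ^ 'n, snd p)" by (simp add: vec_eq_iff)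
    show ?thesis by (simp only: e dd_dir_add[OF that] dd_dir_scaleR[OF that])
  qed
  \<comment> \<open>The vertical divergence of \<open>Q\<close> has degree one; this follows by
    differentiating Euler's identity for \<open>Q\<close> once more in \<open>y\<close>.\<close>
  have hvQ: "dd (0, snd p) (vdiv Q) p = vdiv Q p"
  proof -
    have "dd (0, snd p) (dd (0, axis m 1) (Q m)) p = dd (0, axis m 1) (Q m) p" for m
    proof -
      have "dd (0, axis m 1) (\<lambda>q. \<Sum>l\<in>UNIV. snd q $ l * dd (0, axis l 1) (Q m) q) p = dd (0, axis m 1) (\<lambda>q. 2 * Q m q) p"
        by (rule dd_transform[OF W(1,2)]) (simp add: dd_snd_axis[OF dQ] hQ)
      moreover have "dd (0, axis m 1) (\<lambda>q. \<Sum>l\<in>UNIV. snd q $ l * dd (0, axis l 1) (Q m) q) p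
        = (\<Sum>l\<in>UNIV. axis m 1 $ l * dd (0, axis l 1) (Q m) p) + (\<Sum>l\<in>UNIV. snd p $ l * dd (0, axis m 1) (dd (0, axis l 1) (Q m)) p)"
        by (simp add: dd_sum dd_mult ddQ dy[OF W(2)] sy' sum.distrib)
      moreover have "(\<Sum>l\<in>UNIV. axis m 1 $ l * dd (0, axis l 1) (Q m) p) = dd (0, axis m 1) (Q m) p"
        by (simp add: sum_axis)
      moreover have "(\<Sum>l\<in>UNIV. snd p $ l * dd (0, axis m 1) (dd (0, axis l 1) (Q m)) p) = dd (0, snd p) (dd (0, axis m 1) (Q m)) p"
        using dd_snd_axis[OF ddQ[of "(0, axis m 1)" m], of "snd p"] Cinf_dd_commute[OF W(1,2) Q] by simp
      ultimately show ?thesis by (simp add: dd_cmult dQ[OF W(2)])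
    qed
    then show ?thesis unfolding vdiv_def[abs_def] by (simp add: dd_sum ddQ)
  qed
  \<comment> \<open>The vertical Jacobian of \<open>Q + P y\<close> is that of \<open>Q\<close> plus
    a matrix of rank one plus \<open>P\<close> times the identity. The trace of its square is
    expanded accordingly.\<close>
  have QQ: "(\<Sum>m\<in>UNIV. \<Sum>l\<in>UNIV. dd (0, axis l 1) (?T m) p * dd (0, axis m 1) (?T l) p)
    = (\<Sum>m\<in>UNIV. \<Sum>l\<in>UNIV. dd (0, axis l 1) (Q m) p * dd (0, axis m 1) (Q l) p)
      + 4 * dd (0, \<chi> l. Q l p) P p + 2 * P p * vdiv Q p + (?n + 3) * (P p)\<^sup>2"
  proof -
    let ?q = "\<lambda>m l. dd (0, axis l 1) (Q m) p" and ?r = "\<lambda>l. dd (0, axis l 1) P p" and ?y = "\<lambda>l. snd p $ l"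
    let ?d = "\<lambda>l m. axis l (1::real) $ m"
    have sw: "?d l m = ?d m l" for l m by (auto simp: axis_def)
    have a1: "(\<Sum>l\<in>UNIV. ?q m l * ?y l) = 2 * Q m p" for m
      using dd_snd_axis[OF dQ[OF W(2), of m], of "snd p"] hQ[OF W(2)] by (simp add: mult.commute)
    have a2: "(\<Sum>m\<in>UNIV. Q m p * ?r m) = dd (0, \<chi> l. Q l p) P p"
      using dd_snd_axis[OF dP[OF W(2)], of "\<chi> l. Q l p"] by simp
    have b1: "(\<Sum>m\<in>UNIV. \<Sum>l\<in>UNIV. ?q m l * (?r m * ?y l)) = 2 * dd (0, \<chi> l. Q l p) P p"
    proof -
      have "(\<Sum>m\<in>UNIV. \<Sum>l\<in>UNIV. ?q m l * (?r m * ?y l)) = (\<Sum>m\<in>UNIV. ?r m * (\<Sum>l\<in>UNIV. ?q m l * ?y l))"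
        by (simp add: sum_distrib_left mult_ac)
      also have "\<dots> = (\<Sum>m\<in>UNIV. 2 * (Q m p * ?r m))" unfolding a1 by (simp add: mult_ac)
      also have "\<dots> = 2 * dd (0, \<chi> l. Q l p) P p" unfolding a2[symmetric] by (rule sum_distrib_left[symmetric])
      finally show ?thesis .
    qed
    have b1': "(\<Sum>m\<in>UNIV. \<Sum>l\<in>UNIV. (?r l * ?y m) * ?q l m) = 2 * dd (0, \<chi> l. Q l p) P p"
      using b1 by (subst sum.swap) (simp add: mult_ac)
    have b2: "(\<Sum>m\<in>UNIV. \<Sum>l\<in>UNIV. (?r l * ?y m) * (?r m * ?y l)) = (P p)\<^sup>2"
    proof -
      have "(\<Sum>m\<in>UNIV. \<Sum>l\<in>UNIV. (?r l * ?y m) * (?r m * ?y l)) = (\<Sum>m\<in>UNIV. ?r m * ?y m) * (\<Sum>l\<in>UNIV. ?r l * ?y l)"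
        by (simp add: sum_product mult_ac)
      then show ?thesis by (simp add: s2[OF W(2)] power2_eq_square)
    qed
    have b3: "(\<Sum>m\<in>UNIV. \<Sum>l\<in>UNIV. ?d l m * f m l) = (\<Sum>m\<in>UNIV. f m m)" for f :: "'n \<Rightarrow> 'n \<Rightarrow> real"
    proof -
      have "(\<Sum>l\<in>UNIV. ?d l m * f m l) = (\<Sum>l\<in>UNIV. ?d m l * f m l)" for m
        by (intro sum.cong refl) (metis sw)
      then show ?thesis by (simp add: sum_axis)
    qed
    have tt: "dd (0, axis l 1) (?T m) p * dd (0, axis m 1) (?T l) p =
        (?q m l * ?q l m + ?q m l * (?r m * ?y l) + (?r l * ?y m) * ?q l m + (?r l * ?y m) * (?r m * ?y l))
         + ?d l m * (P p * ?q m l + P p * ?q l m + P p * (?r l * ?y m) + P p * (?r m * ?y l)) + ?d l m * (?d l m * (P p)\<^sup>2)" for l m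
      unfolding dT[OF W(2)] snd_conv sw[of m l] by algebra
    have "(\<Sum>m\<in>UNIV. \<Sum>l\<in>UNIV. dd (0, axis l 1) (?T m) p * dd (0, axis m 1) (?T l) p)
      = (\<Sum>m\<in>UNIV. \<Sum>l\<in>UNIV. (?q m l * ?q l m + ?q m l * (?r m * ?y l) + (?r l * ?y m) * ?q l m + (?r l * ?y m) * (?r m * ?y l))
         + ?d l m * (P p * ?q m l + P p * ?q l m + P p * (?r l * ?y m) + P p * (?r m * ?y l)) + ?d l m * (?d l m * (P p)\<^sup>2))"
      by (simp only: tt)
    also have "\<dots> = (\<Sum>m\<in>UNIV. \<Sum>l\<in>UNIV. ?q m l * ?q l m) + 2 * dd (0, \<chi> l. Q l p) P p + 2 * dd (0, \<chi> l. Q l p) P p + (P p)\<^sup>2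
       + (\<Sum>m\<in>UNIV. P p * ?q m m + P p * ?q m m + P p * (?r m * ?y m) + P p * (?r m * ?y m)) + (\<Sum>m\<in>(UNIV::'n set). ?d m m * (P p)\<^sup>2)"
      by (simp only: sum.distrib b1 b1' b2 b3)
    also have "\<dots> = (\<Sum>m\<in>UNIV. \<Sum>l\<in>UNIV. ?q m l * ?q l m) + 2 * dd (0, \<chi> l. Q l p) P p + 2 * dd (0, \<chi> l. Q l p) P p + (P p)\<^sup>2
       + (P p * vdiv Q p + P p * vdiv Q p + P p * P p + P p * P p) + ?n * (P p)\<^sup>2"
      by (simp only: sum.distrib sum_distrib_left[symmetric] sum_distrib_right[symmetric] s2[OF W(2)] vdiv_def s1)
    finally show ?thesis by (simp add: algebra_simps power2_eq_square)
  qed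
  show ?thesis
    unfolding RicOp_deviation[OF W T] hT dvT QQ vT2[OF dvQ] vT2[OF dP[OF W(2)]] hvQ hP[OF W(2)]
    by (simp add: algebra_simps power2_eq_square)
qed

end

section \<open>The singular square metric with a 1-form of unit length\<close>

lemma Cinf_inner_snd:
  assumes "open S" "\<And>i. Cinf S (\<lambda>p. w p $ i)"
  shows "Cinf S (\<lambda>p::(real ^ 'n::finite) \<times> (real ^ 'n). w p \<bullet> snd p)"
  unfolding inner_vec_def inner_real_def
  by (intro Cinf_sum Cinf_mult assms Cinf_linear[OF bounded_linear_snd_nth])

text \<open>One-variable calculus for the energy (\<alpha> + \<beta>)^4 / \<alpha>^2. The derivative
  is sorted into a multiple of \<alpha> d\<alpha> and a multiple of d\<beta>, because \<alpha>
  d\<alpha> is half the derivative of a quadratic form in \<open>y\<close>. The two coefficients are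
  \<open>c1\<close> and \<open>c2\<close> below.\<close>

lemma DERIV_Er:
  fixes f g :: "real \<Rightarrow> real"
  assumes f: "(f has_real_derivative f') (at 0)" and g: "(g has_real_derivative g') (at 0)" and p: "f 0 > 0"
  shows "((\<lambda>t. (f t + g t) ^ 4 / f t ^ 2) has_real_derivative
    2 * (f 0 + g 0) ^ 3 * (f 0 - g 0) / f 0 ^ 4 * (f 0 * f') + 4 * (f 0 + g 0) ^ 3 / f 0 ^ 2 * g') (at 0)"
proof -
  define F where "F = f 0"
  define G where "G = g 0"
  have F: "F \<noteq> 0" using p F_def by simp
  have "((\<lambda>t. (f t + g t) ^ 4 / f t ^ 2) has_real_derivative
     ((4 * (F + G) ^ 3 * (f' + g')) * F ^ 2 - (F + G) ^ 4 * (2 * F * f')) / (F ^ 2 * F ^ 2)) (at 0)"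
    using p unfolding F_def G_def by (auto intro!: derivative_eq_intros f g simp: numeral_eq_Suc)
  moreover have "((4 * (F + G) ^ 3 * (f' + g')) * F ^ 2 - (F + G) ^ 4 * (2 * F * f')) / (F ^ 2 * F ^ 2)
     = 2 * (F + G) ^ 3 * (F - G) / F ^ 4 * (F * f') + 4 * (F + G) ^ 3 / F ^ 2 * g'"
    using F by (simp add: divide_simps) algebra
  ultimately show ?thesis unfolding F_def G_def by simp
qed

lemma DERIV_c1:
  fixes f g :: "real \<Rightarrow> real"
  assumes f: "(f has_real_derivative f') (at 0)" and g: "(g has_real_derivative g') (at 0)" and p: "f 0 > 0"
  shows "((\<lambda>t. 2 * (f t + g t) ^ 3 * (f t - g t) / f t ^ 4) has_real_derivative
    4 * (f 0 + g 0) ^ 2 / f 0 ^ 5 * (g 0 * (2 * g 0 - f 0) * f' + f 0 * (f 0 - 2 * g 0) * g')) (at 0)"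
proof -
  define F where "F = f 0"
  define G where "G = g 0"
  have F: "F \<noteq> 0" using p F_def by simp
  have "((\<lambda>t. 2 * (f t + g t) ^ 3 * (f t - g t) / f t ^ 4) has_real_derivative
     ((2 * (3 * (F+G)^2 * (f'+g')) * (F-G) + 2 * (F+G)^3*(f'-g')) * F^4 - 2 * (F+G)^3 * (F-G) * (4 * F^3 * f')) / (F^4 * F^4)) (at 0)"
    using p unfolding F_def G_def by (auto intro!: derivative_eq_intros f g simp: numeral_eq_Suc)
  moreover have "((2 * (3 * (F+G)^2 * (f'+g')) * (F-G) + 2 * (F+G)^3*(f'-g')) * F^4 - 2 * (F+G)^3 * (F-G) * (4 * F^3 * f')) / (F^4 * F^4)
     = 4 * (F + G) ^ 2 / F ^ 5 * (G * (2 * G - F) * f' + F * (F - 2 * G) * g')"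
    using F by (simp add: divide_simps) algebra
  ultimately show ?thesis unfolding F_def G_def by simp
qed

lemma DERIV_c2:
  fixes f g :: "real \<Rightarrow> real"
  assumes f: "(f has_real_derivative f') (at 0)" and g: "(g has_real_derivative g') (at 0)" and p: "f 0 > 0"
  shows "((\<lambda>t. 4 * (f t + g t) ^ 3 / f t ^ 2) has_real_derivative
    4 * (f 0 + g 0) ^ 2 / f 0 ^ 3 * ((f 0 - 2 * g 0) * f' + 3 * f 0 * g')) (at 0)"
proof -
  define F where "F = f 0"
  define G where "G = g 0"
  have F: "F \<noteq> 0" using p F_def by simp
  have "((\<lambda>t. 4 * (f t + g t) ^ 3 / f t ^ 2) has_real_derivative
     ((4 * (3 * (F+G)^2 * (f'+g'))) * F^2 - 4 * (F+G)^3 * (2 * F * f')) / (F^2 * F^2)) (at 0)"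
    using p unfolding F_def G_def by (auto intro!: derivative_eq_intros f g simp: numeral_eq_Suc)
  moreover have "((4 * (3 * (F+G)^2 * (f'+g'))) * F^2 - 4 * (F+G)^3 * (2 * F * f')) / (F^2 * F^2)
     = 4 * (F + G) ^ 2 / F ^ 3 * ((F - 2 * G) * f' + 3 * F * g')"
    using F by (simp add: divide_simps) algebra
  ultimately show ?thesis unfolding F_def G_def by simp
qed

locale unit_form = metric_chart U a for U :: "(real ^ 'n::finite) set" and a +
  fixes b :: "real ^ 'n \<Rightarrow> real ^ 'n"
  assumes b_smooth: "\<And>i. Cinf U (\<lambda>x. b x $ i)"
    and b_unit: "\<And>x. x \<in> U \<Longrightarrow> b x \<bullet> (matrix_inv (a x) *v b x) = 1"
begin

definition bu :: "real ^ 'n \<Rightarrow> real ^ 'n" where "bu x = matrix_inv (a x) *v b x"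
definition rm :: "real ^ 'n \<Rightarrow> real ^ 'n ^ 'n" where "rm x = (\<chi> i j. r_tensor a b i j x)"
definition sm :: "real ^ 'n \<Rightarrow> real ^ 'n ^ 'n" where "sm x = (\<chi> i j. s_tensor a b i j x)"
definition smx :: "real ^ 'n \<Rightarrow> real ^ 'n ^ 'n" where "smx x = (\<chi> i j. s_mixed a b i j x)"
abbreviation "sf \<equiv> s_form a b"

lemma raise_bu: "raise a b = bu"
  by (auto simp: raise_def bu_def vec_eq_iff matrix_vector_mult_def fun_eq_iff)

lemma covd_smooth: "(\<And>i. Cinf U (\<lambda>x. w x $ i)) \<Longrightarrow> Cinf U (covd a w i j)"
  unfolding covd_def[abs_def] pd_dd
  by (intro Cinf_diff Cinf_sum Cinf_mult Cinf_dd openU christoffel_smooth)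

lemma rm_smooth: "Cinf U (\<lambda>x. rm x $ i $ j)" and sm_smooth: "Cinf U (\<lambda>x. sm x $ i $ j)"
  unfolding rm_def sm_def r_tensor_def s_tensor_def vec_lambda_beta
  by (intro Cinf_mult Cinf_const Cinf_add Cinf_diff covd_smooth b_smooth openU)+

lemma smx_smooth: "Cinf U (\<lambda>x. smx x $ i $ j)"
  unfolding smx_def s_mixed_def vec_lambda_beta
  using sm_smooth unfolding sm_def vec_lambda_beta
  by (intro Cinf_sum Cinf_mult ai_smooth openU)

lemma bu_smooth: "Cinf U (\<lambda>x. bu x $ i)"
  unfolding bu_def matrix_vector_mult_def vec_lambda_beta
  by (intro Cinf_sum Cinf_mult ai_smooth b_smooth openU)

lemma sf_eq: "sf x \<bullet> v = gin sm x (bu x) v"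
  unfolding s_form_def raise_bu gin_sum sm_def inner_vec_def
  by (simp add: sum_distrib_left sum_distrib_right mult_ac) (rule sum.swap)

lemma sf_smooth: "Cinf U (\<lambda>x. sf x $ i)"
  unfolding s_form_def raise_bu vec_lambda_beta
  using sm_smooth unfolding sm_def vec_lambda_beta
  by (intro Cinf_sum Cinf_mult bu_smooth openU)

lemma vdiffI: "(\<And>i. Cinf U (\<lambda>x. w x $ i)) \<Longrightarrow> x \<in> U \<Longrightarrow> vdiff w x"
  unfolding vdiff_def using Cinf_differentiable by blast

lemma mdiffI: "(\<And>i j. Cinf U (\<lambda>x. w x $ i $ j)) \<Longrightarrow> x \<in> U \<Longrightarrow> mdiff w x"
  unfolding mdiff_def using Cinf_differentiable by blast

lemmas b_vdiff = vdiffI[OF b_smooth] and bu_vdiff = vdiffI[OF bu_smooth] and sf_vdiff = vdiffI[OF sf_smooth]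
lemmas rm_mdiff = mdiffI[OF rm_smooth] and sm_mdiff = mdiffI[OF sm_smooth] and smx_mdiff = mdiffI[OF smx_smooth]

lemma gin_bu: "x \<in> U \<Longrightarrow> gin a x v (bu x) = b x \<bullet> v"
  unfolding bu_def by (simp add: gin_ai inner_commute)

lemma gin_bu': "x \<in> U \<Longrightarrow> gin a x (bu x) v = b x \<bullet> v"
  unfolding bu_def by (simp add: gin_ai')

lemma b_bu: "x \<in> U \<Longrightarrow> b x \<bullet> bu x = 1"
  unfolding bu_def by (rule b_unit)

lemma gin_smx: "x \<in> U \<Longrightarrow> gin a x v (smx x *v w) = gin sm x v w"
proof -
  assume x: "x \<in> U"
  have "smx x *v w = matrix_inv (a x) *v (sm x *v w)"
    unfolding matrix_vector_mul_assoc smx_def sm_def s_mixed_def by (simp add: matrix_matrix_mult_def)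
  then show ?thesis using gin_ai[OF x] by (simp add: gin_def)
qed

lemma gin_smx': "x \<in> U \<Longrightarrow> gin a x (smx x *v w) v = gin sm x v w"
  using gin_smx gin_sym by metis

lemma b_smx: "x \<in> U \<Longrightarrow> b x \<bullet> (smx x *v v) = sf x \<bullet> v"
  by (metis gin_bu' gin_smx sf_eq)

lemma sm_skew: "gin sm x v w = - gin sm x w v"
proof -
  have e: "sm x $ i $ j = - sm x $ j $ i" for i j by (simp add: sm_def s_tensor_def field_simps)
  have "sm x $ i $ j * v $ i * w $ j = - (sm x $ j $ i * w $ j * v $ i)" for i j
    by (subst e) simp
  then show ?thesis unfolding gin_sum by (subst sum.swap) (simp add: sum_negf)
qed

lemma sm_diag [simp]: "gin sm x v v = 0"
  using sm_skew[of x v v] by simp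

lemma rm_sym: "gin rm x v w = gin rm x w v"
proof -
  have e: "rm x $ i $ j = rm x $ j $ i" for i j by (simp add: rm_def r_tensor_def add.commute)
  have f: "rm x $ i $ j * v $ i * w $ j = rm x $ j $ i * w $ j * v $ i" for i j
    by (subst e) simp
  show ?thesis unfolding gin_sum by (subst sum.swap, intro sum.cong refl, rule f)
qed

lemma covf_b:
  assumes "x \<in> U"
  shows "covf a b x v u = gin rm x v u + gin sm x v u"
  unfolding covf_covd[OF b_vdiff[OF assms]] gin_sum rm_def sm_def r_tensor_def s_tensor_def
  by (simp add: sum.distrib[symmetric] algebra_simps)

text \<open>Differentiating the constant b_i b^i = 1 gives two terms. Lowering the index of b^i
  shows that they are equal, so each of them vanishes.\<close>

lemma covf_bu:
  assumes x: "x \<in> U"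
  shows "covf a b x (bu x) u = 0"
proof -
  let ?p = "(x, 0 :: real ^ 'n)"
  let ?v = "\<lambda>p::(real ^ 'n) \<times> (real ^ 'n). bu (fst p)"
  have p: "fst ?p \<in> U" "?p \<in> TU" using x by auto
  have v: "vdiff ?v ?p" using vdiff_fst[of bu ?p] bu_vdiff x by simp
  have w: "vdiff b (fst ?p)" using b_vdiff x by simp
  have "dd (hor a ?p u) (\<lambda>p. b (fst p) \<bullet> ?v p) ?p = dd (hor a ?p u) (\<lambda>p. 1) ?p"
    by (rule dd_transform[OF openTU p(2)]) (auto simp: b_bu)
  then have 1: "covf a b x (bu x) u + b x \<bullet> cov a u ?v ?p = 0"
    using dd_hor_inner[OF w v p(1), of u] by simp
  have "dd (hor a ?p u) (\<lambda>p. gin a (fst p) (bu (fst p)) (bu x)) ?p = dd (hor a ?p u) (\<lambda>p. b (fst p) \<bullet> bu x) ?p"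
    by (rule dd_transform[OF openTU p(2)]) (auto simp: gin_bu')
  then have "gin a x (cov a u ?v ?p) (bu x) + gin a x (bu x) (Gam a x u (bu x)) = covf a b x (bu x) u + b x \<bullet> Gam a x u (bu x)"
    using dd_hor_gin[OF p(1) v vdiff_const, of u "bu x"] dd_hor_inner[OF w vdiff_const p(1), of u "bu x"] by simp
  then show ?thesis using 1 x by (simp add: gin_bu gin_bu')
qed

text \<open>This is the gain from unit length: the components of r in the direction of b are no new
  unknowns but those of -s.\<close>

lemma r_bu: "x \<in> U \<Longrightarrow> gin rm x (bu x) v = - (sf x \<bullet> v)"
  using covf_bu[of x v] covf_b[of x "bu x" v] by (simp add: sf_eq)

lemma r_bu': "x \<in> U \<Longrightarrow> gin rm x v (bu x) = - (sf x \<bullet> v)"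
  using r_bu rm_sym by metis

lemma sf_bu [simp]: "sf x \<bullet> bu x = 0"
  by (simp add: sf_eq)

definition be :: "(real ^ 'n) \<times> (real ^ 'n) \<Rightarrow> real" where "be p = b (fst p) \<bullet> snd p"
definition s0 :: "(real ^ 'n) \<times> (real ^ 'n) \<Rightarrow> real" where "s0 p = sf (fst p) \<bullet> snd p"
definition r00 :: "(real ^ 'n) \<times> (real ^ 'n) \<Rightarrow> real" where "r00 p = gin rm (fst p) (snd p) (snd p)"
definition al :: "(real ^ 'n) \<times> (real ^ 'n) \<Rightarrow> real" where "al p = sqrt (Af p)"
definition sy :: "(real ^ 'n) \<times> (real ^ 'n) \<Rightarrow> real ^ 'n" where "sy p = smx (fst p) *v snd p"
definition W :: "((real ^ 'n) \<times> (real ^ 'n)) set" where "W = {p \<in> TU. Af p - be p ^ 2 \<noteq> 0}"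

lemma be_smooth: "Cinf TU be" and s0_smooth: "Cinf TU s0" and r00_smooth: "Cinf TU r00" and sy_smooth: "Cinf TU (\<lambda>p. sy p $ i)"
  unfolding be_def[abs_def] s0_def[abs_def] r00_def[abs_def] sy_def matrix_vector_mult_def vec_lambda_beta
     apply (intro Cinf_inner_snd openTU Cinf_fst b_smooth)
    apply (intro Cinf_inner_snd openTU Cinf_fst sf_smooth)
   apply (unfold gin_sum, intro Cinf_sum Cinf_mult openTU Cinf_fst rm_smooth Cinf_snd_nth)
  by (intro Cinf_sum Cinf_mult openTU Cinf_fst smx_smooth Cinf_snd_nth)

lemma W_TU: "W \<subseteq> TU" and W_U: "p \<in> W \<Longrightarrow> fst p \<in> U"
  unfolding W_def by auto

lemma open_W: "open W"
proof -
  have "continuous_on TU (\<lambda>p. Af p - be p ^ 2)"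
    by (intro Cinf_continuous Cinf_diff Cinf_power openTU Af_smooth be_smooth)
  then have "open ((\<lambda>p. Af p - be p ^ 2) -` (- {0}) \<inter> TU)"
    using continuous_on_open_vimage[OF openTU] by blast
  moreover have "(\<lambda>p. Af p - be p ^ 2) -` (- {0}) \<inter> TU = W" unfolding W_def by auto
  ultimately show ?thesis by simp
qed

text \<open>The difference \<alpha>^2 - \<beta>^2 is the squared length of the part of
  \<open>y\<close> orthogonal to b. Hence \<open>W\<close> consists of the \<open>y\<close> that are
  not multiples of b, and there \<alpha> exceeds the absolute value of \<beta>.\<close>

lemma Af_perp:
  assumes "fst p \<in> U"
  shows "Af p - be p ^ 2 = gin a (fst p) (snd p - be p *\<^sub>R bu (fst p)) (snd p - be p *\<^sub>R bu (fst p))"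
  using assms by (simp add: gin_simps gin_bu gin_bu' b_bu Af_def be_def power2_eq_square algebra_simps)

lemma W_pos:
  assumes "p \<in> W"
  shows "al p > 0" "al p - be p > 0" "al p + be p > 0" "Af p > 0" "Af p = al p ^ 2" "Af p - be p ^ 2 > 0"
proof -
  have p: "fst p \<in> U" using W_U assms .
  have "Af p - be p ^ 2 \<ge> 0" unfolding Af_perp[OF p] by (rule gin_nonneg[OF p])
  then show D: "Af p - be p ^ 2 > 0" using assms unfolding W_def by auto
  then show A: "Af p > 0" by (smt (verit) zero_le_power2)
  then show "al p > 0" unfolding al_def by simp
  show A2: "Af p = al p ^ 2" using A unfolding al_def by simp
  have "\<bar>be p\<bar> < al p"
    by (rule power2_less_imp_less) (use D A2 \<open>al p > 0\<close> in auto)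
  then show "al p - be p > 0" "al p + be p > 0" by auto
qed

lemma al_smooth: "Cinf W al"
  unfolding al_def[abs_def] using W_pos(4)
  by (intro Cinf_sqrt open_W Cinf_subset[OF Af_smooth W_TU])

lemmas be_smooth_W = Cinf_subset[OF be_smooth W_TU] and s0_smooth_W = Cinf_subset[OF s0_smooth W_TU]
  and r00_smooth_W = Cinf_subset[OF r00_smooth W_TU] and Af_smooth_W = Cinf_subset[OF Af_smooth W_TU]
  and sy_smooth_W = Cinf_subset[OF sy_smooth W_TU] and bu_smooth_W = Cinf_subset[OF Cinf_fst[OF bu_smooth] W_TU]

lemmas al_D = dd_DERIV[OF Cinf_differentiable[OF al_smooth]] and be_D = dd_DERIV[OF Cinf_differentiable[OF be_smooth_W]]
  and s0_D = dd_DERIV[OF Cinf_differentiable[OF s0_smooth_W]] and r00_D = dd_DERIV[OF Cinf_differentiable[OF r00_smooth_W]]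

lemma dd_al: "p \<in> W \<Longrightarrow> dd v al p = dd v Af p / (2 * al p)"
  unfolding al_def[abs_def] using W_pos(4)[of p] dd_sqrt[OF Cinf_differentiable[OF Af_smooth_W]]
  by (simp add: field_simps)

lemma dd_ver_al: "p \<in> W \<Longrightarrow> dd (0, u) al p = gin a (fst p) (snd p) u / al p"
  by (simp add: dd_al dd_ver_Af W_U)

lemma dd_hor_al: "p \<in> W \<Longrightarrow> dd (hor a p u) al p = 0"
  by (simp add: dd_al dd_hor_Af W_U)

lemma dd_ver_inner: "fst p \<in> U \<Longrightarrow> vdiff w (fst p) \<Longrightarrow> dd (0, u) (\<lambda>p. w (fst p) \<bullet> snd p) p = w (fst p) \<bullet> u"
  using dd_inner[OF vdiff_fst[of w p] vdiff_snd, of "(0, u)"] vdd_fst[of w p "(0, u)"] linear_0[OF vdd_linear[of w "fst p"]]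
  by simp

lemma dd_ver_be: "fst p \<in> U \<Longrightarrow> dd (0, u) be p = b (fst p) \<bullet> u"
  unfolding be_def[abs_def] by (rule dd_ver_inner[OF _ b_vdiff])

lemma dd_ver_s0: "fst p \<in> U \<Longrightarrow> dd (0, u) s0 p = sf (fst p) \<bullet> u"
  unfolding s0_def[abs_def] by (rule dd_ver_inner[OF _ sf_vdiff])

lemma dd_ver_gin_fst:
  assumes "fst p \<in> U" "mdiff N (fst p)"
  shows "dd (0, u) (\<lambda>p. gin N (fst p) (snd p) (snd p)) p = gin N (fst p) u (snd p) + gin N (fst p) (snd p) u"
  using dd_gin[OF mdiff_fst[of N p] vdiff_snd vdiff_snd, of "(0, u)"] mdd_fst[of N p "(0, u)"] linear_0[OF mdd_linear[of N "fst p"]] assms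
  by (simp add: gin_def)

lemma dd_ver_r00: "fst p \<in> U \<Longrightarrow> dd (0, u) r00 p = 2 * gin rm (fst p) (snd p) u"
  unfolding r00_def[abs_def] using dd_ver_gin_fst[OF _ rm_mdiff] rm_sym[of "fst p" u "snd p"] by simp

lemma dd_hor_be: "fst p \<in> U \<Longrightarrow> dd (hor a p u) be p = gin rm (fst p) (snd p) u + gin sm (fst p) (snd p) u"
  unfolding be_def[abs_def] using dd_hor_inner[OF b_vdiff vdiff_snd, of p u] by (simp add: covf_b)

lemma dd_hor_s0: "fst p \<in> U \<Longrightarrow> dd (hor a p u) s0 p = covf a sf (fst p) (snd p) u"
  unfolding s0_def[abs_def] using dd_hor_inner[OF sf_vdiff vdiff_snd, of p u] by simp

definition Er :: "(real ^ 'n) \<times> (real ^ 'n) \<Rightarrow> real" where "Er p = (al p + be p) ^ 4 / (al p) ^ 2"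
definition c1 :: "(real ^ 'n) \<times> (real ^ 'n) \<Rightarrow> real" where "c1 p = 2 * (al p + be p) ^ 3 * (al p - be p) / al p ^ 4"
definition c2 :: "(real ^ 'n) \<times> (real ^ 'n) \<Rightarrow> real" where "c2 p = 4 * (al p + be p) ^ 3 / al p ^ 2"

lemma Er_smooth: "Cinf W Er" and c1_smooth: "Cinf W c1" and c2_smooth: "Cinf W c2"
  unfolding Er_def[abs_def] c1_def[abs_def] c2_def[abs_def]
  using W_pos(1)
  by (intro Cinf_divide Cinf_mult Cinf_power Cinf_add Cinf_diff Cinf_const open_W al_smooth be_smooth_W; force)+

lemma dd_Er: "p \<in> W \<Longrightarrow> dd v Er p = c1 p * (al p * dd v al p) + c2 p * dd v be p"
  unfolding Er_def[abs_def] c1_def c2_def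
  using DERIV_Er[OF al_D be_D, of p p v v] W_pos(1)[of p] by (intro dd_eqI) simp

lemma dd_c1: "p \<in> W \<Longrightarrow> dd v c1 p = 4 * (al p + be p) ^ 2 / al p ^ 5 *
    (be p * (2 * be p - al p) * dd v al p + al p * (al p - 2 * be p) * dd v be p)"
  unfolding c1_def[abs_def]
  using DERIV_c1[OF al_D be_D, of p p v v] W_pos(1)[of p] by (intro dd_eqI) simp

lemma dd_c2: "p \<in> W \<Longrightarrow> dd v c2 p = 4 * (al p + be p) ^ 2 / al p ^ 3 *
    ((al p - 2 * be p) * dd v al p + 3 * al p * dd v be p)"
  unfolding c2_def[abs_def]
  using DERIV_c2[OF al_D be_D, of p p v v] W_pos(1)[of p] by (intro dd_eqI) simp

lemma dd_ver_Er: "p \<in> W \<Longrightarrow> dd (0, w) Er p = c1 p * gin a (fst p) (snd p) w + c2 p * (b (fst p) \<bullet> w)"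
  using W_pos(1)[of p] by (simp add: dd_Er dd_ver_al dd_ver_be W_U)

lemma dd_dd_Er:
  assumes p: "p \<in> W"
  shows "dd v (dd (0, w) Er) p = dd v c1 p * gin a (fst p) (snd p) w + c1 p * dd v (\<lambda>p. gin a (fst p) (snd p) w) p
     + dd v c2 p * (b (fst p) \<bullet> w) + c2 p * dd v (\<lambda>p. b (fst p) \<bullet> w) p"
proof -
  have "dd v (dd (0, w) Er) p = dd v (\<lambda>p. c1 p * gin a (fst p) (snd p) w + c2 p * (b (fst p) \<bullet> w)) p"
    by (rule dd_transform[OF open_W p]) (simp add: dd_ver_Er)
  moreover have "(\<lambda>p. gin a (fst p) (snd p) w) differentiable (at p)"
    using Cinf_differentiable[OF gin_snd_smooth] W_TU p by blast
  moreover have "(\<lambda>p. b (fst p) \<bullet> w) differentiable (at p)"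
    by (intro diff_inner vdiff_fst b_vdiff W_U[OF p] vdiff_const)
  ultimately show ?thesis
    using Cinf_differentiable[OF c1_smooth p] Cinf_differentiable[OF c2_smooth p]
    by (simp add: dd_add dd_mult)
qed

text \<open>The factor \<open>lam\<close> is the ratio \<open>c2 / c1\<close>, which is what
  balances the terms with s in the Euler-Lagrange equations. Then \<open>chi\<close> is the solution
  of the one scalar equation that remains.\<close>

definition lam :: "(real ^ 'n) \<times> (real ^ 'n) \<Rightarrow> real" where "lam p = 2 * al p ^ 2 / (al p - be p)"
definition chi :: "(real ^ 'n) \<times> (real ^ 'n) \<Rightarrow> real" where
  "chi p = (r00 p - 2 * lam p * s0 p) / (3 * (al p ^ 2 - be p ^ 2))"
definition psi :: "(real ^ 'n) \<times> (real ^ 'n) \<Rightarrow> real" where "psi p = al p ^ 2 * chi p"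
definition Pf :: "(real ^ 'n) \<times> (real ^ 'n) \<Rightarrow> real" where "Pf p = (al p - 2 * be p) * chi p"
text \<open>Everything in the deviation that is not a multiple of \<open>y\<close>. The multiple
  \<open>Pf\<close> of \<open>y\<close> is kept apart as the projective part treated by
  \<open>RicOp_projective\<close>.\<close>

definition Qf :: "'n \<Rightarrow> (real ^ 'n) \<times> (real ^ 'n) \<Rightarrow> real" where
  "Qf i p = lam p * sy p $ i + psi p * bu (fst p) $ i"

abbreviation "F \<equiv> singular_square a b"

lemma F_eq: "fst p \<in> U \<Longrightarrow> F (fst p) (snd p) = (al p + be p)\<^sup>2 / al p"
proof -
  assume p: "fst p \<in> U"
  have "form_norm a b (fst p) = sqrt (gin (\<lambda>x. matrix_inv (a x)) (fst p) (b (fst p)) (b (fst p)))"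
    unfolding form_norm_def gin_sum ..
  then have "form_norm a b (fst p) = 1" using b_unit[OF p] by (simp add: gin_def)
  then show ?thesis
    unfolding singular_square_def alpha_gin al_def Af_def be_def pairing_def by (simp add: inner_vec_def)
qed

end

section \<open>Nondegeneracy and spray of the singular square metric\<close>

context unit_form
begin

lemma hess_Er:
  assumes p: "p \<in> W"
  shows "dd (0, u) (dd (0, w) Er) p = 4 * (al p + be p) ^ 2 / al p ^ 5 *
       (be p * (2 * be p - al p) * (gin a (fst p) (snd p) u / al p) + al p * (al p - 2 * be p) * (b (fst p) \<bullet> u)) * gin a (fst p) (snd p) w
     + c1 p * gin a (fst p) u w
     + 4 * (al p + be p) ^ 2 / al p ^ 3 * ((al p - 2 * be p) * (gin a (fst p) (snd p) u / al p) + 3 * al p * (b (fst p) \<bullet> u)) * (b (fst p) \<bullet> w)"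
proof -
  note x = W_U[OF p]
  have "dd (0, u) (\<lambda>p. b (fst p) \<bullet> w) p = 0"
    using dd_inner[OF vdiff_fst[OF b_vdiff[OF x]] vdiff_const, of "(0, u)" w] vdd_fst[OF b_vdiff[OF x], of "(0, u)"]
      linear_0[OF vdd_linear[OF b_vdiff[OF x]]] by simp
  then show ?thesis using p x
    by (simp add: dd_dd_Er dd_c1 dd_c2 dd_ver_gin_snd dd_ver_al dd_ver_be)
qed

lemma gin_snd: "p \<in> W \<Longrightarrow> gin a (fst p) (snd p) (snd p) = al p ^ 2"
  using W_pos(5)[of p] unfolding Af_def by simp

lemma energy_F: "q \<in> W \<Longrightarrow> energy F (fst q) (snd q) = Er q"
  using W_U[of q] unfolding energy_def Er_def by (simp add: F_eq power_divide flip: power_mult)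

text \<open>The Hessian involves \<open>u\<close> only through X = a(y, u), Z = b(u) and a(u, w).
  Testing with \<open>w = y\<close> and \<open>w = bu\<close> gives two linear equations that force
  X = Z = 0; what is left is a positive multiple of a(u, w).\<close>

lemma hess_Er_kernel:
  assumes p: "p \<in> W" and h: "\<And>w. dd (0, u) (dd (0, w) Er) p = 0"
  shows "u = 0"
proof -
  let ?x = "fst p" and ?y = "snd p"
  note x = W_U[OF p] and pos = W_pos[OF p]
  let ?A = "al p" and ?B = "be p"
  have yy: "gin a ?x ?y ?y = ?A ^ 2" by (rule gin_snd[OF p])
  have by': "b ?x \<bullet> ?y = ?B" by (simp add: be_def)
  define X where "X = gin a ?x ?y u"
  define Z where "Z = b ?x \<bullet> u"
  have H: "(?B * (2 * ?B - ?A) * X + ?A\<^sup>2 * (?A - 2 * ?B) * Z) * gin a ?x ?y w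
      + (?A + ?B) * (?A - ?B) * ?A\<^sup>2 / 2 * gin a ?x u w
      + ?A\<^sup>2 * ((?A - 2 * ?B) * X + 3 * ?A\<^sup>2 * Z) * (b ?x \<bullet> w) = 0" (is "?H w = 0") for w
  proof -
    have "dd (0, u) (dd (0, w) Er) p = 4 * (?A + ?B)\<^sup>2 / ?A ^ 6 * ?H w"
      unfolding hess_Er[OF p] X_def[symmetric] Z_def[symmetric] c1_def
      using pos(1) by (simp add: field_simps power_numeral_reduce)
    moreover have "4 * (?A + ?B)\<^sup>2 / ?A ^ 6 \<noteq> 0" using pos(1,3) by simp
    ultimately show ?thesis using h[of w] by (metis mult_eq_0_iff)
  qed
  have X': "gin a ?x u ?y = X" using gin_sym[OF x] X_def by simp
  have "?A\<^sup>2 * (?A + ?B) * ((?A - ?B) * X + 2 * ?A\<^sup>2 * Z) = 0"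
    using H[of ?y] unfolding yy by' X' by algebra
  then have e2: "(?A - ?B) * X + 2 * ?A\<^sup>2 * Z = 0" using pos by simp
  have e3: "(?B * (2 * ?B - ?A) * X + ?A\<^sup>2 * (?A - 2 * ?B) * Z) * ?B
      + (?A + ?B) * (?A - ?B) * ?A\<^sup>2 / 2 * Z
      + ?A\<^sup>2 * ((?A - 2 * ?B) * X + 3 * ?A\<^sup>2 * Z) = 0"
    using H[of "bu ?x"] unfolding gin_bu[OF x] b_bu[OF x] by' Z_def[symmetric] by simp
  \<comment> \<open>Elimination of \<open>Z\<close> between the two equations. The factor of
    \<open>X\<close> that remains is a product of \<alpha> - \<beta> and powers of \<alpha> +
    \<beta>, hence positive on \<open>W\<close>.\<close>
  have "3 * (X * ((?A - ?B) * (?A + ?B) * (?A + ?B)))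
    = (2 * (?A - 2 * ?B) * ?B + (?A\<^sup>2 - ?B\<^sup>2) + 6 * ?A\<^sup>2) * ((?A - ?B) * X + 2 * ?A\<^sup>2 * Z)
      - 4 * ((?B * (2 * ?B - ?A) * X + ?A\<^sup>2 * (?A - 2 * ?B) * Z) * ?B
      + (?A + ?B) * (?A - ?B) * ?A\<^sup>2 / 2 * Z + ?A\<^sup>2 * ((?A - 2 * ?B) * X + 3 * ?A\<^sup>2 * Z))"
    by (simp add: field_simps power2_eq_square)
  then have "X * ((?A - ?B) * (?A + ?B) * (?A + ?B)) = 0" unfolding e2 e3 by simp
  then have X0: "X = 0" using pos by simp
  then have Z0: "Z = 0" using e2 pos by simp
  have "gin a ?x u u = 0" using H[of u] pos unfolding X0 Z0 by simp
  then show "u = 0" using gin_eq_0_iff[OF x] by simp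
qed

text \<open>The Einstein condition is imposed at nondegenerate points only; this makes it available
  on all of \<open>W\<close>.\<close>

lemma nondegenerate_W:
  assumes p: "p \<in> W"
  shows "nondegenerate_at F (fst p) (snd p)"
proof -
  have "(fst p, snd p) \<in> W" using p by simp
  then have "invertible (fundamental_tensor F (fst p) (snd p))"
    by (rule fundamental_tensor_invertible[OF open_W _ Er_smooth energy_F]) (use hess_Er_kernel[OF p] in auto)
  moreover have "snd p \<noteq> 0"
    using W_pos(4)[OF p] unfolding Af_def by (auto simp: gin_simps)
  ultimately show ?thesis unfolding nondegenerate_at_def by blast
qed

text \<open>Both sides of the Euler-Lagrange equations are combinations of a(y, w), b(w) and s(w,
  y). The last coefficient determines \<lambda>. The first two look like separate conditions on
  \<chi>, but with the explicit energy they amount to the same equation \<open>ch\<close>, as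
  \<open>k1\<close> and \<open>k2\<close> show.\<close>

lemma spray_F:
  assumes p: "p \<in> W"
  shows "spray F i (fst p) (snd p) = G0 i p + (Qf i p + Pf p * snd p $ i)"
proof -
  let ?x = "fst p" and ?y = "snd p"
  note x = W_U[OF p] and pos = W_pos[OF p]
  let ?A = "al p" and ?B = "be p" and ?z = "s0 p" and ?r = "r00 p" and ?l = "lam p" and ?c = "chi p"
  define v where "v = ?l *\<^sub>R sy p + ?c *\<^sub>R (?A ^ 2 *\<^sub>R bu ?x + (?A - 2 * ?B) *\<^sub>R ?y)"
  have yy: "gin a ?x ?y ?y = ?A ^ 2" by (rule gin_snd[OF p])
  have by': "b ?x \<bullet> ?y = ?B" by (simp add: be_def)
  note hess = hess_Er[OF p]
  have "spray F i ?x ?y = G0 i p + v $ i"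
  proof (rule spray_eq_hor[OF open_W p W_TU Er_smooth energy_F hess_Er_kernel[OF p]])
    show "dd (hor a p ?y) (dd (0, w) Er) p - dd (hor a p w) Er p - dd (0, Gam a ?x w ?y) Er p
        = 2 * dd (0, v) (dd (0, w) Er) p" for w
    proof -
      let ?sw = "gin sm ?x w ?y"
      define X where "X = gin a ?x ?y w"
      define Z where "Z = b ?x \<bullet> w"
      have "dd (hor a p ?y) (\<lambda>p. b (fst p) \<bullet> w) p = covf a b ?x w ?y + b ?x \<bullet> Gam a ?x ?y w"
        using dd_hor_inner[OF b_vdiff[OF x] vdiff_const x, of ?y w] by simp
      then have L1: "dd (hor a p ?y) (dd (0, w) Er) p = dd (hor a p ?y) c1 p * X + c1 p * gin a ?x ?y (Gam a ?x ?y w)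
          + dd (hor a p ?y) c2 p * Z + c2 p * (gin rm ?x w ?y + ?sw + b ?x \<bullet> Gam a ?x ?y w)"
        unfolding dd_dd_Er[OF p] dd_hor_gin_snd[OF x] X_def Z_def by (simp add: covf_b[OF x])
      have L2: "dd (hor a p w) Er p = c2 p * (gin rm ?x w ?y - ?sw)"
        unfolding dd_Er[OF p] dd_hor_al[OF p] dd_hor_be[OF x] rm_sym[of ?x ?y w] sm_skew[of ?x ?y w] by simp
      have L3: "dd (0, Gam a ?x w ?y) Er p = c1 p * gin a ?x ?y (Gam a ?x ?y w) + c2 p * (b ?x \<bullet> Gam a ?x ?y w)"
        unfolding dd_ver_Er[OF p] Gam_sym[OF x, of w ?y] ..
      have dB: "dd (hor a p ?y) be p = ?r" unfolding dd_hor_be[OF x] r00_def by simp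
      have L4: "dd (hor a p ?y) c1 p = 4 * (?A + ?B) ^ 2 / ?A ^ 5 * (?A * (?A - 2 * ?B) * ?r)"
        unfolding dd_c1[OF p] dd_hor_al[OF p] dB by simp
      have L5: "dd (hor a p ?y) c2 p = 4 * (?A + ?B) ^ 2 / ?A ^ 3 * (3 * ?A * ?r)"
        unfolding dd_c2[OF p] dd_hor_al[OF p] dB by simp
      have L: "dd (hor a p ?y) (dd (0, w) Er) p - dd (hor a p w) Er p - dd (0, Gam a ?x w ?y) Er p
        = dd (hor a p ?y) c1 p * X + dd (hor a p ?y) c2 p * Z + c2 p * (2 * ?sw)"
        unfolding L1 L2 L3 by algebra
      have S1: "gin a ?x ?y (sy p) = 0" unfolding sy_def by (simp add: gin_smx[OF x])
      have S2: "b ?x \<bullet> sy p = ?z" unfolding sy_def s0_def by (rule b_smx[OF x])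
      have S3: "gin a ?x (sy p) w = ?sw" unfolding sy_def by (simp add: gin_smx'[OF x])
      have v1: "gin a ?x ?y v = ?c * ?A\<^sup>2 * (?A - ?B)"
        unfolding v_def by (simp add: gin_simps S1 gin_bu[OF x] by' yy power2_eq_square algebra_simps)
      have v2: "b ?x \<bullet> v = ?l * ?z + ?c * (?A\<^sup>2 + (?A - 2 * ?B) * ?B)"
        unfolding v_def by (simp add: inner_add_right S2 b_bu[OF x] by')
      have v3: "gin a ?x v w = ?l * ?sw + ?c * (?A\<^sup>2 * Z + (?A - 2 * ?B) * X)"
        unfolding v_def by (simp add: gin_simps S3 gin_bu'[OF x] X_def Z_def)
      have lm: "?l * (?A - ?B) = 2 * ?A\<^sup>2" unfolding lam_def using pos(2) by simp
      have ch: "?r = 3 * (?A\<^sup>2 - ?B\<^sup>2) * ?c + 2 * ?l * ?z"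
        unfolding chi_def using pos(5,6) by simp
      \<comment> \<open>The comparison of the coefficients of s(w, y), and the reason for the value
        of \<open>lam\<close>.\<close>
      have cc: "c1 p * ?l = c2 p" unfolding c1_def c2_def lam_def using pos by (simp add: divide_simps)
      have k1: "?r * (?A * (?A - 2 * ?B)) = 2 * (?B * (2 * ?B - ?A) * (?c * ?A * (?A - ?B)) + ?A * (?A - 2 * ?B) * (?l * ?z + ?c * (?A\<^sup>2 + (?A - 2 * ?B) * ?B)))
          + (?A + ?B) * (?A - ?B) * ?c * (?A - 2 * ?B) * ?A"
        unfolding ch by (simp add: algebra_simps power2_eq_square)
      have k2: "?r * (3 * ?A) = 2 * ((?A - 2 * ?B) * (?c * ?A * (?A - ?B)) + 3 * ?A * (?l * ?z + ?c * (?A\<^sup>2 + (?A - 2 * ?B) * ?B)))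
          + (?A + ?B) * (?A - ?B) * ?c * ?A"
        unfolding ch by (simp add: algebra_simps power2_eq_square)
      have q: "?c * ?A\<^sup>2 * (?A - ?B) / ?A = ?c * ?A * (?A - ?B)" using pos(1) by (simp add: power2_eq_square)
      define m where "m = 4 * (?A + ?B) ^ 2 / ?A ^ 5"
      have m3: "4 * (?A + ?B) ^ 2 / ?A ^ 3 = m * ?A\<^sup>2" unfolding m_def using pos(1) by (simp add: divide_simps power_numeral_reduce)
      have m1: "c1 p = m * ((?A + ?B) * (?A - ?B) * ?A) / 2" unfolding m_def c1_def using pos(1) by (simp add: divide_simps power_numeral_reduce)
      have "dd (hor a p ?y) (dd (0, w) Er) p - dd (hor a p w) Er p - dd (0, Gam a ?x w ?y) Er p
        = m * X * (?r * (?A * (?A - 2 * ?B))) + m * ?A\<^sup>2 * Z * (?r * (3 * ?A)) + c1 p * ?l * (2 * ?sw)"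
        unfolding L L4 L5 cc m3 m_def[symmetric] by (simp add: algebra_simps power2_eq_square)
      also have "\<dots> = 2 * dd (0, v) (dd (0, w) Er) p"
        unfolding hess v1 v2 v3 k1 k2 q m3 m_def[symmetric] X_def[symmetric] Z_def[symmetric] m1 by (simp add: field_simps power2_eq_square)
      finally show ?thesis .
    qed
  qed
  also have "v $ i = Qf i p + Pf p * snd p $ i"
    unfolding v_def Qf_def Pf_def psi_def by (simp add: algebra_simps)
  finally show ?thesis .
qed

end

section \<open>Derivatives of the spray and the Ricci curvature of F\<close>

context unit_form
begin

lemma quotient_rule_split:
  fixes D :: real
  shows "D \<noteq> 0 \<Longrightarrow> (d * (3 * D) - n * (3 * e)) / ((3 * D) * (3 * D)) = d / (3 * D) - n / (3 * D) * e / D"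
  by (simp add: field_simps)

lemma quotient_cancel:
  fixes D :: real
  shows "D \<noteq> 0 \<Longrightarrow> 2 * (c * (3 * D)) / (3 * D) - c * (2 * D) / D = 0"
  by simp

lemma dd_lam:
  assumes p: "p \<in> W"
  shows "dd v lam p = 2 * al p * (al p - 2 * be p) / (al p - be p)\<^sup>2 * dd v al p
    + 2 * al p ^ 2 / (al p - be p)\<^sup>2 * dd v be p"
proof -
  let ?A = "al p" and ?B = "be p"
  have nz: "?A - ?B \<noteq> 0" using W_pos(2)[OF p] by simp
  have "dd v lam p = (4 * ?A * dd v al p * (?A - ?B) - 2 * ?A ^ 2 * (dd v al p - dd v be p)) / ((?A - ?B) * (?A - ?B))"
    unfolding lam_def[abs_def]
    by (rule dd_eqI) (use nz in \<open>auto intro!: derivative_eq_intros al_D be_D p\<close>)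
  also have "\<dots> = 2 * ?A * (?A - 2 * ?B) / (?A - ?B)\<^sup>2 * dd v al p + 2 * ?A ^ 2 / (?A - ?B)\<^sup>2 * dd v be p"
    using nz by (simp add: divide_simps) (simp add: algebra_simps power2_eq_square)
  finally show ?thesis .
qed

lemma lam_smooth: "Cinf W lam"
  unfolding lam_def[abs_def] using W_pos(2)
  by (intro Cinf_divide Cinf_mult Cinf_power Cinf_diff Cinf_const open_W al_smooth be_smooth_W; force)

lemma chi_smooth: "Cinf W chi"
  unfolding chi_def[abs_def] using W_pos(5,6)
  by (intro Cinf_divide Cinf_mult Cinf_power Cinf_diff Cinf_const open_W al_smooth be_smooth_W lam_smooth
      r00_smooth_W s0_smooth_W; force)

lemma psi_smooth: "Cinf W psi" and Pf_smooth: "Cinf W Pf" and Qf_smooth: "Cinf W (Qf i)"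
  unfolding psi_def[abs_def] Pf_def[abs_def] Qf_def[abs_def]
  by (intro Cinf_add Cinf_mult Cinf_power Cinf_diff Cinf_const open_W al_smooth be_smooth_W lam_smooth chi_smooth
      sy_smooth_W bu_smooth_W)+

lemmas lam_D = dd_DERIV[OF Cinf_differentiable[OF lam_smooth]] and chi_D = dd_DERIV[OF Cinf_differentiable[OF chi_smooth]]
  and psi_D = dd_DERIV[OF Cinf_differentiable[OF psi_smooth]]

lemma chi_den: "p \<in> W \<Longrightarrow> al p ^ 2 - be p ^ 2 \<noteq> 0"
  using W_pos(5,6)[of p] by simp

lemma dd_chi:
  assumes p: "p \<in> W"
  shows "dd v chi p = (dd v r00 p - 2 * lam p * dd v s0 p - 2 * s0 p * dd v lam p) / (3 * (al p ^ 2 - be p ^ 2))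
    - chi p * (2 * al p * dd v al p - 2 * be p * dd v be p) / (al p ^ 2 - be p ^ 2)"
proof -
  let ?D = "al p ^ 2 - be p ^ 2" and ?n = "r00 p - 2 * lam p * s0 p"
  let ?d = "dd v r00 p - 2 * lam p * dd v s0 p - 2 * s0 p * dd v lam p"
  let ?e = "2 * al p * dd v al p - 2 * be p * dd v be p"
  have nz: "?D \<noteq> 0" using chi_den[OF p] .
  have "dd v chi p = (?d * (3 * ?D) - ?n * (3 * ?e)) / ((3 * ?D) * (3 * ?D))"
    unfolding chi_def[abs_def]
    by (rule dd_eqI) (use nz in \<open>auto intro!: derivative_eq_intros al_D be_D lam_D r00_D s0_D p simp: algebra_simps\<close>)
  also have "\<dots> = ?d / (3 * ?D) - ?n / (3 * ?D) * ?e / ?D"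
    using quotient_rule_split[OF nz] .
  finally show ?thesis unfolding chi_def .
qed

lemma dd_psi: "p \<in> W \<Longrightarrow> dd v psi p = 2 * al p * dd v al p * chi p + al p ^ 2 * dd v chi p"
  unfolding psi_def[abs_def]
  by (rule dd_eqI) (auto intro!: derivative_eq_intros al_D chi_D)

lemma dd_Pf: "p \<in> W \<Longrightarrow> dd v Pf p = (dd v al p - 2 * dd v be p) * chi p + (al p - 2 * be p) * dd v chi p"
  unfolding Pf_def[abs_def]
  by (rule dd_eqI) (auto intro!: derivative_eq_intros al_D be_D chi_D)

lemma dd_ver_sy: "fst p \<in> U \<Longrightarrow> dd (0, u) (\<lambda>p. sy p $ i) p = (smx (fst p) *v u) $ i"
proof -
  assume p: "fst p \<in> U"
  have "vdd (0, u) (\<lambda>p. smx (fst p) *v snd p) p = smx (fst p) *v u"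
    using vdd_matvec[OF mdiff_fst[OF smx_mdiff[OF p]] vdiff_snd, of "(0, u)"]
      mdd_fst[OF smx_mdiff[OF p], of "(0, u)"] linear_0[OF mdd_linear[OF smx_mdiff[OF p]]] by simp
  then show ?thesis unfolding sy_def[abs_def] vdd_def by (simp add: vec_eq_iff)
qed

lemma dd_Qf:
  assumes p: "p \<in> W"
  shows "dd v (Qf i) p = dd v lam p * sy p $ i + lam p * dd v (\<lambda>p. sy p $ i) p
    + dd v psi p * bu (fst p) $ i + psi p * dd v (\<lambda>p. bu (fst p) $ i) p"
  using Cinf_differentiable[OF lam_smooth p] Cinf_differentiable[OF psi_smooth p]
    Cinf_differentiable[OF sy_smooth_W p] Cinf_differentiable[OF bu_smooth_W p]
  unfolding Qf_def[abs_def] by (simp add: dd_add dd_mult)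

lemma dd_ver_bu: "fst p \<in> U \<Longrightarrow> dd (0, u) (\<lambda>p. bu (fst p) $ i) p = 0"
  using dd_fst[OF Cinf_differentiable[OF bu_smooth], of p "(0, u)" i]
    dd_dir_zero[OF Cinf_differentiable[OF bu_smooth], of "fst p" i] by simp

lemma dd_ver_Qf: "p \<in> W \<Longrightarrow> dd (0, u) (Qf i) p = dd (0, u) lam p * sy p $ i + lam p * (smx (fst p) *v u) $ i
    + dd (0, u) psi p * bu (fst p) $ i"
  using W_U[of p] by (simp add: dd_Qf dd_ver_sy dd_ver_bu)

lemma dd_snd_al: "p \<in> W \<Longrightarrow> dd (0, snd p) al p = al p"
  using W_pos(1)[of p] by (simp add: dd_ver_al gin_snd power2_eq_square)

lemma dd_snd_be: "p \<in> W \<Longrightarrow> dd (0, snd p) be p = be p"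
  using W_U[of p] by (simp add: dd_ver_be be_def)

lemma dd_snd_lam:
  assumes p: "p \<in> W" shows "dd (0, snd p) lam p = lam p"
proof -
  let ?A = "al p" and ?d = "al p - be p"
  have "2 * ?A * (?A - 2 * be p) / ?d\<^sup>2 * ?A + 2 * ?A\<^sup>2 / ?d\<^sup>2 * be p = (2 * ?A\<^sup>2 * ?d) / ?d\<^sup>2"
    unfolding add_divide_distrib[symmetric] times_divide_eq_left
    by (rule arg_cong[of _ _ "\<lambda>u. u / ?d\<^sup>2"]) (simp add: algebra_simps power2_eq_square)
  also have "\<dots> = 2 * ?A\<^sup>2 / ?d" using W_pos(2)[OF p] by (simp add: power2_eq_square)
  finally show ?thesis unfolding dd_lam[OF p] dd_snd_al[OF p] dd_snd_be[OF p] lam_def .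
qed

lemma dd_snd_chi:
  assumes p: "p \<in> W" shows "dd (0, snd p) chi p = 0"
proof -
  have 1: "dd (0, snd p) r00 p = 2 * r00 p" "dd (0, snd p) s0 p = s0 p"
    using dd_ver_r00[OF W_U[OF p]] dd_ver_s0[OF W_U[OF p]] by (simp_all add: r00_def s0_def)
  let ?D = "al p ^ 2 - be p ^ 2"
  have nz: "?D \<noteq> 0" using chi_den[OF p] .
  have e: "chi p * (3 * ?D) = r00 p - 2 * lam p * s0 p" using nz unfolding chi_def by simp
  have n: "2 * r00 p - 2 * lam p * s0 p - 2 * s0 p * lam p = 2 * (chi p * (3 * ?D))" unfolding e by simp
  have d: "2 * al p * al p - 2 * be p * be p = 2 * ?D" by (simp add: power2_eq_square)
  show ?thesis
    unfolding dd_chi[OF p] dd_snd_al[OF p] dd_snd_be[OF p] dd_snd_lam[OF p] 1 n d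
    using quotient_cancel[OF nz] .
qed

lemma hom_Pf: "p \<in> W \<Longrightarrow> dd (0, snd p) Pf p = Pf p"
  unfolding dd_Pf dd_snd_chi dd_snd_al dd_snd_be Pf_def by simp

lemma hom_Qf: "p \<in> W \<Longrightarrow> dd (0, snd p) (Qf i) p = 2 * Qf i p"
  unfolding dd_ver_Qf dd_psi dd_snd_lam dd_snd_chi dd_snd_al Qf_def sy_def psi_def
  by (simp add: power2_eq_square algebra_simps)

lemma ricci_F_RicOp: "p \<in> W \<Longrightarrow> ricci F (fst p) (snd p) = RicOp (\<lambda>i q. G0 i q + (Qf i q + Pf q * snd q $ i)) p"
  by (rule ricci_RicOp[OF open_W])
    (auto intro!: Cinf_add Cinf_mult open_W Cinf_subset[OF G0_smooth W_TU] Qf_smooth Pf_smooth Cinf_snd_nth spray_F)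

lemma smx_trace: "x \<in> U \<Longrightarrow> (\<Sum>m\<in>UNIV. smx x $ m $ m) = 0"
proof -
  assume x: "x \<in> U"
  have e: "matrix_inv (a x) $ m $ k * sm x $ k $ m = - (matrix_inv (a x) $ k $ m * sm x $ m $ k)" for k m
    unfolding ai_sym[OF x, of m k] by (simp add: sm_def s_tensor_def field_simps)
  have "(\<Sum>m\<in>UNIV. smx x $ m $ m) = (\<Sum>m\<in>UNIV. \<Sum>k\<in>UNIV. matrix_inv (a x) $ m $ k * sm x $ k $ m)"
    unfolding smx_def s_mixed_def sm_def by simp
  moreover have "\<dots> = - (\<Sum>m\<in>UNIV. \<Sum>k\<in>UNIV. matrix_inv (a x) $ k $ m * sm x $ m $ k)"
    by (subst e) (simp add: sum_negf)
  moreover have "(\<Sum>m\<in>UNIV. \<Sum>k\<in>UNIV. matrix_inv (a x) $ k $ m * sm x $ m $ k)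
    = (\<Sum>m\<in>UNIV. \<Sum>k\<in>UNIV. matrix_inv (a x) $ m $ k * sm x $ k $ m)"
    by (rule sum.swap)
  ultimately show ?thesis by linarith
qed

lemma g_y_sy: "fst p \<in> U \<Longrightarrow> gin a (fst p) (snd p) (sy p) = 0"
  unfolding sy_def by (simp add: gin_smx)

lemma b_sy: "fst p \<in> U \<Longrightarrow> b (fst p) \<bullet> sy p = s0 p"
  unfolding sy_def s0_def by (rule b_smx)

lemma dd_sy:
  assumes p: "p \<in> W"
  shows "dd (0, sy p) al p = 0" "dd (0, sy p) be p = s0 p" "dd (0, sy p) s0 p = sf (fst p) \<bullet> sy p"
    "dd (0, sy p) r00 p = 2 * gin rm (fst p) (snd p) (sy p)"
  using W_U[OF p] by (simp_all add: dd_ver_al[OF p] g_y_sy dd_ver_be b_sy dd_ver_s0 dd_ver_r00)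

lemma dd_bu:
  assumes p: "p \<in> W"
  shows "dd (0, bu (fst p)) al p = be p / al p" "dd (0, bu (fst p)) be p = 1" "dd (0, bu (fst p)) s0 p = 0"
    "dd (0, bu (fst p)) r00 p = - 2 * s0 p"
  using W_U[OF p] by (simp_all add: dd_ver_al[OF p] gin_bu be_def dd_ver_be b_bu dd_ver_s0 dd_ver_r00 r_bu' s0_def)

text \<open>The trace of s vanishes by skewness. Of the two directional derivatives left over, the
  one of \<open>lam\<close> along s^i_0 is cancelled by the s_0 part of the one of
  \<open>psi\<close> along b, so that no s_0 survives explicitly.\<close>

lemma vdiv_Qf:
  assumes p: "p \<in> W"
  shows "vdiv Qf p = 2 * be p * chi p"
proof -
  note dl = Cinf_differentiable[OF lam_smooth p] and dp = Cinf_differentiable[OF psi_smooth p]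
  let ?A = "al p" and ?B = "be p"
  have "vdiv Qf p = (\<Sum>m\<in>UNIV. sy p $ m * dd (0, axis m 1) lam p) + lam p * (\<Sum>m\<in>UNIV. smx (fst p) $ m $ m)
     + (\<Sum>m\<in>UNIV. bu (fst p) $ m * dd (0, axis m 1) psi p)"
  proof -
    have "(smx (fst p) *v axis m 1) $ m = smx (fst p) $ m $ m" for m
      by (simp add: matrix_vector_mult_def sum_axis)
    then show ?thesis unfolding vdiv_def dd_ver_Qf[OF p] by (simp add: sum.distrib sum_distrib_left mult_ac)
  qed
  also have "\<dots> = dd (0, sy p) lam p + dd (0, bu (fst p)) psi p"
    unfolding dd_snd_axis[OF dl] dd_snd_axis[OF dp] smx_trace[OF W_U[OF p]] by simp
  also have "\<dots> = 2 * be p * chi p"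
  proof -
    have lb: "dd (0, bu (fst p)) lam p = 2 * (?A + 2 * ?B) / (?A - ?B)"
      unfolding dd_lam[OF p] dd_bu[OF p] using W_pos(1,2)[OF p] by (simp add: divide_simps) (simp add: algebra_simps power2_eq_square)
    have "dd (0, bu (fst p)) chi p = (- 2 * s0 p - 2 * s0 p * (2 * (?A + 2 * ?B) / (?A - ?B))) / (3 * (?A ^ 2 - ?B ^ 2))"
      unfolding dd_chi[OF p] lb dd_bu[OF p] using W_pos(1)[OF p] by simp
    also have "\<dots> = - 2 * s0 p / (?A - ?B)\<^sup>2"
    proof -
      have "?A ^ 2 - ?B ^ 2 = (?A - ?B) * (?A + ?B)" by algebra
      then show ?thesis using W_pos(2,3)[OF p] by (simp add: divide_simps) (simp add: algebra_simps power2_eq_square)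
    qed
    finally show ?thesis
      unfolding dd_psi[OF p] dd_lam[OF p] dd_bu[OF p] dd_sy[OF p] using W_pos(1,2)[OF p] by simp
  qed
  finally show ?thesis .
qed

lemma hor_axis_sum:
  assumes "f differentiable (at p)"
  shows "(\<Sum>m\<in>UNIV. dd (hor a p (axis m 1)) f p * v $ m) = dd (hor a p v) f p"
proof -
  note lin = dd_hor_linear[OF assms, of a]
  have "dd (hor a p v) f p = dd (hor a p (\<Sum>m\<in>UNIV. v $ m *\<^sub>R axis m 1)) f p"
    using axis_expansion[of v] by simp
  also have "\<dots> = (\<Sum>m\<in>UNIV. v $ m * dd (hor a p (axis m 1)) f p)"
    by (simp add: linear_sum[OF lin] linear_cmul[OF lin])
  finally show ?thesis by (simp add: mult.commute)
qed

text \<open>In index notation \<open>E0\<close> is s^m_{0|m} and \<open>rb\<close> is the divergence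
  b^m_{|m}. The latter does not depend on \<open>y\<close>, so \<open>rb\<close> may be evaluated at
  \<open>y = 0\<close>.\<close>

definition E0 :: "(real ^ 'n) \<times> (real ^ 'n) \<Rightarrow> real" where "E0 = hdiv (\<lambda>i p. sy p $ i)"
definition rb :: "real ^ 'n \<Rightarrow> real" where "rb x = hdiv (\<lambda>i p. bu (fst p) $ i) (x, 0)"

lemma rb_eq: "fst p \<in> U \<Longrightarrow> hdiv (\<lambda>i p. bu (fst p) $ i) p = rb (fst p)"
proof -
  assume p: "fst p \<in> U"
  have "dd v (\<lambda>p. bu (fst p) $ i) p = dd (fst v) (\<lambda>x. bu x $ i) (fst p)" for v i
    using dd_fst[OF Cinf_differentiable[OF bu_smooth p]] .
  moreover have "dd v (\<lambda>p. bu (fst p) $ i) (fst p, 0 :: real ^ 'n) = dd (fst v) (\<lambda>x. bu x $ i) (fst p)" for v i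
    using dd_fst[of "\<lambda>x. bu x $ i" "(fst p, 0 :: real ^ 'n)" v] Cinf_differentiable[OF bu_smooth p] by simp
  ultimately show ?thesis unfolding rb_def hdiv_def by (simp add: hor_def)
qed

lemma hdiv_Qf:
  assumes p: "p \<in> W"
  shows "hdiv Qf p = dd (hor a p (sy p)) lam p + lam p * E0 p + dd (hor a p (bu (fst p))) psi p + psi p * rb (fst p)"
proof -
  note dl = Cinf_differentiable[OF lam_smooth p] and dp = Cinf_differentiable[OF psi_smooth p]
  have "(\<chi> l. Qf l p) = lam p *\<^sub>R (\<chi> l. sy p $ l) + psi p *\<^sub>R (\<chi> l. bu (fst p) $ l)"
    unfolding Qf_def by (simp add: vec_eq_iff)
  then have "dd (hor a p (axis m 1)) (Qf m) p + Gam a (fst p) (axis m 1) (\<chi> l. Qf l p) $ m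
    = dd (hor a p (axis m 1)) lam p * sy p $ m
      + lam p * (dd (hor a p (axis m 1)) (\<lambda>p. sy p $ m) p + Gam a (fst p) (axis m 1) (\<chi> l. sy p $ l) $ m)
      + dd (hor a p (axis m 1)) psi p * bu (fst p) $ m
      + psi p * (dd (hor a p (axis m 1)) (\<lambda>p. bu (fst p) $ m) p + Gam a (fst p) (axis m 1) (\<chi> l. bu (fst p) $ l) $ m)" for m
    unfolding dd_Qf[OF p] by (simp add: Gam_simps algebra_simps)
  then have "hdiv Qf p = (\<Sum>m\<in>UNIV. dd (hor a p (axis m 1)) lam p * sy p $ m) + lam p * E0 p
      + (\<Sum>m\<in>UNIV. dd (hor a p (axis m 1)) psi p * bu (fst p) $ m) + psi p * rb (fst p)"
    unfolding hdiv_def[of Qf] E0_def rb_eq[OF W_U[OF p], symmetric] hdiv_def[of "\<lambda>i p. sy p $ i"] hdiv_def[of "\<lambda>i p. bu (fst p) $ i"]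
    by (simp only: sum.distrib sum_distrib_left[symmetric])
  then show ?thesis unfolding hor_axis_sum[OF dl] hor_axis_sum[OF dp] .
qed

text \<open>The squared norm s_{ij} s^{ij}; the sign makes up for the skewness of s.\<close>

definition Sg :: "real ^ 'n \<Rightarrow> real" where
  "Sg x = - (\<Sum>m\<in>UNIV. \<Sum>l\<in>UNIV. smx x $ m $ l * smx x $ l $ m)"

text \<open>The vertical Jacobian of \<open>Qf\<close> is \<open>lam\<close> times s plus two
  matrices of rank one. Each product of two of these summands has a trace that is a scalar
  contraction or a directional derivative.\<close>

lemma QQ_Qf:
  assumes p: "p \<in> W"
  shows "(\<Sum>m\<in>UNIV. \<Sum>l\<in>UNIV. dd (0, axis l 1) (Qf m) p * dd (0, axis m 1) (Qf l) p)
    = (dd (0, sy p) lam p)\<^sup>2 + (dd (0, bu (fst p)) psi p)\<^sup>2 - lam p ^ 2 * Sg (fst p)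
      + 2 * lam p * dd (0, smx (fst p) *v sy p) lam p + 2 * dd (0, bu (fst p)) lam p * dd (0, sy p) psi p
      + 2 * lam p * dd (0, smx (fst p) *v bu (fst p)) psi p"
proof -
  note dl = Cinf_differentiable[OF lam_smooth p] and dp = Cinf_differentiable[OF psi_smooth p]
  let ?l = "\<lambda>m. dd (0, axis m 1) lam p" and ?q = "\<lambda>m. dd (0, axis m 1) psi p"
    and ?S = "\<lambda>m. sy p $ m" and ?b = "\<lambda>m. bu (fst p) $ m" and ?M = "\<lambda>m l. smx (fst p) $ m $ l" and ?c = "lam p"
  have e: "dd (0, axis l 1) (Qf m) p = ?l l * ?S m + ?c * ?M m l + ?q l * ?b m" for l m
  proof -
    have "(smx (fst p) *v axis l 1) $ m = ?M m l" by (simp add: matrix_vector_mult_def sum_axis)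
    then show ?thesis unfolding dd_ver_Qf[OF p] by simp
  qed
  have s1: "(\<Sum>m\<in>UNIV. v $ m * ?l m) = dd (0, v) lam p" and s2: "(\<Sum>m\<in>UNIV. v $ m * ?q m) = dd (0, v) psi p" for v
    using dd_snd_axis[OF dl] dd_snd_axis[OF dp] by auto
  have f1: "(\<Sum>m\<in>UNIV. \<Sum>l\<in>UNIV. f l * v $ m * (g m * w $ l)) = (\<Sum>m\<in>UNIV. v $ m * g m) * (\<Sum>l\<in>UNIV. w $ l * f l)"
    for f g :: "'n \<Rightarrow> real" and v w :: "real ^ 'n"
    by (subst sum_product, intro sum.cong refl) (simp add: mult_ac)
  have f2: "(\<Sum>m\<in>UNIV. \<Sum>l\<in>UNIV. f l * v $ m * (?M l m)) = (\<Sum>l\<in>UNIV. (smx (fst p) *v v) $ l * f l)"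
    for f :: "'n \<Rightarrow> real" and v :: "real ^ 'n"
    by (subst sum.swap) (simp add: matrix_vector_mult_def sum_distrib_left sum_distrib_right mult_ac)
  have f3: "(\<Sum>m\<in>UNIV. \<Sum>l\<in>UNIV. f m * v $ l * (?M m l)) = (\<Sum>l\<in>UNIV. (smx (fst p) *v v) $ l * f l)"
    for f :: "'n \<Rightarrow> real" and v :: "real ^ 'n"
    by (simp add: matrix_vector_mult_def sum_distrib_left sum_distrib_right mult_ac)
  have "(\<Sum>m\<in>UNIV. \<Sum>l\<in>UNIV. dd (0, axis l 1) (Qf m) p * dd (0, axis m 1) (Qf l) p)
    = (\<Sum>m\<in>UNIV. \<Sum>l\<in>UNIV. ?l l * sy p $ m * (?l m * sy p $ l) + ?q l * bu (fst p) $ m * (?q m * bu (fst p) $ l)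
        + ?c ^ 2 * (?M m l * ?M l m) + ?c * (?l l * sy p $ m * ?M l m) + ?c * (?l m * sy p $ l * ?M m l)
        + ?l l * sy p $ m * (?q m * bu (fst p) $ l) + ?q l * bu (fst p) $ m * (?l m * sy p $ l)
        + ?c * (?q l * bu (fst p) $ m * ?M l m) + ?c * (?q m * bu (fst p) $ l * ?M m l))"
    unfolding e by (intro sum.cong refl) (simp add: algebra_simps power2_eq_square)
  also have "\<dots> = (dd (0, sy p) lam p) * (dd (0, sy p) lam p) + (dd (0, bu (fst p)) psi p) * (dd (0, bu (fst p)) psi p)
     + ?c ^ 2 * (- Sg (fst p)) + ?c * dd (0, smx (fst p) *v sy p) lam p + ?c * dd (0, smx (fst p) *v sy p) lam p
     + dd (0, sy p) psi p * dd (0, bu (fst p)) lam p + dd (0, bu (fst p)) lam p * dd (0, sy p) psi p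
     + ?c * dd (0, smx (fst p) *v bu (fst p)) psi p + ?c * dd (0, smx (fst p) *v bu (fst p)) psi p"
    unfolding sum.distrib sum_distrib_left[symmetric] f1 f2 f3 s1 s2 Sg_def by simp
  finally show ?thesis by (simp add: power2_eq_square)
qed

text \<open>Where s_0 = 0, \<chi> simplifies to \<open>r00 p / (3 * D)\<close>, but the derivatives
  of s_0 stay and enter as \<open>om\<close>, \<open>N\<close> and covariant derivatives of s. The
  letters \<open>la\<close>, \<open>lb\<close> are the partial derivatives of \<lambda> in \<alpha>,
  \<beta>, and \<open>ld\<close> its vertical derivative along b; \<open>cs\<close> is the vertical
  derivative of \<chi> along s^i_0, and \<open>cb\<close>, \<open>c0\<close> are its horizontal
  derivatives along b and \<open>y\<close>.\<close>

theorem ricci_F: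
  assumes p: "p \<in> W" and z: "s0 p = 0"
  defines "x \<equiv> fst p" and "y \<equiv> snd p" and "A \<equiv> al p" and "B \<equiv> be p" and "n \<equiv> real CARD('n)"
  defines "D \<equiv> A\<^sup>2 - B\<^sup>2" and "l \<equiv> 2 * A\<^sup>2 / (A - B)" and "lb \<equiv> 2 * A\<^sup>2 / (A - B)\<^sup>2"
    and "la \<equiv> 2 * A * (A - 2 * B) / (A - B)\<^sup>2" and "ld \<equiv> 2 * (A + 2 * B) / (A - B)"
  defines "c \<equiv> r00 p / (3 * D)"
    and "kap \<equiv> gin rm x y (sy p)" and "sig \<equiv> gin a x (sy p) (sy p)" and "om \<equiv> sf x \<bullet> sy p"
    and "N \<equiv> gin a x (smx x *v bu x) (smx x *v bu x)" and "rs \<equiv> gin rm x y (smx x *v bu x)"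
  defines "cs \<equiv> (2 * kap - 2 * l * om) / (3 * D)"
    and "cb \<equiv> (dd (hor a p (bu x)) r00 p - 2 * l * covf a sf x y (bu x)) / (3 * D)"
    and "c0 \<equiv> (dd (hor a p y) r00 p - 2 * l * covf a sf x y y) / (3 * D) + 2 * c * B * r00 p / D"
  shows "ricci F x y = RB x y y + 2 * (lb * (kap - sig) + l * E0 p + A\<^sup>2 * cb + A\<^sup>2 * c * rb x)
    - 2 * (r00 p * c + B * c0) + 2 * (2 * l * B * cs + 2 * A\<^sup>2 * c\<^sup>2)
    - ((2 * B * c)\<^sup>2 - l\<^sup>2 * Sg x + 2 * l * (lb * om - la * sig / A) + 2 * ld * (A\<^sup>2 * cs)
        + 2 * l * (A\<^sup>2 * ((2 * rs + 2 * l * N) / (3 * D))))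
    + (n - 1) * (((A - 2 * B) * c)\<^sup>2 - ((A - 2 * B) * c0 - 2 * r00 p * c)
        + 2 * (l * ((A - 2 * B) * cs) + A\<^sup>2 * c * ((B / A - 2) * c)))"
proof -
  note x = W_U[OF p] and pos = W_pos[OF p]
  note abbr = x_def[symmetric] y_def[symmetric] A_def[symmetric] B_def[symmetric] n_def[symmetric]
  have xU: "x \<in> U" using x unfolding x_def .
  have l: "lam p = l" unfolding lam_def l_def A_def B_def ..
  have c: "chi p = c" unfolding chi_def c_def D_def A_def B_def z by simp
  have Dnz: "D \<noteq> 0" using chi_den[OF p] unfolding D_def A_def B_def .
  have Anz: "A \<noteq> 0" "A - B \<noteq> 0" using pos unfolding A_def B_def by auto
  have dlam: "dd v lam p = la * dd v al p + lb * dd v be p" for v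
    unfolding dd_lam[OF p] la_def lb_def A_def B_def ..
  have dchi: "dd v chi p = (dd v r00 p - 2 * l * dd v s0 p) / (3 * D) - c * (2 * A * dd v al p - 2 * B * dd v be p) / D" for v
    unfolding dd_chi[OF p] z l c D_def A_def B_def by simp
  have dpsi: "dd v psi p = 2 * A * dd v al p * c + A\<^sup>2 * dd v chi p" for v
    unfolding dd_psi[OF p] c A_def ..
  have dP: "dd v Pf p = (dd v al p - 2 * dd v be p) * c + (A - 2 * B) * dd v chi p" for v
    unfolding dd_Pf[OF p] c A_def B_def ..
  have dv: "dd v (vdiv Qf) p = 2 * (dd v be p * c + B * dd v chi p)" for v
  proof -
    have "dd v (vdiv Qf) p = dd v (\<lambda>p. 2 * (be p * chi p)) p"
      by (rule dd_transform[OF open_W p]) (simp add: vdiv_Qf)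
    also have "\<dots> = 2 * (dd v be p * c + B * dd v chi p)"
      by (rule dd_eqI) (auto intro!: derivative_eq_intros be_D chi_D p simp: c B_def)
    finally show ?thesis .
  qed
  note S = dd_sy[OF p, unfolded z, folded kap_def om_def, folded x_def y_def, folded kap_def om_def]
  note bb = dd_bu[OF p, unfolded z, folded x_def A_def B_def]
  have cS: "dd (0, sy p) chi p = cs" unfolding dchi S cs_def by simp
  have cB: "dd (0, bu x) chi p = 0" unfolding dchi bb using Anz by simp
  have hS: "dd (hor a p (sy p)) al p = 0" "dd (hor a p (sy p)) be p = kap - sig"
    unfolding dd_hor_al[OF p] dd_hor_be[OF x] abbr kap_def sig_def
    using sm_skew[of x y "sy p"] gin_smx[OF xU, of "sy p" y] unfolding sy_def abbr by simp_all
  have hb: "dd (hor a p (bu x)) al p = 0" "dd (hor a p (bu x)) be p = 0" "dd (hor a p (bu x)) s0 p = covf a sf x y (bu x)"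
    unfolding dd_hor_al[OF p] dd_hor_be[OF x] dd_hor_s0[OF x] abbr
    using sm_skew[of x y "bu x"] r_bu'[OF xU, of y] sf_eq[of x y] z unfolding s0_def abbr by simp_all
  have hy: "dd (hor a p y) al p = 0" "dd (hor a p y) be p = r00 p" "dd (hor a p y) s0 p = covf a sf x y y"
    unfolding dd_hor_al[OF p] dd_hor_be[OF x] dd_hor_s0[OF x] r00_def abbr by simp_all
  have chb: "dd (hor a p (bu x)) chi p = cb" unfolding dchi hb cb_def by simp
  have chy: "dd (hor a p y) chi p = c0" unfolding dchi hy c0_def by simp
  have vSS: "dd (0, smx x *v sy p) al p = - sig / A" "dd (0, smx x *v sy p) be p = om"
    unfolding dd_ver_al[OF p] dd_ver_be[OF x] abbr b_smx[OF xU] om_def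
    using gin_smx[OF xU, of y "sy p"] sm_skew[of x y "sy p"] gin_smx[OF xU, of "sy p" y]
    unfolding sig_def sy_def abbr by simp_all
  have vSb: "dd (0, smx x *v bu x) al p = 0" "dd (0, smx x *v bu x) be p = 0"
     "dd (0, smx x *v bu x) s0 p = - N" "dd (0, smx x *v bu x) r00 p = 2 * rs"
    unfolding dd_ver_al[OF p] dd_ver_be[OF x] dd_ver_s0[OF x] dd_ver_r00[OF x] abbr b_smx[OF xU] rs_def N_def
    using gin_smx[OF xU, of y "bu x"] sm_skew[of x y "bu x"] sf_eq[of x y] z sf_eq[of x "smx x *v bu x"]
      sm_skew[of x "bu x" "smx x *v bu x"] gin_smx[OF xU, of "smx x *v bu x" "bu x"]
    unfolding s0_def abbr by simp_all
  have Qv: "dd (0, \<chi> i. Qf i p) f p = l * dd (0, sy p) f p + A\<^sup>2 * c * dd (0, bu x) f p" if f: "f differentiable (at p)" for f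
  proof -
    have "(0, \<chi> i. Qf i p) = l *\<^sub>R (0 :: real ^ 'n, sy p) + (A\<^sup>2 * c) *\<^sub>R (0, bu x)"
      unfolding Qf_def l psi_def c abbr by (simp add: vec_eq_iff)
    then show ?thesis by (simp only: dd_dir_add[OF f] dd_dir_scaleR[OF f])
  qed
  have dvd: "vdiv Qf differentiable (at p)"
    by (rule Cinf_differentiable[OF vdiv_smooth[OF open_W Qf_smooth] p])
  have bpsi: "dd (0, bu x) psi p = 2 * B * c" unfolding dpsi bb cB using Anz by simp
  have Spsi: "dd (0, sy p) psi p = A\<^sup>2 * cs" unfolding dpsi S cS by simp
  have Sbpsi: "dd (0, smx x *v bu x) psi p = A\<^sup>2 * ((2 * rs + 2 * l * N) / (3 * D))" unfolding dpsi vSb dchi by simp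
  have blam: "dd (0, bu x) lam p = ld" unfolding dlam bb ld_def la_def lb_def using Anz by (simp add: divide_simps) (simp add: algebra_simps power2_eq_square)
  have Slam: "dd (0, sy p) lam p = 0" unfolding dlam S by simp
  have SSlam: "dd (0, smx x *v sy p) lam p = lb * om - la * sig / A" unfolding dlam vSS by simp
  have hdQ: "hdiv Qf p = lb * (kap - sig) + l * E0 p + A\<^sup>2 * cb + A\<^sup>2 * c * rb x"
    unfolding hdiv_Qf[OF p] l psi_def abbr c dlam hS dpsi hb chb by simp
  have Pv: "Pf p = (A - 2 * B) * c" unfolding Pf_def c A_def B_def ..
  have "ricci F x y = RicOp G0 p + 2 * hdiv Qf p
    - dd (hor a p (snd p)) (vdiv Qf) p + 2 * dd (0, \<chi> l. Qf l p) (vdiv Qf) p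
    - (\<Sum>m\<in>UNIV. \<Sum>l\<in>UNIV. dd (0, axis l 1) (Qf m) p * dd (0, axis m 1) (Qf l) p)
    + (real CARD('n) - 1) * ((Pf p)\<^sup>2 - dd (hor a p (snd p)) Pf p + 2 * dd (0, \<chi> l. Qf l p) Pf p)"
    unfolding x_def y_def ricci_F_RicOp[OF p]
    by (rule RicOp_projective[OF open_W p W_TU Qf_smooth Pf_smooth hom_Qf hom_Pf])
  also have "RicOp G0 p = RB x y y"
    using ricci_alpha[OF x] ricci_alpha_RB[OF x] unfolding x_def y_def by simp
  finally show ?thesis
    unfolding Qv[OF dvd] Qv[OF Cinf_differentiable[OF Pf_smooth p]]
    unfolding QQ_Qf[OF p] hdQ abbr Pv dv dP l
      S cS bb cB hy chy bpsi Spsi Sbpsi blam Slam SSlam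
    by (simp add: algebra_simps power2_eq_square[of c])
qed

end

section \<open>Consequences of the Einstein condition for a 1-form of unit length\<close>

text \<open>Here \<beta> = 1, which explains the literal \<open>1\<close>s, and \<open>z\<close> is
  \<alpha> - \<beta>. Each singular factor is paired with the power of \<open>z\<close> that makes
  it regular; no product in the formula has a pole of order above three, so \<open>z ^ 3\<close>
  leaves an expression that stays continuous at the pole.\<close>

lemma pole_scaling:
  fixes z A :: real
  defines "iA \<equiv> 1 / A"
  assumes L: "z * l = L" "z\<^sup>2 * lb = Lb" "z\<^sup>2 * la = La" "z * ld = Ld"
    and C: "z\<^sup>2 * cs = CS" "z\<^sup>2 * cb = CB" "z\<^sup>2 * c0 = C0" "z\<^sup>2 * cn = CN"
  shows "z ^ 3 * (R + 2 * (lb * (k - s) + l * E + A\<^sup>2 * cb + A\<^sup>2 * c * rb)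
      - 2 * (r0 * c + 1 * c0) + 2 * (2 * l * 1 * cs + 2 * A\<^sup>2 * c\<^sup>2)
      - ((2 * 1 * c)\<^sup>2 - l\<^sup>2 * Sg + 2 * l * (lb * om - la * s / A) + 2 * ld * (A\<^sup>2 * cs) + 2 * l * (A\<^sup>2 * cn))
      + m * (((A - 2 * 1) * c)\<^sup>2 - ((A - 2 * 1) * c0 - 2 * r0 * c)
         + 2 * (l * ((A - 2 * 1) * cs) + A\<^sup>2 * c * ((1 / A - 2) * c))))
    = z ^ 3 * R + 2 * (z * Lb * (k - s) + z\<^sup>2 * L * E + z * A\<^sup>2 * CB + z ^ 3 * A\<^sup>2 * c * rb)
      - 2 * (z ^ 3 * r0 * c + z * C0) + 2 * (2 * L * CS + 2 * z ^ 3 * A\<^sup>2 * c\<^sup>2)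
      - (z ^ 3 * (2 * c)\<^sup>2 - z * L\<^sup>2 * Sg + 2 * L * (Lb * om - La * s * iA) + 2 * Ld * (A\<^sup>2 * CS)
         + 2 * L * (A\<^sup>2 * CN))
      + m * (z ^ 3 * ((A - 2) * c)\<^sup>2 - ((A - 2) * (z * C0) - 2 * z ^ 3 * r0 * c)
         + 2 * (L * ((A - 2) * CS) + z ^ 3 * A\<^sup>2 * c * ((iA - 2) * c)))"
proof -
  have d: "la * s / A = la * s * iA" "1 / A = iA" by (simp_all add: iA_def)
  show ?thesis
    unfolding d L[symmetric] C[symmetric] by (simp add: algebra_simps power2_eq_square power3_eq_cube)
qed

text \<open>The formula of \<open>ricci_F\<close> at \<alpha> = 1, \<beta> = t. With
  \<open>i = 1 / (1 - t)\<close> the rules \<open>i * t = i - 1\<close> and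
  \<open>i\<^sup>2 * D = 2 * i - 1\<close> reduce every product to a polynomial in \<open>t\<close>
  plus multiples of \<open>i\<close> and \<open>i\<^sup>2\<close>.\<close>

lemma partial_fractions:
  fixes t :: real
  assumes t: "t < 1" "-1 < t"
  defines "D \<equiv> 1 - t\<^sup>2" and "l \<equiv> 2 / (1 - t)" and "lb \<equiv> 2 / (1 - t)\<^sup>2" and "la \<equiv> 2 * (1 - 2 * t) / (1 - t)\<^sup>2"
    and "ld \<equiv> 2 * (1 + 2 * t) / (1 - t)"
  shows "t\<^sup>2 * Rb + D * Rw + 2 * (lb * (D * k - D * s) + l * (t * E) + h / 3 + c * rb)
      - 2 * (3 * c * D * c + t * (t * C2 / 3 + 6 * c\<^sup>2 * t)) + 2 * (2 * l * t * (2 / 3 * k) + 2 * c\<^sup>2)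
      - ((2 * t * c)\<^sup>2 - l\<^sup>2 * Sg - 2 * l * (la * (D * s)) + 2 * ld * (2 / 3 * k))
      + m * (((1 - 2 * t) * c)\<^sup>2 - ((1 - 2 * t) * (t * C2 / 3 + 6 * c\<^sup>2 * t) - 2 * (3 * c * D) * c)
          + 2 * (l * ((1 - 2 * t) * (2 / 3 * k)) + c * ((t - 2) * c)))
    = (Rw - 4 * (k - s) - 4 * E + 2 / 3 * h + 2 * c * rb - 2 * c\<^sup>2 - 16 * s + m * (3 * c\<^sup>2 + 16 / 3 * k))
      + m * (- 8 * c\<^sup>2 - C2 / 3) * t
      + (Rb - Rw - 10 * c\<^sup>2 - 2 / 3 * C2 + m * (10 * c\<^sup>2 + 2 / 3 * C2)) * t\<^sup>2
      + (32 * s + 4 * E + (16 / 3 - 8 / 3 * m) * k) / (1 - t) + (4 * Sg - 16 * s) / (1 - t)\<^sup>2"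
proof -
  define i where "i = 1 / (1 - t)"
  have i: "i * (1 - t) = 1" unfolding i_def using t by simp
  have it: "i * t = i - 1" using i by (simp add: algebra_simps)
  have l: "l = 2 * i" "lb = 2 * i\<^sup>2" "la = 2 * (1 - 2 * t) * i\<^sup>2" "ld = 2 * (1 + 2 * t) * i"
    unfolding l_def lb_def la_def ld_def i_def by (simp_all add: power_one_over)
  have iD: "i\<^sup>2 * D = 2 * i - 1"
  proof -
    have "i\<^sup>2 * D = (i * (1 - t)) * (i + i * t)" unfolding D_def by (simp add: algebra_simps power2_eq_square)
    then show ?thesis unfolding i it by simp
  qed
  have iiD: "i * (i\<^sup>2 * D) = 2 * i\<^sup>2 - i" unfolding iD by (simp add: algebra_simps power2_eq_square)
  have "i\<^sup>2 * t = i * (i * t)" by (simp add: power2_eq_square)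
  then have iit: "i\<^sup>2 * t = i\<^sup>2 - i" unfolding it by (simp add: power2_eq_square right_diff_distrib)
  have T1: "lb * (D * k - D * s) = (4 * i - 2) * (k - s)"
  proof -
    have "lb * (D * k - D * s) = 2 * (i\<^sup>2 * D) * (k - s)" unfolding l by (simp add: algebra_simps)
    then show ?thesis unfolding iD by simp
  qed
  have T2: "l * (t * E) = 2 * (i - 1) * E"
  proof -
    have "l * (t * E) = 2 * (i * t) * E" unfolding l by simp
    then show ?thesis unfolding it .
  qed
  have T3: "2 * l * t * (2 / 3 * k) = 8 / 3 * (i - 1) * k"
  proof -
    have "2 * l * t * (2 / 3 * k) = 8 / 3 * (i * t) * k" unfolding l by simp
    then show ?thesis unfolding it .
  qed
  have T4: "2 * l * (la * (D * s)) = - 16 * i\<^sup>2 * s + 40 * i * s - 16 * s"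
  proof -
    have "2 * l * (la * (D * s)) = 8 * (i * (i\<^sup>2 * D)) * (1 - 2 * t) * s" unfolding l by (simp add: algebra_simps)
    also have "\<dots> = 8 * (2 * i\<^sup>2 - i - 4 * (i\<^sup>2 * t) + 2 * (i * t)) * s" unfolding iiD by (simp add: algebra_simps)
    finally show ?thesis unfolding iit it by (simp add: algebra_simps)
  qed
  have T5: "2 * ld * (2 / 3 * k) = 8 * i * k - 16 / 3 * k"
  proof -
    have "2 * ld * (2 / 3 * k) = 8 / 3 * (i + 2 * (i * t)) * k" unfolding l by (simp add: field_simps)
    then show ?thesis unfolding it by (simp add: field_simps)
  qed
  have T6: "l * ((1 - 2 * t) * (2 / 3 * k)) = 4 / 3 * (2 - i) * k"
  proof -
    have "l * ((1 - 2 * t) * (2 / 3 * k)) = 4 / 3 * (i - 2 * (i * t)) * k" unfolding l by (simp add: field_simps)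
    then show ?thesis unfolding it by (simp add: field_simps)
  qed
  have T7: "l\<^sup>2 * Sg = 4 * i\<^sup>2 * Sg" unfolding l by (simp add: power2_eq_square)
  have T8: "X / (1 - t) = X * i" "X / (1 - t)\<^sup>2 = X * i\<^sup>2" for X
    unfolding i_def by (simp_all add: power_one_over)
  show ?thesis
    unfolding T1 T2 T3 T4 T5 T6 T7 T8 unfolding D_def by (simp add: field_simps power2_eq_square)
qed

text \<open>Poles of different order at t = 1 and polynomials of different degree are linearly
  independent, and the fourth power on the right exceeds the degree two on the left. Seven sample
  points already give a linear system with only the zero solution.\<close>

lemma partial_fractions_unique:
  fixes p0 p1 p2 c3 c4 k :: real
  assumes "\<And>t. -1 < t \<Longrightarrow> t < 1 \<Longrightarrow> p0 + p1 * t + p2 * t\<^sup>2 + c3 / (1 - t) + c4 / (1 - t)\<^sup>2 = k * (1 + t) ^ 4"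
  shows "k = 0" "p0 = 0" "p1 = 0" "p2 = 0" "c3 = 0" "c4 = 0"
proof -
  note e = assms[of 0] assms[of "1/2"] assms[of "-1/2"] assms[of "1/3"] assms[of "-1/3"] assms[of "2/3"] assms[of "-2/3"]
  have e': "p0 + c3 + c4 = k"
    "p0 + p1 / 2 + p2 / 4 + 2 * c3 + 4 * c4 = 81 / 16 * k" "p0 - p1 / 2 + p2 / 4 + 2 / 3 * c3 + 4 / 9 * c4 = k / 16"
    "p0 + p1 / 3 + p2 / 9 + 3 / 2 * c3 + 9 / 4 * c4 = 256 / 81 * k" "p0 - p1 / 3 + p2 / 9 + 3 / 4 * c3 + 9 / 16 * c4 = 16 / 81 * k"
    "p0 + 2 / 3 * p1 + 4 / 9 * p2 + 3 * c3 + 9 * c4 = 625 / 81 * k" "p0 - 2 / 3 * p1 + 4 / 9 * p2 + 3 / 5 * c3 + 9 / 25 * c4 = k / 81"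
    using e by (simp_all add: power2_eq_square power4_eq_xxxx field_simps)
  show "k = 0" "p0 = 0" "p1 = 0" "p2 = 0" "c3 = 0" "c4 = 0" using e' by linarith+
qed

context unit_form
begin

text \<open>In index notation r_{ij|k} v^i w^j u^k, with the direction of differentiation as the
  first vector.\<close>

definition Dr :: "real ^ 'n \<Rightarrow> real ^ 'n \<Rightarrow> real ^ 'n \<Rightarrow> real ^ 'n \<Rightarrow> real" where
  "Dr x u v w = gin (mdd u rm) x v w - gin rm x (Gam a x u v) w - gin rm x v (Gam a x u w)"

lemma Dr_linear1: "x \<in> U \<Longrightarrow> linear (\<lambda>u. Dr x u v w)"
  and Dr_linear2: "linear (\<lambda>v. Dr x u v w)" and Dr_linear3: "linear (\<lambda>w. Dr x u v w)"
proof -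
  assume x: "x \<in> U"
  have "gin (mdd (u + u') rm) x v w = gin (mdd u rm) x v w + gin (mdd u' rm) x v w" for u u'
    using linear_add[OF mdd_linear[OF rm_mdiff[OF x]]] unfolding gin_def by (simp add: matrix_vector_mult_add_rdistrib inner_add_right)
  moreover have "gin (mdd (c *\<^sub>R u) rm) x v w = c * gin (mdd u rm) x v w" for u c
    using linear_cmul[OF mdd_linear[OF rm_mdiff[OF x]]] unfolding gin_def by (simp add: scaleR_matrix_vector_assoc[symmetric])
  ultimately show "linear (\<lambda>u. Dr x u v w)"
    unfolding Dr_def by (auto intro!: linearI simp: gin_simps Gam_simps algebra_simps)
qed (auto intro!: linearI simp: Dr_def gin_simps Gam_simps algebra_simps)

lemmas Dr_simps =
  linear_add[OF Dr_linear1] linear_add[OF Dr_linear2] linear_add[OF Dr_linear3]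
  linear_cmul[OF Dr_linear1] linear_cmul[OF Dr_linear2] linear_cmul[OF Dr_linear3]

lemmas RB_simps =
  linear_add[OF RB_linear1] linear_add[OF RB_linear2]
  linear_cmul[OF RB_linear1] linear_cmul[OF RB_linear2]

lemmas covf_simps =
  linear_add[OF covf_linear1] linear_add[OF covf_linear2]
  linear_cmul[OF covf_linear1] linear_cmul[OF covf_linear2]

lemma dd_hor_r00:
  assumes "fst p \<in> U"
  shows "dd (hor a p u) r00 p = Dr (fst p) u (snd p) (snd p)"
  using dd_gin[OF mdiff_fst[of rm p] vdiff_snd vdiff_snd, of "hor a p u"] mdd_fst[of rm p "hor a p u"] rm_mdiff[OF assms]
  unfolding r00_def[abs_def] Dr_def by (simp add: gin_def hor_def linear_neg[OF matrix_vector_mul_linear])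

definition E0l :: "real ^ 'n \<Rightarrow> real ^ 'n \<Rightarrow> real" where
  "E0l x y = (\<Sum>m\<in>UNIV. (mdd (axis m 1) smx x *v y) $ m - (smx x *v Gam a x (axis m 1) y) $ m
     + Gam a x (axis m 1) (smx x *v y) $ m)"

lemma E0_eq:
  assumes "fst p \<in> U"
  shows "E0 p = E0l (fst p) (snd p)"
proof -
  have "dd (hor a p u) (\<lambda>p. sy p $ i) p = (mdd u smx (fst p) *v snd p) $ i - (smx (fst p) *v Gam a (fst p) u (snd p)) $ i" for u i
  proof -
    have "vdd (hor a p u) (\<lambda>p. smx (fst p) *v snd p) p = mdd u smx (fst p) *v snd p - smx (fst p) *v Gam a (fst p) u (snd p)"
      using vdd_matvec[OF mdiff_fst[OF smx_mdiff[OF assms]] vdiff_snd, of "hor a p u"] mdd_fst[OF smx_mdiff[OF assms], of "hor a p u"]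
      by (simp add: hor_def linear_neg[OF matrix_vector_mul_linear])
    then show ?thesis unfolding sy_def[abs_def] vdd_def by (simp add: vec_eq_iff)
  qed
  then show ?thesis unfolding E0_def hdiv_def E0l_def sy_def by simp
qed

lemma E0l_linear: "linear (\<lambda>y. E0l x y)"
  unfolding E0l_def
  by (rule linearI) (simp_all add: matrix_vector_right_distrib matrix_vector_mult_scaleR Gam_simps
      sum.distrib sum_subtractf sum_distrib_left algebra_simps)

lemmas E0l_simps = linear_add[OF E0l_linear] linear_cmul[OF E0l_linear]

text \<open>The place where n \<ge> 3 enters: b and s span at most two dimensions. Orthogonality to
  s makes s_0 vanish on the whole plane of b and \<open>w\<close>, so that \<open>ricci_F\<close>
  applies there.\<close>

lemma perp_exists:
  assumes "CARD('n) \<ge> 3" "x \<in> U"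
  obtains w where "gin a x w w = 1" "b x \<bullet> w = 0" "sf x \<bullet> w = 0"
proof -
  have "dim {b x, sf x} \<le> card {b x, sf x}" by (rule dim_le_card') simp
  also have "\<dots> \<le> 2" by (simp add: card_insert_if)
  finally have "dim {b x, sf x} < DIM(real ^ 'n)" using assms(1) by simp
  then obtain u where u: "u \<noteq> 0" "\<And>y. y \<in> span {b x, sf x} \<Longrightarrow> orthogonal u y"
    using orthogonal_to_subspace_exists by blast
  have "orthogonal u (b x)" "orthogonal u (sf x)" using u(2) by (simp_all add: span_base)
  moreover have "gin a x u u > 0" using gin_pos assms(2) u(1) by blast
  ultimately show thesis
    using that[of "(1 / sqrt (gin a x u u)) *\<^sub>R u"]
    by (simp add: gin_simps orthogonal_def inner_commute)
qed

end

lemma scaled_quotient: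
  fixes z q :: real
  assumes "z \<noteq> 0" "q \<noteq> 0"
  shows "z\<^sup>2 * ((X - 2 * (L / z) * Y) / (3 * (z * q))) = (z * X - 2 * L * Y) / (3 * q)"
  using assms by (simp add: field_simps power2_eq_square)

section \<open>Vanishing of s_i\<close>

context unit_form
begin

lemma frame_point:
  assumes x: "x \<in> U" and w: "gin a x w w = 1" "b x \<bullet> w = 0"
  shows "Af (x, t *\<^sub>R bu x + v *\<^sub>R w) = t\<^sup>2 + v\<^sup>2" "be (x, t *\<^sub>R bu x + v *\<^sub>R w) = t"
    "v \<noteq> 0 \<Longrightarrow> (x, t *\<^sub>R bu x + v *\<^sub>R w) \<in> W"
proof -
  show 1: "Af (x, t *\<^sub>R bu x + v *\<^sub>R w) = t\<^sup>2 + v\<^sup>2"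
    unfolding Af_def using x w by (simp add: gin_simps gin_bu gin_bu' b_bu power2_eq_square)
  show 2: "be (x, t *\<^sub>R bu x + v *\<^sub>R w) = t"
    unfolding be_def using x w by (simp add: inner_add_right b_bu)
  show "(x, t *\<^sub>R bu x + v *\<^sub>R w) \<in> W" if "v \<noteq> 0"
    unfolding W_def using 1 2 x that by simp
qed

text \<open>Contracting the second index of s with b changes the sign, so
  \<open>smx x *v bu x\<close> is -s^i. Both contractions are therefore the squared length of s up
  to sign.\<close>

lemma gin_smx_bu: "x \<in> U \<Longrightarrow> gin rm x (bu x) (smx x *v bu x) = gin a x (smx x *v bu x) (smx x *v bu x)"
  "x \<in> U \<Longrightarrow> sf x \<bullet> (smx x *v bu x) = - gin a x (smx x *v bu x) (smx x *v bu x)"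
proof -
  assume x: "x \<in> U"
  show 1: "sf x \<bullet> (smx x *v bu x) = - gin a x (smx x *v bu x) (smx x *v bu x)"
    unfolding sf_eq gin_smx[OF x] using sm_skew[of x "bu x" "smx x *v bu x"] .
  then show "gin rm x (bu x) (smx x *v bu x) = gin a x (smx x *v bu x) (smx x *v bu x)"
    unfolding r_bu[OF x] by simp
qed

text \<open>The Ricci curvature of \<open>F\<close> along \<open>b + v w\<close> has a pole of order three in \<open>\<alpha> - \<beta>\<close> as \<open>v\<close> tends to 0,
  whose coefficient is a multiple of \<open>s\<^sub>i s\<^sup>i\<close>.\<close>

lemma einstein_smx_bu:
  assumes n: "CARD('n) \<ge> 3" and x: "x \<in> U"
    and K: "\<And>y. (x, y) \<in> W \<Longrightarrow> ricci F x y = (real CARD('n) - 1) * K * (F x y)\<^sup>2"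
  shows "smx x *v bu x = 0"
proof -
  obtain w where w: "gin a x w w = 1" "b x \<bullet> w = 0" "sf x \<bullet> w = 0" using perp_exists[OF n x] .
  define m where "m = real CARD('n) - 1"
  define S0 where "S0 = smx x *v bu x"
  define S1 where "S1 = smx x *v w"
  define N where "N = gin a x S0 S0"
  define y where "y v = 1 *\<^sub>R bu x + v *\<^sub>R w" for v
  define A where "A v = sqrt (1 + v\<^sup>2)" for v :: real
  \<comment> \<open>This is \<alpha> - \<beta> along the curve. It vanishes to second order at
    \<open>v = 0\<close>, because \<open>z v * (A v + 1)\<close> equals
    \<open>v\<^sup>2\<close>.\<close>
  define z where "z v = A v - 1" for v
  \<comment> \<open>The value of \<chi> on the curve, independent of \<open>v\<close>: since r(b, w)
    = - s(w) = 0, both r_00 and \<alpha>^2 - \<beta>^2 are multiples of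
    \<open>v\<^sup>2\<close>.\<close>
  define c where "c = gin rm x w w / 3"
  define rr where "rr v = v\<^sup>2 * gin rm x w w" for v :: real
  define Rf where "Rf v = RB x (y v) (y v)" for v
  define kap where "kap v = gin rm x (y v) (S0 + v *\<^sub>R S1)" for v
  define sig where "sig v = gin a x (S0 + v *\<^sub>R S1) (S0 + v *\<^sub>R S1)" for v
  define om where "om v = sf x \<bullet> (S0 + v *\<^sub>R S1)" for v
  define rs where "rs v = gin rm x (y v) S0" for v
  define Ef where "Ef v = E0l x (y v)" for v
  define rdb where "rdb v = Dr x (bu x) (y v) (y v)" for v
  define rdy where "rdy v = Dr x (y v) (y v) (y v)" for v
  define sdb where "sdb v = covf a sf x (y v) (bu x)" for v
  define sdy where "sdy v = covf a sf x (y v) (y v)" for v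
  define L where "L v = 2 * (A v)\<^sup>2" for v
  define CS where "CS v = (z v * (2 * kap v) - 2 * L v * om v) / (3 * (A v + 1))" for v
  define CB where "CB v = (z v * rdb v - 2 * L v * sdb v) / (3 * (A v + 1))" for v
  define C0 where "C0 v = (z v * rdy v - 2 * L v * sdy v) / (3 * (A v + 1)) + (z v)\<^sup>2 * (6 * c\<^sup>2)" for v
  define CN where "CN v = (z v * (2 * rs v) - 2 * L v * (- N)) / (3 * (A v + 1))" for v
  \<comment> \<open>The Ricci curvature times \<open>z ^ 3\<close> as provided by
    \<open>pole_scaling\<close>, in a form that also makes sense at \<open>v = 0\<close>.\<close>
  define G where "G v = (z v) ^ 3 * Rf v + 2 * (z v * L v * (kap v - sig v) + (z v)\<^sup>2 * L v * Ef v + z v * (A v)\<^sup>2 * CB v + (z v) ^ 3 * (A v)\<^sup>2 * c * rb x)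
      - 2 * ((z v) ^ 3 * rr v * c + z v * C0 v) + 2 * (2 * L v * CS v + 2 * (z v) ^ 3 * (A v)\<^sup>2 * c\<^sup>2)
      - ((z v) ^ 3 * (2 * c)\<^sup>2 - z v * (L v)\<^sup>2 * Sg x + 2 * L v * (L v * om v - 2 * A v * (A v - 2) * sig v * (1 / A v))
         + 2 * (2 * (A v + 2)) * ((A v)\<^sup>2 * CS v) + 2 * L v * ((A v)\<^sup>2 * CN v))
      + m * ((z v) ^ 3 * ((A v - 2) * c)\<^sup>2 - ((A v - 2) * (z v * C0 v) - 2 * (z v) ^ 3 * rr v * c)
         + 2 * (L v * ((A v - 2) * CS v) + (z v) ^ 3 * (A v)\<^sup>2 * c * ((1 / A v - 2) * c)))" for v
  have A0: "A 0 = 1" and z0: "z 0 = 0" by (simp_all add: A_def z_def)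
  \<comment> \<open>At the limit point \<open>L\<close> is 2, and both \<open>CS\<close> and
    \<open>CN\<close> are two thirds of \<open>N\<close>. The terms with \<open>om\<close> and
    \<open>sig\<close> cancel each other.\<close>
  have G0: "G 0 = - 8 / 3 * (m + 2) * N"
  proof -
    have "kap 0 = N" "om 0 = - N" "sig 0 = N" "rs 0 = N"
      using gin_smx_bu[OF x] unfolding kap_def om_def sig_def rs_def N_def S0_def y_def by simp_all
    then show ?thesis unfolding G_def CS_def CN_def L_def A0 z0 by (simp add: field_simps)
  qed
  have cA: "isCont A 0" unfolding A_def by (intro continuous_intros)
  have cz: "isCont z 0" unfolding z_def by (intro continuous_intros cA)
  have c1: "isCont Rf 0" "isCont kap 0" "isCont sig 0" "isCont om 0" "isCont rs 0" "isCont Ef 0" "isCont rr 0"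
    unfolding Rf_def kap_def sig_def om_def rs_def Ef_def y_def rr_def
    by (auto simp: RB_simps x gin_simps E0l_simps inner_add_right intro!: continuous_intros)
  have sfd: "vdiff sf x" by (rule sf_vdiff[OF x])
  have c2: "isCont rdb 0" "isCont rdy 0" "isCont sdb 0" "isCont sdy 0"
    unfolding rdb_def rdy_def sdb_def sdy_def y_def
    by (auto simp: Dr_simps x covf_simps sfd intro!: continuous_intros)
  have cL: "isCont L 0" unfolding L_def by (intro continuous_intros cA)
  have c3: "isCont CS 0" "isCont CB 0" "isCont C0 0" "isCont CN 0"
    unfolding CS_def CB_def C0_def CN_def
    by (intro continuous_intros cA cz c1 c2 cL; simp add: A0)+
  have "isCont G 0"
    unfolding G_def by (intro continuous_intros cA cz c1 c2 c3 cL; simp add: A0)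
  then have lim1: "(G \<longlongrightarrow> G 0) (at 0)" unfolding isCont_def .
  \<comment> \<open>The other side of the Einstein equation times \<open>z ^ 3\<close>, which tends
    to 0. It agrees with \<open>G\<close> for \<open>v \<noteq> 0\<close> only, so the values at 0
    are compared through limits.\<close>
  define H where "H v = (z v) ^ 3 * (m * K * ((A v + 1)\<^sup>2 / A v)\<^sup>2)" for v
  have "isCont H 0"
    unfolding H_def by (intro continuous_intros cA cz; simp add: A0)
  then have lim2: "(H \<longlongrightarrow> H 0) (at 0)" unfolding isCont_def .
  have eq: "G v = H v" if v: "v \<noteq> 0" for v
  proof -
    let ?p = "(x, y v)"
    have A1: "A v > 1" unfolding A_def using v by simp
    have zn: "z v \<noteq> 0" "A v + 1 \<noteq> 0" "A v \<noteq> 0" using A1 unfolding z_def by auto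
    have p: "?p \<in> W" using frame_point(3)[OF x w(1,2) v, of 1] unfolding y_def .
    have s0: "s0 ?p = 0" unfolding s0_def y_def using w(3) by (simp add: inner_add_right)
    have alp: "al ?p = A v" unfolding al_def A_def y_def frame_point(1)[OF x w(1,2)] by simp
    have bep: "be ?p = 1" unfolding y_def frame_point(2)[OF x w(1,2)] ..
    have syp: "sy ?p = S0 + v *\<^sub>R S1"
      unfolding sy_def y_def S0_def S1_def by (simp add: matrix_vector_right_distrib matrix_vector_mult_scaleR)
    have r00p: "r00 ?p = rr v"
      unfolding r00_def y_def rr_def using w(3) by (simp add: gin_simps r_bu[OF x] r_bu'[OF x] power2_eq_square)
    have E0p: "E0 ?p = Ef v" unfolding Ef_def using E0_eq[of ?p] x by simp
    have hb: "dd (hor a ?p u) r00 ?p = Dr x u (y v) (y v)" for u using dd_hor_r00[of ?p] x by simp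
    have D: "(A v)\<^sup>2 - 1\<^sup>2 = z v * (A v + 1)" unfolding z_def by (simp add: algebra_simps power2_eq_square)
    have zA: "A v - 1 = z v" unfolding z_def ..
    have "(A v)\<^sup>2 = 1 + v\<^sup>2" unfolding A_def by simp
    then have Dv: "z v * (A v + 1) = v\<^sup>2" unfolding D[symmetric] by simp
    have cc: "rr v / (3 * (z v * (A v + 1))) = c" unfolding Dv rr_def c_def using v by simp
    have cc2: "2 * c * 1 * rr v / (z v * (A v + 1)) = 6 * c\<^sup>2"
      unfolding Dv rr_def c_def using v by (simp add: power2_eq_square)
    note R = ricci_F[OF p s0, unfolded fst_conv snd_conv alp bep r00p syp E0p hb D zA cc cc2, folded S0_def,
        folded Rf_def kap_def sig_def om_def rs_def rdb_def rdy_def sdb_def sdy_def N_def m_def]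
    have "(z v) ^ 3 * ricci F x (y v) = G v"
      unfolding R G_def
    proof (rule pole_scaling)
      show "z v * (2 * (A v)\<^sup>2 / z v) = L v" "(z v)\<^sup>2 * (2 * (A v)\<^sup>2 / (z v)\<^sup>2) = L v"
        "(z v)\<^sup>2 * (2 * A v * (A v - 2 * 1) / (z v)\<^sup>2) = 2 * A v * (A v - 2)"
        "z v * (2 * (A v + 2 * 1) / z v) = 2 * (A v + 2)"
        using zn unfolding L_def by simp_all
      show "(z v)\<^sup>2 * ((2 * kap v - 2 * (2 * (A v)\<^sup>2 / z v) * om v) / (3 * (z v * (A v + 1)))) = CS v"
        "(z v)\<^sup>2 * ((rdb v - 2 * (2 * (A v)\<^sup>2 / z v) * sdb v) / (3 * (z v * (A v + 1)))) = CB v"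
        unfolding CS_def CB_def L_def by (rule scaled_quotient[OF zn(1,2)])+
      show "(z v)\<^sup>2 * ((rdy v - 2 * (2 * (A v)\<^sup>2 / z v) * sdy v) / (3 * (z v * (A v + 1))) + 6 * c\<^sup>2) = C0 v"
        unfolding C0_def L_def distrib_left[of "(z v)\<^sup>2"] scaled_quotient[OF zn(1,2)] ..
      show "(z v)\<^sup>2 * ((2 * rs v + 2 * (2 * (A v)\<^sup>2 / z v) * N) / (3 * (z v * (A v + 1)))) = CN v"
        unfolding CN_def L_def scaled_quotient[OF zn(1,2), symmetric] by simp
    qed
    moreover have "F x (y v) = (A v + 1)\<^sup>2 / A v" using F_eq[of ?p] x alp bep by simp
    ultimately show ?thesis using K[OF p] unfolding H_def m_def by simp
  qed
  have "\<forall>\<^sub>F v in at 0. G v = H v" using eq by (auto simp: eventually_at_filter)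
  then have "(H \<longlongrightarrow> G 0) (at 0)" using lim1 tendsto_cong by fast
  then have "G 0 = H 0" using lim2 tendsto_unique[OF at_neq_bot] by blast
  then have "N = 0" unfolding G0 H_def z0 using n unfolding m_def by simp
  then show ?thesis unfolding N_def S0_def using gin_eq_0_iff[OF x] by simp
qed

end

text \<open>The polynomial x^2 + y^2 is irreducible over the reals, so if it divides the square of a
  quadratic form it divides the form, which is then a multiple of it. Five sample points suffice to
  derive this by elimination.\<close>

lemma quadratic_square_ratio:
  fixes A B C P Q R :: real
  assumes "\<And>x y :: real. (A * x\<^sup>2 + 2 * B * x * y + C * y\<^sup>2)\<^sup>2 = (x\<^sup>2 + y\<^sup>2) * (P * x\<^sup>2 + 2 * Q * x * y + R * y\<^sup>2)"
  shows "A = C" "B = 0"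
proof -
  have e: "A\<^sup>2 = P" "C\<^sup>2 = R" "(A + 2 * B + C)\<^sup>2 = 2 * (P + 2 * Q + R)" "(A - 2 * B + C)\<^sup>2 = 2 * (P - 2 * Q + R)"
    "(4 * A + 4 * B + C)\<^sup>2 = 5 * (4 * P + 4 * Q + R)"
    using assms[of 1 0] assms[of 0 1] assms[of 1 1] assms[of 1 "-1"] assms[of 2 1] by (simp_all add: mult_ac)
  have 1: "4 * B\<^sup>2 = (A - C)\<^sup>2" using e(3,4) unfolding e(1,2)[symmetric] by (simp add: power2_eq_square algebra_simps)
  have "2 * (A * C) + 4 * (A * B) + 4 * (B * B) + 4 * (B * C) = A * A + C * C + 4 * Q"
    "2 * (A * C) + 4 * (B * B) + 4 * Q = A * A + C * C + 4 * (A * B) + 4 * (B * C)"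
    "8 * (A * C) + 8 * (B * C) + 16 * (B * B) + 32 * (A * B) = 4 * (A * A) + 4 * (C * C) + 20 * Q"
    using e(3,4,5) unfolding e(1,2)[symmetric] by (simp_all add: power2_eq_square algebra_simps)
  then have "A * B = B * C" by linarith
  then have 2: "B * (A - C) = 0" by (simp add: algebra_simps)
  from 1 2 show "A = C" "B = 0" by auto
qed

section \<open>The covariant derivative of b and the case s_i = 0\<close>

context unit_form
begin

lemma cov_bu:
  assumes x: "x \<in> U"
  shows "gin a x (vdd u bu x + Gam a x u (bu x)) v = gin rm x v u + gin sm x v u"
proof -
  let ?p = "(x, 0 :: real ^ 'n)"
  let ?v = "\<lambda>p::(real ^ 'n) \<times> (real ^ 'n). bu (fst p)"
  have p: "fst ?p \<in> U" "?p \<in> TU" using x by auto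
  have vd: "vdiff ?v ?p" using vdiff_fst[of bu ?p] bu_vdiff x by simp
  have w: "vdiff b (fst ?p)" using b_vdiff x by simp
  have c: "cov a u ?v ?p = vdd u bu x + Gam a x u (bu x)"
    unfolding cov_def using vdd_fst[of bu ?p "hor a ?p u"] bu_vdiff[OF x] by (simp add: hor_def)
  have "dd (hor a ?p u) (\<lambda>p. gin a (fst p) (bu (fst p)) v) ?p = dd (hor a ?p u) (\<lambda>p. b (fst p) \<bullet> v) ?p"
    by (rule dd_transform[OF openTU p(2)]) (auto simp: gin_bu')
  then have "gin a x (cov a u ?v ?p) v + gin a x (bu x) (Gam a x u v) = covf a b x v u + b x \<bullet> Gam a x u v"
    using dd_hor_gin[OF p(1) vd vdiff_const, of u v] dd_hor_inner[OF w vdiff_const p(1), of u v] by simp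
  then show ?thesis unfolding c by (simp add: gin_bu'[OF x] covf_b[OF x])
qed

definition rmx :: "real ^ 'n \<Rightarrow> real ^ 'n ^ 'n" where "rmx x = matrix_inv (a x) ** rm x"

lemma smx_mult: "smx x = matrix_inv (a x) ** sm x"
  unfolding smx_def sm_def s_mixed_def by (simp add: matrix_matrix_mult_def)

lemma cov_bu_eq:
  assumes x: "x \<in> U"
  shows "vdd u bu x + Gam a x u (bu x) = rmx x *v u + smx x *v u"
proof (rule gin_eqI[OF x])
  fix w
  have "gin a x (rmx x *v u) w = gin rm x w u"
    unfolding rmx_def matrix_vector_mul_assoc[symmetric] gin_ai'[OF x] unfolding gin_def by (rule inner_commute)
  then show "gin a x (vdd u bu x + Gam a x u (bu x)) w = gin a x (rmx x *v u + smx x *v u) w"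
    unfolding cov_bu[OF x] by (simp add: gin_simps gin_smx'[OF x])
qed

lemma matvec_axis_nth: "(M *v axis m 1) $ k = (M :: real ^ 'n ^ 'n) $ k $ m"
  by (simp add: matrix_vector_mult_def sum_axis)

text \<open>Transposition preserves the trace but reverses the sign, because one factor is skew and
  the other symmetric with respect to the metric.\<close>

lemma trace_smx_rmx:
  assumes x: "x \<in> U"
  shows "trace (smx x ** rmx x) = 0"
proof -
  let ?i = "matrix_inv (a x)"
  have t: "transpose ?i = ?i" "transpose (sm x) = - sm x" "transpose (rm x) = rm x"
    unfolding transpose_def vec_eq_iff using ai_sym[OF x]
    by (simp_all add: sm_def rm_def s_tensor_def r_tensor_def field_simps)
  have tr: "trace (transpose M) = trace M" for M :: "real ^ 'n ^ 'n" by (simp add: trace_def transpose_def)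
  have neg: "(- M) ** N = - (M ** N)" "M ** (- N) = - (M ** N)" for M N :: "real ^ 'n ^ 'n"
    by (simp_all add: matrix_matrix_mult_def vec_eq_iff sum_negf)
  have "trace (smx x ** rmx x) = trace (transpose (?i ** sm x ** (?i ** rm x)))"
    unfolding tr smx_mult rmx_def ..
  also have "\<dots> = - trace (rm x ** (?i ** sm x ** ?i))"
    unfolding matrix_transpose_mul t by (simp add: matrix_mul_assoc neg trace_def sum_negf)
  also have "\<dots> = - trace (smx x ** rmx x)"
    unfolding trace_mul_sym[of "rm x"] smx_mult rmx_def by (simp add: matrix_mul_assoc)
  finally show ?thesis by simp
qed

lemma sf_zeroI:
  assumes x: "x \<in> U" and "smx x *v bu x = 0"
  shows "sf x = 0"
proof -
  have "sf x \<bullet> v = 0" for v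
    using sm_skew[of x "bu x" v] gin_smx[OF x, of v "bu x"] assms(2) sf_eq[of x v] by (simp add: gin_simps)
  then show ?thesis by (metis inner_eq_zero_iff)
qed

end

text \<open>The vanishing of s_i is required on all of \<open>U\<close> and not just at one point,
  since relations such as s_{ij} b^j = 0 are going to be differentiated.\<close>

locale unit_form_s0 = unit_form U a b for U :: "(real ^ 'n::finite) set" and a b +
  assumes sf_zero: "\<And>x. x \<in> U \<Longrightarrow> s_form a b x = 0"
begin

lemma s0_zero: "fst p \<in> U \<Longrightarrow> s0 p = 0"
  unfolding s0_def by (simp add: sf_zero)

lemma smx_bu_zero: "x \<in> U \<Longrightarrow> smx x *v bu x = 0"
proof (rule gin_eqI)
  fix w assume x: "x \<in> U"
  show "gin a x (smx x *v bu x) w = gin a x 0 w"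
    unfolding gin_smx'[OF x] sm_skew[of x w] sf_eq[symmetric] by (simp add: sf_zero[OF x] gin_simps)
qed

lemma rm_bu_zero: "x \<in> U \<Longrightarrow> gin rm x (bu x) v = 0" "x \<in> U \<Longrightarrow> gin rm x v (bu x) = 0"
  by (simp_all add: r_bu r_bu' sf_zero)

lemma covf_sf_zero: "x \<in> U \<Longrightarrow> covf a sf x v u = 0"
  unfolding covf_def using vdd_transform[OF openU, of x sf "\<lambda>_. 0" u] by (simp add: sf_zero)

lemma Dr_bbb:
  assumes x: "x \<in> U"
  shows "Dr x (bu x) (bu x) (bu x) = 0"
proof -
  have "dd (bu x) (\<lambda>z. gin rm z (bu z) (bu x)) x = dd (bu x) (\<lambda>_. 0) x"
    by (rule dd_transform[OF openU x]) (simp add: rm_bu_zero)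
  then have "gin (mdd (bu x) rm) x (bu x) (bu x) + gin rm x (vdd (bu x) bu x) (bu x) = 0"
    using dd_gin[OF rm_mdiff[OF x] bu_vdiff[OF x] vdiff_const, of "bu x" "bu x"] by (simp add: gin_simps)
  then show ?thesis unfolding Dr_def by (simp add: rm_bu_zero[OF x])
qed

text \<open>Differentiating s^m_j b^j = 0 moves the derivative from s to b. There b^j_{|m} splits
  into r and s: the trace of s with r vanishes, and the trace of s with itself is
  \<open>- Sg x\<close>.\<close>

lemma E0l_bu:
  assumes x: "x \<in> U"
  shows "E0l x (bu x) = Sg x"
proof -
  have z: "mdd u smx x *v bu x = - (smx x *v vdd u bu x)" for u
  proof -
    have "vdd u (\<lambda>z. smx z *v bu z) x = vdd u (\<lambda>_. 0) x"
      by (rule vdd_transform[OF openU x]) (simp add: smx_bu_zero)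
    then show ?thesis
      using vdd_matvec[OF smx_mdiff[OF x] bu_vdiff[OF x], of u] by (simp add: eq_neg_iff_add_eq_0)
  qed
  have "E0l x (bu x) = - (\<Sum>m\<in>UNIV. (smx x *v (vdd (axis m 1) bu x + Gam a x (axis m 1) (bu x))) $ m)"
    unfolding E0l_def z smx_bu_zero[OF x]
    by (simp add: Gam_simps matrix_vector_right_distrib sum.distrib sum_subtractf sum_negf)
  also have "\<dots> = - (trace (smx x ** rmx x) + trace (smx x ** smx x))"
    unfolding cov_bu_eq[OF x] matrix_vector_right_distrib matrix_vector_mul_assoc
    by (simp add: matvec_axis_nth trace_def sum.distrib)
  also have "trace (smx x ** smx x) = - Sg x"
    unfolding Sg_def trace_def matrix_matrix_mult_def by simp
  finally show ?thesis unfolding trace_smx_rmx[OF x] by simp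
qed

text \<open>Along \<open>y = t b \<plusminus> \<surd>(1 - t\<^sup>2) w\<close>, where \<open>\<alpha> = 1\<close> and \<open>\<beta> = t\<close>, the average over the two signs is a rational
  function of \<open>t\<close> with a double pole at \<open>t = 1\<close>, which has to equal \<open>(n - 1) K (1 + t)\<^sup>4\<close>.\<close>

lemma einstein_coefficients:
  assumes x: "x \<in> U" and w: "gin a x w w = 1" "b x \<bullet> w = 0"
    and K: "\<And>y. (x, y) \<in> W \<Longrightarrow> ricci F x y = (real CARD('n) - 1) * K * (F x y)\<^sup>2"
  defines "m \<equiv> real CARD('n) - 1"
    and "c \<equiv> gin rm x w w / 3" and "k \<equiv> gin rm x w (smx x *v w)" and "s \<equiv> gin a x (smx x *v w) (smx x *v w)"
    and "h \<equiv> Dr x (bu x) w w" and "C2 \<equiv> Dr x (bu x) w w + Dr x w (bu x) w + Dr x w w (bu x)"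
  shows "m * K = 0" "m * (- 8 * c\<^sup>2 - C2 / 3) = 0" "32 * s + 4 * Sg x + (16 / 3 - 8 / 3 * m) * k = 0" "4 * Sg x - 16 * s = 0"
proof -
  define S1 where "S1 = smx x *v w"
  define Rb where "Rb = RB x (bu x) (bu x)"
  define Rw where "Rw = RB x w w"
  have "Rw - 4 * (k - s) - 4 * Sg x + 2 / 3 * h + 2 * c * rb x - 2 * c\<^sup>2 - 16 * s + m * (3 * c\<^sup>2 + 16 / 3 * k)
      + m * (- 8 * c\<^sup>2 - C2 / 3) * t
      + (Rb - Rw - 10 * c\<^sup>2 - 2 / 3 * C2 + m * (10 * c\<^sup>2 + 2 / 3 * C2)) * t\<^sup>2
      + (32 * s + 4 * Sg x + (16 / 3 - 8 / 3 * m) * k) / (1 - t) + (4 * Sg x - 16 * s) / (1 - t)\<^sup>2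
      = m * K * (1 + t) ^ 4" if t: "-1 < t" "t < 1" for t
  proof -
    define D where "D = 1 - t\<^sup>2"
    define l where "l = 2 / (1 - t)"
    define lb where "lb = 2 / (1 - t)\<^sup>2"
    define la where "la = 2 * (1 - 2 * t) / (1 - t)\<^sup>2"
    define ld where "ld = 2 * (1 + 2 * t) / (1 - t)"
    \<comment> \<open>The names \<open>o1\<close>, \<open>o2\<close> collect the odd contributions
      to the derivatives of \<chi>, with the factor \<open>u\<close> split off. Together with the
      other odd terms they form \<open>od\<close>; the even terms form \<open>ev\<close>.\<close>
    define o1 where "o1 = t * (Dr x (bu x) (bu x) w + Dr x (bu x) w (bu x)) / (3 * D)"
    define o2 where "o2 = (t\<^sup>2 * (Dr x w (bu x) (bu x) + Dr x (bu x) w (bu x) + Dr x (bu x) (bu x) w) + D * Dr x w w w) / (3 * D)"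
    define ev where "ev = t\<^sup>2 * Rb + D * Rw + 2 * (lb * (D * k - D * s) + l * (t * Sg x) + h / 3 + c * rb x)
      - 2 * (3 * c * D * c + t * (t * C2 / 3 + 6 * c\<^sup>2 * t)) + 2 * (2 * l * t * (2 / 3 * k) + 2 * c\<^sup>2)
      - ((2 * t * c)\<^sup>2 - l\<^sup>2 * Sg x - 2 * l * (la * (D * s)) + 2 * ld * (2 / 3 * k))
      + m * (((1 - 2 * t) * c)\<^sup>2 - ((1 - 2 * t) * (t * C2 / 3 + 6 * c\<^sup>2 * t) - 2 * (3 * c * D) * c)
          + 2 * (l * ((1 - 2 * t) * (2 / 3 * k)) + c * ((t - 2) * c)))"
    define od where "od = t * (RB x (bu x) w + RB x w (bu x)) + 2 * (l * E0l x w + o1) - 2 * t * o2 - m * (1 - 2 * t) * o2"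
    have "t\<^sup>2 < 1" using t by (simp add: abs_square_less_1)
    then have D: "D > 0" unfolding D_def by simp
    have X: "ev + u * od = m * K * (1 + t) ^ 4" if u: "u\<^sup>2 = D" for u
    proof -
      define y where "y = t *\<^sub>R bu x + u *\<^sub>R w"
      let ?p = "(x, y)"
      have u0: "u \<noteq> 0" using u D by auto
      have p: "?p \<in> W" using frame_point(3)[OF x w u0] unfolding y_def .
      have s0: "s0 ?p = 0" using s0_zero x by simp
      have alp: "al ?p = 1" unfolding al_def y_def frame_point(1)[OF x w] u D_def by simp
      have bep: "be ?p = t" unfolding y_def frame_point(2)[OF x w] ..
      have syp: "sy ?p = u *\<^sub>R S1"
        unfolding sy_def y_def S1_def by (simp add: matrix_vector_right_distrib matrix_vector_mult_scaleR smx_bu_zero[OF x])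
      have r00p: "r00 ?p = 3 * c * D"
        unfolding r00_def y_def u[symmetric] c_def by (simp add: gin_simps rm_bu_zero[OF x] power2_eq_square)
      have E0p: "E0 ?p = t * Sg x + u * E0l x w"
        using E0_eq[of ?p] x unfolding y_def by (simp add: E0l_simps E0l_bu)
      have hb: "dd (hor a ?p v) r00 ?p = Dr x v y y" for v using dd_hor_r00[of ?p] x by simp
      have kap: "gin rm x y (u *\<^sub>R S1) = D * k" and sig: "gin a x (u *\<^sub>R S1) (u *\<^sub>R S1) = D * s"
        unfolding y_def u[symmetric] k_def s_def S1_def by (simp_all add: gin_simps rm_bu_zero[OF x] power2_eq_square)
      have om: "sf x \<bullet> v = 0" for v by (simp add: sf_zero[OF x])
      have D1: "1\<^sup>2 - t\<^sup>2 = D" by (simp add: D_def)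
      have l1: "2 * 1\<^sup>2 / (1 - t) = l" "2 * 1\<^sup>2 / (1 - t)\<^sup>2 = lb" "2 * 1 * (1 - 2 * t) / (1 - t)\<^sup>2 = la" "2 * (1 + 2 * t) / (1 - t) = ld"
        unfolding l_def lb_def la_def ld_def by simp_all
      have RBy: "RB x y y = t\<^sup>2 * Rb + t * u * (RB x (bu x) w + RB x w (bu x)) + D * Rw"
        unfolding y_def u[symmetric] Rb_def Rw_def by (simp add: RB_simps x algebra_simps power2_eq_square)
      have cc: "3 * c * D / (3 * D) = c" using D by simp
      have cs: "(2 * (D * k) - 2 * l * 0) / (3 * D) = 2 / 3 * k" using D by simp
      have Db: "(Dr x (bu x) y y - 2 * l * covf a sf x y (bu x)) / (3 * D) = u * o1 + h / 3"
      proof -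
        have "Dr x (bu x) y y = t * u * (Dr x (bu x) (bu x) w + Dr x (bu x) w (bu x)) + D * h"
          unfolding y_def u[symmetric] h_def by (simp add: Dr_simps x Dr_bbb algebra_simps power2_eq_square)
        then show ?thesis unfolding covf_sf_zero[OF x] o1_def using D by (simp add: add_divide_distrib)
      qed
      have Dy: "(Dr x y y y - 2 * l * covf a sf x y y) / (3 * D) + 2 * c * t * (3 * c * D) / D = t * C2 / 3 + u * o2 + 6 * c\<^sup>2 * t"
      proof -
        have "Dr x y y y = t * D * C2 + u * (t\<^sup>2 * (Dr x w (bu x) (bu x) + Dr x (bu x) w (bu x) + Dr x (bu x) (bu x) w) + D * Dr x w w w)"
          unfolding y_def u[symmetric] C2_def by (simp add: Dr_simps x Dr_bbb algebra_simps power2_eq_square)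
        then show ?thesis unfolding covf_sf_zero[OF x] o2_def using D by (simp add: field_simps power2_eq_square)
      qed
      note R = ricci_F[OF p s0, unfolded fst_conv snd_conv alp bep r00p syp E0p hb smx_bu_zero[OF x] om kap sig D1 l1 cc cs Db Dy RBy, folded m_def]
      have "ricci F x y = ev + u * od"
        unfolding R ev_def od_def by (simp add: gin_simps algebra_simps)
      moreover have "F x y = (1 + t)\<^sup>2" using F_eq[of ?p] x alp bep by simp
      ultimately show ?thesis using K[OF p] unfolding m_def by (simp flip: power_mult)
    qed
    \<comment> \<open>Both square roots of \<open>D\<close> are admissible values of
      \<open>u\<close>. Adding the two equations removes \<open>od\<close>, about which nothing is
      known.\<close>
    have "(sqrt D)\<^sup>2 = D" "(- sqrt D)\<^sup>2 = D" using D by simp_all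
    from X[OF this(1)] X[OF this(2)] have "ev = m * K * (1 + t) ^ 4" by simp
    moreover have "ev = Rw - 4 * (k - s) - 4 * Sg x + 2 / 3 * h + 2 * c * rb x - 2 * c\<^sup>2 - 16 * s + m * (3 * c\<^sup>2 + 16 / 3 * k)
      + m * (- 8 * c\<^sup>2 - C2 / 3) * t
      + (Rb - Rw - 10 * c\<^sup>2 - 2 / 3 * C2 + m * (10 * c\<^sup>2 + 2 / 3 * C2)) * t\<^sup>2
      + (32 * s + 4 * Sg x + (16 / 3 - 8 / 3 * m) * k) / (1 - t) + (4 * Sg x - 16 * s) / (1 - t)\<^sup>2"
      unfolding ev_def D_def l_def lb_def la_def ld_def by (rule partial_fractions[OF t(2,1)])
    ultimately show ?thesis by simp
  qed
  note u = partial_fractions_unique[OF this]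
  show "m * K = 0" "m * (- 8 * c\<^sup>2 - C2 / 3) = 0" "32 * s + 4 * Sg x + (16 / 3 - 8 / 3 * m) * k = 0" "4 * Sg x - 16 * s = 0"
    using u by blast+
qed

end

section \<open>Vanishing of s_{ij} and proportionality of r to the metric on the complement of
  b\<close>

context unit_form
begin

text \<open>Extends by scaling what is known on unit vectors orthogonal to b. Bilinearity of
  \<open>f\<close> supplies the square of the length.\<close>

lemma perp_homogeneous:
  assumes x: "x \<in> U" and l: "\<And>v. linear (\<lambda>u. f u v)" "\<And>u. linear (f u)"
    and h: "\<And>w. gin a x w w = 1 \<Longrightarrow> b x \<bullet> w = 0 \<Longrightarrow> f w w = k" and w: "b x \<bullet> w = 0"
  shows "f w w = k * gin a x w w"
proof (cases "w = 0")
  case True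
  then show ?thesis using linear_0[OF l(2)] by (simp add: gin_simps)
next
  case False
  define s where "s = sqrt (gin a x w w)"
  have g: "gin a x w w > 0" using gin_pos[OF x False] .
  then have s: "s > 0" "s * s = gin a x w w" unfolding s_def by simp_all
  define w1 where "w1 = (1 / s) *\<^sub>R w"
  have ww: "w = s *\<^sub>R w1" unfolding w1_def using s by simp
  have "gin a x w1 w1 = 1" unfolding w1_def using s(1) s(2)[symmetric] by (simp add: gin_simps)
  moreover have "b x \<bullet> w1 = 0" unfolding w1_def using w by simp
  ultimately have "f w1 w1 = k" by (rule h)
  then have "f w w = s * s * k"
    using linear_cmul[OF l(1), of s w1 "s *\<^sub>R w1"] linear_cmul[OF l(2), of w1 s w1] unfolding ww by simp
  then show ?thesis unfolding s(2) by simp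
qed

lemma perp_part:
  assumes "x \<in> U"
  shows "b x \<bullet> (v - (b x \<bullet> v) *\<^sub>R bu x) = 0"
  using b_bu[OF assms] by (simp add: inner_diff_right)

text \<open>The trace of b^i_{|j} = c (\<delta>^i_j - b^i b_j) solved for c. Taking the trace as the
  definition makes smoothness evident, whereas the pointwise factor is only known to exist.\<close>

definition cc :: "real ^ 'n \<Rightarrow> real" where "cc x = rb x / (real CARD('n) - 1)"

lemma rb_sum:
  assumes x: "x \<in> U" shows "rb x = (\<Sum>m\<in>UNIV. (vdd (axis m 1) bu x + Gam a x (axis m 1) (bu x)) $ m)"
proof -
  have "dd (hor a (x, 0) (axis m 1)) (\<lambda>p. bu (fst p) $ m) (x, 0) = vdd (axis m 1) bu x $ m" for m
    using dd_fst[of "\<lambda>x. bu x $ m" "(x, 0 :: real ^ 'n)" "hor a (x, 0) (axis m 1)"] Cinf_differentiable[OF bu_smooth x]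
    unfolding vdd_def by (simp add: hor_def)
  then show ?thesis unfolding rb_def hdiv_def by simp
qed

lemma cc_smooth: "Cinf U cc"
proof -
  have "Cinf U (\<lambda>x. (\<Sum>m\<in>UNIV. (vdd (axis m 1) bu x + Gam a x (axis m 1) (bu x)) $ m) / (real CARD('n) - 1))"
    unfolding vdd_def Gam_def vector_add_component vec_lambda_beta divide_inverse
    by (intro Cinf_mult Cinf_const Cinf_sum Cinf_add Cinf_dd bu_smooth christoffel_smooth openU)
  then show ?thesis
    using Cinf_cong[OF openU, of cc "\<lambda>x. (\<Sum>m\<in>UNIV. (vdd (axis m 1) bu x + Gam a x (axis m 1) (bu x)) $ m) / (real CARD('n) - 1)"]
    unfolding cc_def by (simp add: rb_sum)
qed

end

context unit_form_s0
begin

lemma gin_rm_perp: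
  assumes x: "x \<in> U"
  shows "gin rm x (u - c *\<^sub>R bu x) (v - d *\<^sub>R bu x) = gin rm x u v"
  by (simp add: gin_simps rm_bu_zero[OF x])

lemma smx_perp: "x \<in> U \<Longrightarrow> smx x *v (v - c *\<^sub>R bu x) = smx x *v v"
  by (simp add: matrix_vector_mult_diff_distrib matrix_vector_mult_scaleR smx_bu_zero)

text \<open>Put S = \<open>smx x\<close>. On unit vectors w orthogonal to b the pole coefficients
  say |S w|^2 = c and (n - 3) r(w, S w) = 18 c. Polarising the first gives S^2 = -c on the
  complement of b. The second, applied to S w, then has left side -18 c^2 and right side 18 c^2, so
  c = 0.\<close>

lemma einstein_smx_zero:
  assumes n: "CARD('n) \<ge> 3" and x: "x \<in> U"
    and K: "\<And>y. (x, y) \<in> W \<Longrightarrow> ricci F x y = (real CARD('n) - 1) * K * (F x y)\<^sup>2"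
  shows "smx x *v v = 0"
proof -
  define m where "m = real CARD('n) - 1"
  define c where "c = Sg x / 4"
  let ?S = "\<lambda>v. smx x *v v"
  have lS: "linear ?S" by (rule matrix_vector_mul_linear)
  have S: "gin a x (?S w) (?S w) = c * gin a x w w" if "b x \<bullet> w = 0" for w
  proof (rule perp_homogeneous[where f = "\<lambda>u v. gin a x (?S u) (?S v)" and k = c, OF x _ _ _ that])
    show "linear (\<lambda>u. gin a x (?S u) (?S v))" "linear (\<lambda>v. gin a x (?S u) (?S v))" for u v
      using linear_compose[OF lS gin_linear1] linear_compose[OF lS gin_linear2] by (simp_all add: o_def)
  qed (use einstein_coefficients(4)[OF x _ _ K] in \<open>simp add: c_def\<close>)
  have k: "(m - 2) * gin rm x w (?S w) = 18 * c * gin a x w w" if "b x \<bullet> w = 0" for w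
  proof (rule perp_homogeneous[where f = "\<lambda>u v. (m - 2) * gin rm x u (?S v)" and k = "18 * c", OF x _ _ _ that])
    show "linear (\<lambda>u. (m - 2) * gin rm x u (?S v))" "linear (\<lambda>v. (m - 2) * gin rm x u (?S v))" for u v
      using linear_add[OF lS] linear_cmul[OF lS] by (auto intro!: linearI simp: gin_simps algebra_simps)
    show "(m - 2) * gin rm x w (?S w) = 18 * c" if w: "gin a x w w = 1" "b x \<bullet> w = 0" for w
      using einstein_coefficients(3)[OF x w K] S[OF w(2)] w(1) unfolding m_def c_def by (simp add: algebra_simps)
  qed
  obtain w where w: "gin a x w w = 1" "b x \<bullet> w = 0" using perp_exists[OF n x] by metis
  have pol: "gin a x (?S u) (?S v) = c * gin a x u v" if u: "b x \<bullet> u = 0" and v: "b x \<bullet> v = 0" for u v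
  proof -
    have "b x \<bullet> (u + v) = 0" using u v by (simp add: inner_add_right)
    from S[OF this] S[OF u] S[OF v] show ?thesis
      using gin_sym[OF x, of v u] gin_sym[OF x, of "?S v" "?S u"]
      by (simp add: linear_add[OF lS] gin_simps algebra_simps)
  qed
  have bS: "b x \<bullet> ?S u = 0" for u by (simp add: b_smx[OF x] sf_zero[OF x])
  have SS: "?S (?S w) = - c *\<^sub>R w"
  proof (rule gin_eqI[OF x])
    fix v
    let ?v = "v - (b x \<bullet> v) *\<^sub>R bu x"
    have "gin a x (?S (?S w)) v = - gin a x (?S w) (?S v)"
      unfolding gin_smx'[OF x, of "?S w"] gin_smx[OF x, of "?S w" v] by (rule sm_skew)
    also have "\<dots> = - (c * gin a x w ?v)"
      using pol[OF w(2) perp_part[OF x, of v]] unfolding smx_perp[OF x] by simp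
    also have "\<dots> = gin a x (- c *\<^sub>R w) v" using w(2) by (simp add: gin_simps gin_bu[OF x])
    finally show "gin a x (?S (?S w)) v = gin a x (- c *\<^sub>R w) v" .
  qed
  \<comment> \<open>The second relation for the vector S w, which is again orthogonal to b by
    \<open>bS\<close>.\<close>
  have "(m - 2) * gin rm x (?S w) (?S (?S w)) = 18 * c * (c * 1)"
    unfolding k[OF bS] S[OF w(2)] w(1) ..
  moreover have "(m - 2) * gin rm x (?S w) (?S (?S w)) = - c * ((m - 2) * gin rm x w (?S w))"
    unfolding SS by (simp add: gin_simps rm_sym[of x "?S w" w])
  ultimately have "c = 0" unfolding k[OF w(2)] w(1) by simp
  then have "gin a x (?S v) (?S v) = 0"
    using S[OF perp_part[OF x, of v]] unfolding smx_perp[OF x] by simp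
  then show ?thesis using gin_eq_0_iff[OF x] by simp
qed

text \<open>The coefficient of t shows that r(w, w)^2 is |w|^2 times a quadratic form. On the plane
  of two orthonormal vectors \<open>quadratic_square_ratio\<close> applies and makes r a multiple of
  the metric; comparison with a fixed \<open>w1\<close> gives one factor for the whole complement of
  b, and polarisation the bilinear statement.\<close>

lemma einstein_umbilic:
  assumes n: "CARD('n) \<ge> 3" and x: "x \<in> U"
    and K: "\<And>y. (x, y) \<in> W \<Longrightarrow> ricci F x y = (real CARD('n) - 1) * K * (F x y)\<^sup>2"
  obtains c where "\<And>u v. gin rm x u v = c * (gin a x u v - (b x \<bullet> u) * (b x \<bullet> v))"
proof -
  \<comment> \<open>The factor -3/8 comes from solving \<open>- 8 * c\<^sup>2 - C2 / 3 = 0\<close>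
    for r(w, w)^2, with \<open>c\<close> a third of r(w, w).\<close>
  define T where "T u v = - 3 / 8 * (Dr x (bu x) u v + Dr x u (bu x) v + Dr x u v (bu x))" for u v
  have lT: "linear (\<lambda>u. T u v)" "linear (T u)" for u v
    unfolding T_def by (auto intro!: linearI simp: Dr_simps x field_simps)
  note T_simps = linear_add[OF lT(1)] linear_add[OF lT(2)] linear_cmul[OF lT(1)] linear_cmul[OF lT(2)]
  have sq: "(gin rm x w w)\<^sup>2 = gin a x w w * T w w" if w: "b x \<bullet> w = 0" for w
  proof (cases "w = 0")
    case True
    then show ?thesis by (simp add: gin_simps)
  next
    case False
    define s where "s = sqrt (gin a x w w)"
    have g: "gin a x w w > 0" using gin_pos[OF x False] .
    then have s: "s > 0" "s * s = gin a x w w" unfolding s_def by simp_all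
    define w1 where "w1 = (1 / s) *\<^sub>R w"
    have ww: "w = s *\<^sub>R w1" unfolding w1_def using s by simp
    have 1: "gin a x w1 w1 = 1" unfolding w1_def using s(1) s(2)[symmetric] by (simp add: gin_simps)
    have 2: "b x \<bullet> w1 = 0" unfolding w1_def using w by simp
    have "- (8 * (gin rm x w1 w1)\<^sup>2 / 3) = Dr x (bu x) w1 w1 + Dr x w1 (bu x) w1 + Dr x w1 w1 (bu x)"
      using einstein_coefficients(2)[OF x 1 2 K] n by (simp add: power_divide)
    then have "(gin rm x w1 w1)\<^sup>2 = T w1 w1" unfolding T_def by (simp add: field_simps)
    then show ?thesis unfolding ww using 1 by (simp add: gin_simps T_simps power2_eq_square)
  qed
  have ortho: "gin rm x w1 w1 = gin rm x w2 w2" "gin rm x w1 w2 = 0"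
    if w1: "gin a x w1 w1 = 1" "b x \<bullet> w1 = 0" and w2: "gin a x w2 w2 = 1" "b x \<bullet> w2 = 0" and o: "gin a x w1 w2 = 0" for w1 w2
  proof -
    have "(gin rm x w1 w1 * X\<^sup>2 + 2 * gin rm x w1 w2 * X * Y + gin rm x w2 w2 * Y\<^sup>2)\<^sup>2
      = (X\<^sup>2 + Y\<^sup>2) * (T w1 w1 * X\<^sup>2 + 2 * ((T w1 w2 + T w2 w1) / 2) * X * Y + T w2 w2 * Y\<^sup>2)" for X Y
    proof -
      let ?w = "X *\<^sub>R w1 + Y *\<^sub>R w2"
      have "gin rm x ?w ?w = gin rm x w1 w1 * X\<^sup>2 + 2 * gin rm x w1 w2 * X * Y + gin rm x w2 w2 * Y\<^sup>2"
        using rm_sym[of x w2 w1] by (simp add: gin_simps power2_eq_square algebra_simps)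
      moreover have "gin a x ?w ?w = X\<^sup>2 + Y\<^sup>2"
        using w1 w2 o gin_sym[OF x, of w2 w1] by (simp add: gin_simps power2_eq_square)
      moreover have "T ?w ?w = T w1 w1 * X\<^sup>2 + 2 * ((T w1 w2 + T w2 w1) / 2) * X * Y + T w2 w2 * Y\<^sup>2"
        by (simp add: T_simps power2_eq_square algebra_simps)
      moreover have "b x \<bullet> ?w = 0" using w1 w2 by (simp add: inner_add_right)
      ultimately show ?thesis using sq[of ?w] by simp
    qed
    from quadratic_square_ratio[OF this] show "gin rm x w1 w1 = gin rm x w2 w2" "gin rm x w1 w2 = 0" by auto
  qed
  obtain w1 where w1: "gin a x w1 w1 = 1" "b x \<bullet> w1 = 0" using perp_exists[OF n x] by metis
  define c where "c = gin rm x w1 w1"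
  have perp: "gin rm x w w = c * gin a x w w" if w: "b x \<bullet> w = 0" for w
  proof -
    define t where "t = gin a x w w1"
    define q where "q = w - t *\<^sub>R w1"
    have wq: "w = t *\<^sub>R w1 + q" unfolding q_def by simp
    have q: "b x \<bullet> q = 0" "gin a x q w1 = 0" "gin a x w1 q = 0"
      using w w1 gin_sym[OF x, of w1 w] unfolding q_def t_def by (simp_all add: inner_diff_right gin_simps)
    have r: "gin rm x q q = c * gin a x q q \<and> gin rm x w1 q = 0"
    proof (cases "q = 0")
      case False
      define s where "s = sqrt (gin a x q q)"
      have s: "s > 0" "s * s = gin a x q q" unfolding s_def using gin_pos[OF x False] by simp_all
      define w2 where "w2 = (1 / s) *\<^sub>R q"
      have qw: "q = s *\<^sub>R w2" unfolding w2_def using s by simp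
      have "gin a x w2 w2 = 1" "b x \<bullet> w2 = 0" "gin a x w1 w2 = 0"
        unfolding w2_def using s(1) s(2)[symmetric] q by (simp_all add: gin_simps)
      from ortho[OF w1 this] \<open>gin a x w2 w2 = 1\<close> show ?thesis unfolding qw c_def by (simp add: gin_simps)
    qed (simp add: gin_simps)
    then show ?thesis
      unfolding wq using q w1 rm_sym[of x q w1] by (simp add: gin_simps c_def[symmetric] algebra_simps)
  qed
  have diag: "gin rm x v v = c * (gin a x v v - (b x \<bullet> v) * (b x \<bullet> v))" for v
    using perp[OF perp_part[OF x, of v]] unfolding gin_rm_perp[OF x]
    by (simp add: gin_simps gin_bu[OF x] gin_bu'[OF x] b_bu[OF x] algebra_simps)
  have "gin rm x u v = c * (gin a x u v - (b x \<bullet> u) * (b x \<bullet> v))" for u v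
    using diag[of "u + v"] diag[of u] diag[of v] rm_sym[of x v u] gin_sym[OF x, of v u]
    by (simp add: gin_simps inner_add_right algebra_simps)
  then show thesis by (rule that)
qed

lemma umbilic_cc:
  assumes n: "CARD('n) \<ge> 3" and x: "x \<in> U" and S: "\<And>v. smx x *v v = 0"
    and c: "\<And>u v. gin rm x u v = c * (gin a x u v - (b x \<bullet> u) * (b x \<bullet> v))"
  shows "c = cc x"
proof -
  have "vdd u bu x + Gam a x u (bu x) = c *\<^sub>R (u - (b x \<bullet> u) *\<^sub>R bu x)" for u
  proof (rule gin_eqI[OF x])
    fix v
    have "gin sm x v u = 0" unfolding gin_smx[OF x, symmetric] S by (simp add: gin_simps)
    then show "gin a x (vdd u bu x + Gam a x u (bu x)) v = gin a x (c *\<^sub>R (u - (b x \<bullet> u) *\<^sub>R bu x)) v"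
      unfolding cov_bu[OF x] c using gin_sym[OF x, of u v] by (simp add: gin_simps gin_bu'[OF x])
  qed
  then have "rb x = (\<Sum>m\<in>UNIV. c * (1 - b x $ m * bu x $ m))"
    unfolding rb_sum[OF x] by (simp add: inner_axis)
  also have "\<dots> = c * (real CARD('n) - b x \<bullet> bu x)"
    unfolding inner_vec_def by (simp add: sum_distrib_left[symmetric] sum_subtractf)
  finally show ?thesis unfolding cc_def b_bu[OF x] using n by simp
qed

end

section \<open>The differential equation for c and the Ricci tensor of \<alpha>\<close>

locale unit_form_warped = unit_form_s0 U a b for U :: "(real ^ 'n::finite) set" and a b +
  assumes smx_zero: "\<And>x v. x \<in> U \<Longrightarrow> smx x *v v = 0"
    and umbilic: "\<And>x u v. x \<in> U \<Longrightarrow> gin rm x u v = cc x * (gin a x u v - (b x \<bullet> u) * (b x \<bullet> v))"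
begin

lemma dd_hor_r00_warped:
  assumes p: "p \<in> W"
  shows "dd (hor a p v) r00 p = dd v cc (fst p) * (Af p - be p ^ 2) - 2 * cc (fst p) * be p * gin rm (fst p) (snd p) v"
proof -
  note x = W_U[OF p]
  have d: "cc differentiable (at (fst p))" "Af differentiable (at p)" "be differentiable (at p)"
    using Cinf_differentiable[OF cc_smooth x] Cinf_differentiable[OF Af_smooth_W p] Cinf_differentiable[OF be_smooth_W p] by auto
  have "dd (hor a p v) r00 p = dd (hor a p v) (\<lambda>p. cc (fst p) * (Af p - be p * be p)) p"
    by (rule dd_transform[OF open_W p]) (simp add: r00_def umbilic W_U Af_def be_def)
  also have "\<dots> = dd v cc (fst p) * (Af p - be p ^ 2) - 2 * cc (fst p) * be p * dd (hor a p v) be p"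
    using d dd_fst[OF d(1), of "hor a p v"] dd_hor_Af[OF x, of v]
    by (simp add: dd_mult dd_diff diff_fst hor_def power2_eq_square algebra_simps)
  also have "dd (hor a p v) be p = gin rm (fst p) (snd p) v"
    unfolding dd_hor_be[OF x] gin_smx[OF x, symmetric] smx_zero[OF x] by (simp add: gin_simps)
  finally show ?thesis .
qed

text \<open>Now s = 0 and \<chi> = c / 3 depends on \<open>x\<close> only, so the Ricci curvature of
  F on the plane has no poles left and is polynomial in t and u. The points t = 0 and t = 1/2, -1/2
  with both signs of u determine all the unknowns.\<close>

lemma einstein_warped:
  assumes n: "CARD('n) \<ge> 3" and x: "x \<in> U" and w: "gin a x w w = 1" "b x \<bullet> w = 0"
    and K: "\<And>y. (x, y) \<in> W \<Longrightarrow> ricci F x y = 0"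
  defines "m \<equiv> real CARD('n) - 1"
  shows "dd (bu x) cc x = - 2 / 3 * (cc x)\<^sup>2" "dd w cc x = 0"
    "RB x w w = (2 / 3 - m) * (cc x)\<^sup>2" "RB x (bu x) (bu x) = RB x w w + 2 / 3 * (m - 1) * (cc x)\<^sup>2"
    "RB x (bu x) w + RB x w (bu x) = 0"
proof -
  define c where "c = cc x / 3"
  define cb where "cb = dd (bu x) cc x"
  define cw where "cw = dd w cc x"
  define Rb where "Rb = RB x (bu x) (bu x)"
  define Rw where "Rw = RB x w w"
  define Rm where "Rm = RB x (bu x) w + RB x w (bu x)"
  have c3: "cc x = 3 * c" by (simp add: c_def)
  have m: "m \<noteq> 0" unfolding m_def using n by simp
  have X: "t\<^sup>2 * Rb + t * u * Rm + D * Rw + 2 * (cb / 3 + c * (m * (3 * c))) - 2 * (3 * c * D * c + t * ((t * cb + u * cw) / 3)) + 4 * c\<^sup>2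
     - (2 * t * c)\<^sup>2 + m * (((1 - 2 * t) * c)\<^sup>2 - ((1 - 2 * t) * ((t * cb + u * cw) / 3) - 2 * (3 * c * D) * c) + 2 * (c * ((t - 2) * c))) = 0"
    if u: "u\<^sup>2 = D" and Du: "D = 1 - t\<^sup>2" and D: "D > 0" for t u D
  proof -
    define y where "y = t *\<^sub>R bu x + u *\<^sub>R w"
    let ?p = "(x, y)"
    have u0: "u \<noteq> 0" using u D by auto
    have p: "?p \<in> W" using frame_point(3)[OF x w u0] unfolding y_def .
    have s0: "s0 ?p = 0" using s0_zero x by simp
    have alp: "al ?p = 1" unfolding al_def y_def frame_point(1)[OF x w] u Du by simp
    have bep: "be ?p = t" unfolding y_def frame_point(2)[OF x w] ..
    have syp: "sy ?p = 0" unfolding sy_def using smx_zero[OF x] by simp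
    have Afp: "Af ?p = 1" unfolding y_def frame_point(1)[OF x w] u Du by simp
    have r00p: "r00 ?p = 3 * c * D"
      unfolding r00_def using umbilic[OF x, of y y] Afp bep by (simp add: Af_def be_def c3 Du power2_eq_square)
    have E0p: "E0 ?p = 0"
    proof -
      have "mdd u smx x *v y = 0" for u
      proof -
        have "vdd u (\<lambda>z. smx z *v y) x = vdd u (\<lambda>_. 0) x"
          by (rule vdd_transform[OF openU x]) (simp add: smx_zero)
        then show ?thesis using vdd_matvec[OF smx_mdiff[OF x] vdiff_const, of u y] by simp
      qed
      then show ?thesis using E0_eq[of ?p] x unfolding E0l_def by (simp add: smx_zero Gam_simps)
    qed
    have om: "sf x \<bullet> v = 0" for v by (simp add: sf_zero[OF x])
    have Sg: "Sg x = 0" using E0l_bu[OF x] E0_eq[of "(x, bu x)"]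
    proof -
      have "smx x $ i $ j = 0" for i j using matvec_axis_nth[of "smx x" j i] smx_zero[OF x] by simp
      then show ?thesis unfolding Sg_def by simp
    qed
    have rb: "rb x = m * (3 * c)" unfolding c_def cc_def m_def[symmetric] using m by simp
    have D1: "1\<^sup>2 - t\<^sup>2 = D" by (simp add: Du)
    have RBy: "RB x y y = t\<^sup>2 * Rb + t * u * Rm + D * Rw"
      unfolding y_def u[symmetric] Rb_def Rw_def Rm_def by (simp add: RB_simps x algebra_simps power2_eq_square)
    have cc1: "3 * c * D / (3 * D) = c" using D by simp
    have ryb: "gin rm x y (bu x) = 0" by (rule rm_bu_zero(2)[OF x])
    have ryy: "gin rm x y y = 3 * c * D" using r00p unfolding r00_def by simp
    have cy: "dd y cc x = t * cb + u * cw"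
      unfolding y_def cb_def cw_def using Cinf_differentiable[OF cc_smooth x] by (simp add: dd_dir_add dd_dir_scaleR)
    have hb: "dd (hor a ?p (bu x)) r00 ?p = cb * D"
      using dd_hor_r00_warped[OF p, of "bu x"] Afp bep by (simp add: ryb Du cb_def)
    have hy: "dd (hor a ?p y) r00 ?p = (t * cb + u * cw) * D - 2 * (3 * c) * t * (3 * c * D)"
      using dd_hor_r00_warped[OF p, of y] Afp bep by (simp add: ryy Du cy c3)
    have Db: "(cb * D - 2 * l * covf a sf x y (bu x)) / (3 * D) = cb / 3" for l
      unfolding covf_sf_zero[OF x] using D by simp
    have Dy: "((t * cb + u * cw) * D - 2 * (3 * c) * t * (3 * c * D) - 2 * l * covf a sf x y y) / (3 * D)
       + 2 * c * t * (3 * c * D) / D = (t * cb + u * cw) / 3" for l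
      unfolding covf_sf_zero[OF x] using D by (simp add: field_simps power2_eq_square)
    note R = ricci_F[OF p s0, unfolded fst_conv snd_conv alp bep r00p syp E0p hb hy smx_bu_zero[OF x] om Sg rb D1 Db Dy RBy cc1, folded m_def]
    have "ricci F x y = t\<^sup>2 * Rb + t * u * Rm + D * Rw + 2 * (cb / 3 + c * (m * (3 * c))) - 2 * (3 * c * D * c + t * ((t * cb + u * cw) / 3)) + 4 * c\<^sup>2
     - (2 * t * c)\<^sup>2 + m * (((1 - 2 * t) * c)\<^sup>2 - ((1 - 2 * t) * ((t * cb + u * cw) / 3) - 2 * (3 * c * D) * c) + 2 * (c * ((t - 2) * c)))"
      unfolding R by (simp add: gin_simps)
    then show ?thesis using K[OF p] by simp
  qed
  \<comment> \<open>The value of u that belongs to t = 1/2 and t = -1/2.\<close>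
  define v where "v = sqrt (3 / 4 :: real)"
  have v: "v\<^sup>2 = 3 / 4" "(- v)\<^sup>2 = 3 / 4" "v > 0" unfolding v_def by simp_all
  note X1 = X[of 1 1 0] X[of "-1" 1 0] X[of v "3/4" "1/2"] X[of "-v" "3/4" "1/2"] X[of v "3/4" "-1/2"] X[of "-v" "3/4" "-1/2"]
  have e1: "Rw + 2 / 3 * cb + 9 * m * c\<^sup>2 - 2 * c\<^sup>2 + m * cw / 3 = 0"
    using X1(2) by (simp add: power2_eq_square algebra_simps)
  have e1': "Rw + 2 / 3 * cb + 9 * m * c\<^sup>2 - 2 * c\<^sup>2 - m * cw / 3 = 0"
    using X1(1) by (simp add: power2_eq_square algebra_simps)
  have "m * cw = 0" using e1 e1' by linarith
  then have cw: "cw = 0" using m by simp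
  have h: "3 / 4 = 1 - (1 / 2 :: real)\<^sup>2" "(3 / 4 :: real) > 0" "3 / 4 = 1 - (- 1 / 2 :: real)\<^sup>2"
    by (simp_all add: power2_eq_square)
  have e2: "Rb / 4 + v * Rm / 2 + 3 / 4 * Rw + cb / 2 - 3 / 2 * c\<^sup>2 + 15 / 2 * (m * c\<^sup>2) = 0"
    using X1(3)[OF v(1) h(1) h(2)] unfolding cw by (simp add: power2_eq_square field_simps)
  have e2': "Rb / 4 - v * Rm / 2 + 3 / 4 * Rw + cb / 2 - 3 / 2 * c\<^sup>2 + 15 / 2 * (m * c\<^sup>2) = 0"
    using X1(4)[OF v(2) h(1) h(2)] unfolding cw by (simp add: power2_eq_square field_simps)
  have e3: "Rb / 4 - v * Rm / 2 + 3 / 4 * Rw + cb / 2 - 3 / 2 * c\<^sup>2 + 19 / 2 * (m * c\<^sup>2) + m * cb / 3 = 0"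
    using X1(5)[OF v(1) h(3) h(2)] unfolding cw by (simp add: power2_eq_square field_simps)
  have vR: "v * Rm = 0" using e2 e2' by linarith
  then show "RB x (bu x) w + RB x w (bu x) = 0" unfolding Rm_def using v(3) by simp
  have "m * (6 * c\<^sup>2 + cb) = 0" using e2' e3 vR by (simp add: algebra_simps)
  then have cb: "cb = - 6 * c\<^sup>2" using m by simp
  have cq: "c\<^sup>2 = (cc x)\<^sup>2 / 9" unfolding c_def by (simp add: power_divide)
  show "dd (bu x) cc x = - 2 / 3 * (cc x)\<^sup>2" using cb cq unfolding cb_def by simp
  show "dd w cc x = 0" using cw unfolding cw_def .
  have Rw: "Rw = 6 * c\<^sup>2 - 9 * (m * c\<^sup>2)" using e1 cb cw by simp
  then show "RB x w w = (2 / 3 - m) * (cc x)\<^sup>2" unfolding cq Rw_def by (simp add: algebra_simps)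
  have "Rb = Rw + 6 * (m * c\<^sup>2) - 6 * c\<^sup>2" using e2 vR cb Rw by linarith
  then show "RB x (bu x) (bu x) = RB x w w + 2 / 3 * (m - 1) * (cc x)\<^sup>2"
    unfolding cq Rb_def Rw_def by (simp add: field_simps)
qed

end

context unit_form
begin

text \<open>The three stages are run one after another on the whole chart, each entering the next
  locale. The formulas for c and the Ricci tensor, known in planes containing b, then cover all
  vectors because every vector lies in such a plane.\<close>

theorem einstein_unit:
  assumes n: "CARD('n) \<ge> 3"
    and E: "\<And>x y. x \<in> U \<Longrightarrow> nondegenerate_at F x y \<Longrightarrow> ricci F x y = (real CARD('n) - 1) * K x * (F x y)\<^sup>2"
  shows "unit_form_warped U a b" "\<And>x. x \<in> U \<Longrightarrow> K x = 0"
    "\<And>x v. x \<in> U \<Longrightarrow> dd v cc x = - 2 / 3 * (cc x)\<^sup>2 * (b x \<bullet> v)"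
    "\<And>x y. x \<in> U \<Longrightarrow> RB x y y = (5 / 3 - real CARD('n)) * (cc x)\<^sup>2 * gin a x y y
      + 2 / 3 * (real CARD('n) - 2) * (cc x)\<^sup>2 * (b x \<bullet> y)\<^sup>2"
proof -
  have E': "ricci F x y = (real CARD('n) - 1) * K x * (F x y)\<^sup>2" if "x \<in> U" "(x, y) \<in> W" for x y
    using E[OF that(1)] nondegenerate_W[OF that(2)] by simp
  interpret s0: unit_form_s0 U a b
    by unfold_locales (rule sf_zeroI[OF _ einstein_smx_bu[OF n _ E']])
  show K0: "K x = 0" if x: "x \<in> U" for x
  proof -
    obtain w where "gin a x w w = 1" "b x \<bullet> w = 0" using perp_exists[OF n x] by metis
    from s0.einstein_coefficients(1)[OF x this E'[OF x]] show ?thesis using n by simp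
  qed
  show 1: "unit_form_warped U a b"
  proof
    show S: "smx x *v v = 0" if "x \<in> U" for x v
      by (rule s0.einstein_smx_zero[OF n that E'[OF that]])
    show "gin rm x u v = cc x * (gin a x u v - (b x \<bullet> u) * (b x \<bullet> v))" if x: "x \<in> U" for x u v
    proof -
      obtain c where c: "\<And>u v. gin rm x u v = c * (gin a x u v - (b x \<bullet> u) * (b x \<bullet> v))"
        using s0.einstein_umbilic[OF n x E'[OF x]] by blast
      then have "c = cc x" by (rule s0.umbilic_cc[OF n x S[OF x]])
      with c show ?thesis by simp
    qed
  qed
  interpret w: unit_form_warped U a b by (rule 1)
  have E0: "ricci F x y = 0" if "x \<in> U" "(x, y) \<in> W" for x y
    using E'[OF that] K0[OF that(1)] by simp
  let ?n = "real CARD('n)"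
  have both: "dd v cc x = - 2 / 3 * (cc x)\<^sup>2 * (b x \<bullet> v) \<and> RB x v v = (5 / 3 - ?n) * (cc x)\<^sup>2 * gin a x v v
      + 2 / 3 * (?n - 2) * (cc x)\<^sup>2 * (b x \<bullet> v)\<^sup>2" if x: "x \<in> U" for x v
  proof -
    define q where "q = v - (b x \<bullet> v) *\<^sub>R bu x"
    define t where "t = b x \<bullet> v"
    have vq: "v = t *\<^sub>R bu x + q" unfolding q_def t_def by simp
    have bq: "b x \<bullet> q = 0" unfolding q_def by (rule perp_part[OF x])
    \<comment> \<open>A vector parallel to b has no orthogonal part to normalise; any unit
      \<open>w\<close> orthogonal to b then serves, with \<open>s = 0\<close>.\<close>
    obtain w s where w: "gin a x w w = 1" "b x \<bullet> w = 0" and qw: "q = s *\<^sub>R w"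
    proof (cases "q = 0")
      case True
      obtain w where "gin a x w w = 1" "b x \<bullet> w = 0" using perp_exists[OF n x] by metis
      then show ?thesis using that[of w 0] True by simp
    next
      case False
      define s where "s = sqrt (gin a x q q)"
      have s: "s > 0" "s * s = gin a x q q" unfolding s_def using gin_pos[OF x False] by simp_all
      show ?thesis
        by (rule that[of "(1 / s) *\<^sub>R q" s]) (use s(1) s(2)[symmetric] bq in \<open>simp_all add: gin_simps\<close>)
    qed
    note e = w.einstein_warped[OF n x w E0[OF x]]
    have v: "v = t *\<^sub>R bu x + s *\<^sub>R w" using vq qw by simp
    have "dd v cc x = t * dd (bu x) cc x + s * dd w cc x"
      unfolding v using Cinf_differentiable[OF cc_smooth x] by (simp add: dd_dir_add dd_dir_scaleR)
    then have A: "dd v cc x = t * (- 2 / 3 * (cc x)\<^sup>2)" using e(1,2) by simp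
    have "RB x v v = t\<^sup>2 * RB x (bu x) (bu x) + t * s * (RB x (bu x) w + RB x w (bu x)) + s\<^sup>2 * RB x w w"
    proof -
      note RB_lin = linear_add[OF RB_linear1[OF x]] linear_add[OF RB_linear2] linear_cmul[OF RB_linear1[OF x]] linear_cmul[OF RB_linear2]
      show ?thesis unfolding v by (simp add: RB_lin algebra_simps power2_eq_square)
    qed
    then have B: "RB x v v = t\<^sup>2 * ((2 / 3 - (?n - 1)) * (cc x)\<^sup>2 + 2 / 3 * ((?n - 1) - 1) * (cc x)\<^sup>2)
        + s\<^sup>2 * ((2 / 3 - (?n - 1)) * (cc x)\<^sup>2)" using e(3-5) by simp
    have C: "gin a x v v = t\<^sup>2 + s\<^sup>2"
      unfolding v using w by (simp add: gin_simps gin_bu[OF x] gin_bu'[OF x] b_bu[OF x] power2_eq_square)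
    show ?thesis unfolding A B C t_def[symmetric] by (simp add: field_simps power2_eq_square)
  qed
  then show "\<And>x v. x \<in> U \<Longrightarrow> dd v cc x = - 2 / 3 * (cc x)\<^sup>2 * (b x \<bullet> v)"
    "\<And>x y. x \<in> U \<Longrightarrow> RB x y y = (5 / 3 - real CARD('n)) * (cc x)\<^sup>2 * gin a x y y
      + 2 / 3 * (real CARD('n) - 2) * (cc x)\<^sup>2 * (b x \<bullet> y)\<^sup>2" by blast+
qed

end

section \<open>Conformal change of the metric\<close>

text \<open>Curvature at a point depends on F over a neighbourhood of it only. Nothing is assumed
  outside \<open>U\<close>, so the equality is carried through every derivative on the open
  set.\<close>

lemma ricci_cong:
  fixes F F' :: "real ^ 'n::finite \<Rightarrow> real ^ 'n \<Rightarrow> real"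
  assumes U: "open U" "x \<in> U" and eq: "\<And>x y. x \<in> U \<Longrightarrow> F x y = F' x y"
  shows "ricci F x y = ricci F' x y" "nondegenerate_at F x y = nondegenerate_at F' x y"
proof -
  have T: "open (U \<times> (UNIV :: (real ^ 'n) set))" using U(1) by (simp add: open_Times)
  have DX: "dx k f x y = dx k g x y" and DY: "dy k f x y = dy k g x y"
    if "\<And>x y. x \<in> U \<Longrightarrow> f x y = g x y" "x \<in> U" for k f g x and y :: "real ^ 'n"
    unfolding dx_dd dy_dd using that
    by (auto intro!: dd_transform[OF T])
  have e0: "energy F x y = energy F' x y" if "x \<in> U" for x y using eq that by (simp add: energy_def)
  have e1: "dy l (energy F) x y = dy l (energy F') x y" if "x \<in> U" for l x y by (rule DY[OF e0 that])
  have e2: "dy j (dy l (energy F)) x y = dy j (dy l (energy F')) x y" if "x \<in> U" for j l x y by (rule DY[OF e1 that])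
  have e3: "dx k (dy l (energy F)) x y = dx k (dy l (energy F')) x y" if "x \<in> U" for k l x y by (rule DX[OF e1 that])
  have e4: "dx k (energy F) x y = dx k (energy F') x y" if "x \<in> U" for k x y by (rule DX[OF e0 that])
  have f: "fundamental_tensor F x y = fundamental_tensor F' x y" if "x \<in> U" for x y
    unfolding fundamental_tensor_def by (simp add: e2 that)
  have s: "spray F i x y = spray F' i x y" if "x \<in> U" for i x y
    unfolding spray_def by (simp add: f e3 e4 that)
  have s1: "dy k (spray F i) x y = dy k (spray F' i) x y" if "x \<in> U" for k i x y by (rule DY[OF s that])
  show "ricci F x y = ricci F' x y"
    unfolding ricci_def riemann_def
    using DX[OF s U(2)] DX[OF s1 U(2)] DY[OF s1 U(2)] s1[OF U(2)] s[OF U(2)] by simp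
  show "nondegenerate_at F x y = nondegenerate_at F' x y"
    unfolding nondegenerate_at_def f[OF U(2)] ..
qed

lemma scaleR_matrix_mult:
  fixes M N :: "real ^ 'n::finite ^ 'n"
  shows "(c *\<^sub>R M) ** (d *\<^sub>R N) = (c * d) *\<^sub>R (M ** N)"
  by (simp add: matrix_matrix_mult_def vec_eq_iff sum_distrib_left mult_ac)

lemma matrix_inv_unique:
  fixes M N :: "real ^ 'n::finite ^ 'n"
  assumes "M ** N = mat 1" "N ** M = mat 1"
  shows "matrix_inv M = N"
proof -
  have "\<exists>B. M ** B = mat 1 \<and> B ** M = mat 1" using assms by blast
  then have i: "M ** matrix_inv M = mat 1 \<and> matrix_inv M ** M = mat 1"
    unfolding matrix_inv_def by (rule someI_ex)
  have "matrix_inv M = matrix_inv M ** (M ** N)" using assms by simp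
  also have "\<dots> = N" using i by (simp add: matrix_mul_assoc)
  finally show ?thesis .
qed

context metric_chart
begin

text \<open>Koszul's formula for constant vector fields, whose brackets vanish. It determines
  \<open>Gam\<close> from derivatives of the metric without components, which suits both conformal
  and coordinate changes.\<close>

lemma koszul:
  assumes x: "x \<in> U"
  shows "2 * gin a x (Gam a x u v) z = gin (mdd u a) x v z + gin (mdd v a) x u z - gin (mdd z a) x u v"
proof -
  have e: "gin (mdd u a) x v w = gin a x (Gam a x u v) w + gin a x v (Gam a x u w)" for u v w
    using gin_compat[OF x, of u v w] dd_gin_const[OF mdiff_a[OF x], of u v w] by simp
  show ?thesis unfolding e Gam_sym[OF x, of v u] Gam_sym[OF x, of z u] Gam_sym[OF x, of z v]
    using gin_sym[OF x, of "Gam a x u z" v] by (simp add: gin_sym[OF x, of u])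
qed

lemma form_norm_gin: "form_norm a w x = sqrt (w x \<bullet> (matrix_inv (a x) *v w x))"
proof -
  have "(\<Sum>i\<in>UNIV. \<Sum>j\<in>UNIV. matrix_inv (a x) $ i $ j * w x $ i * w x $ j) = gin (\<lambda>x. matrix_inv (a x)) x (w x) (w x)"
    unfolding gin_sum ..
  then show ?thesis unfolding form_norm_def gin_def by simp
qed

end

locale form_chart = metric_chart U a for U :: "(real ^ 'n::finite) set" and a +
  fixes b :: "real ^ 'n \<Rightarrow> real ^ 'n"
  assumes b_smooth: "\<And>i. Cinf U (\<lambda>x. b x $ i)"
    and b_nonzero: "\<And>x. x \<in> U \<Longrightarrow> b x \<noteq> 0"
begin

abbreviation "f \<equiv> form_norm a b"

lemma f_radicand_pos: "x \<in> U \<Longrightarrow> b x \<bullet> (matrix_inv (a x) *v b x) > 0"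
proof -
  assume x: "x \<in> U"
  have "matrix_inv (a x) *v b x \<noteq> 0" using a_ai_vec[OF x, of "b x"] b_nonzero[OF x] by auto
  from gin_pos[OF x this] show ?thesis using gin_ai'[OF x] by simp
qed

lemma f_pos: "x \<in> U \<Longrightarrow> f x > 0"
  unfolding form_norm_gin using f_radicand_pos by simp

lemma f_smooth: "Cinf U f"
proof -
  have "Cinf U (\<lambda>x. b x \<bullet> (matrix_inv (a x) *v b x))"
    unfolding inner_vec_def inner_real_def matrix_vector_mult_def vec_lambda_beta
    by (intro Cinf_sum Cinf_mult b_smooth ai_smooth openU)
  then show ?thesis unfolding form_norm_gin[abs_def] using f_radicand_pos
    by (intro Cinf_sqrt openU)
qed

text \<open>The fourth power arises because \<alpha> is multiplied by the square of the length of
  \<beta>. The inverse metric then scales by \<open>1 / f x ^ 4\<close>, just enough to give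
  \<open>b'\<close> unit length.\<close>

definition a' :: "real ^ 'n \<Rightarrow> real ^ 'n ^ 'n" where "a' x = f x ^ 4 *\<^sub>R a x"
definition b' :: "real ^ 'n \<Rightarrow> real ^ 'n" where "b' x = f x *\<^sub>R b x"

lemma gin_a': "gin a' x v w = f x ^ 4 * gin a x v w"
  unfolding a'_def gin_def by (simp add: scaleR_matrix_vector_assoc[symmetric])

lemma ai': "x \<in> U \<Longrightarrow> matrix_inv (a' x) = (1 / f x ^ 4) *\<^sub>R matrix_inv (a x)"
  unfolding a'_def using f_pos[of x]
  by (intro matrix_inv_unique) (simp_all add: scaleR_matrix_mult ai_left ai_right)

end

lemma raise_eq: "raise a w x = matrix_inv (a x) *v w x"
  by (simp add: raise_def vec_eq_iff matrix_vector_mult_def)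

lemma r_tensor_sum:
  assumes "vdiff b x"
  shows "(\<Sum>i\<in>UNIV. \<Sum>j\<in>UNIV. r_tensor a b i j x * v $ i * w $ j) = 1 / 2 * (covf a b x v w + covf a b x w v)"
proof -
  have "covf a b x w v = (\<Sum>i\<in>UNIV. \<Sum>j\<in>UNIV. covd a b j i x * v $ i * w $ j)"
    unfolding covf_covd[OF assms] by (subst sum.swap) (simp add: mult_ac)
  then show ?thesis unfolding covf_covd[OF assms, of a v w] r_tensor_def
    by (simp add: sum.distrib[symmetric] sum_distrib_left algebra_simps)
qed

lemma s_tensor_sum:
  assumes "vdiff b x"
  shows "(\<Sum>i\<in>UNIV. \<Sum>j\<in>UNIV. s_tensor a b i j x * v $ i * w $ j) = 1 / 2 * (covf a b x v w - covf a b x w v)"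
proof -
  have "covf a b x w v = (\<Sum>i\<in>UNIV. \<Sum>j\<in>UNIV. covd a b j i x * v $ i * w $ j)"
    unfolding covf_covd[OF assms] by (subst sum.swap) (simp add: mult_ac)
  then show ?thesis unfolding covf_covd[OF assms, of a v w] s_tensor_def
    by (simp add: sum_subtractf[symmetric] sum_distrib_left algebra_simps)
qed

lemma s_form_inner:
  assumes "vdiff b x"
  shows "s_form a b x \<bullet> w = 1 / 2 * (covf a b x (raise a b x) w - covf a b x w (raise a b x))"
  unfolding s_tensor_sum[OF assms, symmetric] s_form_def inner_vec_def
  by (simp add: sum_distrib_left sum_distrib_right mult_ac) (rule sum.swap)

lemma s_mixed_matvec: "(\<Sum>j\<in>UNIV. s_mixed a b i j x * w $ j) = (matrix_inv (a x) *v (\<chi> m. \<Sum>j\<in>UNIV. s_tensor a b m j x * w $ j)) $ i"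
  unfolding s_mixed_def matrix_vector_mult_def
  by (simp add: sum_distrib_left sum_distrib_right mult_ac) (rule sum.swap)

lemma t_scalar_eq:
  "t_scalar a b x = s_form a b x \<bullet> (\<chi> m. \<Sum>j\<in>UNIV. s_mixed a b m j x * raise a b x $ j)"
proof -
  have "t_scalar a b x = (\<Sum>i\<in>UNIV. \<Sum>j\<in>UNIV. \<Sum>m\<in>UNIV. raise a b x $ i * s_tensor a b i m x * (s_mixed a b m j x * raise a b x $ j))"
    unfolding t_scalar_def t_tensor_def by (simp add: sum_distrib_left sum_distrib_right mult_ac)
  also have "\<dots> = (\<Sum>m\<in>UNIV. \<Sum>j\<in>UNIV. \<Sum>i\<in>UNIV. raise a b x $ i * s_tensor a b i m x * (s_mixed a b m j x * raise a b x $ j))"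
    by (rule sum3_reverse)
  also have "\<dots> = s_form a b x \<bullet> (\<chi> m. \<Sum>j\<in>UNIV. s_mixed a b m j x * raise a b x $ j)"
    unfolding s_form_def inner_vec_def inner_real_def vec_lambda_beta sum_product
    by (rule sum.cong[OF refl], subst sum.swap) simp
  finally show ?thesis .
qed

definition dvg :: "(real ^ 'n \<Rightarrow> real ^ 'n ^ 'n) \<Rightarrow> (real ^ 'n \<Rightarrow> real ^ 'n) \<Rightarrow> real ^ 'n::finite \<Rightarrow> real" where
  "dvg a v x = (\<Sum>m\<in>UNIV. (vdd (axis m 1) v x + Gam a x (axis m 1) (v x)) $ m)"

lemma divergence_dvg: "divergence a v x = dvg a v x"
proof -
  have "Gam a x (axis m 1) w $ m = (\<Sum>j\<in>UNIV. christoffel a m m j x * w $ j)" for m w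
  proof -
    have "Gam a x (axis m 1) w $ m = (\<Sum>j\<in>UNIV. \<Sum>i\<in>UNIV. axis m 1 $ i * (christoffel a m i j x * w $ j))"
      unfolding Gam_def by (subst sum.swap) (simp add: mult_ac)
    then show ?thesis by (simp add: sum_axis)
  qed
  then show ?thesis unfolding divergence_def dvg_def vdd_def pd_dd by simp
qed

lemma dvg_scaleR:
  assumes "f differentiable (at x)" "vdiff v x"
  shows "dvg a (\<lambda>x. f x *\<^sub>R v x) x = dd (v x) f x + f x * dvg a v x"
proof -
  have "dd (v x) f x = (\<Sum>m\<in>UNIV. v x $ m * dd (axis m 1) f x)"
    using dd_pd[OF assms(1), of "v x"] by (simp add: pd_dd)
  moreover have "(vdd (axis m 1) (\<lambda>x. f x *\<^sub>R v x) x + Gam a x (axis m 1) (f x *\<^sub>R v x)) $ m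
    = v x $ m * dd (axis m 1) f x + f x * (vdd (axis m 1) v x + Gam a x (axis m 1) (v x)) $ m" for m
    unfolding vdd_scaleR[OF assms] by (simp add: Gam_simps algebra_simps)
  ultimately show ?thesis unfolding dvg_def by (simp only: sum.distrib sum_distrib_left)
qed

lemma dvg_add:
  assumes "vdiff v x" "vdiff w x"
  shows "dvg a (\<lambda>x. v x + w x) x = dvg a v x + dvg a w x"
  unfolding dvg_def vdd_add[OF assms] by (simp add: Gam_simps sum.distrib)

lemma dvg_transform:
  assumes "open S" "x \<in> S" "\<And>y. y \<in> S \<Longrightarrow> v y = w y"
  shows "dvg a v x = dvg a w x"
  unfolding dvg_def using vdd_transform[OF assms] assms(3)[OF assms(2)] by simp

lemma inner_axis_sum: "(\<Sum>m\<in>UNIV. (w \<bullet> axis m 1) * v $ m) = (w :: real ^ 'n::finite) \<bullet> v"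
  unfolding inner_vec_def inner_real_def sum_axis ..

context metric_chart
begin

end

context form_chart
begin

lemma f_sq: "x \<in> U \<Longrightarrow> (f x)\<^sup>2 = b x \<bullet> (matrix_inv (a x) *v b x)"
  unfolding form_norm_gin using f_radicand_pos[of x] by simp

sublocale u: unit_form U a' b'
proof
  show "open U" by (rule openU)
  show "Cinf U (\<lambda>x. a' x $ i $ j)" for i j
    unfolding a'_def by (simp, intro Cinf_mult Cinf_power openU f_smooth a_smooth)
  show "a' x $ i $ j = a' x $ j $ i" if "x \<in> U" for x i j
    unfolding a'_def using a_sym[OF that, of i j] by simp
  show "0 < y \<bullet> (a' x *v y)" if "x \<in> U" "y \<noteq> 0" for x y
    using gin_a'[of x y y] a_pos[OF that] f_pos[OF that(1)] unfolding gin_def by simp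
  show "Cinf U (\<lambda>x. b' x $ i)" for i
    unfolding b'_def by (simp, intro Cinf_mult openU f_smooth b_smooth)
  show "b' x \<bullet> (matrix_inv (a' x) *v b' x) = 1" if "x \<in> U" for x
  proof -
    have "b' x \<bullet> (matrix_inv (a' x) *v b' x) = (f x)\<^sup>2 * (f x)\<^sup>2 / f x ^ 4"
      unfolding ai'[OF that] b'_def f_sq[OF that, symmetric]
      using f_sq[OF that] by (simp add: matrix_vector_mult_scaleR scaleR_matrix_vector_assoc[symmetric] power2_eq_square)
    then show ?thesis using f_pos[OF that] by (simp add: power2_eq_square power4_eq_xxxx)
  qed
qed

lemma singular_square_conformal:
  assumes x: "x \<in> U"
  shows "singular_square a b x y = singular_square a' b' x y"
proof -
  have al: "alpha a' x y = (f x)\<^sup>2 * alpha a x y"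
  proof -
    have "sqrt (f x ^ 4) = (f x)\<^sup>2" by (simp add: real_sqrt_unique flip: power_mult)
    then show ?thesis unfolding alpha_gin gin_a' real_sqrt_mult by simp
  qed
  have n: "form_norm a' b' x = 1" using u.form_norm_gin[of b' x] u.b_unit[OF x] by simp
  have p: "pairing b' x y = f x * pairing b x y" unfolding pairing_def b'_def by (simp add: sum_distrib_left mult_ac)
  have "f x \<noteq> 0" using f_pos[OF x] by simp
  then show ?thesis
    unfolding singular_square_def al n p
    by (cases "alpha a x y = 0") (simp_all add: field_simps power2_eq_square)
qed

text \<open>This is - d log f. As a = f^(-4) a', the exponent phi in a = e^(2 phi) a' has d phi = 2
  \<open>up\<close>, the source of the factors 2 below.\<close>

definition up :: "real ^ 'n \<Rightarrow> real ^ 'n" where "up x = (\<chi> i. - pd i f x / f x)"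
definition V :: "real ^ 'n \<Rightarrow> real ^ 'n" where "V x = matrix_inv (a' x) *v up x"
definition ub :: "real ^ 'n \<Rightarrow> real" where "ub x = up x \<bullet> u.bu x"

lemma up_smooth: "Cinf U (\<lambda>x. up x $ i)"
  unfolding up_def pd_dd vec_lambda_beta using f_pos
  by (intro Cinf_divide Cinf_minus Cinf_dd f_smooth openU) force

lemma V_smooth: "Cinf U (\<lambda>x. V x $ i)"
  unfolding V_def matrix_vector_mult_def vec_lambda_beta
  by (intro Cinf_sum Cinf_mult openU u.ai_smooth up_smooth)

lemma ub_smooth: "Cinf U ub"
  unfolding ub_def[abs_def] inner_vec_def inner_real_def
  by (intro Cinf_sum Cinf_mult openU u.bu_smooth up_smooth)

lemmas f_diff = Cinf_differentiable[OF f_smooth] and ub_diff = Cinf_differentiable[OF ub_smooth]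
lemmas up_vdiff = u.vdiffI[OF up_smooth] and V_vdiff = u.vdiffI[OF V_smooth]

lemma dd_f: "x \<in> U \<Longrightarrow> dd v f x = - f x * (up x \<bullet> v)"
  unfolding up_def inner_vec_def dd_pd[OF f_diff] using f_pos[of x]
  by (simp add: sum_distrib_left sum_negf mult_ac)

lemma gin_V: "x \<in> U \<Longrightarrow> gin a' x (V x) v = up x \<bullet> v" "x \<in> U \<Longrightarrow> gin a' x v (V x) = up x \<bullet> v"
  unfolding V_def by (simp_all add: u.gin_ai u.gin_ai' inner_commute)

lemma b'_V: "x \<in> U \<Longrightarrow> b' x \<bullet> V x = ub x"
  unfolding ub_def using gin_V(2)[of x "u.bu x"] by (simp add: u.gin_bu')

lemma Gam_conformal:
  assumes x: "x \<in> U"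
  shows "Gam a x v w = Gam a' x v w + 2 *\<^sub>R ((up x \<bullet> v) *\<^sub>R w + (up x \<bullet> w) *\<^sub>R v - gin a' x v w *\<^sub>R V x)"
proof (rule u.gin_eqI[OF x])
  fix z
  \<comment> \<open>Differentiating the conformal factor f^4 produces -4 \<open>up\<close>; this is
    the only difference between the two Koszul formulas.\<close>
  have m: "gin (mdd v a') x p q = f x ^ 4 * gin (mdd v a) x p q - 4 * (up x \<bullet> v) * gin a' x p q" for v p q
  proof -
    have e: "dd v (\<lambda>x. f x ^ 4 * a x $ i $ j) x = f x ^ 4 * mdd v a x $ i $ j - 4 * (up x \<bullet> v) * (f x ^ 4 * a x $ i $ j)" for i j
    proof -
      have d4: "(\<lambda>x. f x ^ 4) differentiable (at x)" using f_diff[OF x] by simp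
      have "dd v (\<lambda>x. f x ^ 4) x = 4 * f x ^ 3 * dd v f x"
        by (rule dd_eqI) (use dd_DERIV[OF f_diff[OF x], of v] in \<open>auto intro!: derivative_eq_intros\<close>)
      also have "\<dots> = - 4 * (up x \<bullet> v) * f x ^ 4"
        unfolding dd_f[OF x] by (simp add: power_numeral_reduce)
      finally show ?thesis
        unfolding dd_mult[OF d4 a_diff[OF x]] by (simp add: mdd_def)
    qed
    then have "mdd v a' x = f x ^ 4 *\<^sub>R mdd v a x - (4 * (up x \<bullet> v)) *\<^sub>R a' x"
      unfolding mdd_def[of v a'] a'_def by (simp add: vec_eq_iff)
    then show ?thesis unfolding gin_def
      by (simp add: matrix_vector_mult_diff_rdistrib inner_diff_right scaleR_matrix_vector_assoc[symmetric])
  qed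
  have "2 * gin a' x (Gam a' x v w) z = f x ^ 4 * (2 * gin a x (Gam a x v w) z)
     - 4 * ((up x \<bullet> v) * gin a' x w z + (up x \<bullet> w) * gin a' x v z - (up x \<bullet> z) * gin a' x v w)"
    unfolding u.koszul[OF x] koszul[OF x] m by (simp add: algebra_simps)
  then show "gin a' x (Gam a x v w) z
    = gin a' x (Gam a' x v w + 2 *\<^sub>R ((up x \<bullet> v) *\<^sub>R w + (up x \<bullet> w) *\<^sub>R v - gin a' x v w *\<^sub>R V x)) z"
    unfolding gin_a'[of x "Gam a x v w"] by (simp add: gin_simps gin_V[OF x]) (simp add: algebra_simps)
qed

text \<open>By \<open>Gam_conformal\<close> the spray of \<open>a\<close> deviates from that of
  \<open>a'\<close> by a quadratic multiple of \<open>V\<close> and by 2 \<open>up\<close>(y) times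
  y. This is the shape that \<open>RicOp_projective\<close> handles, so the machinery used for F
  also yields the conformal change of the Ricci curvature.\<close>

lemma ricci_conformal:
  assumes x: "x \<in> U"
  shows "ricci (alpha a) x y = u.RB x y y - 2 * gin a' x y y * dvg a' V x - 2 * (real CARD('n) - 2) * covf a' up x y y
    + 4 * (real CARD('n) - 2) * (up x \<bullet> y)\<^sup>2 - 4 * (real CARD('n) - 2) * gin a' x y y * (up x \<bullet> V x)"
proof -
  let ?p = "(x, y)"
  have p: "?p \<in> TU" "fst ?p \<in> U" using x by auto
  define Q where "Q i p = - 1 * u.Af p * V (fst p) $ i" for i p
  define P where "P p = 2 * (up (fst p) \<bullet> snd p)" for p
  have Qs: "Cinf TU (Q i)" for i
    unfolding Q_def by (intro Cinf_mult Cinf_const openTU u.Af_smooth Cinf_fst V_smooth)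
  have Ps0: "Cinf TU (\<lambda>p. up (fst p) \<bullet> snd p)"
    by (intro Cinf_inner_snd openTU Cinf_fst up_smooth)
  then have Ps: "Cinf TU P"
    unfolding P_def by (intro Cinf_mult Cinf_const openTU)
  have sp: "spray (alpha a) i (fst q) (snd q) = u.G0 i q + (Q i q + P q * snd q $ i)" if "q \<in> TU" for i q
  proof -
    have q: "fst q \<in> U" using that by auto
    show ?thesis
      unfolding spray_alpha[OF q] G0_def u.G0_def Gam_conformal[OF q] Q_def P_def u.Af_def by (simp add: algebra_simps)
  qed
  have dV: "dd v (\<lambda>p. V (fst p) $ i) q = vdd (fst v) V (fst q) $ i" if "q \<in> TU" for v i q
    using dd_fst[OF Cinf_differentiable[OF V_smooth], of q v i] that unfolding vdd_def by auto
  have dQ: "dd v (Q i) q = - dd v u.Af q * V (fst q) $ i - u.Af q * vdd (fst v) V (fst q) $ i" if "q \<in> TU" for v i q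
    unfolding Q_def using that dV[OF that, of v i]
      Cinf_differentiable[OF u.Af_smooth that] Cinf_differentiable[OF Cinf_fst[OF V_smooth] that]
    by (simp add: dd_mult dd_minus)
  have V0: "vdd 0 V z = 0" if "z \<in> U" for z using linear_0[OF vdd_linear[OF V_vdiff[OF that]]] .
  have dQv: "dd (0, w) (Q i) q = - 2 * gin a' (fst q) (snd q) w * V (fst q) $ i" if "q \<in> TU" for w i q
  proof -
    have "fst q \<in> U" using that by auto
    then show ?thesis using dQ[OF that, of "(0, w)" i] V0 by (simp add: u.dd_ver_Af)
  qed
  have dP: "dd v P q = 2 * dd v (\<lambda>p. up (fst p) \<bullet> snd p) q" if "q \<in> TU" for v q
    unfolding P_def by (rule dd_cmult[OF Cinf_differentiable[OF Ps0 that]])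
  have dPv: "dd (0, w) P q = 2 * (up (fst q) \<bullet> w)" if "q \<in> TU" for w q
  proof -
    have q: "fst q \<in> U" using that by auto
    show ?thesis unfolding dP[OF that] u.dd_ver_inner[OF q up_vdiff[OF q]] ..
  qed
  have hP: "dd (0, snd q) P q = P q" if "q \<in> TU" for q unfolding dPv[OF that] P_def ..
  have hQ: "dd (0, snd q) (Q i) q = 2 * Q i q" if "q \<in> TU" for i q
    unfolding dQv[OF that] Q_def u.Af_def by simp
  have tau: "u.vdiv Q q = - 2 * (up (fst q) \<bullet> snd q)" if "q \<in> TU" for q
  proof -
    have q: "fst q \<in> U" using that by auto
    have "u.vdiv Q q = - 2 * (\<Sum>m\<in>UNIV. V (fst q) $ m * gin a' (fst q) (snd q) (axis m 1))"
      unfolding u.vdiv_def dQv[OF that] by (simp add: sum_distrib_left sum_negf mult_ac)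
    also have "(\<Sum>m\<in>UNIV. V (fst q) $ m * gin a' (fst q) (snd q) (axis m 1)) = gin a' (fst q) (snd q) (\<Sum>m\<in>UNIV. V (fst q) $ m *\<^sub>R axis m 1)"
      unfolding linear_sum[OF gin_linear2] by (simp add: linear_cmul[OF gin_linear2])
    finally show ?thesis unfolding axis_expansion[symmetric] gin_V(2)[OF q] .
  qed
  have dtau: "dd v (u.vdiv Q) ?p = - 1 * dd v P ?p" for v
  proof -
    have "dd v (u.vdiv Q) ?p = dd v (\<lambda>p. - 1 * P p) ?p"
      by (rule dd_transform[OF openTU p(1)]) (simp add: tau P_def)
    then show ?thesis using dd_cmult[OF Cinf_differentiable[OF Ps p(1)], of v "-1"] by simp
  qed
  have hor: "dd (hor a' ?p y) P ?p = 2 * covf a' up x y y"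
    unfolding dP[OF p(1)] using u.dd_hor_inner[OF up_vdiff[OF p(2)] vdiff_snd p(2), of y] by simp
  have Qv: "(\<chi> l. Q l ?p) = - gin a' x y y *\<^sub>R V x" unfolding Q_def u.Af_def by (simp add: vec_eq_iff)
  have hd: "u.hdiv Q ?p = - gin a' x y y * dvg a' V x"
  proof -
    have "dd (hor a' ?p (axis m 1)) (Q m) ?p + Gam a' x (axis m 1) (\<chi> l. Q l ?p) $ m
      = - gin a' x y y * (vdd (axis m 1) V x + Gam a' x (axis m 1) (V x)) $ m" for m
      unfolding Qv using dQ[OF p(1), of "hor a' ?p (axis m 1)" m] u.dd_hor_Af[OF p(2)]
      by (simp add: hor_def Gam_simps u.Af_def algebra_simps)
    then show ?thesis unfolding u.hdiv_def dvg_def by (simp add: sum_distrib_left)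
  qed
  have QQ: "(\<Sum>m\<in>UNIV. \<Sum>l\<in>UNIV. dd (0, axis l 1) (Q m) ?p * dd (0, axis m 1) (Q l) ?p) = 4 * (up x \<bullet> y)\<^sup>2"
  proof -
    have e: "(\<Sum>m\<in>UNIV. V x $ m * gin a' x y (axis m 1)) = up x \<bullet> y"
      using tau[OF p(1)] unfolding u.vdiv_def dQv[OF p(1)] by (simp add: sum_negf sum_distrib_left[symmetric] mult_ac)
    have "(\<Sum>m\<in>UNIV. \<Sum>l\<in>UNIV. dd (0, axis l 1) (Q m) ?p * dd (0, axis m 1) (Q l) ?p)
      = (\<Sum>m\<in>UNIV. \<Sum>l\<in>UNIV. 4 * ((V x $ m * gin a' x y (axis m 1)) * (V x $ l * gin a' x y (axis l 1))))"
      unfolding dQv[OF p(1)] by (simp add: mult_ac)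
    also have "\<dots> = 4 * ((\<Sum>m\<in>UNIV. V x $ m * gin a' x y (axis m 1)) * (\<Sum>l\<in>UNIV. V x $ l * gin a' x y (axis l 1)))"
      unfolding sum_product by (simp add: sum_distrib_left)
    finally show ?thesis unfolding e by (simp add: power2_eq_square)
  qed
  have "ricci (alpha a) x y = RicOp (\<lambda>i q. u.G0 i q + (Q i q + P q * snd q $ i)) ?p"
    using ricci_RicOp[OF openTU p(1), of "\<lambda>i q. u.G0 i q + (Q i q + P q * snd q $ i)" "alpha a"] sp
    by (simp add: Cinf_add Cinf_mult openTU u.G0_smooth Qs Ps Cinf_snd_nth)
  also have "\<dots> = RicOp u.G0 ?p + 2 * u.hdiv Q ?p - dd (hor a' ?p y) (u.vdiv Q) ?p + 2 * dd (0, \<chi> l. Q l ?p) (u.vdiv Q) ?p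
    - (\<Sum>m\<in>UNIV. \<Sum>l\<in>UNIV. dd (0, axis l 1) (Q m) ?p * dd (0, axis m 1) (Q l) ?p)
    + (real CARD('n) - 1) * ((P ?p)\<^sup>2 - dd (hor a' ?p y) P ?p + 2 * dd (0, \<chi> l. Q l ?p) P ?p)"
    using u.RicOp_projective[OF openTU p(1) order_refl Qs Ps hQ hP] by simp
  also have "RicOp u.G0 ?p = u.RB x y y"
    using u.ricci_alpha[OF p(2)] u.ricci_alpha_RB[OF x, of y] by simp
  finally show ?thesis
    unfolding dtau hor hd QQ Qv dPv[OF p(1)] unfolding P_def by (simp add: algebra_simps power2_eq_square)
qed

end

text \<open>The left side is the Ricci curvature of \<alpha> in terms of the unit form, the right
  side the one in the theorem. With u = \<open>up\<close>, the letters \<open>A\<close>,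
  \<open>B\<close>, \<open>p\<close> stand for a'(y, y), b'(y), u(y), \<open>h\<close> for u_{0|0},
  and \<open>Q\<close> for the squared norm of the part of u orthogonal to b'. After substitution
  every term of the bracket carries the factor f^4 that the prefactor removes, leaving a polynomial
  identity.\<close>

lemma conformal_ricci_identity:
  fixes f c h :: real
  assumes f: "f \<noteq> 0"
    and defs: "C = f ^ 3 * (c + 2 * ub)" "D = - f * (c + 3 * ub)" "db = f ^ 4 * (ub * (c + 3 * ub) + 2 / 3 * c\<^sup>2 - 3 * Bb)"
      "t = - (1 / 4) * f ^ 8 * Q" "divs = 1 / 2 * f ^ 6 * (dv - Bb - ub * (n - 1) * c + (2 * n - 6) * Q)"
      "d0 = f * (p * (c + 3 * ub) + 2 / 3 * c\<^sup>2 * B - 3 * By)" "s0 = 1 / 2 * f\<^sup>2 * (p - ub * B)"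
      "s00 = 1 / 2 * f\<^sup>2 * (h - By * B - ub * c * (A - B\<^sup>2) - 6 * p * (p - ub * B) + 2 * A * Q)"
      "al2 = A / f ^ 4" "be = B / f" "Q = q - ub\<^sup>2"
  shows "(5 / 3 - n) * c\<^sup>2 * A + 2 / 3 * (n - 2) * c\<^sup>2 * B\<^sup>2 - 2 * A * dv - 2 * (n - 2) * h + 4 * (n - 2) * p\<^sup>2 - 4 * (n - 2) * A * q
    = - 1 / (9 * f ^ 4) * ((9 * (n - 1) * f ^ 2 * C ^ 2 - 2 * f ^ 6 * D ^ 2 - 6 * f ^ 4 * db + 144 * (n - 3) * t + 36 * f ^ 2 * divs) * al2
       - 2 * (n - 2) * f ^ 4 * D ^ 2 * be ^ 2 - 6 * (n - 2) * f ^ 4 * be * d0 - 72 * (n - 2) * C * be * s0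
       - 84 * (n - 2) * f ^ 2 * D * be * s0 + 288 * (n - 2) * s0 ^ 2 + 36 * (n - 2) * f ^ 2 * s00)"
proof -
  have A: "A = f ^ 4 * al2" and B: "B = f * be" using f defs(9,10) by simp_all
  let ?N = "p - ub * B" and ?c1 = "c + 2 * ub" and ?d1 = "c + 3 * ub"
  let ?G = "p * (c + 3 * ub) + 2 / 3 * c\<^sup>2 * B - 3 * By"
  let ?S = "h - By * B - ub * c * (A - B\<^sup>2) - 6 * p * (p - ub * B) + 2 * A * Q"
  let ?R = "dv - Bb - ub * (n - 1) * c + (2 * n - 6) * Q"
  let ?E = "ub * (c + 3 * ub) + 2 / 3 * c\<^sup>2 - 3 * Bb"
  have e: "9 * (n - 1) * f ^ 2 * C ^ 2 * al2 = f ^ 4 * (9 * (n - 1) * ?c1\<^sup>2 * A)"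
    "2 * f ^ 6 * D ^ 2 * al2 = f ^ 4 * (2 * ?d1\<^sup>2 * A)"
    "6 * f ^ 4 * db * al2 = f ^ 4 * (6 * ?E * A)"
    "144 * (n - 3) * t * al2 = f ^ 4 * (- 36 * (n - 3) * Q * A)"
    "36 * f ^ 2 * divs * al2 = f ^ 4 * (18 * ?R * A)"
  proof -
    have g: "k * f ^ 2 * (f ^ 3 * w)\<^sup>2 * al2 = f ^ 4 * (k * w\<^sup>2 * (f ^ 4 * al2))"
      "k * f ^ 6 * (- f * w)\<^sup>2 * al2 = f ^ 4 * (k * w\<^sup>2 * (f ^ 4 * al2))"
      "k * f ^ 4 * (f ^ 4 * w) * al2 = f ^ 4 * (k * w * (f ^ 4 * al2))"
      "144 * k * (- (1 / 4) * f ^ 8 * w) * al2 = f ^ 4 * (- 36 * k * w * (f ^ 4 * al2))"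
      "36 * f ^ 2 * (1 / 2 * f ^ 6 * w) * al2 = f ^ 4 * (18 * w * (f ^ 4 * al2))" for k w
      by (simp_all add: power_mult_distrib eval_nat_numeral mult_ac)
    show "9 * (n - 1) * f ^ 2 * C ^ 2 * al2 = f ^ 4 * (9 * (n - 1) * ?c1\<^sup>2 * A)"
      unfolding defs(1) A by (rule g(1))
    show "2 * f ^ 6 * D ^ 2 * al2 = f ^ 4 * (2 * ?d1\<^sup>2 * A)"
      unfolding defs(2) A by (rule g(2))
    show "6 * f ^ 4 * db * al2 = f ^ 4 * (6 * ?E * A)"
      unfolding defs(3) A by (rule g(3))
    show "144 * (n - 3) * t * al2 = f ^ 4 * (- 36 * (n - 3) * Q * A)"
      unfolding defs(4) A by (rule g(4))
    show "36 * f ^ 2 * divs * al2 = f ^ 4 * (18 * ?R * A)"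
      unfolding defs(5) A by (rule g(5))
  qed
  have e': "2 * (n - 2) * f ^ 4 * D ^ 2 * be ^ 2 = f ^ 4 * (2 * (n - 2) * ?d1\<^sup>2 * B\<^sup>2)"
    "6 * (n - 2) * f ^ 4 * be * d0 = f ^ 4 * (6 * (n - 2) * B * ?G)"
    "72 * (n - 2) * C * be * s0 = f ^ 4 * (36 * (n - 2) * ?c1 * B * ?N)"
    "84 * (n - 2) * f ^ 2 * D * be * s0 = f ^ 4 * (- 42 * (n - 2) * ?d1 * B * ?N)"
    "288 * (n - 2) * s0 ^ 2 = f ^ 4 * (72 * (n - 2) * ?N\<^sup>2)"
    "36 * (n - 2) * f ^ 2 * s00 = f ^ 4 * (18 * (n - 2) * ?S)"
  proof -
    show "2 * (n - 2) * f ^ 4 * D ^ 2 * be ^ 2 = f ^ 4 * (2 * (n - 2) * ?d1\<^sup>2 * B\<^sup>2)"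
      unfolding defs(2) B by (simp add: power_mult_distrib)
    show "6 * (n - 2) * f ^ 4 * be * d0 = f ^ 4 * (6 * (n - 2) * B * ?G)"
      unfolding defs(6) using B by simp
    have "C * be = f\<^sup>2 * (?c1 * B)" "f\<^sup>2 * D * be = - (f\<^sup>2 * (?d1 * B))"
      unfolding defs(1,2) B by (simp_all add: power2_eq_square power3_eq_cube)
    then have cb: "C * be = f\<^sup>2 * (?c1 * B)" and fdb: "f\<^sup>2 * D * be = - (f\<^sup>2 * (?d1 * B))" .
    have g: "72 * m * (f\<^sup>2 * (w * B)) * (1 / 2 * f\<^sup>2 * v) = f ^ 4 * (36 * m * w * B * v)"
      "84 * m * (- (f\<^sup>2 * (w * B))) * (1 / 2 * f\<^sup>2 * v) = f ^ 4 * (- 42 * m * w * B * v)" for m w v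
      by (simp_all add: eval_nat_numeral mult_ac)
    have "72 * (n - 2) * C * be * s0 = 72 * (n - 2) * (C * be) * s0" by (simp only: mult.assoc)
    also have "\<dots> = f ^ 4 * (36 * (n - 2) * ?c1 * B * ?N)"
      unfolding cb defs(7) by (rule g(1))
    finally show "72 * (n - 2) * C * be * s0 = f ^ 4 * (36 * (n - 2) * ?c1 * B * ?N)" .
    have "84 * (n - 2) * f ^ 2 * D * be * s0 = 84 * (n - 2) * (f\<^sup>2 * D * be) * s0" by (simp only: mult.assoc)
    also have "\<dots> = f ^ 4 * (- 42 * (n - 2) * ?d1 * B * ?N)"
      unfolding fdb defs(7) by (rule g(2))
    finally show "84 * (n - 2) * f ^ 2 * D * be * s0 = f ^ 4 * (- 42 * (n - 2) * ?d1 * B * ?N)" .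
    have g2: "288 * m * (1 / 2 * f\<^sup>2 * w) ^ 2 = f ^ 4 * (72 * m * w\<^sup>2)" "36 * m * f ^ 2 * (1 / 2 * f\<^sup>2 * w) = f ^ 4 * (18 * m * w)" for m w
      by (simp_all add: power_mult_distrib eval_nat_numeral mult_ac)
    show "288 * (n - 2) * s0 ^ 2 = f ^ 4 * (72 * (n - 2) * ?N\<^sup>2)"
      unfolding defs(7) by (rule g2(1))
    show "36 * (n - 2) * f ^ 2 * s00 = f ^ 4 * (18 * (n - 2) * ?S)"
      unfolding defs(8) by (rule g2(2))
  qed
  let ?Y = "9 * (n - 1) * ?c1\<^sup>2 * A - 2 * ?d1\<^sup>2 * A - 6 * ?E * A + (- 36 * (n - 3) * Q * A) + 18 * ?R * A
     - 2 * (n - 2) * ?d1\<^sup>2 * B\<^sup>2 - 6 * (n - 2) * B * ?G - 36 * (n - 2) * ?c1 * B * ?N - (- 42 * (n - 2) * ?d1 * B * ?N)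
     + 72 * (n - 2) * ?N\<^sup>2 + 18 * (n - 2) * ?S"
  have cancel: "- 1 / (9 * f ^ 4) * (f ^ 4 * w) = - w / 9" for w using f by simp
  have "- 1 / (9 * f ^ 4) * ((9 * (n - 1) * f ^ 2 * C ^ 2 - 2 * f ^ 6 * D ^ 2 - 6 * f ^ 4 * db + 144 * (n - 3) * t + 36 * f ^ 2 * divs) * al2
       - 2 * (n - 2) * f ^ 4 * D ^ 2 * be ^ 2 - 6 * (n - 2) * f ^ 4 * be * d0 - 72 * (n - 2) * C * be * s0
       - 84 * (n - 2) * f ^ 2 * D * be * s0 + 288 * (n - 2) * s0 ^ 2 + 36 * (n - 2) * f ^ 2 * s00)
     = - 1 / (9 * f ^ 4) * (f ^ 4 * ?Y)"
    unfolding left_diff_distrib[of _ _ al2] distrib_right[of _ _ al2] e e' by (simp only: right_diff_distrib distrib_left)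
  also have "\<dots> = - ?Y / 9" by (rule cancel)
  also have "\<dots> = (5 / 3 - n) * c\<^sup>2 * A + 2 / 3 * (n - 2) * c\<^sup>2 * B\<^sup>2 - 2 * A * dv - 2 * (n - 2) * h + 4 * (n - 2) * p\<^sup>2 - 4 * (n - 2) * A * q"
    unfolding defs(11) by (simp add: field_simps power2_eq_square)
  finally show ?thesis by (rule sym)
qed

section \<open>The three equations for the original metric and 1-form\<close>

locale form_chart_warped = form_chart U a b for U :: "(real ^ 'n::finite) set" and a b +
  assumes warped: "unit_form_warped U a' b'"
    and dd_cc: "\<And>x v. x \<in> U \<Longrightarrow> dd v u.cc x = - 2 / 3 * (u.cc x)\<^sup>2 * (b' x \<bullet> v)"
    and RB_warped: "\<And>x y. x \<in> U \<Longrightarrow> u.RB x y y = (5 / 3 - real CARD('n)) * (u.cc x)\<^sup>2 * gin a' x y y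
      + 2 / 3 * (real CARD('n) - 2) * (u.cc x)\<^sup>2 * (b' x \<bullet> y)\<^sup>2"
    and dim3: "CARD('n) \<ge> 3"
begin

sublocale w: unit_form_warped U a' b' by (rule warped)

text \<open>By \<open>covf_b_conf\<close>, r_00 is 1/f times c (A - B^2) - 3 p B + 2 ub A. Replacing
  p through s_0 = f^2 (p - ub B) / 2 and sorting by \<alpha>^2 = A / f^4 and \<beta>^2 = B^2 / f^2
  gives the coefficients \<open>Cf\<close> and \<open>Df\<close>.\<close>

definition Cf :: "real ^ 'n \<Rightarrow> real" where "Cf x = f x ^ 3 * (u.cc x + 2 * ub x)"
definition Df :: "real ^ 'n \<Rightarrow> real" where "Df x = - f x * (u.cc x + 3 * ub x)"

lemma Cf_smooth: "Cinf U Cf" and Df_smooth: "Cinf U Df"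
  unfolding Cf_def[abs_def] Df_def[abs_def]
  by (intro Cinf_mult Cinf_power Cinf_add Cinf_minus Cinf_const openU f_smooth u.cc_smooth ub_smooth)+

lemma covf_b'_warped: "x \<in> U \<Longrightarrow> covf a' b' x v w = u.cc x * (gin a' x v w - (b' x \<bullet> v) * (b' x \<bullet> w))"
  using w.smx_zero[of x w] u.gin_smx[of x v w] by (simp add: u.covf_b w.umbilic gin_simps)

lemma b_vdiff: "x \<in> U \<Longrightarrow> vdiff b x"
  by (rule u.vdiffI[OF b_smooth])

lemma vdd_b:
  assumes x: "x \<in> U"
  shows "vdd v b x = (1 / f x) *\<^sub>R ((up x \<bullet> v) *\<^sub>R b' x + vdd v b' x)"
proof -
  have f: "f x \<noteq> 0" using f_pos[OF x] by simp
  have "vdd v b x = vdd v (\<lambda>x. inverse (f x) *\<^sub>R b' x) x"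
    by (rule vdd_transform[OF openU x]) (use f_pos in \<open>force simp: b'_def\<close>)
  also have "\<dots> = (1 / f x) *\<^sub>R ((up x \<bullet> v) *\<^sub>R b' x + vdd v b' x)"
    using f by (subst vdd_scaleR[OF _ u.b_vdiff[OF x]])
      (simp_all add: f_diff[OF x] dd_inverse dd_f[OF x] scaleR_add_right divide_inverse)
  finally show ?thesis .
qed

lemma covf_b_conf:
  assumes x: "x \<in> U"
  shows "covf a b x v w = (1 / f x) * (u.cc x * (gin a' x v w - (b' x \<bullet> v) * (b' x \<bullet> w)) - (up x \<bullet> w) * (b' x \<bullet> v)
     - 2 * (up x \<bullet> v) * (b' x \<bullet> w) + 2 * gin a' x v w * ub x)"
proof -
  have f: "f x \<noteq> 0" using f_pos[OF x] by simp
  have b: "b x = (1 / f x) *\<^sub>R b' x" unfolding b'_def using f by simp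
  have "covf a b x v w = (1 / f x) * ((up x \<bullet> w) * (b' x \<bullet> v) + covf a' b' x v w - 2 * ((up x \<bullet> v) * (b' x \<bullet> w) + (up x \<bullet> w) * (b' x \<bullet> v) - gin a' x v w * ub x))"
    unfolding covf_def vdd_b[OF x] Gam_conformal[OF x] b
    by (simp add: inner_add_left inner_add_right inner_diff_right b'_V[OF x] add_divide_distrib diff_divide_distrib)
  then show ?thesis unfolding covf_b'_warped[OF x] by (simp add: algebra_simps)
qed

lemma ai_conf: "x \<in> U \<Longrightarrow> matrix_inv (a x) *v v = f x ^ 4 *\<^sub>R (matrix_inv (a' x) *v v)"
  unfolding ai' using f_pos[of x] by (simp add: scaleR_matrix_vector_assoc[symmetric])

lemma raise_b: "x \<in> U \<Longrightarrow> raise a b x = f x ^ 3 *\<^sub>R u.bu x"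
  unfolding raise_eq ai_conf u.bu_def b'_def using f_pos[of x]
  by (simp add: matrix_vector_mult_scaleR power_numeral_reduce)

text \<open>The unit form b' is closed, so the curl of b = b' / f comes from the derivative of f
  alone and is a wedge product of b' with \<open>up\<close>. This is the origin of the third
  equation.\<close>

lemma s_sum:
  assumes x: "x \<in> U"
  shows "(\<Sum>i\<in>UNIV. \<Sum>j\<in>UNIV. s_tensor a b i j x * v $ i * w $ j) = 1 / (2 * f x) * ((up x \<bullet> w) * (b' x \<bullet> v) - (up x \<bullet> v) * (b' x \<bullet> w))"
  unfolding s_tensor_sum[OF b_vdiff[OF x]] covf_b_conf[OF x] using f_pos[OF x] u.gin_sym[OF x, of w v]
  by (simp add: field_simps)

lemma s_form_conf:
  assumes x: "x \<in> U"
  shows "s_form a b x = (1 / 2 * (f x)\<^sup>2) *\<^sub>R (up x - ub x *\<^sub>R b' x)"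
proof -
  have f: "f x \<noteq> 0" using f_pos[OF x] by simp
  have "s_form a b x \<bullet> w = ((1 / 2 * (f x)\<^sup>2) *\<^sub>R (up x - ub x *\<^sub>R b' x)) \<bullet> w" for w
    unfolding s_form_inner[OF b_vdiff[OF x]] s_tensor_sum[OF b_vdiff[OF x], symmetric] s_sum[OF x] raise_b[OF x]
  proof -
    have "1 / (2 * f x) * ((up x \<bullet> w) * (b' x \<bullet> (f x ^ 3 *\<^sub>R u.bu x)) - (up x \<bullet> (f x ^ 3 *\<^sub>R u.bu x)) * (b' x \<bullet> w))
      = 1 / (2 * f x) * (f x ^ 3 * ((up x \<bullet> w) - ub x * (b' x \<bullet> w)))"
      using u.b_bu[OF x] by (simp add: ub_def right_diff_distrib mult_ac)
    also have "\<dots> = 1 / 2 * (f x)\<^sup>2 * ((up x \<bullet> w) - ub x * (b' x \<bullet> w))" using f by (simp add: power2_eq_square power3_eq_cube)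
    also have "\<dots> = ((1 / 2 * (f x)\<^sup>2) *\<^sub>R (up x - ub x *\<^sub>R b' x)) \<bullet> w" by (simp add: inner_diff_left)
    finally show "1 / (2 * f x) * ((up x \<bullet> w) * (b' x \<bullet> (f x ^ 3 *\<^sub>R u.bu x)) - (up x \<bullet> (f x ^ 3 *\<^sub>R u.bu x)) * (b' x \<bullet> w))
      = ((1 / 2 * (f x)\<^sup>2) *\<^sub>R (up x - ub x *\<^sub>R b' x)) \<bullet> w" .
  qed
  then show ?thesis by (subst vector_eq_rdot[symmetric]) blast
qed

lemma raise_s: "x \<in> U \<Longrightarrow> raise a (s_form a b) x = (1 / 2 * f x ^ 6) *\<^sub>R (V x - ub x *\<^sub>R u.bu x)"
  unfolding raise_eq ai_conf s_form_conf V_def u.bu_def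
  by (simp add: matrix_vector_mult_scaleR matrix_vector_mult_diff_distrib power_numeral_reduce)

lemma s_mixed_conf:
  assumes x: "x \<in> U"
  shows "(\<chi> i. \<Sum>j\<in>UNIV. s_mixed a b i j x * w $ j) = (1 / 2 * f x ^ 3) *\<^sub>R ((up x \<bullet> w) *\<^sub>R u.bu x - (b' x \<bullet> w) *\<^sub>R V x)"
proof -
  have f: "f x \<noteq> 0" using f_pos[OF x] by simp
  let ?s = "\<chi> m. \<Sum>j\<in>UNIV. s_tensor a b m j x * w $ j"
  have "?s \<bullet> v = (1 / (2 * f x)) *\<^sub>R ((up x \<bullet> w) *\<^sub>R b' x - (b' x \<bullet> w) *\<^sub>R up x) \<bullet> v" for v
  proof -
    have "?s \<bullet> v = (\<Sum>i\<in>UNIV. \<Sum>j\<in>UNIV. s_tensor a b i j x * v $ i * w $ j)"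
      unfolding inner_vec_def by (simp add: sum_distrib_left sum_distrib_right mult_ac)
    then show ?thesis unfolding s_sum[OF x] by (simp add: inner_diff_left mult_ac)
  qed
  then have s: "?s = (1 / (2 * f x)) *\<^sub>R ((up x \<bullet> w) *\<^sub>R b' x - (b' x \<bullet> w) *\<^sub>R up x)" by (subst vector_eq_rdot[symmetric]) blast
  have "(\<chi> i. \<Sum>j\<in>UNIV. s_mixed a b i j x * w $ j) = matrix_inv (a x) *v ?s"
    unfolding s_mixed_matvec by (simp add: vec_eq_iff)
  also have "\<dots> = (1 / 2 * f x ^ 3) *\<^sub>R ((up x \<bullet> w) *\<^sub>R u.bu x - (b' x \<bullet> w) *\<^sub>R V x)"
    unfolding s ai_conf[OF x] V_def u.bu_def using f
    by (simp add: matrix_vector_mult_scaleR matrix_vector_mult_diff_distrib power_numeral_reduce)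
  finally show ?thesis .
qed

lemma t_conf:
  assumes x: "x \<in> U"
  shows "t_scalar a b x = - (1 / 4) * f x ^ 8 * (up x \<bullet> V x - (ub x)\<^sup>2)"
proof -
  let ?Q = "up x \<bullet> V x - (ub x)\<^sup>2"
  have g: "1 / 2 * f x ^ 3 * (f x ^ 3 * (1 / 2 * (f x)\<^sup>2 * - q)) = - (1 / 4) * f x ^ 8 * q" for q
    by (simp add: eval_nat_numeral)
  have Z: "(up x \<bullet> (f x ^ 3 *\<^sub>R u.bu x)) *\<^sub>R u.bu x - (b' x \<bullet> (f x ^ 3 *\<^sub>R u.bu x)) *\<^sub>R V x
      = f x ^ 3 *\<^sub>R (ub x *\<^sub>R u.bu x - V x)"
    using u.b_bu[OF x] by (simp add: ub_def scaleR_diff_right)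
  have Q: "(up x - ub x *\<^sub>R b' x) \<bullet> (ub x *\<^sub>R u.bu x - V x) = - ?Q"
    using b'_V[OF x] u.b_bu[OF x] by (simp add: ub_def[symmetric] inner_diff_left inner_diff_right power2_eq_square)
  have "t_scalar a b x = ((1 / 2 * (f x)\<^sup>2) *\<^sub>R (up x - ub x *\<^sub>R b' x)) \<bullet> ((1 / 2 * f x ^ 3) *\<^sub>R (f x ^ 3 *\<^sub>R (ub x *\<^sub>R u.bu x - V x)))"
    unfolding t_scalar_eq s_mixed_conf[OF x] raise_b[OF x] s_form_conf[OF x] Z ..
  also have "\<dots> = 1 / 2 * f x ^ 3 * (f x ^ 3 * (1 / 2 * (f x)\<^sup>2 * - ?Q))"
    by (simp only: inner_scaleR_left inner_scaleR_right Q)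
  also have "\<dots> = - (1 / 4) * f x ^ 8 * ?Q" by (rule g)
  finally show ?thesis .
qed

lemma s00_conf:
  fixes y :: "real ^ 'n"
  assumes x: "x \<in> U"
  defines "A \<equiv> gin a' x y y" and "B \<equiv> b' x \<bullet> y" and "p \<equiv> up x \<bullet> y"
  shows "(\<Sum>i\<in>UNIV. \<Sum>j\<in>UNIV. covd a (s_form a b) i j x * y $ i * y $ j)
    = 1 / 2 * (f x)\<^sup>2 * (covf a' up x y y - dd y ub x * B - ub x * u.cc x * (A - B\<^sup>2) - 6 * p * (p - ub x * B) + 2 * A * (up x \<bullet> V x - (ub x)\<^sup>2))"
proof -
  let ?e = "\<lambda>x. up x + (- ub x) *\<^sub>R b' x" and ?g = "\<lambda>x. 1 / 2 * (f x)\<^sup>2"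
  have s: "s_form a b z = ?g z *\<^sub>R ?e z" if "z \<in> U" for z using s_form_conf[OF that] by simp
  have dg: "?g differentiable (at x)" using f_diff[OF x] by simp
  have dub: "(\<lambda>x. - ub x) differentiable (at x)" using ub_diff[OF x] by simp
  have ve: "vdiff ?e x" by (intro vdiff_add vdiff_scaleR up_vdiff u.b_vdiff x dub)
  have ddg: "dd y ?g x = - (f x)\<^sup>2 * p"
  proof -
    have "dd y ?g x = 1 / 2 * (2 * f x * dd y f x)"
      by (rule dd_eqI) (use dd_DERIV[OF f_diff[OF x], of y] in \<open>auto intro!: derivative_eq_intros\<close>)
    then show ?thesis unfolding dd_f[OF x] p_def by (simp add: power2_eq_square)
  qed
  have vs: "vdiff (s_form a b) x"
  proof -
    have "vdiff (\<lambda>x. ?g x *\<^sub>R ?e x) x" by (intro vdiff_scaleR dg ve)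
    then show ?thesis unfolding vdiff_def
      using differentiable_transform_open[OF openU x, of "\<lambda>z. (?g z *\<^sub>R ?e z) $ i" "\<lambda>z. s_form a b z $ i" for i] s by simp
  qed
  have vd: "vdd y (s_form a b) x = (- (f x)\<^sup>2 * p) *\<^sub>R ?e x + ?g x *\<^sub>R (vdd y up x + (- dd y ub x *\<^sub>R b' x - ub x *\<^sub>R vdd y b' x))"
  proof -
    have "vdd y (s_form a b) x = vdd y (\<lambda>z. ?g z *\<^sub>R ?e z) x" by (rule vdd_transform[OF openU x]) (rule s)
    also have "\<dots> = (- (f x)\<^sup>2 * p) *\<^sub>R ?e x + ?g x *\<^sub>R vdd y ?e x"
      unfolding vdd_scaleR[OF dg ve] ddg ..
    also have "vdd y ?e x = vdd y up x + (- dd y ub x *\<^sub>R b' x - ub x *\<^sub>R vdd y b' x)"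
      using vdd_add[OF up_vdiff[OF x] vdiff_scaleR[OF dub u.b_vdiff[OF x]], of y] vdd_scaleR[OF dub u.b_vdiff[OF x], of y]
        dd_minus[OF ub_diff[OF x], of y] by simp
    finally show ?thesis .
  qed
  have G: "Gam a x y y = Gam a' x y y + (4 * p) *\<^sub>R y - (2 * A) *\<^sub>R V x"
    unfolding Gam_conformal[OF x] p_def A_def by (simp add: vec_eq_iff algebra_simps)
  have H: "covf a' up x y y = vdd y up x \<bullet> y - up x \<bullet> Gam a' x y y"
    and Bb: "vdd y b' x \<bullet> y = u.cc x * (A - B\<^sup>2) + b' x \<bullet> Gam a' x y y"
    using covf_b'_warped[OF x, of y y] unfolding covf_def A_def B_def by (simp_all add: power2_eq_square)
  have "(\<Sum>i\<in>UNIV. \<Sum>j\<in>UNIV. covd a (s_form a b) i j x * y $ i * y $ j) = covf a (s_form a b) x y y"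
    by (rule covf_covd[OF vs, symmetric])
  also have "\<dots> = 1 / 2 * (f x)\<^sup>2 * (- 2 * p * (p - ub x * B) + (vdd y up x \<bullet> y - dd y ub x * B - ub x * (vdd y b' x \<bullet> y))
       - (up x \<bullet> Gam a' x y y - ub x * (b' x \<bullet> Gam a' x y y) + 2 * (2 * p * (p - ub x * B) - A * (up x \<bullet> V x - ub x * ub x))))"
    unfolding covf_def vd s[OF x] G
    by (simp add: inner_add_left inner_add_right inner_diff_left inner_diff_right b'_V[OF x] B_def[symmetric] p_def[symmetric] algebra_simps)
  finally show ?thesis unfolding H Bb by (simp add: algebra_simps power2_eq_square)
qed

text \<open>The trace of \<open>Gam_conformal\<close>: its three terms contribute 1, n and -1 times
  2 \<open>up\<close>(v).\<close>

lemma dvg_conf: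
  assumes x: "x \<in> U"
  shows "dvg a v x = dvg a' v x + 2 * real CARD('n) * (up x \<bullet> v x)"
proof -
  have "(vdd (axis m 1) v x + Gam a x (axis m 1) (v x)) $ m = (vdd (axis m 1) v x + Gam a' x (axis m 1) (v x)) $ m
     + (2 * ((up x \<bullet> axis m 1) * v x $ m) + 2 * (up x \<bullet> v x) * axis m 1 $ m - 2 * (V x $ m * gin a' x (axis m 1) (v x)))" for m
    unfolding Gam_conformal[OF x] by (simp add: algebra_simps)
  then have "dvg a v x = dvg a' v x + (2 * (\<Sum>m\<in>UNIV. (up x \<bullet> axis m 1) * v x $ m)
     + 2 * (up x \<bullet> v x) * (\<Sum>m\<in>(UNIV::'n set). axis m (1::real) $ m) - 2 * (\<Sum>m\<in>UNIV. V x $ m * gin a' x (axis m 1) (v x)))"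
    unfolding dvg_def by (simp only: sum.distrib sum_subtractf sum_distrib_left)
  also have "(\<Sum>m\<in>UNIV. V x $ m * gin a' x (axis m 1) (v x)) = gin a' x (\<Sum>m\<in>UNIV. V x $ m *\<^sub>R axis m 1) (v x)"
    unfolding linear_sum[OF gin_linear1] by (simp add: linear_cmul[OF gin_linear1])
  finally show ?thesis unfolding axis_expansion[symmetric] gin_V(1)[OF x] inner_axis_sum by (simp add: algebra_simps)
qed

lemma divs_conf:
  assumes x: "x \<in> U"
  shows "divergence a (raise a (s_form a b)) x = 1 / 2 * f x ^ 6 * (dvg a' V x - dd (u.bu x) ub x
    - ub x * (real CARD('n) - 1) * u.cc x + (2 * real CARD('n) - 6) * (up x \<bullet> V x - (ub x)\<^sup>2))"
proof -
  let ?Z = "\<lambda>x. V x + (- ub x) *\<^sub>R u.bu x" and ?g = "\<lambda>x. 1 / 2 * f x ^ 6"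
  have dg: "?g differentiable (at x)" using f_diff[OF x] by simp
  have dub: "(\<lambda>x. - ub x) differentiable (at x)" using ub_diff[OF x] by simp
  have vZ: "vdiff ?Z x" by (intro vdiff_add vdiff_scaleR V_vdiff u.bu_vdiff x dub)
  have ddg: "dd v ?g x = - 3 * f x ^ 6 * (up x \<bullet> v)" for v
  proof -
    have "dd v ?g x = 1 / 2 * (6 * f x ^ 5 * dd v f x)"
      by (rule dd_eqI) (use dd_DERIV[OF f_diff[OF x], of v] in \<open>auto intro!: derivative_eq_intros\<close>)
    then show ?thesis unfolding dd_f[OF x] by (simp add: power_numeral_reduce)
  qed
  have bu: "dvg a' u.bu x = (real CARD('n) - 1) * u.cc x"
    unfolding u.cc_def dvg_def u.rb_sum[OF x] using dim3 by simp
  have uZ: "up x \<bullet> ?Z x = up x \<bullet> V x - (ub x)\<^sup>2" by (simp add: inner_diff_right ub_def power2_eq_square)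
  have "divergence a (raise a (s_form a b)) x = dvg a (\<lambda>x. ?g x *\<^sub>R ?Z x) x"
    unfolding divergence_dvg by (rule dvg_transform[OF openU x]) (simp add: raise_s)
  also have "\<dots> = dd (?Z x) ?g x + ?g x * dvg a' ?Z x + 2 * real CARD('n) * (up x \<bullet> (?g x *\<^sub>R ?Z x))"
    unfolding dvg_conf[OF x] dvg_scaleR[OF dg vZ] inner_scaleR_right by (simp only: distrib_left mult_ac add_ac)
  also have "dvg a' ?Z x = dvg a' V x + (dd (u.bu x) (\<lambda>x. - ub x) x - ub x * dvg a' u.bu x)"
    using dvg_add[OF V_vdiff[OF x] vdiff_scaleR[OF dub u.bu_vdiff[OF x]]] dvg_scaleR[OF dub u.bu_vdiff[OF x]] by simp
  finally show ?thesis
    unfolding ddg dd_minus[OF ub_diff[OF x]] bu inner_scaleR_right uZ by (simp add: algebra_simps)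
qed

lemma dd_Df:
  assumes x: "x \<in> U"
  shows "dd v Df x = f x * ((up x \<bullet> v) * (u.cc x + 3 * ub x) + 2 / 3 * (u.cc x)\<^sup>2 * (b' x \<bullet> v) - 3 * dd v ub x)"
proof -
  have "dd v Df x = - dd v f x * (u.cc x + 3 * ub x) - f x * (dd v u.cc x + 3 * dd v ub x)"
    unfolding Df_def[abs_def]
    by (rule dd_eqI) (use dd_DERIV[OF f_diff[OF x], of v] dd_DERIV[OF ub_diff[OF x], of v]
        dd_DERIV[OF Cinf_differentiable[OF u.cc_smooth x], of v] in \<open>auto intro!: derivative_eq_intros\<close>)
  then show ?thesis unfolding dd_f[OF x] dd_cc[OF x] by (simp add: algebra_simps)
qed

lemma pairing_inner: "pairing w x y = w x \<bullet> y"
  unfolding pairing_def by (simp add: inner_vec_def)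

lemma pairing_grad: "g differentiable (at x) \<Longrightarrow> (\<Sum>i\<in>UNIV. grad_form g x $ i * v $ i) = dd v g x"
  unfolding grad_form_def by (simp add: dd_pd mult.commute)

text \<open>The function \<open>g\<close> stands for the global d read in the chart, which is known
  to agree with \<open>Df\<close> on \<open>U\<close> only; its differential is then the same by
  locality.\<close>

theorem chart_equations:
  fixes y :: "real ^ 'n"
  assumes x: "x \<in> U" and g: "\<And>z. z \<in> U \<Longrightarrow> g z = Df z"
  defines "n \<equiv> real CARD('n)" and "\<alpha> \<equiv> alpha a x y" and "\<beta> \<equiv> pairing b x y"
    and "s0 \<equiv> pairing (s_form a b) x y"
  shows "ricci (alpha a) x y =
            - 1 / (9 * f x ^ 4) *
              ((9 * (n - 1) * f x ^ 2 * Cf x ^ 2 - 2 * f x ^ 6 * Df x ^ 2 - 6 * f x ^ 4 * pairing (grad_form g) x (raise a b x)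
                  + 144 * (n - 3) * t_scalar a b x + 36 * f x ^ 2 * divergence a (raise a (s_form a b)) x) * \<alpha> ^ 2
               - 2 * (n - 2) * f x ^ 4 * Df x ^ 2 * \<beta> ^ 2
               - 6 * (n - 2) * f x ^ 4 * \<beta> * pairing (grad_form g) x y
               - 72 * (n - 2) * Cf x * \<beta> * s0
               - 84 * (n - 2) * f x ^ 2 * Df x * \<beta> * s0
               + 288 * (n - 2) * s0 ^ 2
               + 36 * (n - 2) * f x ^ 2 * (\<Sum>i\<in>UNIV. \<Sum>j\<in>UNIV. covd a (s_form a b) i j x * y $ i * y $ j))"
    and "(\<Sum>i\<in>UNIV. \<Sum>j\<in>UNIV. r_tensor a b i j x * y $ i * y $ j) = Cf x * \<alpha> ^ 2 + Df x * \<beta> ^ 2 - 6 / f x ^ 2 * \<beta> * s0"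
    and "(\<Sum>j\<in>UNIV. s_mixed a b i j x * y $ j) = 1 / f x ^ 2 * (s0 * raise a b x $ i - \<beta> * raise a (s_form a b) x $ i)"
proof -
  define A where "A = gin a' x y y"
  define B where "B = b' x \<bullet> y"
  define p where "p = up x \<bullet> y"
  have f: "f x \<noteq> 0" using f_pos[OF x] by simp
  have al2: "\<alpha>\<^sup>2 = A / f x ^ 4"
    unfolding \<alpha>_def alpha_gin A_def gin_a' using gin_nonneg[OF x, of y] f by simp
  have be: "\<beta> = B / f x" unfolding \<beta>_def pairing_inner B_def b'_def using f by simp
  have s0: "s0 = 1 / 2 * (f x)\<^sup>2 * (p - ub x * B)"
    unfolding s0_def pairing_inner s_form_conf[OF x] p_def B_def by (simp add: inner_diff_left)
  have gd: "g differentiable (at x)"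
    by (rule differentiable_transform_open[OF openU x, of Df]) (simp_all add: g Cinf_differentiable[OF Df_smooth x])
  have dg: "pairing (grad_form g) x v = dd v Df x" for v
    unfolding pairing_def pairing_grad[OF gd] by (rule dd_transform[OF openU x g])
  have d0: "pairing (grad_form g) x y = f x * (p * (u.cc x + 3 * ub x) + 2 / 3 * (u.cc x)\<^sup>2 * B - 3 * dd y ub x)"
    unfolding dg dd_Df[OF x] p_def B_def ..
  have db: "pairing (grad_form g) x (raise a b x) = f x ^ 4 * (ub x * (u.cc x + 3 * ub x) + 2 / 3 * (u.cc x)\<^sup>2 - 3 * dd (u.bu x) ub x)"
  proof -
    have "pairing (grad_form g) x (raise a b x) = f x ^ 3 * dd (u.bu x) Df x"
      unfolding dg raise_b[OF x] by (rule dd_dir_scaleR[OF Cinf_differentiable[OF Df_smooth x]])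
    then show ?thesis unfolding dd_Df[OF x] u.b_bu[OF x] ub_def[symmetric] by (simp add: power_numeral_reduce)
  qed
  show "ricci (alpha a) x y =
            - 1 / (9 * f x ^ 4) *
              ((9 * (n - 1) * f x ^ 2 * Cf x ^ 2 - 2 * f x ^ 6 * Df x ^ 2 - 6 * f x ^ 4 * pairing (grad_form g) x (raise a b x)
                  + 144 * (n - 3) * t_scalar a b x + 36 * f x ^ 2 * divergence a (raise a (s_form a b)) x) * \<alpha> ^ 2
               - 2 * (n - 2) * f x ^ 4 * Df x ^ 2 * \<beta> ^ 2
               - 6 * (n - 2) * f x ^ 4 * \<beta> * pairing (grad_form g) x y
               - 72 * (n - 2) * Cf x * \<beta> * s0
               - 84 * (n - 2) * f x ^ 2 * Df x * \<beta> * s0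
               + 288 * (n - 2) * s0 ^ 2
               + 36 * (n - 2) * f x ^ 2 * (\<Sum>i\<in>UNIV. \<Sum>j\<in>UNIV. covd a (s_form a b) i j x * y $ i * y $ j))"
    unfolding ricci_conformal[OF x] RB_warped[OF x]
    unfolding A_def[symmetric] B_def[symmetric] p_def[symmetric] n_def[symmetric]
    by (rule conformal_ricci_identity[OF f Cf_def Df_def db t_conf[OF x] divs_conf[OF x, folded n_def] d0 s0
          s00_conf[OF x, of y, folded A_def B_def p_def] al2 be refl])
  show "(\<Sum>i\<in>UNIV. \<Sum>j\<in>UNIV. r_tensor a b i j x * y $ i * y $ j) = Cf x * \<alpha> ^ 2 + Df x * \<beta> ^ 2 - 6 / f x ^ 2 * \<beta> * s0"
  proof -
    have "(\<Sum>i\<in>UNIV. \<Sum>j\<in>UNIV. r_tensor a b i j x * y $ i * y $ j) = (1 / f x) * (u.cc x * (A - B * B) - 3 * p * B + 2 * A * ub x)"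
      unfolding r_tensor_sum[OF b_vdiff[OF x]] covf_b_conf[OF x] A_def B_def p_def by (simp add: algebra_simps)
    moreover have "f x ^ 3 * w * (A / f x ^ 4) = 1 / f x * (w * A)" "- f x * w * (B / f x)\<^sup>2 = 1 / f x * (- w * B\<^sup>2)"
      "6 / (f x)\<^sup>2 * (B / f x) * (1 / 2 * (f x)\<^sup>2 * w) = 1 / f x * (3 * B * w)" for w
      using f by (simp_all add: eval_nat_numeral)
    ultimately show ?thesis unfolding Cf_def Df_def al2 be s0
      by (simp only: distrib_left[of "1 / f x", symmetric] right_diff_distrib[of "1 / f x", symmetric])
        (simp add: algebra_simps power2_eq_square)
  qed
  show "(\<Sum>j\<in>UNIV. s_mixed a b i j x * y $ j) = 1 / f x ^ 2 * (s0 * raise a b x $ i - \<beta> * raise a (s_form a b) x $ i)"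
  proof -
    have "(\<Sum>j\<in>UNIV. s_mixed a b i j x * y $ j) = (\<chi> i. \<Sum>j\<in>UNIV. s_mixed a b i j x * y $ j) $ i" by simp
    also have "\<dots> = 1 / 2 * f x ^ 3 * (p * u.bu x $ i - B * V x $ i)"
      unfolding s_mixed_conf[OF x] p_def B_def by simp
    also have "\<dots> = 1 / f x ^ 2 * (1 / 2 * (f x)\<^sup>2 * (p - ub x * B) * (f x ^ 3 * u.bu x $ i) - B / f x * (1 / 2 * f x ^ 6 * (V x $ i - ub x * u.bu x $ i)))"
    proof -
      have "1 / 2 * k ^ 3 * (p * e - B * w) = 1 / k ^ 2 * (1 / 2 * k\<^sup>2 * (p - q * B) * (k ^ 3 * e) - B / k * (1 / 2 * k ^ 6 * (w - q * e)))"
        if "k \<noteq> 0" for k e w q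
        using that by (simp add: eval_nat_numeral field_simps)
      then show ?thesis using f by blast
    qed
    finally show ?thesis unfolding s0 be raise_b[OF x] raise_s[OF x] by simp
  qed
qed

end

section \<open>Change of charts\<close>

lemma has_derivative_vdd:
  fixes \<phi> :: "'e::real_normed_vector \<Rightarrow> real ^ 'n::finite"
  assumes "vdiff \<phi> x"
  shows "(\<phi> has_derivative (\<lambda>v. vdd v \<phi> x)) (at x)"
proof -
  have "((\<lambda>z. \<Sum>i\<in>UNIV. \<phi> z $ i *\<^sub>R axis i (1::real)) has_derivative (\<lambda>v. \<Sum>i\<in>UNIV. dd v (\<lambda>z. \<phi> z $ i) x *\<^sub>R axis i (1::real))) (at x)"
    by (intro has_derivative_sum has_derivative_scaleR_left dd_has_derivative)
      (use assms in \<open>auto simp: vdiff_def\<close>)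
  then show ?thesis unfolding vec_scaleR_sum_axis vec_lambda_eta vdd_def .
qed

lemma dd_compose:
  fixes \<phi> :: "'e::real_normed_vector \<Rightarrow> real ^ 'n::finite"
  assumes "vdiff \<phi> x" "g differentiable (at (\<phi> x))"
  shows "dd v (\<lambda>z. g (\<phi> z)) x = dd (vdd v \<phi> x) g (\<phi> x)" "(\<lambda>z. g (\<phi> z)) differentiable (at x)"
proof -
  have "((\<lambda>z. g (\<phi> z)) has_derivative (\<lambda>v. dd (vdd v \<phi> x) g (\<phi> x))) (at x)"
    using has_derivative_compose[OF has_derivative_vdd[OF assms(1)] dd_has_derivative[OF assms(2)]] .
  then show "dd v (\<lambda>z. g (\<phi> z)) x = dd (vdd v \<phi> x) g (\<phi> x)" "(\<lambda>z. g (\<phi> z)) differentiable (at x)"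
    by (auto intro: dd_frechet differentiableI)
qed

text \<open>The transformation laws are stated as pullback along the coordinate change, with
  \<open>vdd v \<phi> x\<close> as the image of \<open>v\<close> under its differential, so that no
  Jacobian entries occur.\<close>

locale chart_change = one: form_chart U a b + two: form_chart U' a\<^sub>2 b\<^sub>2
  for U U' :: "(real ^ 'n::finite) set" and a b a\<^sub>2 b\<^sub>2 +
  fixes W :: "(real ^ 'n) set" and \<phi> :: "real ^ 'n \<Rightarrow> real ^ 'n"
  assumes openW: "open W" and WU: "W \<subseteq> U" and \<phi>U: "\<And>x. x \<in> W \<Longrightarrow> \<phi> x \<in> U'"
    and \<phi>_smooth: "\<And>i. Cinf W (\<lambda>x. \<phi> x $ i)"
    and a_law: "\<And>x v w. x \<in> W \<Longrightarrow> gin a x v w = gin a\<^sub>2 (\<phi> x) (vdd v \<phi> x) (vdd w \<phi> x)"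
    and b_law: "\<And>x v. x \<in> W \<Longrightarrow> b x \<bullet> v = b\<^sub>2 (\<phi> x) \<bullet> vdd v \<phi> x"
begin

abbreviation J :: "real ^ 'n \<Rightarrow> real ^ 'n \<Rightarrow> real ^ 'n" where "J x v \<equiv> vdd v \<phi> x"

lemma U: "x \<in> W \<Longrightarrow> x \<in> U"
  using WU by blast

lemma \<phi>_vdiff: "x \<in> W \<Longrightarrow> vdiff \<phi> x"
  unfolding vdiff_def using Cinf_differentiable[OF \<phi>_smooth] by blast

lemma J_vdiff: "x \<in> W \<Longrightarrow> vdiff (\<lambda>x. J x v) x"
  unfolding vdiff_def vdd_def using Cinf_differentiable[OF Cinf_dd[OF \<phi>_smooth]] by simp

lemma J_commute: "x \<in> W \<Longrightarrow> vdd u (\<lambda>x. J x v) x = vdd v (\<lambda>x. J x u) x"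
  unfolding vdd_def using Cinf_dd_commute[OF openW _ \<phi>_smooth] by simp

text \<open>The differential preserves a positive definite form, hence is injective, and between
  spaces of equal dimension also surjective. Vectors in the second chart can thus be tested against
  images of vectors.\<close>

lemma J_surj:
  assumes x: "x \<in> W"
  shows "surj (J x)"
proof -
  have l: "linear (J x)" by (rule vdd_linear[OF \<phi>_vdiff[OF x]])
  have "v = 0" if "J x v = 0" for v
    using a_law[OF x, of v v] that one.gin_eq_0_iff[OF U[OF x], of v] by (simp add: gin_def)
  then have "inj (J x)" using l by (simp add: linear_injective_0)
  then show ?thesis using l linear_injective_imp_surjective by blast
qed

lemma raise_change:
  assumes x: "x \<in> W"
  shows "J x (raise a b x) = raise a\<^sub>2 b\<^sub>2 (\<phi> x)"
proof (rule two.gin_eqI[OF \<phi>U[OF x]])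
  fix w
  obtain v where w: "w = J x v" using J_surj[OF x] by blast
  show "gin a\<^sub>2 (\<phi> x) (J x (raise a b x)) w = gin a\<^sub>2 (\<phi> x) (raise a\<^sub>2 b\<^sub>2 (\<phi> x)) w"
    unfolding raise_eq two.gin_ai'[OF \<phi>U[OF x]]
    using one.gin_ai'[OF U[OF x], of "b x" v] unfolding w a_law[OF x] b_law[OF x] .
qed

lemma norm_change:
  assumes x: "x \<in> W"
  shows "form_norm a b x = form_norm a\<^sub>2 b\<^sub>2 (\<phi> x)"
  unfolding one.form_norm_gin two.form_norm_gin
  unfolding raise_eq[symmetric] b_law[OF x] raise_change[OF x] ..

lemma mdiff_change: "x \<in> W \<Longrightarrow> mdiff (\<lambda>z. a\<^sub>2 (\<phi> z)) x"
  and mdd_change: "x \<in> W \<Longrightarrow> mdd v (\<lambda>z. a\<^sub>2 (\<phi> z)) x = mdd (J x v) a\<^sub>2 (\<phi> x)"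
  unfolding mdiff_def mdd_def using dd_compose[OF \<phi>_vdiff two.a_diff[OF \<phi>U]] by simp_all

lemma vdiff_change: "x \<in> W \<Longrightarrow> vdiff (\<lambda>z. b\<^sub>2 (\<phi> z)) x"
  and vdd_change: "x \<in> W \<Longrightarrow> vdd v (\<lambda>z. b\<^sub>2 (\<phi> z)) x = vdd (J x v) b\<^sub>2 (\<phi> x)"
  unfolding vdiff_def vdd_def[of _ "\<lambda>z. b\<^sub>2 (\<phi> z)"] vdd_def[of _ b\<^sub>2]
  using dd_compose[OF \<phi>_vdiff Cinf_differentiable[OF two.b_smooth \<phi>U]] by simp_all

lemma mdd_a_change:
  assumes x: "x \<in> W"
  shows "gin (mdd u a) x v w = gin (mdd (J x u) a\<^sub>2) (\<phi> x) (J x v) (J x w)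
    + gin a\<^sub>2 (\<phi> x) (vdd u (\<lambda>x. J x v) x) (J x w) + gin a\<^sub>2 (\<phi> x) (J x v) (vdd u (\<lambda>x. J x w) x)"
proof -
  have g: "gin (\<lambda>z. N z) x = gin N x" for N :: "real ^ 'n \<Rightarrow> real ^ 'n ^ 'n" and x ..
  have N: "gin (\<lambda>z. a\<^sub>2 (\<phi> z)) x = gin a\<^sub>2 (\<phi> x)" for x unfolding gin_def by simp
  have "gin (mdd u a) x v w = dd u (\<lambda>x. gin a x v w) x"
    by (rule dd_gin_const[symmetric, OF one.mdiff_a[OF U[OF x]]])
  also have "\<dots> = dd u (\<lambda>x. gin (\<lambda>z. a\<^sub>2 (\<phi> z)) x (J x v) (J x w)) x"
    by (rule dd_transform[OF openW x]) (simp add: a_law N)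
  also have "\<dots> = gin (mdd u (\<lambda>z. a\<^sub>2 (\<phi> z))) x (J x v) (J x w)
    + gin (\<lambda>z. a\<^sub>2 (\<phi> z)) x (vdd u (\<lambda>x. J x v) x) (J x w) + gin (\<lambda>z. a\<^sub>2 (\<phi> z)) x (J x v) (vdd u (\<lambda>x. J x w) x)"
    by (rule dd_gin[OF mdiff_change[OF x] J_vdiff[OF x] J_vdiff[OF x]])
  also have "gin (mdd u (\<lambda>z. a\<^sub>2 (\<phi> z))) x (J x v) (J x w) = gin (mdd (J x u) a\<^sub>2) (\<phi> x) (J x v) (J x w)"
    unfolding gin_def mdd_change[OF x] ..
  finally show ?thesis unfolding N .
qed

lemma vdd_b_change:
  assumes x: "x \<in> W"
  shows "vdd u b x \<bullet> v = vdd (J x u) b\<^sub>2 (\<phi> x) \<bullet> J x v + b\<^sub>2 (\<phi> x) \<bullet> vdd u (\<lambda>x. J x v) x"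
proof -
  have b: "vdiff b x" unfolding vdiff_def using Cinf_differentiable[OF one.b_smooth U[OF x]] by blast
  have "vdd u b x \<bullet> v = dd u (\<lambda>x. b x \<bullet> v) x" using dd_inner[OF b vdiff_const] by simp
  also have "\<dots> = dd u (\<lambda>x. b\<^sub>2 (\<phi> x) \<bullet> J x v) x"
    by (rule dd_transform[OF openW x]) (rule b_law)
  also have "\<dots> = vdd (J x u) b\<^sub>2 (\<phi> x) \<bullet> J x v + b\<^sub>2 (\<phi> x) \<bullet> vdd u (\<lambda>x. J x v) x"
    unfolding dd_inner[OF vdiff_change[OF x] J_vdiff[OF x]] vdd_change[OF x] ..
  finally show ?thesis .
qed

text \<open>The second derivatives of \<open>\<phi>\<close> cancel by symmetry, as for a Lie derivative of the metric.\<close>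

lemma covf_change:
  assumes x: "x \<in> W"
  shows "covf a b x y y = covf a\<^sub>2 b\<^sub>2 (\<phi> x) (J x y) (J x y)"
proof -
  note x' = \<phi>U[OF x]
  let ?z = "raise a b x" and ?H = "\<lambda>u v. vdd u (\<lambda>x. J x v) x"
  \<comment> \<open>Koszul's formula tested on the vector dual to b expresses this through
    derivatives of the metric, whose transformation is \<open>mdd_a_change\<close>.\<close>
  have "2 * (b x \<bullet> Gam a x y y) = 2 * gin (mdd y a) x y ?z - gin (mdd ?z a) x y y"
    using one.koszul[OF U[OF x], of y y ?z] one.gin_ai'[OF U[OF x], of "b x" "Gam a x y y"] one.gin_sym[OF U[OF x], of ?z]
    unfolding raise_eq by simp
  also have "\<dots> = 2 * gin (mdd (J x y) a\<^sub>2) (\<phi> x) (J x y) (J x ?z) - gin (mdd (J x ?z) a\<^sub>2) (\<phi> x) (J x y) (J x y)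
      + 2 * gin a\<^sub>2 (\<phi> x) (?H y y) (J x ?z)"
    unfolding mdd_a_change[OF x] J_commute[OF x, of ?z y] two.gin_sym[OF x', of "J x y" "?H y ?z"] by simp
  also have "gin a\<^sub>2 (\<phi> x) (?H y y) (J x ?z) = b\<^sub>2 (\<phi> x) \<bullet> ?H y y"
    unfolding raise_change[OF x] unfolding raise_eq two.gin_ai[OF x'] by (rule inner_commute)
  also have "2 * gin (mdd (J x y) a\<^sub>2) (\<phi> x) (J x y) (J x ?z) - gin (mdd (J x ?z) a\<^sub>2) (\<phi> x) (J x y) (J x y)
      = 2 * (b\<^sub>2 (\<phi> x) \<bullet> Gam a\<^sub>2 (\<phi> x) (J x y) (J x y))"
    using two.koszul[OF x', of "J x y" "J x y" "J x ?z"] two.gin_ai'[OF x', of "b\<^sub>2 (\<phi> x)" "Gam a\<^sub>2 (\<phi> x) (J x y) (J x y)"]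
      two.gin_sym[OF x', of "J x ?z" "Gam a\<^sub>2 (\<phi> x) (J x y) (J x y)"]
    unfolding raise_change[OF x] unfolding raise_eq by simp
  finally show ?thesis unfolding covf_def vdd_b_change[OF x] by simp
qed

end

lemma (in form_chart_warped) covf_eq:
  assumes x: "x \<in> U"
  shows "covf a b x y y = Cf x * gin a x y y + Df x * (b x \<bullet> y)\<^sup>2 - 6 / (f x)\<^sup>2 * (b x \<bullet> y) * (s_form a b x \<bullet> y)"
  using chart_equations(2)[OF x, of Df y] r_tensor_sum[OF b_vdiff[OF x], of a y y] gin_nonneg[OF x, of y]
  by (simp add: alpha_gin pairing_inner)

lemma (in form_chart_warped) covf_raise:
  assumes x: "x \<in> U"
  shows "covf a b x (raise a b x) (raise a b x) = Cf x * (f x)\<^sup>2 + Df x * (f x) ^ 4"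
proof -
  have b: "b x \<bullet> raise a b x = (f x)\<^sup>2" unfolding f_sq[OF x] raise_eq ..
  have s: "s_form a b x \<bullet> raise a b x = 0" unfolding s_form_inner[OF b_vdiff[OF x]] by simp
  have g: "gin a x (raise a b x) (raise a b x) = (f x)\<^sup>2" unfolding b[symmetric] unfolding raise_eq gin_ai[OF x] by (rule inner_commute)
  show ?thesis unfolding covf_eq[OF x] b s g by simp
qed

locale warped_chart_change = chart_change U U' a b a\<^sub>2 b\<^sub>2 W \<phi> + one: form_chart_warped U a b + two: form_chart_warped U' a\<^sub>2 b\<^sub>2
  for U U' :: "(real ^ 'n::finite) set" and a b a\<^sub>2 b\<^sub>2 W \<phi>
begin

text \<open>On a vector orthogonal to \<beta> the second equation reads r_00 = c \<alpha>^2, and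
  r_00, \<alpha> and \<beta> do not depend on the chart.\<close>

lemma Cf_change:
  assumes x: "x \<in> W"
  shows "one.Cf x = two.Cf (\<phi> x)"
proof -
  note xU = U[OF x] and x' = \<phi>U[OF x]
  obtain w where w: "gin one.a' x w w = 1" "one.b' x \<bullet> w = 0" using one.u.perp_exists[OF one.dim3 xU] by metis
  have g: "gin a x w w \<noteq> 0" using w(1) unfolding one.gin_a' by auto
  have b: "b x \<bullet> w = 0" using w(2) one.f_pos[OF xU] unfolding one.b'_def by simp
  have "one.Cf x * gin a x w w = two.Cf (\<phi> x) * gin a x w w"
    using covf_change[OF x, of w] b
    unfolding one.covf_eq[OF xU] two.covf_eq[OF x'] b_law[OF x, symmetric] a_law[OF x, symmetric] by simp
  then show ?thesis using g by simp
qed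

text \<open>On the vector b^i the values of \<alpha>^2 and \<beta> are both f^2 and s_0 vanishes, so
  r_00 = c f^2 + d f^4 fixes d once c is known.\<close>

lemma Df_change:
  assumes x: "x \<in> W"
  shows "one.Df x = two.Df (\<phi> x)"
proof -
  note xU = U[OF x] and x' = \<phi>U[OF x]
  have "one.Df x * form_norm a b x ^ 4 = two.Df (\<phi> x) * form_norm a b x ^ 4"
    using covf_change[OF x, of "raise a b x"]
    unfolding raise_change[OF x] one.covf_raise[OF xU] two.covf_raise[OF x'] Cf_change[OF x] norm_change[OF x] by simp
  then show ?thesis using one.f_pos[OF xU] by simp
qed

end

lemma (in form_chart) einstein_chart:
  assumes n: "CARD('n) \<ge> 3"
    and E: "\<And>x y. x \<in> U \<Longrightarrow> nondegenerate_at (singular_square a b) x y \<Longrightarrow>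
      ricci (singular_square a b) x y = (real CARD('n) - 1) * K x * (singular_square a b x y)\<^sup>2"
  shows "form_chart_warped U a b" "\<And>x. x \<in> U \<Longrightarrow> K x = 0"
proof -
  have E': "ricci (singular_square a' b') x y = (real CARD('n) - 1) * K x * (singular_square a' b' x y)\<^sup>2"
    if x: "x \<in> U" and y: "nondegenerate_at (singular_square a' b') x y" for x y
    using E[OF x, of y] y ricci_cong[OF openU x singular_square_conformal, where y = y] singular_square_conformal[OF x, of y] by simp
  note e = u.einstein_unit[OF n E']
  show "form_chart_warped U a b" by (intro form_chart_warped.intro form_chart_warped_axioms.intro form_chart_axioms e n)
  show "K x = 0" if "x \<in> U" for x by (rule e(2)[OF _ _ that])
qed

section \<open>From charts to the manifold\<close>

lemma is_chart_inj:
  assumes "is_chart X \<kappa>"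
  shows "inj_on (cmap \<kappa>) (cdom \<kappa>)"
proof -
  have "cdom \<kappa> \<subseteq> topspace X" using assms openin_subset unfolding is_chart_def by blast
  then have "topspace (subtopology X (cdom \<kappa>)) = cdom \<kappa>" by auto
  then show ?thesis using assms homeomorphic_imp_injective_map unfolding is_chart_def by metis
qed

lemma in_chart_cmap: "is_chart X \<kappa> \<Longrightarrow> p \<in> cdom \<kappa> \<Longrightarrow> in_chart \<kappa> f (cmap \<kappa> p) = f p"
  unfolding in_chart_def using is_chart_inj by (metis inv_into_f_f)

lemma is_chart_overlap_open:
  assumes k: "is_chart X \<kappa>" and k': "is_chart X \<kappa>'"
  shows "open (cmap \<kappa> ` (cdom \<kappa> \<inter> cdom \<kappa>'))"
proof -
  have "openin (subtopology X (cdom \<kappa>)) (cdom \<kappa> \<inter> cdom \<kappa>')"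
    using k k' unfolding is_chart_def by (metis openin_subtopology_Int2 inf_commute)
  then have "openin (top_of_set (cimg \<kappa>)) (cmap \<kappa> ` (cdom \<kappa> \<inter> cdom \<kappa>'))"
    using k homeomorphic_imp_open_map unfolding is_chart_def open_map_def by blast
  then show ?thesis using k openin_open_trans unfolding is_chart_def by blast
qed

locale form_manifold =
  fixes X :: "'m topology" and A :: "('m, 'n::finite) chart set"
    and a :: "('m, 'n) chart \<Rightarrow> real ^ 'n \<Rightarrow> real ^ 'n ^ 'n" and b :: "('m, 'n) chart \<Rightarrow> real ^ 'n \<Rightarrow> real ^ 'n"
  assumes manifold: "smooth_manifold X A"
    and metric: "riemannian_metric A a"
    and form: "one_form A b"
    and nonvanishing: "\<forall>\<kappa>\<in>A. \<forall>x\<in>cimg \<kappa>. b \<kappa> x \<noteq> 0"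
begin

lemma chart: "\<kappa> \<in> A \<Longrightarrow> is_chart X \<kappa>"
  using manifold unfolding smooth_manifold_def by blast

lemma cimg_open: "\<kappa> \<in> A \<Longrightarrow> open (cimg \<kappa>)"
  using chart unfolding is_chart_def by blast

lemma form_chart:
  assumes k: "\<kappa> \<in> A"
  shows "form_chart (cimg \<kappa>) (a \<kappa>) (b \<kappa>)"
proof
  note o = cimg_open[OF k]
  have m: "\<And>i j. smooth_on (cimg \<kappa>) (\<lambda>x. a \<kappa> x $ i $ j)" "\<And>x. x \<in> cimg \<kappa> \<Longrightarrow> transpose (a \<kappa> x) = a \<kappa> x"
    "\<And>x y. x \<in> cimg \<kappa> \<Longrightarrow> y \<noteq> 0 \<Longrightarrow> 0 < y \<bullet> (a \<kappa> x *v y)"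
    using metric k unfolding riemannian_metric_def by blast+
  show "open (cimg \<kappa>)" by (rule o)
  show "Cinf (cimg \<kappa>) (\<lambda>x. a \<kappa> x $ i $ j)" for i j using m(1) smooth_on_Cinf[OF o] by blast
  show "a \<kappa> x $ i $ j = a \<kappa> x $ j $ i" if "x \<in> cimg \<kappa>" for x i j
    using m(2)[OF that] by (metis transpose_def vec_lambda_beta)
  show "0 < y \<bullet> (a \<kappa> x *v y)" if "x \<in> cimg \<kappa>" "y \<noteq> 0" for x y by (rule m(3)[OF that])
  show "Cinf (cimg \<kappa>) (\<lambda>x. b \<kappa> x $ i)" for i
    using form k smooth_on_Cinf[OF o] unfolding one_form_def by blast
  show "b \<kappa> x \<noteq> 0" if "x \<in> cimg \<kappa>" for x using nonvanishing k that by blast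
qed

text \<open>The double sums over Jacobian entries are recognised as a matrix congruence, and the
  Jacobian as the matrix of the differential of the coordinate change.\<close>

lemma chart_change:
  assumes k: "\<kappa> \<in> A" and k': "\<kappa>' \<in> A"
  shows "chart_change (cimg \<kappa>) (cimg \<kappa>') (a \<kappa>) (b \<kappa>) (a \<kappa>') (b \<kappa>') (cmap \<kappa> ` (cdom \<kappa> \<inter> cdom \<kappa>')) (coord_change \<kappa> \<kappa>')"
proof (intro chart_change.intro chart_change_axioms.intro form_chart k k')
  let ?W = "cmap \<kappa> ` (cdom \<kappa> \<inter> cdom \<kappa>')" and ?\<phi> = "coord_change \<kappa> \<kappa>'"
  show o: "open ?W" by (rule is_chart_overlap_open[OF chart[OF k] chart[OF k']])
  show "?W \<subseteq> cimg \<kappa>" by blast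
  have \<phi>: "?\<phi> (cmap \<kappa> p) = cmap \<kappa>' p" if "p \<in> cdom \<kappa>" for p
    unfolding coord_change_def by (rule in_chart_cmap[OF chart[OF k] that])
  show "?\<phi> x \<in> cimg \<kappa>'" if "x \<in> ?W" for x using that \<phi> by auto
  show S: "Cinf ?W (\<lambda>x. ?\<phi> x $ i)" for i
    using manifold k k' smooth_on_Cinf[OF o] unfolding smooth_manifold_def by blast
  define M where "M p = (\<chi> l i. jac \<kappa> \<kappa>' p l i)" for p
  have J: "vdd v ?\<phi> (cmap \<kappa> p) = M p *v v" if p: "p \<in> cdom \<kappa> \<inter> cdom \<kappa>'" for p v
    unfolding vdd_def M_def jac_def matrix_vector_mult_def
    using dd_pd[OF Cinf_differentiable[OF S]] p by (simp add: mult.commute)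
  show "gin (a \<kappa>) x v w = gin (a \<kappa>') (?\<phi> x) (vdd v ?\<phi> x) (vdd w ?\<phi> x)" if xW: "x \<in> ?W" for x v w
  proof -
    obtain p where p: "p \<in> cdom \<kappa> \<inter> cdom \<kappa>'" "x = cmap \<kappa> p" using xW by blast
    have "a \<kappa> x $ i $ j = (transpose (M p) ** (a \<kappa>' (cmap \<kappa>' p) ** M p)) $ i $ j" for i j
    proof -
      have "a \<kappa> x $ i $ j = (\<Sum>l\<in>UNIV. \<Sum>m\<in>UNIV. jac \<kappa> \<kappa>' p l i * jac \<kappa> \<kappa>' p m j * a \<kappa>' (cmap \<kappa>' p) $ l $ m)"
        using metric k k' p unfolding riemannian_metric_def by blast
      then show ?thesis unfolding matrix_matrix_mult_def transpose_def M_def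
        by (simp add: sum_distrib_left mult_ac)
    qed
    then have "a \<kappa> x = transpose (M p) ** (a \<kappa>' (cmap \<kappa>' p) ** M p)" by (simp add: vec_eq_iff)
    then have "gin (a \<kappa>) x v w = v \<bullet> (transpose (M p) *v (a \<kappa>' (cmap \<kappa>' p) *v (M p *v w)))"
      unfolding gin_def by (simp add: matrix_vector_mul_assoc)
    also have "\<dots> = (M p *v v) \<bullet> (a \<kappa>' (cmap \<kappa>' p) *v (M p *v w))"
      unfolding transpose_matrix_vector by (metis dot_lmul_matrix inner_commute)
    finally show ?thesis unfolding gin_def p(2) J[OF p(1)] using \<phi> p(1) by simp
  qed
  show "b \<kappa> x \<bullet> v = b \<kappa>' (?\<phi> x) \<bullet> vdd v ?\<phi> x" if xW: "x \<in> ?W" for x v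
  proof -
    obtain p where p: "p \<in> cdom \<kappa> \<inter> cdom \<kappa>'" "x = cmap \<kappa> p" using xW by blast
    have "b \<kappa> x $ i = (b \<kappa>' (cmap \<kappa>' p) v* M p) $ i" for i
    proof -
      have "b \<kappa> x $ i = (\<Sum>l\<in>UNIV. jac \<kappa> \<kappa>' p l i * b \<kappa>' (cmap \<kappa>' p) $ l)"
        using form k k' p unfolding one_form_def by blast
      then show ?thesis unfolding M_def vector_matrix_mult_def by (simp add: mult.commute)
    qed
    then have "b \<kappa> x = b \<kappa>' (cmap \<kappa>' p) v* M p" by (simp add: vec_eq_iff)
    then show ?thesis unfolding p(2) J[OF p(1)] using \<phi> p(1) by (simp add: dot_lmul_matrix)
  qed
qed

text \<open>At each point the value is taken in an arbitrarily chosen chart; agreement on overlaps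
  makes the choice irrelevant, and in any fixed chart the glued function is the given smooth
  one.\<close>

lemma scalar_field_family:
  assumes smooth: "\<And>\<kappa>. \<kappa> \<in> A \<Longrightarrow> Cinf (cimg \<kappa>) (g \<kappa>)"
    and change: "\<And>\<kappa> \<kappa>' p. \<kappa> \<in> A \<Longrightarrow> \<kappa>' \<in> A \<Longrightarrow> p \<in> cdom \<kappa> \<inter> cdom \<kappa>' \<Longrightarrow> g \<kappa> (cmap \<kappa> p) = g \<kappa>' (cmap \<kappa>' p)"
  obtains c where "scalar_field A c" "\<And>\<kappa> p. \<kappa> \<in> A \<Longrightarrow> p \<in> cdom \<kappa> \<Longrightarrow> c p = g \<kappa> (cmap \<kappa> p)"
proof -
  define s where "s p = (SOME \<kappa>. \<kappa> \<in> A \<and> p \<in> cdom \<kappa>)" for p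
  define c where "c p = g (s p) (cmap (s p) p)" for p
  have c: "c p = g \<kappa> (cmap \<kappa> p)" if "\<kappa> \<in> A" "p \<in> cdom \<kappa>" for \<kappa> p
  proof -
    have "s p \<in> A \<and> p \<in> cdom (s p)" unfolding s_def by (rule someI[of _ \<kappa>]) (use that in blast)
    then show ?thesis unfolding c_def using change[of "s p" \<kappa> p] that by blast
  qed
  have "smooth_on (cimg \<kappa>) (in_chart \<kappa> c)" if k: "\<kappa> \<in> A" for \<kappa>
  proof -
    have "in_chart \<kappa> c x = g \<kappa> x" if "x \<in> cimg \<kappa>" for x
      using that in_chart_cmap[OF chart[OF k], of _ c] c[OF k] by auto
    then have "Cinf (cimg \<kappa>) (in_chart \<kappa> c)" using Cinf_cong[OF cimg_open[OF k]] smooth[OF k] by blast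
    then show ?thesis using smooth_on_Cinf[OF cimg_open[OF k]] by blast
  qed
  then have "scalar_field A c" unfolding scalar_field_def by blast
  then show ?thesis using that c by blast
qed

lemma ricci_flat_imp_einstein:
  assumes "ricci_flat A F"
  shows "einstein A F"
  unfolding einstein_def
proof (intro exI conjI)
  show "scalar_field A (\<lambda>p. 0)"
    unfolding scalar_field_def in_chart_def using smooth_on_Cinf[OF cimg_open] Cinf_const by blast
qed (use assms in \<open>auto simp: ricci_flat_def\<close>)

lemma einstein_warped:
  assumes n: "CARD('n) \<ge> 3" and E: "einstein A (\<lambda>\<kappa>. singular_square (a \<kappa>) (b \<kappa>))"
  shows "\<And>\<kappa>. \<kappa> \<in> A \<Longrightarrow> form_chart_warped (cimg \<kappa>) (a \<kappa>) (b \<kappa>)"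
    and "ricci_flat A (\<lambda>\<kappa>. singular_square (a \<kappa>) (b \<kappa>))"
proof -
  obtain K where K: "\<And>\<kappa> p y. \<kappa> \<in> A \<Longrightarrow> p \<in> cdom \<kappa> \<Longrightarrow> nondegenerate_at (singular_square (a \<kappa>) (b \<kappa>)) (cmap \<kappa> p) y \<Longrightarrow>
        ricci (singular_square (a \<kappa>) (b \<kappa>)) (cmap \<kappa> p) y = (real CARD('n) - 1) * K p * (singular_square (a \<kappa>) (b \<kappa>) (cmap \<kappa> p) y)\<^sup>2"
    using E unfolding einstein_def by metis
  have 1: "form_chart_warped (cimg \<kappa>) (a \<kappa>) (b \<kappa>) \<and> (\<forall>p\<in>cdom \<kappa>. K p = 0)" if k: "\<kappa> \<in> A" for \<kappa>
  proof -
    interpret form_chart "cimg \<kappa>" "a \<kappa>" "b \<kappa>" by (rule form_chart[OF k])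
    have "ricci (singular_square (a \<kappa>) (b \<kappa>)) x y = (real CARD('n) - 1) * in_chart \<kappa> K x * (singular_square (a \<kappa>) (b \<kappa>) x y)\<^sup>2"
      if "x \<in> cimg \<kappa>" "nondegenerate_at (singular_square (a \<kappa>) (b \<kappa>)) x y" for x y
      using that K[OF k] in_chart_cmap[OF chart[OF k], of _ K] by auto
    from einstein_chart[OF n this] show ?thesis using in_chart_cmap[OF chart[OF k], of _ K] by auto
  qed
  then show "\<And>\<kappa>. \<kappa> \<in> A \<Longrightarrow> form_chart_warped (cimg \<kappa>) (a \<kappa>) (b \<kappa>)" by blast
  show "ricci_flat A (\<lambda>\<kappa>. singular_square (a \<kappa>) (b \<kappa>))"
    unfolding ricci_flat_def using K 1 by simp
qed

end

theorem theorem1p1: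
  fixes X :: "'m topology"
    and A :: "('m, 'n::finite) chart set"
    and a :: "('m, 'n) chart \<Rightarrow> real ^ 'n \<Rightarrow> real ^ 'n ^ 'n"
    and b :: "('m, 'n) chart \<Rightarrow> real ^ 'n \<Rightarrow> real ^ 'n"
  assumes dim: "CARD('n) \<ge> 3"
    and manifold: "smooth_manifold X A"
    and metric: "riemannian_metric A a"
    and form: "one_form A b"
    and nonvanishing: "\<forall>\<kappa>\<in>A. \<forall>x\<in>cimg \<kappa>. b \<kappa> x \<noteq> 0"
  shows "einstein A (\<lambda>\<kappa>. singular_square (a \<kappa>) (b \<kappa>)) \<longleftrightarrow>
    ricci_flat A (\<lambda>\<kappa>. singular_square (a \<kappa>) (b \<kappa>)) \<and>
    (\<exists>c d. scalar_field A c \<and> scalar_field A d \<and>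
      (\<forall>\<kappa>\<in>A. \<forall>p\<in>cdom \<kappa>. \<forall>y.
        let x = cmap \<kappa> p; n = real CARD('n);
            \<alpha> = alpha (a \<kappa>) x y; \<beta> = pairing (b \<kappa>) x y; bn = form_norm (a \<kappa>) (b \<kappa>) x;
            bup = raise (a \<kappa>) (b \<kappa>); s = s_form (a \<kappa>) (b \<kappa>); ss = raise (a \<kappa>) s;
            s0 = pairing s x y;
            s00 = (\<Sum>i\<in>UNIV. \<Sum>j\<in>UNIV. covd (a \<kappa>) s i j x * y $ i * y $ j);
            divs = divergence (a \<kappa>) ss x;
            t = t_scalar (a \<kappa>) (b \<kappa>) x;
            dd = grad_form (in_chart \<kappa> d);
            d0 = pairing dd x y; db = pairing dd x (bup x);
            C = c p; D = d p
        in
          ricci (alpha (a \<kappa>)) x y =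
            - 1 / (9 * bn ^ 4) *
              ((9 * (n - 1) * bn ^ 2 * C ^ 2 - 2 * bn ^ 6 * D ^ 2 - 6 * bn ^ 4 * db
                  + 144 * (n - 3) * t + 36 * bn ^ 2 * divs) * \<alpha> ^ 2
               - 2 * (n - 2) * bn ^ 4 * D ^ 2 * \<beta> ^ 2
               - 6 * (n - 2) * bn ^ 4 * \<beta> * d0
               - 72 * (n - 2) * C * \<beta> * s0
               - 84 * (n - 2) * bn ^ 2 * D * \<beta> * s0
               + 288 * (n - 2) * s0 ^ 2
               + 36 * (n - 2) * bn ^ 2 * s00) \<and>
          (\<Sum>i\<in>UNIV. \<Sum>j\<in>UNIV. r_tensor (a \<kappa>) (b \<kappa>) i j x * y $ i * y $ j) =
            C * \<alpha> ^ 2 + D * \<beta> ^ 2 - 6 / bn ^ 2 * \<beta> * s0 \<and>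
          (\<forall>i. (\<Sum>j\<in>UNIV. s_mixed (a \<kappa>) (b \<kappa>) i j x * y $ j) =
            1 / bn ^ 2 * (s0 * bup x $ i - \<beta> * ss x $ i))))"
proof -
  interpret form_manifold X A a b by unfold_locales (fact manifold metric form nonvanishing)+
  show ?thesis
  proof (rule iffI, goal_cases)
    case E: 1
    note w = einstein_warped(1)[OF dim E]
    have ch: "form_chart_warped.Cf (a \<kappa>) (b \<kappa>) (cmap \<kappa> p) = form_chart_warped.Cf (a \<kappa>') (b \<kappa>') (cmap \<kappa>' p) \<and>
        form_chart_warped.Df (a \<kappa>) (b \<kappa>) (cmap \<kappa> p) = form_chart_warped.Df (a \<kappa>') (b \<kappa>') (cmap \<kappa>' p)"
      if k: "\<kappa> \<in> A" "\<kappa>' \<in> A" "p \<in> cdom \<kappa> \<inter> cdom \<kappa>'" for \<kappa> \<kappa>' p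
    proof -
      interpret c: warped_chart_change "cimg \<kappa>" "cimg \<kappa>'" "a \<kappa>" "b \<kappa>" "a \<kappa>'" "b \<kappa>'"
        "cmap \<kappa> ` (cdom \<kappa> \<inter> cdom \<kappa>')" "coord_change \<kappa> \<kappa>'"
        by (intro warped_chart_change.intro chart_change w k)
      have "coord_change \<kappa> \<kappa>' (cmap \<kappa> p) = cmap \<kappa>' p"
        unfolding coord_change_def using in_chart_cmap[OF chart] k by blast
      then show ?thesis using c.Cf_change[of "cmap \<kappa> p"] c.Df_change[of "cmap \<kappa> p"] k(3) by simp
    qed
    obtain c where c: "scalar_field A c"
      "\<And>\<kappa> p. \<kappa> \<in> A \<Longrightarrow> p \<in> cdom \<kappa> \<Longrightarrow> c p = form_chart_warped.Cf (a \<kappa>) (b \<kappa>) (cmap \<kappa> p)"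
      by (rule scalar_field_family[of "\<lambda>\<kappa>. form_chart_warped.Cf (a \<kappa>) (b \<kappa>)"])
        (use ch form_chart_warped.Cf_smooth[OF w] in blast)+
    obtain d where d: "scalar_field A d"
      "\<And>\<kappa> p. \<kappa> \<in> A \<Longrightarrow> p \<in> cdom \<kappa> \<Longrightarrow> d p = form_chart_warped.Df (a \<kappa>) (b \<kappa>) (cmap \<kappa> p)"
      by (rule scalar_field_family[of "\<lambda>\<kappa>. form_chart_warped.Df (a \<kappa>) (b \<kappa>)"])
        (use ch form_chart_warped.Df_smooth[OF w] in blast)+
    \<comment> \<open>Needed because the equations contain the differential of d, which is taken in
      the chart on its whole image and not just at one point.\<close>
    have d': "in_chart \<kappa> d z = form_chart_warped.Df (a \<kappa>) (b \<kappa>) z" if "\<kappa> \<in> A" "z \<in> cimg \<kappa>" for \<kappa> z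
      using that d(2) in_chart_cmap[OF chart, of \<kappa> _ d] by auto
    show ?case
      apply (rule conjI[OF einstein_warped(2)[OF dim E]], rule exI[of _ c], rule exI[of _ d])
      unfolding Let_def
      apply (intro conjI c(1) d(1) ballI allI)
      subgoal premises k for \<kappa> p y
        by (rule form_chart_warped.chart_equations(1)[OF w[OF k(1)] imageI[OF k(2)] d'[OF k(1)], folded c(2)[OF k] d(2)[OF k]])
      subgoal premises k for \<kappa> p y
        by (rule form_chart_warped.chart_equations(2)[OF w[OF k(1)] imageI[OF k(2)] d'[OF k(1)], folded c(2)[OF k] d(2)[OF k]])
      subgoal premises k for \<kappa> p y i
        by (rule form_chart_warped.chart_equations(3)[OF w[OF k(1)] imageI[OF k(2)] d'[OF k(1)]])
      done
  next
    case 2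
    then show ?case using ricci_flat_imp_einstein by blast
  qed
qed

end
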